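(* Let $D\subset\mathbb{R}^n$ be a bounded domain and $m\in L^\infty(D)$ complex valued. Suppose that there are real numbers $m^*\ge m_*>0$, a unit complex number $e^{i\theta}$, and a neighborhood $N$ of $\partial D$ such that $\Re(e^{i\theta}m(x))>m_*$ in $N$ and $|m(x)|<m^*$ in all of $D$. Then for $\lambda$ real, positive, and large enough: 1. The operator $$(B-\lambda I):H^2_0(D)\oplus\{v\in L^2(D):\Delta v\in L^2(D)\}\longrightarrow L^2(D)\oplus L^2(D)$$ is invertible. 2. If we write the resolvent in block form, $$(B-\lambda I)^{-1}=\begin{pmatrix}R_{11}&R_{12}\\R_{21}&R_{22}\end{pmatrix},$$ then $R_{11}$, $R_{12}$, and $R_{22}$ are compact. If $\phi(x)$ is a smooth function vanishing in a neighborhood of $\partial D$ and equal to $1$ on $D\setminus N$, then $\phi R_{21}$ is compact. 3. With $\phi$ as in item 2, there is a constant $K$, independent of $\lambda$, such that $$\|R_{11}\|+\|R_{12}\|+\|R_{22}\|+\|\phi R_{21}\|\le\frac{K}{\lambda}.$$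
   Context: $H^2_0(D)$ is the completion of $C_0^\infty(D)$ in the norm $\|u\|_2^2=\|u\|^2+\|\Delta u\|^2$, where $\|\cdot\|$ is the $L^2(D)$ norm. $B$ is the unbounded operator on $L^2(D)\oplus L^2(D)$ with domain $H^2_0(D)\oplus\{v\in L^2(D):\Delta v\in L^2(D)\}$ given by $B(u,v)=(\Delta u+mv,\ \Delta v)$, with $\Delta v$ taken in the distributional sense. The blocks $R_{jk}$ are operators on $L^2(D)$; compactness and the norms in item 3 refer to operators from $L^2(D)$ to $L^2(D)$. A neighborhood $N$ of $\partial D$ means an open set containing $\partial D$; pointwise conditions on $m$ are imposed on $N\cap D$, almost everywhere. *)

theory Defs
  imports "HOL-Analysis.Analysis"
begin

section \<open>Lebesgue spaces on a domain\<close>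

text \<open>Elements of $L^2(D)$ and $L^\infty(D)$ are represented by functions on the whole space;
  only their values on \<open>D\<close> matter, and equality in the space is \<open>ae_eq D\<close>.\<close>

definition L2 :: "'a::euclidean_space set \<Rightarrow> ('a \<Rightarrow> complex) set" where
  "L2 D = {f. f \<in> borel_measurable (lebesgue_on D) \<and>
              integrable (lebesgue_on D) (\<lambda>x. (cmod (f x))\<^sup>2)}"

definition Linfty :: "'a::euclidean_space set \<Rightarrow> ('a \<Rightarrow> complex) set" where
  "Linfty D = {f. f \<in> borel_measurable (lebesgue_on D) \<and>
                  (\<exists>C. AE x in lebesgue_on D. cmod (f x) \<le> C)}"

definition l2norm :: "'a::euclidean_space set \<Rightarrow> ('a \<Rightarrow> complex) \<Rightarrow> real" where
  "l2norm D f = sqrt (integral\<^sup>L (lebesgue_on D) (\<lambda>x. (cmod (f x))\<^sup>2))"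

definition ae_eq :: "'a::euclidean_space set \<Rightarrow> ('a \<Rightarrow> complex) \<Rightarrow> ('a \<Rightarrow> complex) \<Rightarrow> bool" where
  "ae_eq D f g \<longleftrightarrow> (AE x in lebesgue_on D. f x = g x)"


section \<open>Smooth functions and test functions\<close>

definition partial_deriv :: "'a::euclidean_space \<Rightarrow> ('a \<Rightarrow> complex) \<Rightarrow> 'a \<Rightarrow> complex" where
  "partial_deriv b f x = frechet_derivative f (at x) b"

text \<open>The next two notions are meant for open sets \<open>S\<close> only.\<close>

primrec Ck_on :: "nat \<Rightarrow> 'a::euclidean_space set \<Rightarrow> ('a \<Rightarrow> complex) \<Rightarrow> bool" where
  "Ck_on 0 S f \<longleftrightarrow> continuous_on S f"
| "Ck_on (Suc k) S f \<longleftrightarrow>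
     f differentiable_on S \<and> (\<forall>b\<in>Basis. Ck_on k S (partial_deriv b f))"

definition smooth_on :: "'a::euclidean_space set \<Rightarrow> ('a \<Rightarrow> complex) \<Rightarrow> bool" where
  "smooth_on S f \<longleftrightarrow> (\<forall>k. Ck_on k S f)"

definition test_functions :: "'a::euclidean_space set \<Rightarrow> ('a \<Rightarrow> complex) set" where
  "test_functions D = {\<psi>. smooth_on UNIV \<psi> \<and>
     compact (closure {x. \<psi> x \<noteq> 0}) \<and> closure {x. \<psi> x \<noteq> 0} \<subseteq> D}"


section \<open>The Laplacian and the space $H^2_0(D)$\<close>

definition laplacian :: "('a::euclidean_space \<Rightarrow> complex) \<Rightarrow> 'a \<Rightarrow> complex" where
  "laplacian f x = (\<Sum>b\<in>Basis. partial_deriv b (partial_deriv b f) x)"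

definition is_distr_laplacian ::
    "'a::euclidean_space set \<Rightarrow> ('a \<Rightarrow> complex) \<Rightarrow> ('a \<Rightarrow> complex) \<Rightarrow> bool" where
  "is_distr_laplacian D v w \<longleftrightarrow>
     (\<forall>\<psi>\<in>test_functions D.
        integral\<^sup>L (lebesgue_on D) (\<lambda>x. v x * laplacian \<psi> x) =
        integral\<^sup>L (lebesgue_on D) (\<lambda>x. w x * \<psi> x))"

definition L2_laplacian_dom :: "'a::euclidean_space set \<Rightarrow> ('a \<Rightarrow> complex) set" where
  "L2_laplacian_dom D = {v \<in> L2 D. \<exists>w\<in>L2 D. is_distr_laplacian D v w}"

text \<open>The distributional Laplacian of an element of \<open>L2_laplacian_dom D\<close>; for open \<open>D\<close> it is
  determined up to a null set.\<close>

definition distr_laplacian ::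
    "'a::euclidean_space set \<Rightarrow> ('a \<Rightarrow> complex) \<Rightarrow> 'a \<Rightarrow> complex" where
  "distr_laplacian D v = (SOME w. w \<in> L2 D \<and> is_distr_laplacian D v w)"

definition H2norm :: "'a::euclidean_space set \<Rightarrow> ('a \<Rightarrow> complex) \<Rightarrow> real" where
  "H2norm D \<psi> = sqrt ((l2norm D \<psi>)\<^sup>2 + (l2norm D (laplacian \<psi>))\<^sup>2)"

text \<open>The completion of the test functions in the norm \<open>H2norm D\<close>, realised inside $L^2(D)$ as
  the set of $L^2$ limits of \<open>H2norm\<close>-Cauchy sequences of test functions. A sequence of this kind
  that tends to $0$ in $L^2$ also tends to $0$ in \<open>H2norm\<close> (the Laplacian is closable), so
  the completion embeds in $L^2(D)$.\<close>

definition H20 :: "'a::euclidean_space set \<Rightarrow> ('a \<Rightarrow> complex) set" where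
  "H20 D = {u \<in> L2 D. \<exists>\<psi> :: nat \<Rightarrow> 'a \<Rightarrow> complex.
     (\<forall>k. \<psi> k \<in> test_functions D) \<and>
     (\<forall>e>0. \<exists>M. \<forall>j\<ge>M. \<forall>k\<ge>M. H2norm D (\<lambda>x. \<psi> j x - \<psi> k x) < e) \<and>
     (\<lambda>k. l2norm D (\<lambda>x. \<psi> k x - u x)) \<longlonglongrightarrow> 0}"


section \<open>Operators on $L^2(D)$\<close>

definition L2_operator ::
    "'a::euclidean_space set \<Rightarrow> (('a \<Rightarrow> complex) \<Rightarrow> ('a \<Rightarrow> complex)) \<Rightarrow> bool" where
  "L2_operator D T \<longleftrightarrow>
     (\<forall>f\<in>L2 D. T f \<in> L2 D) \<and>
     (\<forall>f\<in>L2 D. \<forall>g\<in>L2 D. ae_eq D f g \<longrightarrow> ae_eq D (T f) (T g)) \<and>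
     (\<forall>f\<in>L2 D. \<forall>g\<in>L2 D. ae_eq D (T (\<lambda>x. f x + g x)) (\<lambda>x. T f x + T g x)) \<and>
     (\<forall>c. \<forall>f\<in>L2 D. ae_eq D (T (\<lambda>x. c * f x)) (\<lambda>x. c * T f x))"

definition L2_compact_operator ::
    "'a::euclidean_space set \<Rightarrow> (('a \<Rightarrow> complex) \<Rightarrow> ('a \<Rightarrow> complex)) \<Rightarrow> bool" where
  "L2_compact_operator D T \<longleftrightarrow> L2_operator D T \<and>
     (\<forall>f :: nat \<Rightarrow> 'a \<Rightarrow> complex.
        (\<forall>k. f k \<in> L2 D) \<and> (\<exists>C. \<forall>k. l2norm D (f k) \<le> C) \<longrightarrow>
        (\<exists>g\<in>L2 D. \<exists>r :: nat \<Rightarrow> nat. strict_mono r \<and>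
           (\<lambda>k. l2norm D (\<lambda>x. T (f (r k)) x - g x)) \<longlonglongrightarrow> 0))"

text \<open>The operator norm takes values in \<open>ennreal\<close>, so that a finite bound on it entails
  boundedness.\<close>

definition L2_opnorm ::
    "'a::euclidean_space set \<Rightarrow> (('a \<Rightarrow> complex) \<Rightarrow> ('a \<Rightarrow> complex)) \<Rightarrow> ennreal" where
  "L2_opnorm D T = (SUP f\<in>{f \<in> L2 D. l2norm D f \<le> 1}. ennreal (l2norm D (T f)))"


section \<open>The operator $B$ and its resolvent\<close>

type_synonym 'a fpair = "('a \<Rightarrow> complex) \<times> ('a \<Rightarrow> complex)"

definition L2_pair :: "'a::euclidean_space set \<Rightarrow> 'a fpair set" where
  "L2_pair D = L2 D \<times> L2 D"

definition pair_ae_eq :: "'a::euclidean_space set \<Rightarrow> 'a fpair \<Rightarrow> 'a fpair \<Rightarrow> bool" where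
  "pair_ae_eq D F G \<longleftrightarrow> ae_eq D (fst F) (fst G) \<and> ae_eq D (snd F) (snd G)"

definition pair_norm :: "'a::euclidean_space set \<Rightarrow> 'a fpair \<Rightarrow> real" where
  "pair_norm D F = sqrt ((l2norm D (fst F))\<^sup>2 + (l2norm D (snd F))\<^sup>2)"

definition domB :: "'a::euclidean_space set \<Rightarrow> 'a fpair set" where
  "domB D = H20 D \<times> L2_laplacian_dom D"

definition opB :: "'a::euclidean_space set \<Rightarrow> ('a \<Rightarrow> complex) \<Rightarrow> 'a fpair \<Rightarrow> 'a fpair" where
  "opB D m = (\<lambda>(u, v). (\<lambda>x. distr_laplacian D u x + m x * v x, distr_laplacian D v))"

definition opB_minus ::
    "'a::euclidean_space set \<Rightarrow> ('a \<Rightarrow> complex) \<Rightarrow> real \<Rightarrow> 'a fpair \<Rightarrow> 'a fpair" where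
  "opB_minus D m l W =
     (\<lambda>x. fst (opB D m W) x - of_real l * fst W x,
      \<lambda>x. snd (opB D m W) x - of_real l * snd W x)"

text \<open>\<open>R\<close> is a bounded two-sided inverse of \<open>A\<close>, an operator in $L^2(D)\oplus L^2(D)$ with
  domain \<open>X\<close>.\<close>

definition is_bounded_inverse ::
    "'a::euclidean_space set \<Rightarrow> 'a fpair set \<Rightarrow> ('a fpair \<Rightarrow> 'a fpair) \<Rightarrow>
     ('a fpair \<Rightarrow> 'a fpair) \<Rightarrow> bool" where
  "is_bounded_inverse D X A R \<longleftrightarrow>
     (\<forall>F\<in>L2_pair D. R F \<in> X) \<and>
     (\<forall>F\<in>L2_pair D. \<forall>G\<in>L2_pair D. pair_ae_eq D F G \<longrightarrow> pair_ae_eq D (R F) (R G)) \<and>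
     (\<forall>F\<in>L2_pair D. pair_ae_eq D (A (R F)) F) \<and>
     (\<forall>W\<in>X. A W \<in> L2_pair D \<and> pair_ae_eq D (R (A W)) W) \<and>
     (\<exists>C. \<forall>F\<in>L2_pair D. pair_norm D (R F) \<le> C * pair_norm D F)"

definition resolventB_exists ::
    "'a::euclidean_space set \<Rightarrow> ('a \<Rightarrow> complex) \<Rightarrow> real \<Rightarrow> bool" where
  "resolventB_exists D m l \<longleftrightarrow> (\<exists>R. is_bounded_inverse D (domB D) (opB_minus D m l) R)"

definition resolventB ::
    "'a::euclidean_space set \<Rightarrow> ('a \<Rightarrow> complex) \<Rightarrow> real \<Rightarrow> 'a fpair \<Rightarrow> 'a fpair" where
  "resolventB D m l = (SOME R. is_bounded_inverse D (domB D) (opB_minus D m l) R)"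

text \<open>The entries of the $2\times 2$ block matrix of the resolvent.\<close>

definition R11 where "R11 D m l f = fst (resolventB D m l (f, \<lambda>x. 0))"
definition R12 where "R12 D m l g = fst (resolventB D m l (\<lambda>x. 0, g))"
definition R21 where "R21 D m l f = snd (resolventB D m l (f, \<lambda>x. 0))"
definition R22 where "R22 D m l g = snd (resolventB D m l (\<lambda>x. 0, g))"

definition mult_op ::
    "('a \<Rightarrow> complex) \<Rightarrow> (('a \<Rightarrow> complex) \<Rightarrow> ('a \<Rightarrow> complex)) \<Rightarrow> ('a \<Rightarrow> complex) \<Rightarrow> 'a \<Rightarrow> complex" where
  "mult_op \<phi> T f = (\<lambda>x. \<phi> x * T f x)"

definition is_cutoff ::
    "'a::euclidean_space set \<Rightarrow> 'a set \<Rightarrow> ('a \<Rightarrow> complex) \<Rightarrow> bool" where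
  "is_cutoff D N \<phi> \<longleftrightarrow> smooth_on D \<phi> \<and>
     (\<exists>U. open U \<and> frontier D \<subseteq> U \<and> (\<forall>x\<in>U \<inter> D. \<phi> x = 0)) \<and>
     (\<forall>x\<in>D - N. \<phi> x = 1)"

end

theory Submission
  imports Defs "HOL-Library.Diagonal_Subsequence" "HOL-Complex_Analysis.Great_Picard"
begin

text \<open>Write $K_\lambda$ for the space of $v \in L^2(D)$ with $(\Delta - \lambda) v = 0$. Since $H^2_0(D)$
  is the closure of the test functions in the graph norm of $\Delta$, the orthogonal complement of
  the range of $\Delta - \lambda$ on $H^2_0(D)$ is $K_\lambda$. Hence, once a particular solution of
  $(\Delta - \lambda) v = g$ is subtracted, the system $(B - \lambda)(u, v) = (f, g)$ asks for
  $v \in K_\lambda$ such that $f - m v$ is orthogonal to $K_\lambda$, and by Lax--Milgram this is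
  uniquely solvable as soon as $\Re(e^{i\theta} \int m |v|^2) \ge c \|v\|^2$ on $K_\lambda$. For
  $v \in K_\lambda$ and a real test function $\zeta$ one has
  $\|\nabla(\zeta v)\|^2 + \lambda \|\zeta v\|^2 = \| |\nabla \zeta| v \|^2$. Applied twice, with nested
  cutoffs, this gives $\|v\|_{L^2(K)} \le (C/\lambda) \|v\|$ for every compact $K \subset D$: so $v$
  concentrates in $N$, which yields coercivity for large $\lambda$ as well as the bound on
  $\phi R_{21}$. Compactness comes from Rellich's theorem and the gradient bound in the identity;
  the map from $g$ to the particular solution is the adjoint of a compact operator.\<close>

section \<open>Hilbert spaces\<close>

text \<open>The boundary carries no smoothness, so there are no traces and no elliptic regularity up
  to it. Hence \<open>u\<close> is only a point of the closed graph of the Laplacian on test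
  functions, \<open>v\<close> only a point of the adjoint graph, and all pointwise work is done in
  the interior on mollified functions. In the interior m may vanish or change sign, so coercivity
  fails on L^2(D) and can only be hoped for on K_l, whose elements are small there. One cutoff gives
  smallness of order l^(-1/2), already enough for coercivity; the second improves it to 1/l, the
  rate claimed for phi R_21. R_21 itself is only bounded uniformly in l: it inverts the compression
  of m to K_l, and decay and compactness appear after cutting off. L^2(D) is placed inside L^2 of
  the whole space as the functions vanishing off D, so that translation and convolution make sense.
  The inner product is the real one; complex scalars, including the rotation e^(i theta), act as
  multiplication operators.\<close>

lemma subspace_closure:
  fixes S :: "'a::real_normed_vector set"
  assumes S: "subspace S" shows "subspace (closure S)"
  unfolding subspace_def
proof (intro conjI ballI allI)
  show "0 \<in> closure S"
    using subspace_0[OF S] closure_subset by auto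
  fix x y assume xy: "x \<in> closure S" "y \<in> closure S"
  obtain s t where "\<forall>n. s n \<in> S" "s \<longlonglongrightarrow> x" "\<forall>n. t n \<in> S" "t \<longlonglongrightarrow> y"
    using xy unfolding closure_sequential by blast
  then have "\<forall>n. s n + t n \<in> S" "(\<lambda>n. s n + t n) \<longlonglongrightarrow> x + y"
    by (auto intro: subspace_add[OF S] tendsto_add)
  then show "x + y \<in> closure S"
    unfolding closure_sequential by (intro exI[of _ "\<lambda>n. s n + t n"] conjI)
next
  fix a x assume "x \<in> closure S"
  then obtain s where "\<forall>n. s n \<in> S" "s \<longlonglongrightarrow> x"
    unfolding closure_sequential by blast
  then have "\<forall>n. a *\<^sub>R s n \<in> S" "(\<lambda>n. a *\<^sub>R s n) \<longlonglongrightarrow> a *\<^sub>R x"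
    by (auto intro: subspace_scale[OF S] tendsto_scaleR)
  then show "a *\<^sub>R x \<in> closure S"
    unfolding closure_sequential by (intro exI[of _ "\<lambda>n. a *\<^sub>R s n"] conjI)
qed

text \<open>A minimising sequence for the distance to \<open>K\<close> is Cauchy by the
  parallelogram law, because midpoints of points of \<open>K\<close> stay in \<open>K\<close>.
  Orthogonality is the first-order condition at the minimiser.\<close>

lemma subspace_projection_exists:
  fixes K :: "'a::{real_inner,complete_space} set"
  assumes K: "subspace K" "closed K"
  shows "\<exists>y\<in>K. \<forall>w\<in>K. inner (x - y) w = 0"
proof -
  define d where "d = infdist x K"
  have ne: "K \<noteq> {}"
    using K(1) subspace_0 by blast
  have lb: "d \<le> norm (x - y)" if "y \<in> K" for y
    using infdist_le[OF that, of x] by (simp add: d_def dist_norm)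
  have "\<exists>y\<in>K. norm (x - y) < d + inverse (Suc n)" for n
  proof -
    have "d < d + inverse (Suc n)"
      by simp
    then have "(INF a\<in>K. dist x a) < d + inverse (Suc n)"
      unfolding d_def infdist_notempty[OF ne] .
    then show ?thesis
      using cInf_lessD[of "dist x ` K"] ne by (auto simp: dist_norm)
  qed
  then obtain y where y: "\<And>n. y n \<in> K" "\<And>n. norm (x - y n) < d + inverse (Suc n)"
    by metis
  have d0: "d \<ge> 0"
    by (simp add: d_def infdist_nonneg)
  \<comment> \<open>The identity 2 (d + e)^2 + 2 (d + e)^2 - 4 d^2 = 4 (2 d e + e^2), together with
    e <= 1, gives a bound linear in e.\<close>
  have par: "(norm (y m - y n))\<^sup>2 \<le> 4 * (2 * d + 1) * inverse (Suc N)" if "m \<ge> N" "n \<ge> N" for m n N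
  proof -
    define e where "e = inverse (real (Suc N))"
    have e: "0 < e" "e \<le> 1"
      by (auto simp: e_def field_simps)
    have le: "norm (x - y k) \<le> d + e" if "k \<ge> N" for k
    proof -
      have "inverse (real (Suc k)) \<le> e"
        using that by (simp add: e_def le_imp_inverse_le)
      then show ?thesis
        using y(2)[of k] by linarith
    qed
    have mid: "d \<le> norm (x - (1/2) *\<^sub>R (y m + y n))"
      by (intro lb subspace_scale[OF K(1)] subspace_add[OF K(1)] y)
    have "(norm (y m - y n))\<^sup>2 = 2 * (norm (x - y m))\<^sup>2 + 2 * (norm (x - y n))\<^sup>2
        - 4 * (norm (x - (1/2) *\<^sub>R (y m + y n)))\<^sup>2"
      unfolding power2_norm_eq_inner by (simp add: inner_simps inner_commute algebra_simps)
    also have "\<dots> \<le> 2 * (d + e)\<^sup>2 + 2 * (d + e)\<^sup>2 - 4 * d\<^sup>2"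
      using power_mono[OF le[OF that(1)], of 2] power_mono[OF le[OF that(2)], of 2] power_mono[OF mid d0, of 2]
      by simp
    also have "\<dots> = 4 * (2 * d * e + e * e)"
      by (simp add: power2_eq_square algebra_simps)
    also have "\<dots> \<le> 4 * (2 * d + 1) * e"
      using e by (simp add: algebra_simps mult_left_le)
    finally show ?thesis
      by (simp add: e_def)
  qed
  have "Cauchy y"
  proof (rule metric_CauchyI)
    fix e :: real assume e: "e > 0"
    have "(\<lambda>N. 4 * (2 * d + 1) * inverse (real (Suc N))) \<longlonglongrightarrow> 4 * (2 * d + 1) * 0"
      by (intro tendsto_intros LIMSEQ_inverse_real_of_nat)
    then have "eventually (\<lambda>N. 4 * (2 * d + 1) * inverse (real (Suc N)) < e\<^sup>2) sequentially"
      using e by (intro order_tendstoD(2)) auto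
    then obtain N where N: "4 * (2 * d + 1) * inverse (real (Suc N)) < e\<^sup>2"
      using eventually_happens trivial_limit_sequentially by blast
    have "dist (y m) (y n) < e" if "m \<ge> N" "n \<ge> N" for m n
    proof -
      have "(norm (y m - y n))\<^sup>2 < e\<^sup>2"
        using par[OF that] N by linarith
      then show ?thesis
        using e power2_less_imp_less[of "norm (y m - y n)" e] by (simp add: dist_norm)
    qed
    then show "\<exists>M. \<forall>m\<ge>M. \<forall>n\<ge>M. dist (y m) (y n) < e"
      by blast
  qed
  then obtain y0 where y0: "y \<longlonglongrightarrow> y0"
    using Cauchy_convergent convergent_def by blast
  have y0K: "y0 \<in> K"
    using closed_sequentially[OF K(2) _ y0] y(1) by blast
  have le: "norm (x - y0) \<le> d"
  proof (rule LIMSEQ_le)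
    show "(\<lambda>n. norm (x - y n)) \<longlonglongrightarrow> norm (x - y0)"
      by (intro tendsto_intros y0)
    show "(\<lambda>n. d + inverse (real (Suc n))) \<longlonglongrightarrow> d"
      using tendsto_add[OF tendsto_const LIMSEQ_inverse_real_of_nat, of d] by simp
    show "\<exists>N. \<forall>n\<ge>N. norm (x - y n) \<le> d + inverse (real (Suc n))"
      using y(2) less_imp_le by blast
  qed
  have "inner (x - y0) w = 0" if w: "w \<in> K" for w
  proof (rule ccontr)
    assume nz: "inner (x - y0) w \<noteq> 0"
    then have w0: "w \<noteq> 0" by auto
    \<comment> \<open>The minimiser over t of the distance from \<open>x\<close> to
      \<open>y0 + t *\<^sub>R w\<close>; a nonzero inner product would push that distance below
      \<open>d\<close>.\<close>
    define t where "t = inner (x - y0) w / (norm w)\<^sup>2"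
    have "d \<le> norm (x - (y0 + t *\<^sub>R w))"
      by (intro lb subspace_add[OF K(1)] y0K subspace_scale[OF K(1)] w)
    then have "(norm (x - y0))\<^sup>2 \<le> (norm (x - (y0 + t *\<^sub>R w)))\<^sup>2"
      using le by (intro power_mono) auto
    also have "\<dots> = (norm (x - y0))\<^sup>2 - 2 * t * inner (x - y0) w + t\<^sup>2 * (norm w)\<^sup>2"
      unfolding power2_norm_eq_inner by (simp add: inner_simps inner_commute algebra_simps power2_eq_square)
    also have "\<dots> = (norm (x - y0))\<^sup>2 - (inner (x - y0) w)\<^sup>2 / (norm w)\<^sup>2"
      using w0 by (simp add: t_def power2_eq_square field_simps)
    finally have "(inner (x - y0) w)\<^sup>2 / (norm w)\<^sup>2 \<le> 0"
      by simp
    moreover have "(inner (x - y0) w)\<^sup>2 / (norm w)\<^sup>2 > 0"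
      using nz w0 by simp
    ultimately show False
      by linarith
  qed
  then show ?thesis
    using y0K by blast
qed

text \<open>\<open>A\<close> acts on the ambient space and may leave \<open>K\<close>; what counts
  is its compression \<open>P A\<close>, with \<open>P\<close> the projection onto \<open>K\<close>.
  The solution is the fixed point of v - t P(A v - F), a contraction of \<open>K\<close> for small
  t, so non-symmetric forms are covered.\<close>

theorem lax_milgram_subspace:
  fixes K :: "'a::{real_inner,complete_space} set"
  assumes K: "subspace K" "closed K" and A: "bounded_linear A"
    and c: "c > 0" "\<And>v. v \<in> K \<Longrightarrow> c * (norm v)\<^sup>2 \<le> inner (A v) v"
  shows "\<exists>v\<in>K. \<forall>w\<in>K. inner (A v - F) w = 0"
proof -
  interpret A: bounded_linear A by fact
  obtain B where B: "B > 0" "\<And>x. norm (A x) \<le> norm x * B"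
    using A.pos_bounded by blast
  obtain P where P: "\<And>x. P x \<in> K" "\<And>x w. w \<in> K \<Longrightarrow> inner (x - P x) w = 0"
    using subspace_projection_exists[OF K] by metis
  have Peq: "inner (P x) w = inner x w" if "w \<in> K" for x w
    using P(2)[OF that, of x] by (simp add: inner_diff_left)
  have Pnorm: "norm (P x) \<le> norm x" for x
  proof -
    have "(norm (P x))\<^sup>2 = inner x (P x)"
      using Peq[OF P(1), of x x] by (simp add: power2_norm_eq_inner)
    also have "\<dots> \<le> norm x * norm (P x)"
      by (rule norm_cauchy_schwarz)
    finally show ?thesis
      by (cases "norm (P x) = 0") (auto simp: power2_eq_square)
  qed
  have Pdiff: "P x - P y = P (x - y)" for x y
  proof -
    define q where "q = P x - P y - P (x - y)"
    have "q \<in> K"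
      unfolding q_def by (intro subspace_diff[OF K(1)] P)
    moreover have "inner q w = 0" if "w \<in> K" for w
      using that by (simp add: q_def inner_diff_left Peq)
    ultimately have "inner q q = 0" by blast
    then show ?thesis
      by (simp add: q_def)
  qed
  \<comment> \<open>Any t with t B^2 < 2 c gives a contraction; this choice has t B^2 <= c.\<close>
  define t where "t = c / (c\<^sup>2 + B\<^sup>2)"
  have t: "t > 0"
    using c B by (simp add: t_def pos_add_strict)
  define \<kappa> where "\<kappa> = 1 - 2 * t * c + t\<^sup>2 * B\<^sup>2"
  have den: "c\<^sup>2 + B\<^sup>2 > 0"
    using c B by (simp add: pos_add_strict)
  have "t * (c\<^sup>2 + B\<^sup>2) = c"
    using den by (simp add: t_def)
  then have tc: "t * B\<^sup>2 \<le> c"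
    by (smt (verit) t zero_le_power2 distrib_left mult_nonneg_nonneg)
  have "t * (t * B\<^sup>2) \<le> t * c"
    using tc t by (intro mult_left_mono) auto
  moreover have "t * c > 0"
    using t c by simp
  ultimately have \<kappa>1: "\<kappa> < 1"
    by (simp add: \<kappa>_def power2_eq_square algebra_simps)
  define \<Phi> where "\<Phi> v = v - t *\<^sub>R P (A v - F)" for v
  have step: "(norm (\<Phi> v - \<Phi> w))\<^sup>2 \<le> \<kappa> * (norm (v - w))\<^sup>2" if "v \<in> K" "w \<in> K" for v w
  proof -
    define z where "z = v - w"
    have z: "z \<in> K"
      unfolding z_def by (intro subspace_diff[OF K(1)] that)
    have "\<Phi> v - \<Phi> w = z - t *\<^sub>R (P (A v - F) - P (A w - F))"
      by (simp add: \<Phi>_def z_def algebra_simps)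
    also have "P (A v - F) - P (A w - F) = P (A z)"
      by (simp add: Pdiff A.diff z_def)
    finally have eq: "\<Phi> v - \<Phi> w = z - t *\<^sub>R P (A z)" .
    have "(norm (\<Phi> v - \<Phi> w))\<^sup>2 = (norm z)\<^sup>2 - 2 * t * inner (P (A z)) z + t\<^sup>2 * (norm (P (A z)))\<^sup>2"
      unfolding eq power2_norm_eq_inner by (simp add: inner_simps inner_commute algebra_simps power2_eq_square)
    also have "\<dots> \<le> (norm z)\<^sup>2 - 2 * t * (c * (norm z)\<^sup>2) + t\<^sup>2 * (norm z * B)\<^sup>2"
    proof -
      have "norm (P (A z)) \<le> norm z * B"
        using Pnorm[of "A z"] B(2)[of z] by linarith
      then have "(norm (P (A z)))\<^sup>2 \<le> (norm z * B)\<^sup>2"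
        by (intro power_mono) auto
      moreover have "c * (norm z)\<^sup>2 \<le> inner (P (A z)) z"
        using c(2)[OF z] Peq[OF z] by simp
      ultimately show ?thesis
        using t by (intro add_mono diff_mono mult_left_mono) auto
    qed
    also have "\<dots> = \<kappa> * (norm z)\<^sup>2"
      by (simp add: \<kappa>_def algebra_simps power_mult_distrib)
    finally show ?thesis
      by (simp add: z_def)
  qed
  \<comment> \<open>If \<open>K\<close> is {0}, nothing forces c <= B and \<open>\<kappa>\<close>
    can be negative; \<open>max 0\<close> keeps the contraction factor nonnegative.\<close>
  define k where "k = sqrt (max 0 \<kappa>)"
  have k: "0 \<le> k" "k < 1"
    using \<kappa>1 by (auto simp: k_def)
  have contr: "dist (\<Phi> v) (\<Phi> w) \<le> k * dist v w" if "v \<in> K" "w \<in> K" for v w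
  proof -
    have "(norm (\<Phi> v - \<Phi> w))\<^sup>2 \<le> max 0 \<kappa> * (norm (v - w))\<^sup>2"
      using step[OF that] by (smt (verit) mult_right_mono zero_le_power2)
    also have "\<dots> = (k * norm (v - w))\<^sup>2"
      by (simp add: k_def power_mult_distrib)
    finally show ?thesis
      using k by (intro power2_le_imp_le[of "dist (\<Phi> v) (\<Phi> w)"]) (auto simp: dist_norm)
  qed
  have "complete K"
    using K(2) complete_eq_closed by blast
  moreover have "K \<noteq> {}"
    using K(1) subspace_0 by blast
  moreover have "\<Phi> ` K \<subseteq> K"
    using P(1) by (auto simp: \<Phi>_def intro!: subspace_diff[OF K(1)] subspace_scale[OF K(1)])
  ultimately have "\<exists>!v\<in>K. \<Phi> v = v"
    using k contr by (intro Banach_fix) auto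
  then obtain v where v: "v \<in> K" "\<Phi> v = v"
    by blast
  then have "P (A v - F) = 0"
    using t by (simp add: \<Phi>_def)
  then have "\<forall>w\<in>K. inner (A v - F) w = 0"
    using Peq by (metis inner_zero_left)
  then show ?thesis
    using v(1) by blast
qed

text \<open>In the application \<open>H\<close> is L^2(D), \<open>G0\<close> the graph of the
  Laplacian on test functions, \<open>M\<close> multiplication by m and \<open>J\<close>
  multiplication by e^(i theta). Unbounded operators appear as graphs: closure and adjoint are then
  subsets of a product space, and Lax-Milgram can be applied to the closed graph itself, a Hilbert
  space in the graph norm. Dissipativity is integration by parts.\<close>

locale dissipative_system =
  fixes H :: "'a::{real_inner,complete_space} set" and G0 :: "('a \<times> 'a) set" and M J :: "'a \<Rightarrow> 'a"
  assumes H: "subspace H" "closed H"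
    and G0: "subspace G0" "G0 \<subseteq> H \<times> H"
    and dissipative: "(p, d) \<in> G0 \<Longrightarrow> inner p d \<le> 0"
    and M: "bounded_linear M" "x \<in> H \<Longrightarrow> M x \<in> H"
    and J: "bounded_linear J" "inner (J x) (J y) = inner x y"
begin

text \<open>The minimal operator; for the Laplacian its domain is H^2_0(D).\<close>

definition Gcl :: "('a \<times> 'a) set" where
  "Gcl = closure G0"

text \<open>The graph of the adjoint; for the Laplacian, the distributional Laplacian on its maximal
  domain in L^2(D).\<close>

definition Gmax :: "('a \<times> 'a) set" where
  "Gmax = {(v, z). v \<in> H \<and> z \<in> H \<and> (\<forall>(p, d)\<in>G0. inner v d = inner z p)}"

text \<open>K_l, as the orthogonal complement in \<open>H\<close> of the range of Delta - l on test
  functions.\<close>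

definition Ker :: "real \<Rightarrow> 'a set" where
  "Ker l = {v \<in> H. \<forall>(p, d)\<in>G0. inner v (d - l *\<^sub>R p) = 0}"

text \<open>The system (B - l)(u, v) = (f, g). Carrying \<open>w\<close> for Delta u and
  \<open>z\<close> for Delta v keeps the relation meaningful before the graphs are known to be
  single valued.\<close>

definition solves :: "real \<Rightarrow> 'a \<Rightarrow> 'a \<Rightarrow> 'a \<Rightarrow> 'a \<Rightarrow> 'a \<Rightarrow> 'a \<Rightarrow> bool" where
  "solves l f g u w v z \<longleftrightarrow> (u, w) \<in> Gcl \<and> (v, z) \<in> Gmax \<and> w - l *\<^sub>R u + M v = f \<and> z - l *\<^sub>R v = g"

section \<open>The minimal graph, the adjoint graph and the kernel\<close>

lemma closed_Gcl: "closed Gcl"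
  by (simp add: Gcl_def)

lemma Gcl_sequence:
  assumes "(u, w) \<in> Gcl"
  shows "\<exists>p d. (\<forall>n::nat. (p n, d n) \<in> G0) \<and> p \<longlonglongrightarrow> u \<and> d \<longlonglongrightarrow> w"
proof -
  obtain s where s: "\<And>n. s n \<in> G0" "s \<longlonglongrightarrow> (u, w)"
    using assms unfolding Gcl_def closure_sequential by blast
  have "(\<lambda>n. fst (s n)) \<longlonglongrightarrow> u" "(\<lambda>n. snd (s n)) \<longlonglongrightarrow> w"
    using tendsto_fst[OF s(2)] tendsto_snd[OF s(2)] by auto
  moreover have "\<forall>n. (fst (s n), snd (s n)) \<in> G0"
    using s(1) by simp
  ultimately show ?thesis
    by (intro exI[of _ "\<lambda>n. fst (s n)"] exI[of _ "\<lambda>n. snd (s n)"] conjI)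
qed

lemma subspace_Gcl: "subspace Gcl"
  unfolding Gcl_def by (rule subspace_closure[OF G0(1)])

lemma Gcl_H:
  assumes "(u, w) \<in> Gcl" shows "u \<in> H" "w \<in> H"
proof -
  have "Gcl \<subseteq> H \<times> H"
    unfolding Gcl_def by (intro closure_minimal G0 closed_Times H)
  then show "u \<in> H" "w \<in> H" using assms by auto
qed

lemma Gcl_dissipative:
  assumes "(u, w) \<in> Gcl" shows "inner u w \<le> 0"
proof -
  obtain p d where s: "\<And>n::nat. (p n, d n) \<in> G0" "p \<longlonglongrightarrow> u" "d \<longlonglongrightarrow> w"
    using Gcl_sequence[OF assms] by blast
  show ?thesis
    by (rule LIMSEQ_le_const2[OF tendsto_inner[OF s(2,3)]]) (use s(1) dissipative in auto)
qed

text \<open>Green's formula passes from test functions to the closure because the inner product is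
  continuous.\<close>

lemma Gmax_Gcl:
  assumes "(v, z) \<in> Gmax" "(u, w) \<in> Gcl"
  shows "inner v w = inner z u"
proof -
  obtain p d where s: "\<And>n::nat. (p n, d n) \<in> G0" "p \<longlonglongrightarrow> u" "d \<longlonglongrightarrow> w"
    using Gcl_sequence[OF assms(2)] by blast
  have "inner v (d n) = inner z (p n)" for n
    using assms(1) s(1)[of n] by (auto simp: Gmax_def)
  then show ?thesis
    using LIMSEQ_unique[OF tendsto_inner[OF tendsto_const[of v] s(3)]] tendsto_inner[OF tendsto_const[of z] s(2)]
    by simp
qed

text \<open>When the square is expanded, the cross term - 2 l <u, w> is nonnegative by
  dissipativity, so each of the other two squares is bounded by the whole. The first bound is the
  source of the factors 1/l; the second supplies the control of Delta u that Rellich's theorem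
  needs.\<close>

lemma Gcl_shift_lower:
  assumes "(u, w) \<in> Gcl" "l \<ge> 0"
  shows "l * norm u \<le> norm (w - l *\<^sub>R u)" "norm w \<le> norm (w - l *\<^sub>R u)"
proof -
  have eq: "(norm (w - l *\<^sub>R u))\<^sup>2 = (norm w)\<^sup>2 - 2 * l * inner u w + (l * norm u)\<^sup>2"
    unfolding power2_norm_eq_inner power_mult_distrib
    by (simp add: inner_simps inner_commute algebra_simps power2_eq_square)
  have le: "2 * l * inner u w \<le> 0"
    using Gcl_dissipative[OF assms(1)] assms(2) by (simp add: mult_nonneg_nonpos)
  have "(l * norm u)\<^sup>2 \<le> (norm (w - l *\<^sub>R u))\<^sup>2" "(norm w)\<^sup>2 \<le> (norm (w - l *\<^sub>R u))\<^sup>2"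
    using le zero_le_power2[of "norm w"] zero_le_power2[of "l * norm u"] unfolding eq by linarith+
  then show "l * norm u \<le> norm (w - l *\<^sub>R u)" "norm w \<le> norm (w - l *\<^sub>R u)"
    by (auto dest: power2_le_imp_le)
qed

lemma Ker_subspace: "subspace (Ker l)" and Ker_closed: "closed (Ker l)"
proof -
  show "subspace (Ker l)"
    using H(1) by (fastforce simp: subspace_def Ker_def inner_add_left)
  have "Ker l = H \<inter> (\<Inter>(p,d)\<in>G0. {v. inner v (d - l *\<^sub>R p) = 0})"
    by (auto simp: Ker_def)
  moreover have "closed {v. inner v (d - l *\<^sub>R p) = 0}" for p d
    by (intro closed_Collect_eq continuous_intros)
  ultimately show "closed (Ker l)"
    using H(2) by (auto intro!: closed_Int closed_INT)
qed

lemma Ker_iff_Gmax: "v \<in> Ker l \<longleftrightarrow> (v, l *\<^sub>R v) \<in> Gmax"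
proof -
  have "v \<in> H \<Longrightarrow> l *\<^sub>R v \<in> H"
    using H(1) by (rule subspace_scale)
  then show ?thesis
    by (auto simp: Ker_def Gmax_def inner_diff_right)
qed

lemma Ker_Gcl:
  assumes "v \<in> Ker l" "(u, w) \<in> Gcl"
  shows "inner v (w - l *\<^sub>R u) = 0"
  using Gmax_Gcl[OF assms(1)[unfolded Ker_iff_Gmax] assms(2)] by (simp add: inner_diff_right)

lemma Gmax_diff:
  assumes "(v, z) \<in> Gmax" "(v', z') \<in> Gmax"
  shows "(v - v', z - z') \<in> Gmax"
  using assms subspace_diff[OF H(1)] by (fastforce simp: Gmax_def inner_diff_left)

lemma Gmax_add:
  assumes "(v, z) \<in> Gmax" "(v', z') \<in> Gmax"
  shows "(v + v', z + z') \<in> Gmax"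
  using assms subspace_add[OF H(1)] by (fastforce simp: Gmax_def inner_add_left)

text \<open>This is the weak form of the fourth-order problem (Delta - l)^2 u = F1 + Delta F2 with u
  in H^2_0. By \<open>Gcl_shift_lower\<close> the form is coercive in the graph norm.\<close>

lemma lax_milgram_Gcl:
  assumes l: "l > 0"
  shows "\<exists>u w. (u, w) \<in> Gcl \<and> (\<forall>u' w'. (u', w') \<in> Gcl \<longrightarrow>
           inner (w - l *\<^sub>R u) (w' - l *\<^sub>R u') = inner F1 u' + inner F2 w')"
proof -
  \<comment> \<open>\<open>A\<close> represents the form on the ambient product space: the
    coefficient of u' is - l (w - l u), that of w' is w - l u. Its values may lie outside
    \<open>Gcl\<close>.\<close>
  define A :: "'a \<times> 'a \<Rightarrow> 'a \<times> 'a" where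
    "A = (\<lambda>q. (- (l *\<^sub>R (snd q - l *\<^sub>R fst q)), snd q - l *\<^sub>R fst q))"
  have A: "bounded_linear A"
    unfolding A_def
    by (intro bounded_linear_Pair bounded_linear_minus bounded_linear_sub bounded_linear_const_scaleR
        bounded_linear_snd bounded_linear_fst)
  have Ain: "inner (A (u, w)) (u', w') = inner (w - l *\<^sub>R u) (w' - l *\<^sub>R u')" for u w u' w'
    by (simp add: A_def inner_simps algebra_simps)
  \<comment> \<open>If n is the norm of w - l u, then the norm of u is at most n / l and that of w
    at most n, so the squared graph norm is at most (1 + 1/l^2) n^2.\<close>
  define c where "c = 1 / (1 + 1 / l\<^sup>2)"
  have c: "c > 0"
    by (simp add: c_def add_pos_nonneg)
  have coer: "c * (norm q)\<^sup>2 \<le> inner (A q) q" if "q \<in> Gcl" for q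
  proof -
    obtain u w where q: "q = (u, w)" by (cases q)
    let ?n = "norm (w - l *\<^sub>R u)"
    note lower = Gcl_shift_lower[OF that[unfolded q], of l]
    have "norm u \<le> ?n / l"
      using lower(1) l by (simp add: pos_le_divide_eq mult.commute)
    then have "(norm u)\<^sup>2 \<le> (?n / l)\<^sup>2"
      by (intro power_mono) auto
    moreover have "(norm w)\<^sup>2 \<le> ?n\<^sup>2"
      using lower l by (intro power_mono) auto
    ultimately have "(norm q)\<^sup>2 \<le> (?n / l)\<^sup>2 + ?n\<^sup>2"
      unfolding q norm_Pair by (simp only: real_sqrt_pow2 add_nonneg_nonneg zero_le_power2 add_mono)
    then have "(norm q)\<^sup>2 \<le> (1 + 1 / l\<^sup>2) * ?n\<^sup>2"
      by (simp add: power_divide algebra_simps)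
    then have "c * (norm q)\<^sup>2 \<le> ?n\<^sup>2"
      unfolding c_def by (simp add: field_simps add_pos_nonneg pos_divide_le_eq)
    then show ?thesis
      by (simp add: q Ain power2_norm_eq_inner)
  qed
  obtain q where q: "q \<in> Gcl" "\<And>q'. q' \<in> Gcl \<Longrightarrow> inner (A q - (F1, F2)) q' = 0"
    using lax_milgram_subspace[OF subspace_Gcl closed_Gcl A c, of "(F1, F2)"] coer by blast
  obtain u w where uw: "q = (u, w)" by (cases q)
  have "inner (w - l *\<^sub>R u) (w' - l *\<^sub>R u') = inner F1 u' + inner F2 w'" if "(u', w') \<in> Gcl" for u' w'
    using q(2)[OF that] Ain[of u w u' w'] by (simp add: uw inner_diff_left)
  then show ?thesis
    using q(1) uw by blast
qed

text \<open>Take v = (Delta - l) u, where u in H^2_0 solves (Delta - l)^2 u = g weakly; then (Delta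
  - l) v = g in the adjoint sense. Testing with u itself gives the identity for the squared norm of
  v, and l |u| <= |v| turns it into the bound. As an element of the range of the minimal operator, v
  is orthogonal to \<open>Ker l\<close>: it is the solution of least norm.\<close>

lemma particular_solution:
  assumes l: "l > 0" and g: "g \<in> H"
  obtains u w where "(u, w) \<in> Gcl" "(w - l *\<^sub>R u, g + l *\<^sub>R (w - l *\<^sub>R u)) \<in> Gmax"
    "(norm (w - l *\<^sub>R u))\<^sup>2 = inner g u" "norm (w - l *\<^sub>R u) \<le> norm g / l"
proof -
  obtain u w where uw: "(u, w) \<in> Gcl"
    "\<And>u' w'. (u', w') \<in> Gcl \<Longrightarrow> inner (w - l *\<^sub>R u) (w' - l *\<^sub>R u') = inner g u'"
    using lax_milgram_Gcl[OF l, of g 0] by auto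
  define v where "v = w - l *\<^sub>R u"
  have vH: "v \<in> H"
    unfolding v_def using Gcl_H[OF uw(1)] H(1) by (intro subspace_diff subspace_scale)
  have "(v, g + l *\<^sub>R v) \<in> Gmax"
    unfolding Gmax_def
  proof (clarsimp, intro conjI)
    show "v \<in> H" by fact
    show "g + l *\<^sub>R v \<in> H"
      using g vH H(1) by (intro subspace_add subspace_scale)
    show "\<forall>(p, d)\<in>G0. inner v d = inner (g + l *\<^sub>R v) p"
    proof clarify
      fix p d assume "(p, d) \<in> G0"
      then have "(p, d) \<in> Gcl"
        unfolding Gcl_def using closure_subset by blast
      from uw(2)[OF this] show "inner v d = inner (g + l *\<^sub>R v) p"
        by (simp add: v_def[symmetric] inner_diff_right inner_add_left)
    qed
  qed
  moreover have nv: "(norm v)\<^sup>2 = inner g u"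
    using uw(2)[OF uw(1)] by (simp add: v_def power2_norm_eq_inner)
  moreover have "norm v \<le> norm g / l"
  proof -
    have "l * (norm v)\<^sup>2 \<le> norm g * (l * norm u)"
      using nv norm_cauchy_schwarz[of g u] l by (simp add: mult.left_commute mult_left_mono)
    also have "\<dots> \<le> norm g * norm v"
      using Gcl_shift_lower(1)[OF uw(1), of l] l by (intro mult_left_mono) (auto simp: v_def)
    finally have "l * norm v \<le> norm g"
      by (cases "norm v = 0") (auto simp: power2_eq_square)
    then show ?thesis
      using l by (simp add: pos_le_divide_eq mult.commute)
  qed
  ultimately show thesis
    using that uw(1) by (simp add: v_def)
qed

end

text \<open>Coercivity is required only on \<open>Ker l\<close> and only after the rotation
  \<open>J\<close>. That \<open>J\<close> maps \<open>Ker l\<close> onto itself allows test vectors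
  to be rotated back. The constants \<open>c\<close> and \<open>B\<close> are parameters apart from
  \<open>l\<close>: in the application they stay fixed as \<open>l\<close> grows, which makes the
  final estimates uniform.\<close>

locale coercive_system = dissipative_system +
  fixes l c B :: real
  assumes l: "l > 0" and c: "c > 0" and B: "B \<ge> 0" "norm (M x) \<le> B * norm x"
    and JK: "v \<in> Ker l \<Longrightarrow> J v \<in> Ker l" "v \<in> Ker l \<Longrightarrow> \<exists>v'\<in>Ker l. J v' = v"
    and coercive: "v \<in> Ker l \<Longrightarrow> c * (norm v)\<^sup>2 \<le> inner (J (M v)) v"
begin

section \<open>Solvability, bounds and compactness for the coercive system\<close>

lemma J_norm: "norm (J x) = norm x"
  by (simp add: norm_eq_sqrt_inner J(2))

lemma J_diff: "J (x - y) = J x - J y"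
  by (rule linear_diff[OF bounded_linear.linear[OF J(1)]])

lemma M_diff: "M (x - y) = M x - M y"
  by (rule linear_diff[OF bounded_linear.linear[OF M(1)]])

lemma M_add: "M (x + y) = M x + M y"
  by (rule linear_add[OF bounded_linear.linear[OF M(1)]])

text \<open>Lax-Milgram on \<open>Ker l\<close> yields v with f - M v orthogonal to
  \<open>Ker l\<close>. Such a vector lies in the range of the minimal Delta - l, because that range
  is closed by the lower bound.\<close>

lemma kernel_solution:
  assumes "f \<in> H"
  obtains u w v where "(u, w) \<in> Gcl" "v \<in> Ker l" "w - l *\<^sub>R u + M v = f"
proof -
  have JM: "bounded_linear (\<lambda>v. J (M v))"
    by (rule bounded_linear_compose[OF J(1) M(1)])
  obtain v where v: "v \<in> Ker l" "\<And>y. y \<in> Ker l \<Longrightarrow> inner (J (M v) - J f) y = 0"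
    using lax_milgram_subspace[OF Ker_subspace Ker_closed JM c, of l "J f"] coercive by blast
  have orth: "inner (f - M v) y = 0" if "y \<in> Ker l" for y
  proof -
    have "inner (f - M v) y = inner (J (f - M v)) (J y)"
      by (simp add: J(2))
    also have "\<dots> = - inner (J (M v) - J f) (J y)"
      by (simp add: J_diff inner_diff_left)
    also have "\<dots> = 0"
      using v(2)[OF JK(1)[OF that]] by simp
    finally show ?thesis .
  qed
  \<comment> \<open>The data represent the functional <f - M v, w' - l u'>, so w - l u is the
    orthogonal projection of f - M v onto the range; \<open>q\<close> is the error of this
    projection up to sign.\<close>
  obtain u w where uw: "(u, w) \<in> Gcl" "\<And>u' w'. (u', w') \<in> Gcl \<Longrightarrow>
      inner (w - l *\<^sub>R u) (w' - l *\<^sub>R u') = inner (f - M v) (w' - l *\<^sub>R u')"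
    using lax_milgram_Gcl[OF l, of "- (l *\<^sub>R (f - M v))" "f - M v"]
    by (auto simp: inner_diff_right)
  define q where "q = w - l *\<^sub>R u - (f - M v)"
  have "f - M v \<in> H" "w - l *\<^sub>R u \<in> H"
    using v(1) assms M(2) Gcl_H[OF uw(1)] H(1)
    by (auto simp: Ker_def intro!: subspace_diff subspace_scale)
  then have qH: "q \<in> H"
    unfolding q_def using subspace_diff[OF H(1)] by blast
  have "q \<in> Ker l"
    unfolding Ker_def
  proof (clarsimp simp: qH)
    fix p d assume "(p, d) \<in> G0"
    then have "(p, d) \<in> Gcl"
      unfolding Gcl_def using closure_subset by blast
    from uw(2)[OF this] show "inner q (d - l *\<^sub>R p) = 0"
      by (simp add: q_def inner_diff_left)
  qed
  \<comment> \<open>\<open>q\<close> lies in \<open>Ker l\<close>, while w - l u and f - M v are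
    both orthogonal to \<open>Ker l\<close>.\<close>
  then have "inner q q = 0"
    using orth[of q] Ker_Gcl[of q l u w] uw(1) unfolding q_def
    by (metis (no_types, lifting) cancel_comm_monoid_add_class.diff_cancel inner_commute inner_diff_left)
  then have "q = 0" by simp
  then show thesis
    using that[OF uw(1) v(1)] by (simp add: q_def)
qed

text \<open>Rotate the equation by \<open>J\<close> and pair it with v. The term with u drops out,
  since v = J v' for some v' in \<open>Ker l\<close> and \<open>J\<close> preserves inner products;
  coercivity bounds what is left.\<close>

lemma kernel_bound:
  assumes "(u, w) \<in> Gcl" "v \<in> Ker l" "w - l *\<^sub>R u + M v = f"
  shows "norm v \<le> norm f / c"
proof -
  obtain v' where v': "v' \<in> Ker l" "J v' = v"
    using JK(2)[OF assms(2)] by blast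
  have "inner (J (w - l *\<^sub>R u)) v = inner (w - l *\<^sub>R u) v'"
    using v'(2) J(2) by metis
  also have "\<dots> = 0"
    using Ker_Gcl[OF v'(1) assms(1)] by (simp add: inner_commute)
  finally have orth: "inner (J (w - l *\<^sub>R u)) v = 0" .
  have "M v = f - (w - l *\<^sub>R u)"
    using assms(3) by (simp add: algebra_simps)
  then have "J (M v) = J f - J (w - l *\<^sub>R u)"
    by (simp only: J_diff)
  then have "c * (norm v)\<^sup>2 \<le> inner (J f) v"
    using coercive[OF assms(2)] orth by (simp add: inner_diff_left)
  also have "\<dots> \<le> norm f * norm v"
    using norm_cauchy_schwarz[of "J f" v] by (simp add: J_norm)
  finally have "c * norm v \<le> norm f"
    by (cases "norm v = 0") (auto simp: power2_eq_square)
  then show ?thesis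
    using c by (simp add: pos_le_divide_eq mult.commute)
qed

lemma solves_decompose:
  assumes "solves l f g u w v z"
  obtains u1 v1 where "v - v1 \<in> Ker l" "w - l *\<^sub>R u + M (v - v1) = f - M v1" "\<exists>w1. (u1, w1) \<in> Gcl \<and> v1 = w1 - l *\<^sub>R u1"
    "(v1, g + l *\<^sub>R v1) \<in> Gmax"
    "(norm v1)\<^sup>2 = inner g u1" "norm v1 \<le> norm g / l"
proof -
  have g: "g \<in> H"
    using assms subspace_diff[OF H(1)] subspace_scale[OF H(1)] unfolding solves_def Gmax_def by auto
  obtain u1 w1 where 1: "(u1, w1) \<in> Gcl" "(w1 - l *\<^sub>R u1, g + l *\<^sub>R (w1 - l *\<^sub>R u1)) \<in> Gmax"
    "(norm (w1 - l *\<^sub>R u1))\<^sup>2 = inner g u1" "norm (w1 - l *\<^sub>R u1) \<le> norm g / l"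
    using particular_solution[OF l g] .
  have z: "z = g + l *\<^sub>R v" "(v, z) \<in> Gmax"
    using assms by (auto simp: solves_def algebra_simps)
  show thesis
  proof (rule that)
    show "v - (w1 - l *\<^sub>R u1) \<in> Ker l"
      unfolding Ker_iff_Gmax using Gmax_diff[OF z(2) 1(2)] by (simp add: z(1) scaleR_diff_right)
    have "f = w - l *\<^sub>R u + M v"
      using assms by (simp add: solves_def)
    then show "w - l *\<^sub>R u + M (v - (w1 - l *\<^sub>R u1)) = f - M (w1 - l *\<^sub>R u1)"
      using M_diff[of v "w1 - l *\<^sub>R u1"] by simp
  qed (use 1 in auto)
qed

lemma solves_exists:
  assumes "f \<in> H" "g \<in> H"
  shows "\<exists>u w v z. solves l f g u w v z"
proof -
  obtain u1 w1 where 1: "(w1 - l *\<^sub>R u1, g + l *\<^sub>R (w1 - l *\<^sub>R u1)) \<in> Gmax"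
    using particular_solution[OF l assms(2)] by metis
  define v1 where "v1 = w1 - l *\<^sub>R u1"
  have "v1 \<in> H"
    using 1 by (auto simp: Gmax_def v1_def)
  then have "f - M v1 \<in> H"
    using assms(1) M(2) H(1) by (intro subspace_diff)
  then obtain u w v where 2: "(u, w) \<in> Gcl" "v \<in> Ker l" "w - l *\<^sub>R u + M v = f - M v1"
    using kernel_solution by blast
  have "(v + v1, l *\<^sub>R v + (g + l *\<^sub>R v1)) \<in> Gmax"
    using Gmax_add[OF 2(2)[unfolded Ker_iff_Gmax] 1] by (simp add: v1_def)
  then have "solves l f g u w (v + v1) (l *\<^sub>R v + (g + l *\<^sub>R v1))"
    using 2 by (simp add: solves_def M_add algebra_simps)
  then show ?thesis by blast
qed

text \<open>Here \<open>e\<close> bounds f - M v1, the right-hand side that remains after the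
  particular solution v1 is subtracted, and \<open>e / c\<close> bounds the kernel part v - v1. The
  bounds on u and w then come from w - l u = (f - M v1) - M (v - v1).\<close>

lemma solves_bounds:
  assumes "solves l f g u w v z"
  defines "e \<equiv> norm f + B * norm g / l"
  shows "norm v \<le> norm g / l + e / c" "l * norm u \<le> e + B * (e / c)" "norm w \<le> e + B * (e / c)"
proof -
  obtain u1 v1 where *: "v - v1 \<in> Ker l" "w - l *\<^sub>R u + M (v - v1) = f - M v1" "norm v1 \<le> norm g / l"
    using solves_decompose[OF assms(1)] by metis
  have G: "(u, w) \<in> Gcl"
    using assms(1) by (simp add: solves_def)
  have "norm (M v1) \<le> B * (norm g / l)"
    using B(2)[of v1] mult_left_mono[OF *(3) B(1)] by linarith
  then have fe: "norm (f - M v1) \<le> e"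
    using norm_triangle_ineq4[of f "M v1"] by (simp add: e_def)
  have v: "norm (v - v1) \<le> e / c"
    using kernel_bound[OF G *(1,2)] divide_right_mono[OF fe, of c] c by linarith
  then show "norm v \<le> norm g / l + e / c"
    using norm_triangle_ineq[of "v - v1" v1] *(3) by simp
  have "w - l *\<^sub>R u = (f - M v1) - M (v - v1)"
    using *(2) by (simp add: algebra_simps)
  then have "norm (w - l *\<^sub>R u) \<le> norm (f - M v1) + norm (M (v - v1))"
    by (simp only: norm_triangle_ineq4)
  also have "norm (M (v - v1)) \<le> B * (e / c)"
    using B(2)[of "v - v1"] mult_left_mono[OF v B(1)] by linarith
  finally have "norm (w - l *\<^sub>R u) \<le> e + B * (e / c)"
    using fe by linarith
  then show "l * norm u \<le> e + B * (e / c)" "norm w \<le> e + B * (e / c)"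
    using Gcl_shift_lower[OF G, of l] l by auto
qed

lemma solves_diff:
  assumes "solves l f g u w v z" "solves l f' g' u' w' v' z'"
  shows "solves l (f - f') (g - g') (u - u') (w - w') (v - v') (z - z')"
proof -
  have "f - f' = (w - l *\<^sub>R u + M v) - (w' - l *\<^sub>R u' + M v')"
       "g - g' = (z - l *\<^sub>R v) - (z' - l *\<^sub>R v')"
    using assms by (auto simp: solves_def)
  then have "w - w' - l *\<^sub>R (u - u') + M (v - v') = f - f'" "z - z' - l *\<^sub>R (v - v') = g - g'"
    by (simp_all add: M_diff algebra_simps)
  then show ?thesis
    using assms Gmax_diff subspace_diff[OF subspace_Gcl, of "(u, w)" "(u', w')"]
    by (simp add: solves_def)
qed

text \<open>The difference of two solutions has zero data, so the bounds force it to vanish.\<close>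

lemma solves_unique:
  assumes "solves l f g u w v z" "solves l f g u' w' v' z'"
  shows "u = u'" "v = v'"
  using solves_bounds[OF solves_diff[OF assms]] l by (auto simp: mult_le_0_iff)

lemma solves_H:
  assumes "solves l f g u w v z" shows "g \<in> H"
proof -
  have "g = z - l *\<^sub>R v" "v \<in> H" "z \<in> H"
    using assms by (auto simp: solves_def Gmax_def)
  then show ?thesis
    using H(1) by (simp add: subspace_diff subspace_scale)
qed

text \<open>For fixed \<open>l\<close> the bounds control u together with w = Delta u, so u stays in
  a bounded set of H^2_0. Rellich's theorem enters as a hypothesis because an abstract Hilbert space
  knows nothing of it.\<close>

lemma first_component_compact:
  fixes u :: "nat \<Rightarrow> 'a"
  assumes rellich: "\<And>(u::nat \<Rightarrow> 'a) w C. \<forall>n. (u n, w n) \<in> Gcl \<and> norm (u n) \<le> C \<and> norm (w n) \<le> C \<Longrightarrow>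
      \<exists>r::nat \<Rightarrow> nat. strict_mono r \<and> convergent (u \<circ> r)"
    and sol: "\<And>n. solves l (f n) (g n) (u n) (w n) (v n) (z n)"
    and bd: "\<And>n. norm (f n) \<le> C" "\<And>n. norm (g n) \<le> C"
  shows "\<exists>r::nat \<Rightarrow> nat. strict_mono r \<and> convergent (u \<circ> r)"
proof -
  define e where "e = C + B * C / l"
  have C: "C \<ge> 0"
    using bd(1)[of 0] norm_ge_zero order_trans by blast
  have le: "norm (f n) + B * norm (g n) / l \<le> e" for n
    unfolding e_def using bd B l by (intro add_mono divide_right_mono mult_left_mono) auto
  have le2: "x + B * (x / c) \<le> e + B * (e / c)" if "x \<le> e" for x
    using that B c by (intro add_mono mult_left_mono divide_right_mono) auto
  show ?thesis
  proof (rule rellich, intro allI conjI)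
    fix n
    show "(u n, w n) \<in> Gcl"
      using sol[of n] by (simp add: solves_def)
    have "l * norm (u n) \<le> e + B * (e / c)"
      using solves_bounds(2)[OF sol[of n]] le2[OF le[of n]] by linarith
    then show "norm (u n) \<le> max (e + B * (e / c)) ((e + B * (e / c)) / l)"
      using l by (simp add: pos_le_divide_eq mult.commute le_max_iff_disj)
    show "norm (w n) \<le> max (e + B * (e / c)) ((e + B * (e / c)) / l)"
      using solves_bounds(3)[OF sol[of n]] le2[OF le[of n]] by linarith
  qed
qed

text \<open>The map from \<open>g\<close> to the particular solution is the adjoint of a compact operator; its
  compactness follows from the identity \<open>(norm v1)\<^sup>2 = inner g u1\<close>.\<close>

lemma second_component_compact:
  fixes v :: "nat \<Rightarrow> 'a"
  assumes rellich: "\<And>(u::nat \<Rightarrow> 'a) w C. \<forall>n. (u n, w n) \<in> Gcl \<and> norm (u n) \<le> C \<and> norm (w n) \<le> C \<Longrightarrow>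
      \<exists>r::nat \<Rightarrow> nat. strict_mono r \<and> convergent (u \<circ> r)"
    and sol: "\<And>n. solves l 0 (g n) (u n) (w n) (v n) (z n)"
    and bd: "\<And>n. norm (g n) \<le> C"
  shows "\<exists>r::nat \<Rightarrow> nat. strict_mono r \<and> convergent (v \<circ> r)"
proof -
  have gH: "g n \<in> H" for n
    using solves_H[OF sol] .
  have "\<forall>n. \<exists>u1 w1. (u1, w1) \<in> Gcl \<and> (w1 - l *\<^sub>R u1, g n + l *\<^sub>R (w1 - l *\<^sub>R u1)) \<in> Gmax \<and>
      norm (w1 - l *\<^sub>R u1) \<le> norm (g n) / l"
    using particular_solution[OF l gH] by metis
  then obtain u1 w1 where 1: "\<And>n. (u1 n, w1 n) \<in> Gcl"
    "\<And>n. (w1 n - l *\<^sub>R u1 n, g n + l *\<^sub>R (w1 n - l *\<^sub>R u1 n)) \<in> Gmax"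
    "\<And>n. norm (w1 n - l *\<^sub>R u1 n) \<le> norm (g n) / l"
    by metis
  define v1 where "v1 n = w1 n - l *\<^sub>R u1 n" for n
  have C: "C \<ge> 0"
    using bd[of 0] norm_ge_zero order_trans by blast
  have v1: "norm (v1 n) \<le> C / l" for n
    using 1(3)[of n] divide_right_mono[OF bd[of n], of l] l by (simp add: v1_def)
  obtain r :: "nat \<Rightarrow> nat" where r: "strict_mono r" "convergent (u1 \<circ> r)"
  proof -
    have "\<exists>r::nat \<Rightarrow> nat. strict_mono r \<and> convergent (u1 \<circ> r)"
    proof (rule rellich, intro allI conjI)
      fix n
      show "(u1 n, w1 n) \<in> Gcl" by (rule 1)
      have "l * norm (u1 n) \<le> C / l" "norm (w1 n) \<le> C / l"
        using Gcl_shift_lower[OF 1(1)[of n], of l] l v1[of n] by (auto simp: v1_def)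
      then show "norm (u1 n) \<le> max (C / l) (C / l / l)" "norm (w1 n) \<le> max (C / l) (C / l / l)"
        using l by (simp_all add: pos_le_divide_eq mult.commute le_max_iff_disj)
    qed
    then show thesis using that by blast
  qed
  \<comment> \<open>The identity for differences: with bounded data, v1 depends on u1 in a
    Hoelder-1/2 manner, so convergence of u1 along \<open>r\<close> passes to v1.\<close>
  have sq: "(norm (v1 m - v1 n))\<^sup>2 \<le> 2 * C * norm (u1 m - u1 n)" for m n
  proof -
    have d: "(u1 m - u1 n, w1 m - w1 n) \<in> Gcl"
      using subspace_diff[OF subspace_Gcl 1(1)[of m] 1(1)[of n]] by simp
    have e: "v1 m - v1 n = (w1 m - w1 n) - l *\<^sub>R (u1 m - u1 n)"
      by (simp add: v1_def algebra_simps)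
    have "inner (v1 m - v1 n) (w1 m - w1 n)
        = inner (g m + l *\<^sub>R v1 m - (g n + l *\<^sub>R v1 n)) (u1 m - u1 n)"
      using Gmax_Gcl[OF Gmax_diff[OF 1(2)[of m] 1(2)[of n]] d] by (simp add: v1_def)
    then have "(norm (v1 m - v1 n))\<^sup>2 = inner (g m - g n) (u1 m - u1 n)"
      unfolding power2_norm_eq_inner by (subst (2) e) (simp add: inner_simps algebra_simps)
    also have "\<dots> \<le> norm (g m - g n) * norm (u1 m - u1 n)"
      by (rule norm_cauchy_schwarz)
    also have "\<dots> \<le> (2 * C) * norm (u1 m - u1 n)"
      using norm_triangle_ineq4[of "g m" "g n"] bd[of m] bd[of n] by (intro mult_right_mono) auto
    finally show ?thesis .
  qed
  \<comment> \<open>Since f = 0, the kernel part v - v1 solves the kernel equation with right-hand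
    side - M v1. By \<open>kernel_bound\<close> it depends Lipschitz continuously on v1, and the
    compactness of v1 carries over to v.\<close>
  have bnd: "norm (v m - v n) \<le> (1 + B / c) * norm (v1 m - v1 n)" for m n
  proof -
    have k: "v k - v1 k \<in> Ker l" for k
      unfolding Ker_iff_Gmax using sol[of k] Gmax_diff[of "v k" "z k" "v1 k", OF _ 1(2)[of k, folded v1_def]]
      by (auto simp: solves_def algebra_simps)
    have "(v m - v1 m) - (v n - v1 n) \<in> Ker l"
      by (intro subspace_diff[OF Ker_subspace] k)
    moreover have "(u m - u n, w m - w n) \<in> Gcl"
      using subspace_diff[OF subspace_Gcl, of "(u m, w m)" "(u n, w n)"] sol by (auto simp: solves_def)
    moreover have "(w m - w n) - l *\<^sub>R (u m - u n) + M ((v m - v1 m) - (v n - v1 n)) = - M (v1 m - v1 n)"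
    proof -
      have "w k = l *\<^sub>R u k - M (v k)" for k
        using sol[of k] by (simp add: solves_def eq_diff_eq diff_add_eq)
      then show ?thesis
        by (simp add: M_diff scaleR_diff_right)
    qed
    ultimately have "norm ((v m - v1 m) - (v n - v1 n)) \<le> norm (- M (v1 m - v1 n)) / c"
      using kernel_bound by blast
    also have "\<dots> \<le> B * norm (v1 m - v1 n) / c"
      using B(2)[of "v1 m - v1 n"] c by (intro divide_right_mono) auto
    finally show ?thesis
      using norm_triangle_ineq[of "(v m - v1 m) - (v n - v1 n)" "v1 m - v1 n"]
      by (simp add: algebra_simps)
  qed
  have "Cauchy (v1 \<circ> r)"
  proof (rule CauchyI)
    fix e :: real assume e: "e > 0"
    have "Cauchy (u1 \<circ> r)"
      using r(2) by (rule convergent_Cauchy)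
    \<comment> \<open>The summand 1 in \<open>2 * C + 1\<close> keeps the divisor positive when C =
      0.\<close>
    then obtain N where N: "\<And>m n. m \<ge> N \<Longrightarrow> n \<ge> N \<Longrightarrow> norm ((u1 \<circ> r) m - (u1 \<circ> r) n) < e\<^sup>2 / (2 * C + 1)"
      using CauchyD[of "u1 \<circ> r" "e\<^sup>2 / (2 * C + 1)"] e C by auto
    have "norm ((v1 \<circ> r) m - (v1 \<circ> r) n) < e" if "m \<ge> N" "n \<ge> N" for m n
    proof -
      have "(norm ((v1 \<circ> r) m - (v1 \<circ> r) n))\<^sup>2 \<le> (2 * C + 1) * norm ((u1 \<circ> r) m - (u1 \<circ> r) n)"
        using sq[of "r m" "r n"] by (auto simp: algebra_simps intro: order_trans)
      also have "\<dots> < e\<^sup>2"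
        using N[OF that] C by (simp add: field_simps)
      finally show ?thesis
        using e by (intro power2_less_imp_less[of _ e]) auto
    qed
    then show "\<exists>M. \<forall>m\<ge>M. \<forall>n\<ge>M. norm ((v1 \<circ> r) m - (v1 \<circ> r) n) < e"
      by blast
  qed
  have "Cauchy (v \<circ> r)"
  proof (rule CauchyI)
    fix e :: real assume e: "e > 0"
    have p: "1 + B / c > 0"
      using B c by (simp add: add_pos_nonneg)
    obtain N where N: "\<And>m n. m \<ge> N \<Longrightarrow> n \<ge> N \<Longrightarrow> norm ((v1 \<circ> r) m - (v1 \<circ> r) n) < e / (1 + B / c)"
      using CauchyD[OF \<open>Cauchy (v1 \<circ> r)\<close>, of "e / (1 + B / c)"] e p by auto
    have "norm ((v \<circ> r) m - (v \<circ> r) n) < e" if "m \<ge> N" "n \<ge> N" for m n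
      using bnd[of "r m" "r n"] mult_strict_left_mono[OF N[OF that] p] p by simp
    then show "\<exists>M. \<forall>m\<ge>M. \<forall>n\<ge>M. norm ((v \<circ> r) m - (v \<circ> r) n) < e"
      by blast
  qed
  then show ?thesis
    using r(1) Cauchy_convergent by blast
qed

end

section \<open>Calculus for $C^k$ functions\<close>

lemma partial_deriv_at:
  assumes "(f has_derivative D) (at x)" shows "partial_deriv b f x = D b"
  using frechet_derivative_at[OF assms] by (simp add: partial_deriv_def)

lemma has_derivative_partial_deriv:
  assumes "f differentiable (at x)"
  shows "(f has_derivative (\<lambda>h. \<Sum>b\<in>Basis. (h \<bullet> b) *\<^sub>R partial_deriv b f x)) (at x)"
proof -
  have D: "(f has_derivative frechet_derivative f (at x)) (at x)"
    using assms frechet_derivative_works by blast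
  then have "linear (frechet_derivative f (at x))"
    using has_derivative_linear by blast
  then have "frechet_derivative f (at x) h = (\<Sum>b\<in>Basis. (h \<bullet> b) *\<^sub>R partial_deriv b f x)" for h
    unfolding partial_deriv_def using linear_sum[of "frechet_derivative f (at x)" "\<lambda>b. (h \<bullet> b) *\<^sub>R b" Basis]
    by (simp add: euclidean_representation linear_scale)
  then have "frechet_derivative f (at x) = (\<lambda>h. \<Sum>b\<in>Basis. (h \<bullet> b) *\<^sub>R partial_deriv b f x)"
    by blast
  then show ?thesis
    using D by simp
qed

lemma Ck_on_0: "Ck_on 0 UNIV f \<longleftrightarrow> (\<forall>x. isCont f x)"
  by (simp add: continuous_on_eq_continuous_at)

lemma Ck_on_Suc: "Ck_on (Suc k) UNIV f \<longleftrightarrow>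
    (\<forall>x. f differentiable (at x)) \<and> (\<forall>b\<in>Basis. Ck_on k UNIV (partial_deriv b f))"
  by (simp add: differentiable_on_def)

declare Ck_on.simps [simp del]

text \<open>Partial derivatives are determined by any known derivative of f, so the closure
  properties below become inductions on the order with explicit product and chain rules.\<close>

lemma Ck_on_SucI:
  assumes "\<And>x. (f has_derivative D x) (at x)" "\<And>b. b \<in> Basis \<Longrightarrow> Ck_on k UNIV (\<lambda>x. D x b)"
  shows "Ck_on (Suc k) UNIV f"
proof -
  have "partial_deriv b f = (\<lambda>x. D x b)" for b
    using partial_deriv_at[OF assms(1)] by auto
  then show ?thesis
    using assms by (auto simp: Ck_on_Suc differentiable_def)
qed

lemma Ck_on_SucD:
  assumes "Ck_on (Suc k) UNIV f"
  shows "(f has_derivative frechet_derivative f (at x)) (at x)"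
    "b \<in> Basis \<Longrightarrow> Ck_on k UNIV (\<lambda>x. frechet_derivative f (at x) b)"
  using assms by (auto simp: Ck_on_Suc frechet_derivative_works[symmetric] partial_deriv_def[abs_def])

lemma Ck_on_pred: "Ck_on (Suc k) UNIV f \<Longrightarrow> Ck_on k UNIV f"
proof (induction k arbitrary: f)
  case 0
  then show ?case
    by (auto simp: Ck_on_Suc Ck_on_0 intro: differentiable_imp_continuous_within)
next
  case (Suc k)
  then show ?case
    using Ck_on_Suc[of "Suc k" f] Ck_on_Suc[of k f] by auto
qed

lemma Ck_on_mono: "Ck_on k UNIV f \<Longrightarrow> j \<le> k \<Longrightarrow> Ck_on j UNIV f"
  by (induction k) (auto simp: le_Suc_eq dest: Ck_on_pred)

lemma Ck_on_const [simp]: "Ck_on k UNIV (\<lambda>x. c)"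
proof (induction k arbitrary: c)
  case (Suc k)
  show ?case
    by (rule Ck_on_SucI[where D="\<lambda>x h. 0"]) (use Suc in auto)
qed (simp add: Ck_on_0)

lemma Ck_on_add:
  "Ck_on k UNIV f \<Longrightarrow> Ck_on k UNIV g \<Longrightarrow> Ck_on k UNIV (\<lambda>x. f x + g x)"
proof (induction k arbitrary: f g)
  case (Suc k)
  show ?case
    by (rule Ck_on_SucI[where D="\<lambda>x h. frechet_derivative f (at x) h + frechet_derivative g (at x) h"])
      (use Suc in \<open>auto intro!: has_derivative_add Ck_on_SucD\<close>)
qed (simp add: Ck_on_0)

lemma Ck_on_mult:
  "Ck_on k UNIV f \<Longrightarrow> Ck_on k UNIV g \<Longrightarrow> Ck_on k UNIV (\<lambda>x. f x * g x)"
proof (induction k arbitrary: f g)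
  case (Suc k)
  have "(f has_derivative frechet_derivative f (at x)) (at x)" "(g has_derivative frechet_derivative g (at x)) (at x)" for x
    using Suc.prems by (auto simp: Ck_on_Suc frechet_derivative_works[symmetric])
  then have D: "((\<lambda>x. f x * g x) has_derivative
      (\<lambda>h. f x * frechet_derivative g (at x) h + frechet_derivative f (at x) h * g x)) (at x)" for x
    by (intro has_derivative_mult)
  show ?case
  proof (rule Ck_on_SucI[OF D])
    fix b :: 'a assume b: "b \<in> Basis"
    have "Ck_on k UNIV (partial_deriv b f)" "Ck_on k UNIV (partial_deriv b g)" "Ck_on k UNIV f" "Ck_on k UNIV g"
      using Suc.prems b by (auto intro: Ck_on_pred) (auto simp: Ck_on_Suc)
    then show "Ck_on k UNIV (\<lambda>x. f x * frechet_derivative g (at x) b + frechet_derivative f (at x) b * g x)"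
      unfolding partial_deriv_def[abs_def] using Suc.IH Ck_on_add by blast
  qed
qed (simp add: Ck_on_0)

lemma Ck_on_minus: "Ck_on k UNIV f \<Longrightarrow> Ck_on k UNIV (\<lambda>x. - f x)"
  using Ck_on_mult[OF Ck_on_const[of k "-1"], of f] by simp

lemma Ck_on_diff: "Ck_on k UNIV f \<Longrightarrow> Ck_on k UNIV g \<Longrightarrow> Ck_on k UNIV (\<lambda>x. f x - g x)"
  using Ck_on_add[of k f "\<lambda>x. - g x"] Ck_on_minus[of k g] by simp

lemma Ck_on_sum: "(\<And>i. i \<in> I \<Longrightarrow> Ck_on k UNIV (f i)) \<Longrightarrow> Ck_on k UNIV (\<lambda>x. \<Sum>i\<in>I. f i x)"
  by (induction I rule: infinite_finite_induct) (auto intro: Ck_on_add)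

lemma Ck_on_cnj: "Ck_on k UNIV f \<Longrightarrow> Ck_on k UNIV (\<lambda>x. cnj (f x))"
proof (induction k arbitrary: f)
  case (Suc k)
  show ?case
    by (rule Ck_on_SucI[where D="\<lambda>x h. cnj (frechet_derivative f (at x) h)"])
      (use Suc in \<open>auto intro!: bounded_linear.has_derivative[OF bounded_linear_cnj] Ck_on_SucD\<close>)
qed (simp add: Ck_on_0)

text \<open>The induction keeps f fixed: the derivative is exp f times the derivative of f, and the
  first factor has the lower order by the induction hypothesis.\<close>

lemma Ck_on_exp: "Ck_on k UNIV f \<Longrightarrow> Ck_on k UNIV (\<lambda>x. exp (f x))"
proof (induction k)
  case (Suc k)
  have "(f has_derivative frechet_derivative f (at x)) (at x)" for x
    using Suc.prems by (auto simp: Ck_on_Suc frechet_derivative_works[symmetric])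
  then have D: "((\<lambda>x. exp (f x)) has_derivative (\<lambda>h. exp (f x) * frechet_derivative f (at x) h)) (at x)" for x
    using has_derivative_compose[of f _ x UNIV exp "\<lambda>h. exp (f x) * h"] DERIV_exp[of "f x"]
    by (auto simp: has_field_derivative_def)
  show ?case
  proof (rule Ck_on_SucI[OF D])
    fix b :: 'a assume b: "b \<in> Basis"
    have "Ck_on k UNIV (partial_deriv b f)" "Ck_on k UNIV (\<lambda>x. exp (f x))"
      using Suc b by (auto intro: Ck_on_pred) (auto simp: Ck_on_Suc)
    then show "Ck_on k UNIV (\<lambda>x. exp (f x) * frechet_derivative f (at x) b)"
      unfolding partial_deriv_def[abs_def] by (intro Ck_on_mult)
  qed
qed (simp add: Ck_on_0)

lemma Ck_on_inner: "Ck_on k UNIV (\<lambda>x. complex_of_real ((x - a) \<bullet> c))"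
proof (cases k)
  case (Suc j)
  have D: "((\<lambda>x. complex_of_real ((x - a) \<bullet> c)) has_derivative (\<lambda>h. complex_of_real (h \<bullet> c))) (at x)" for x
    by (auto intro!: derivative_eq_intros)
  show ?thesis
    unfolding Suc by (rule Ck_on_SucI[OF D]) simp
qed (simp add: Ck_on_0 continuous_intros)

lemma has_derivative_reflect:
  assumes "f differentiable (at (a - x))"
  shows "((\<lambda>x. f (a - x)) has_derivative (\<lambda>h. - frechet_derivative f (at (a - x)) h)) (at x)"
proof -
  have D: "(f has_derivative frechet_derivative f (at (a - x))) (at (a - x))"
    using assms frechet_derivative_works by blast
  have "((\<lambda>x. a - x) has_derivative (\<lambda>h. - h)) (at x)"
    by (auto intro!: derivative_eq_intros)
  from has_derivative_compose[OF this, of f, OF D] show ?thesis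
    using has_derivative_linear[OF D] by (simp add: linear_neg)
qed

lemma partial_deriv_reflect:
  assumes "f differentiable (at (a - x))"
  shows "partial_deriv b (\<lambda>x. f (a - x)) x = - partial_deriv b f (a - x)"
  using partial_deriv_at[OF has_derivative_reflect[OF assms]] by (simp add: partial_deriv_def)

lemma Ck_on_reflect: "Ck_on k UNIV f \<Longrightarrow> Ck_on k UNIV (\<lambda>x. f (a - x))"
proof (induction k arbitrary: f)
  case (Suc k)
  show ?case
  proof (rule Ck_on_SucI[OF has_derivative_reflect])
    fix b :: 'a assume b: "b \<in> Basis"
    have "Ck_on k UNIV (\<lambda>x. partial_deriv b f (a - x))"
      using Suc b by (auto simp: Ck_on_Suc)
    then show "Ck_on k UNIV (\<lambda>x. - frechet_derivative f (at (a - x)) b)"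
      unfolding partial_deriv_def[abs_def] by (intro Ck_on_minus)
  qed (use Suc.prems in \<open>auto simp: Ck_on_Suc\<close>)
qed (auto simp: Ck_on_0 intro!: isCont_o2[of _ "\<lambda>x. a - x"] continuous_intros)

lemma smooth_on_differentiable: "smooth_on UNIV f \<Longrightarrow> f differentiable (at x)"
  unfolding smooth_on_def using Ck_on_Suc by blast

lemma smooth_on_continuous: "smooth_on UNIV f \<Longrightarrow> continuous_on A f"
  unfolding smooth_on_def using Ck_on_0[of f] continuous_at_imp_continuous_on by blast

lemma smooth_on_partial_deriv: "smooth_on UNIV f \<Longrightarrow> b \<in> Basis \<Longrightarrow> smooth_on UNIV (partial_deriv b f)"
  unfolding smooth_on_def using Ck_on_Suc by blast

lemma smooth_on_const: "smooth_on UNIV (\<lambda>x. c)"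
  and smooth_on_add: "smooth_on UNIV f \<Longrightarrow> smooth_on UNIV g \<Longrightarrow> smooth_on UNIV (\<lambda>x. f x + g x)"
  and smooth_on_diff: "smooth_on UNIV f \<Longrightarrow> smooth_on UNIV g \<Longrightarrow> smooth_on UNIV (\<lambda>x. f x - g x)"
  and smooth_on_minus: "smooth_on UNIV f \<Longrightarrow> smooth_on UNIV (\<lambda>x. - f x)"
  and smooth_on_mult: "smooth_on UNIV f \<Longrightarrow> smooth_on UNIV g \<Longrightarrow> smooth_on UNIV (\<lambda>x. f x * g x)"
  and smooth_on_cnj: "smooth_on UNIV f \<Longrightarrow> smooth_on UNIV (\<lambda>x. cnj (f x))"
  and smooth_on_exp: "smooth_on UNIV f \<Longrightarrow> smooth_on UNIV (\<lambda>x. exp (f x))"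
  and smooth_on_reflect: "smooth_on UNIV f \<Longrightarrow> smooth_on UNIV (\<lambda>x. f (a - x))"
  by (simp_all add: smooth_on_def Ck_on_add Ck_on_diff Ck_on_minus Ck_on_mult Ck_on_cnj Ck_on_exp Ck_on_reflect)

lemma smooth_on_sum: "(\<And>i. i \<in> I \<Longrightarrow> smooth_on UNIV (f i)) \<Longrightarrow> smooth_on UNIV (\<lambda>x. \<Sum>i\<in>I. f i x)"
  by (simp add: smooth_on_def Ck_on_sum)

lemma partial_deriv_add:
  assumes "f differentiable (at x)" "g differentiable (at x)"
  shows "partial_deriv b (\<lambda>x. f x + g x) x = partial_deriv b f x + partial_deriv b g x"
  using assms partial_deriv_at[OF has_derivative_add]
  by (simp add: frechet_derivative_works partial_deriv_def)

lemma partial_deriv_mult: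
  assumes "f differentiable (at x)" "g differentiable (at x)"
  shows "partial_deriv b (\<lambda>x. f x * g x) x = f x * partial_deriv b g x + partial_deriv b f x * g x"
  using assms partial_deriv_at[OF has_derivative_mult]
  by (simp add: frechet_derivative_works partial_deriv_def)

lemma partial_deriv_cnj:
  assumes "f differentiable (at x)"
  shows "partial_deriv b (\<lambda>x. cnj (f x)) x = cnj (partial_deriv b f x)"
  using assms partial_deriv_at[OF bounded_linear.has_derivative[OF bounded_linear_cnj]]
  by (simp add: frechet_derivative_works partial_deriv_def)

lemma partial_deriv_cmult:
  assumes "f differentiable (at x)"
  shows "partial_deriv b (\<lambda>x. c * f x) x = c * partial_deriv b f x"
  using partial_deriv_mult[of "\<lambda>x. c" x f b] assms partial_deriv_at[OF has_derivative_const, of b c x] by simp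

lemma laplacian_add:
  assumes "smooth_on UNIV f" "smooth_on UNIV g"
  shows "laplacian (\<lambda>x. f x + g x) = (\<lambda>x. laplacian f x + laplacian g x)"
proof -
  have "partial_deriv b (\<lambda>x. f x + g x) = (\<lambda>x. partial_deriv b f x + partial_deriv b g x)" for b
    using assms by (auto intro!: partial_deriv_add smooth_on_differentiable)
  then show ?thesis
    unfolding laplacian_def using assms
    by (auto simp: sum.distrib[symmetric] intro!: sum.cong partial_deriv_add smooth_on_differentiable smooth_on_partial_deriv)
qed

lemma laplacian_cmult:
  assumes "smooth_on UNIV f"
  shows "laplacian (\<lambda>x. c * f x) = (\<lambda>x. c * laplacian f x)"
proof -
  have "partial_deriv b (\<lambda>x. c * f x) = (\<lambda>x. c * partial_deriv b f x)" for b
    using assms by (auto intro!: partial_deriv_cmult smooth_on_differentiable)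
  then show ?thesis
    unfolding laplacian_def using assms
    by (auto simp: sum_distrib_left intro!: sum.cong partial_deriv_cmult smooth_on_differentiable smooth_on_partial_deriv)
qed

lemma laplacian_diff:
  assumes "smooth_on UNIV f" "smooth_on UNIV g"
  shows "laplacian (\<lambda>x. f x - g x) = (\<lambda>x. laplacian f x - laplacian g x)"
  using laplacian_add[OF assms(1) smooth_on_minus[OF assms(2)]] laplacian_cmult[OF assms(2), of "-1"] by simp

lemma laplacian_cnj:
  assumes "smooth_on UNIV f"
  shows "laplacian (\<lambda>x. cnj (f x)) = (\<lambda>x. cnj (laplacian f x))"
proof -
  have "partial_deriv b (\<lambda>x. cnj (f x)) = (\<lambda>x. cnj (partial_deriv b f x))" for b
    using assms by (auto intro!: partial_deriv_cnj smooth_on_differentiable)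
  then show ?thesis
    unfolding laplacian_def using assms
    by (auto intro!: sum.cong partial_deriv_cnj smooth_on_differentiable smooth_on_partial_deriv)
qed

lemma laplacian_reflect:
  assumes "smooth_on UNIV f"
  shows "laplacian (\<lambda>x. f (a - x)) = (\<lambda>x. laplacian f (a - x))"
proof -
  have eq: "partial_deriv b (\<lambda>x. f (a - x)) = (\<lambda>x. - 1 * partial_deriv b f (a - x))" for b
    using assms by (auto intro!: partial_deriv_reflect smooth_on_differentiable)
  have "partial_deriv b (\<lambda>x. - 1 * partial_deriv b f (a - x)) x = partial_deriv b (partial_deriv b f) (a - x)"
    if "b \<in> Basis" for b x
    using partial_deriv_cmult[OF smooth_on_differentiable[OF smooth_on_reflect[OF smooth_on_partial_deriv[OF assms that]]], of b "-1" a x]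
      partial_deriv_reflect[OF smooth_on_differentiable[OF smooth_on_partial_deriv[OF assms that]], of b a x]
    by simp
  then show ?thesis
    unfolding laplacian_def eq by auto
qed

lemma smooth_on_laplacian: "smooth_on UNIV f \<Longrightarrow> smooth_on UNIV (laplacian f)"
  unfolding laplacian_def[abs_def] by (intro smooth_on_sum smooth_on_partial_deriv)

section \<open>Test functions and supports\<close>

lemma test_functionsI:
  assumes "smooth_on UNIV \<psi>" "compact K" "K \<subseteq> D" "\<And>x. x \<notin> K \<Longrightarrow> \<psi> x = 0"
  shows "\<psi> \<in> test_functions D"
proof -
  have "closure {x. \<psi> x \<noteq> 0} \<subseteq> K"
    using assms by (intro closure_minimal compact_imp_closed) auto
  moreover from this have "compact (closure {x. \<psi> x \<noteq> 0})"
    using compact_Int_closed[OF assms(2), of "closure {x. \<psi> x \<noteq> 0}"] by (simp add: Int_absorb1)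
  ultimately show ?thesis
    using assms(1,3) unfolding test_functions_def by blast
qed

lemma test_functionsE:
  assumes "\<psi> \<in> test_functions D"
  obtains K where "smooth_on UNIV \<psi>" "compact K" "K \<subseteq> D" "\<And>x. x \<notin> K \<Longrightarrow> \<psi> x = 0"
proof (rule that[of "closure {x. \<psi> x \<noteq> 0}"])
  show "\<psi> x = 0" if "x \<notin> closure {x. \<psi> x \<noteq> 0}" for x
    using that closure_subset[of "{x. \<psi> x \<noteq> 0}"] by blast
qed (use assms in \<open>auto simp only: test_functions_def mem_Collect_eq\<close>)

lemma partial_deriv_zero_outside:
  assumes "closed K" "\<And>x. x \<notin> K \<Longrightarrow> f x = 0" "x \<notin> K"
  shows "partial_deriv b f x = 0"
proof -
  have "((\<lambda>x. 0) has_derivative (\<lambda>h. 0)) (at x)"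
    by simp
  then have "(f has_derivative (\<lambda>h. 0)) (at x)"
    by (rule has_derivative_transform_within_open[of _ _ _ _ "- K"]) (use assms in auto)
  then show ?thesis
    by (simp add: partial_deriv_at)
qed

lemma laplacian_zero_outside:
  assumes "closed K" "\<And>x. x \<notin> K \<Longrightarrow> f x = 0" "x \<notin> K"
  shows "laplacian f x = 0"
  unfolding laplacian_def
  using partial_deriv_zero_outside[OF assms(1) _ assms(3)] partial_deriv_zero_outside[OF assms(1,2)]
  by (auto intro!: sum.neutral)

section \<open>Smooth bump functions\<close>

definition flat_exp :: "nat \<Rightarrow> real \<Rightarrow> real" where
  "flat_exp k t = (if t > 0 then exp (- (1 / t)) / t ^ k else 0)"

lemma flat_exp_nonneg: "flat_exp k t \<ge> 0"
  by (simp add: flat_exp_def)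

lemma flat_exp_0_pos_iff: "flat_exp 0 t > 0 \<longleftrightarrow> t > 0"
  by (simp add: flat_exp_def)

text \<open>On the right of 0, put s = 1/t: then s^k exp(-s) tends to 0 as s grows.\<close>

lemma tendsto_flat_exp_0: "(flat_exp k \<longlongrightarrow> 0) (at 0)"
proof -
  have "((\<lambda>t. (inverse t) ^ k / exp (inverse t)) \<longlongrightarrow> (0::real)) (at_right 0)"
    using filterlim_compose[OF tendsto_power_div_exp_0 filterlim_inverse_at_top_right] by simp
  moreover have "\<forall>\<^sub>F t in at_right 0. (inverse t) ^ k / exp (inverse t) = flat_exp k t"
    by (auto simp: eventually_at_right_less flat_exp_def exp_minus field_simps
        intro!: eventually_mono[OF eventually_at_right_less[of 0]])
  ultimately have "(flat_exp k \<longlongrightarrow> 0) (at_right 0)"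
    by (rule Lim_transform_eventually)
  moreover have "(flat_exp k \<longlongrightarrow> 0) (at_left 0)"
    by (rule tendsto_eventually) (auto simp: flat_exp_def eventually_at_left_field intro!: exI[of _ "-1"])
  ultimately show ?thesis
    by (simp add: filterlim_split_at)
qed

text \<open>The factors 1/t^k are included so that the family is closed under differentiation;
  smoothness of exp(-1/t) across 0 is then one induction over the whole family.\<close>

lemma DERIV_flat_exp:
  "(flat_exp k has_real_derivative flat_exp (k + 2) t - real k * flat_exp (k + 1) t) (at t)"
proof -
  consider "t > 0" | "t < 0" | "t = 0" by linarith
  then show ?thesis
  proof cases
    case 1
    have "((\<lambda>t. exp (- (1 / t)) / t ^ k) has_real_derivative
        flat_exp (k + 2) t - real k * flat_exp (k + 1) t) (at t)"
    proof (cases "k = 0")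
      case False
      then have "t ^ k = t * t ^ (k - Suc 0)"
        by (cases k) auto
      then show ?thesis
        using 1 False by (auto intro!: derivative_eq_intros simp: flat_exp_def divide_simps) (simp add: algebra_simps)
    qed (use 1 in \<open>auto intro!: derivative_eq_intros simp: flat_exp_def field_simps power2_eq_square\<close>)
    then show ?thesis
      by (rule has_field_derivative_transform_within_open[of _ _ _ "{0<..}"]) (use 1 in \<open>auto simp: flat_exp_def\<close>)
  next
    case 2
    have "((\<lambda>t. 0) has_real_derivative flat_exp (k + 2) t - real k * flat_exp (k + 1) t) (at t)"
      using 2 by (simp add: flat_exp_def)
    then show ?thesis
      by (rule has_field_derivative_transform_within_open[of _ _ _ "{..<0}"]) (use 2 in \<open>auto simp: flat_exp_def\<close>)
  next
    case 3
    \<comment> \<open>At 0 the difference quotient of the k-th function is the next function of the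
      family, whose limit is 0.\<close>
    have "(\<lambda>h. (flat_exp k (0 + h) - flat_exp k 0) / h) = flat_exp (k + 1)"
      by (auto simp: flat_exp_def)
    then have "(flat_exp k has_real_derivative 0) (at 0)"
      unfolding DERIV_def using tendsto_flat_exp_0[of "k + 1"] by simp
    then show ?thesis
      using 3 by (simp add: flat_exp_def)
  qed
qed

text \<open>The squared distance is a polynomial in x, so no singularity arises at the centre, and
  the bump is positive exactly on the open ball.\<close>

definition bump :: "'a::euclidean_space \<Rightarrow> real \<Rightarrow> 'a \<Rightarrow> real" where
  "bump a r x = flat_exp 0 (r\<^sup>2 - (x - a) \<bullet> (x - a))"

text \<open>Each derivative raises \<open>k\<close> and brings in an affine factor, so the induction
  on the order runs over all \<open>k\<close> at once.\<close>

lemma Ck_on_flat_exp: "Ck_on n UNIV (\<lambda>x. complex_of_real (flat_exp k (r - (x - a) \<bullet> (x - a))))"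
proof (induction n arbitrary: k)
  case 0
  have "isCont (flat_exp k) t" for t
    using DERIV_flat_exp DERIV_isCont by blast
  then show ?case
    unfolding Ck_on_0
    by (intro allI continuous_intros isCont_o2[of _ "\<lambda>x. r - (x - a) \<bullet> (x - a)" "flat_exp k"])
next
  case (Suc n)
  let ?q = "\<lambda>x. r - (x - a) \<bullet> (x - a)"
  have q: "(?q has_derivative (\<lambda>h. - 2 * ((x - a) \<bullet> h))) (at x)" for x
    by (auto intro!: derivative_eq_intros simp: inner_commute[of _ "x - a"])
  have D: "((\<lambda>x. complex_of_real (flat_exp k (?q x))) has_derivative
     (\<lambda>h. complex_of_real ((flat_exp (k + 2) (?q x) - real k * flat_exp (k + 1) (?q x)) * (- 2 * ((x - a) \<bullet> h))))) (at x)" for x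
    using has_derivative_compose[OF q[of x] DERIV_flat_exp[of k "?q x", unfolded has_field_derivative_def]]
    by (rule has_derivative_of_real)
  show ?case
  proof (rule Ck_on_SucI[OF D])
    fix b :: 'a
    have "Ck_on n UNIV (\<lambda>x. (complex_of_real (flat_exp (k + 2) (?q x)) - of_nat k * complex_of_real (flat_exp (k + 1) (?q x))) *
        (- 2 * complex_of_real ((x - a) \<bullet> b)))"
      by (intro Ck_on_mult Ck_on_diff Ck_on_const Ck_on_inner Suc)
    then show "Ck_on n UNIV (\<lambda>x. complex_of_real ((flat_exp (k + 2) (?q x) - real k * flat_exp (k + 1) (?q x)) * (- 2 * ((x - a) \<bullet> b))))"
      by simp
  qed
qed

lemma smooth_on_bump: "smooth_on UNIV (\<lambda>x. complex_of_real (bump a r x))"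
  by (simp add: smooth_on_def bump_def Ck_on_flat_exp)

lemma bump_nonneg: "bump a r x \<ge> 0"
  by (simp add: bump_def flat_exp_nonneg)

lemma bump_pos_iff:
  assumes "r > 0" shows "bump a r x > 0 \<longleftrightarrow> x \<in> ball a r"
proof -
  have "bump a r x > 0 \<longleftrightarrow> (norm (x - a))\<^sup>2 < r\<^sup>2"
    by (simp add: bump_def flat_exp_0_pos_iff power2_norm_eq_inner)
  also have "\<dots> \<longleftrightarrow> norm (x - a) < r"
    using assms power2_less_imp_less[of "norm (x - a)" r] power_strict_mono[of "norm (x - a)" r 2] by auto
  finally show ?thesis
    by (simp add: dist_norm norm_minus_commute)
qed

section \<open>The Hilbert space $L^2$\<close>

text \<open>Borel measurability on the whole space, rather than Lebesgue measurability on D, makes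
  translates, reflections and functions such as f (x - z) on the product space measurable, as
  Tonelli's theorem requires.\<close>

definition sqint :: "('a::euclidean_space \<Rightarrow> complex) \<Rightarrow> bool" where
  "sqint f \<longleftrightarrow> f \<in> borel_measurable borel \<and> integrable lborel (\<lambda>x. (cmod (f x))\<^sup>2)"

lemma sqint_measurable [measurable_dest]: "sqint f \<Longrightarrow> f \<in> borel_measurable borel"
  by (simp add: sqint_def)

lemma sqint_zero: "sqint (\<lambda>x. 0)"
  by (simp add: sqint_def)

lemma sqint_bound:
  assumes "sqint f" "g \<in> borel_measurable borel" "AE x in lborel. cmod (g x) \<le> C * cmod (f x)"
  shows "sqint g"
  unfolding sqint_def
proof
  note [measurable] = assms(2) sqint_measurable[OF assms(1)]
  show "integrable lborel (\<lambda>x. (cmod (g x))\<^sup>2)"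
  proof (rule Bochner_Integration.integrable_bound)
    show "integrable lborel (\<lambda>x. C\<^sup>2 * (cmod (f x))\<^sup>2)"
      using assms(1) by (simp add: sqint_def)
    show "AE x in lborel. norm ((cmod (g x))\<^sup>2) \<le> norm (C\<^sup>2 * (cmod (f x))\<^sup>2)"
      using assms(3)
    proof eventually_elim
      case (elim x)
      then have "(cmod (g x))\<^sup>2 \<le> (C * cmod (f x))\<^sup>2"
        by (intro power_mono) auto
      then show ?case
        by (simp add: power_mult_distrib)
    qed
  qed measurable
qed fact

lemma sqint_add:
  assumes "sqint f" "sqint g" shows "sqint (\<lambda>x. f x + g x)"
  unfolding sqint_def
proof
  note [measurable] = assms[THEN sqint_measurable]
  show "(\<lambda>x. f x + g x) \<in> borel_measurable borel"
    by measurable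
  show "integrable lborel (\<lambda>x. (cmod (f x + g x))\<^sup>2)"
  proof (rule Bochner_Integration.integrable_bound)
    show "integrable lborel (\<lambda>x. 2 * (cmod (f x))\<^sup>2 + 2 * (cmod (g x))\<^sup>2)"
      using assms by (simp add: sqint_def)
    have "(cmod (f x + g x))\<^sup>2 \<le> 2 * (cmod (f x))\<^sup>2 + 2 * (cmod (g x))\<^sup>2" for x
    proof -
      have "(cmod (f x + g x))\<^sup>2 \<le> (cmod (f x) + cmod (g x))\<^sup>2"
        by (intro power_mono norm_triangle_ineq) auto
      also have "\<dots> \<le> 2 * (cmod (f x))\<^sup>2 + 2 * (cmod (g x))\<^sup>2"
        using sum_squares_bound[of "cmod (f x)" "cmod (g x)"] by (simp add: power2_sum)
      finally show ?thesis .
    qed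
    then show "AE x in lborel. norm ((cmod (f x + g x))\<^sup>2) \<le> norm (2 * (cmod (f x))\<^sup>2 + 2 * (cmod (g x))\<^sup>2)"
      by simp
  qed measurable
qed

lemma sqint_mult_bounded:
  assumes "sqint f" "\<phi> \<in> borel_measurable borel" "\<And>x. cmod (\<phi> x) \<le> C"
  shows "sqint (\<lambda>x. \<phi> x * f x)"
proof (rule sqint_bound[OF assms(1)])
  note [measurable] = assms(2) sqint_measurable[OF assms(1)]
  show "(\<lambda>x. \<phi> x * f x) \<in> borel_measurable borel"
    by measurable
  show "AE x in lborel. cmod (\<phi> x * f x) \<le> C * cmod (f x)"
    using assms(3) by (simp add: norm_mult mult_right_mono)
qed

lemma sqint_cmult: "sqint f \<Longrightarrow> sqint (\<lambda>x. c * f x)"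
  by (rule sqint_mult_bounded[of f _ "cmod c"]) auto

lemma sqint_minus: "sqint f \<Longrightarrow> sqint (\<lambda>x. - f x)"
  using sqint_cmult[of f "-1"] by simp

lemma sqint_diff: "sqint f \<Longrightarrow> sqint g \<Longrightarrow> sqint (\<lambda>x. f x - g x)"
  using sqint_add[of f "\<lambda>x. - g x"] sqint_minus[of g] by simp

lemma sqint_scaleR: "sqint f \<Longrightarrow> sqint (\<lambda>x. c *\<^sub>R f x)"
  using sqint_cmult[of f "complex_of_real c"] by (simp add: scaleR_conv_of_real)

lemma sqint_inner_integrable:
  assumes "sqint f" "sqint g" shows "integrable lborel (\<lambda>x. f x \<bullet> g x)"
proof (rule Bochner_Integration.integrable_bound)
  note [measurable] = assms[THEN sqint_measurable]
  show "integrable lborel (\<lambda>x. (cmod (f x))\<^sup>2 + (cmod (g x))\<^sup>2)"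
    using assms by (simp add: sqint_def)
  have "\<bar>f x \<bullet> g x\<bar> \<le> (cmod (f x))\<^sup>2 + (cmod (g x))\<^sup>2" for x
  proof -
    have "\<bar>f x \<bullet> g x\<bar> \<le> cmod (f x) * cmod (g x)"
      by (rule Cauchy_Schwarz_ineq2)
    also have "\<dots> \<le> (cmod (f x))\<^sup>2 + (cmod (g x))\<^sup>2"
      using sum_squares_bound[of "cmod (f x)" "cmod (g x)"]
        mult_nonneg_nonneg[OF norm_ge_zero norm_ge_zero, of "f x" "g x"] by linarith
    finally show ?thesis .
  qed
  then show "AE x in lborel. norm (f x \<bullet> g x) \<le> norm ((cmod (f x))\<^sup>2 + (cmod (g x))\<^sup>2)"
    by simp
qed (use assms in measurable)

definition sqint_eq :: "('a::euclidean_space \<Rightarrow> complex) \<Rightarrow> ('a \<Rightarrow> complex) \<Rightarrow> bool" where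
  "sqint_eq f g \<longleftrightarrow> sqint f \<and> sqint g \<and> (AE x in lborel. f x = g x)"

quotient_type (overloaded) 'a l2 = "'a::euclidean_space \<Rightarrow> complex" / partial: sqint_eq
proof (rule part_equivpI)
  show "\<exists>f::'a \<Rightarrow> complex. sqint_eq f f"
    using sqint_zero by (auto simp: sqint_eq_def)
  show "symp (sqint_eq :: ('a \<Rightarrow> complex) \<Rightarrow> _)"
    by (auto simp: symp_def sqint_eq_def elim: AE_mp)
  show "transp (sqint_eq :: ('a \<Rightarrow> complex) \<Rightarrow> _)"
    unfolding transp_def sqint_eq_def by auto
qed

text \<open>The inner product is the real part of the Hermitian one. Complex information is regained
  by pairing also with i times a function, and complex scalars act through
  \<open>l2_mult\<close>.\<close>

instantiation l2 :: (euclidean_space) real_inner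
begin

lift_definition zero_l2 :: "'a l2" is "\<lambda>x. 0"
  by (simp add: sqint_eq_def sqint_zero)

lift_definition plus_l2 :: "'a l2 \<Rightarrow> 'a l2 \<Rightarrow> 'a l2" is "\<lambda>f g x. f x + g x"
  by (auto simp: sqint_eq_def sqint_add)

lift_definition minus_l2 :: "'a l2 \<Rightarrow> 'a l2 \<Rightarrow> 'a l2" is "\<lambda>f g x. f x - g x"
  by (auto simp: sqint_eq_def sqint_diff)

lift_definition uminus_l2 :: "'a l2 \<Rightarrow> 'a l2" is "\<lambda>f x. - f x"
  by (auto simp: sqint_eq_def sqint_minus)

lift_definition scaleR_l2 :: "real \<Rightarrow> 'a l2 \<Rightarrow> 'a l2" is "\<lambda>c f x. c *\<^sub>R f x"
  by (auto simp: sqint_eq_def sqint_scaleR)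

lift_definition inner_l2 :: "'a l2 \<Rightarrow> 'a l2 \<Rightarrow> real" is "\<lambda>f g. \<integral>x. f x \<bullet> g x \<partial>lborel"
  unfolding sqint_eq_def by (intro integral_cong_AE) (auto dest: sqint_measurable)

definition norm_l2 :: "'a l2 \<Rightarrow> real" where "norm_l2 f = sqrt (f \<bullet> f)"
definition sgn_l2 :: "'a l2 \<Rightarrow> 'a l2" where "sgn_l2 f = inverse (norm f) *\<^sub>R f"
definition dist_l2 :: "'a l2 \<Rightarrow> 'a l2 \<Rightarrow> real" where "dist_l2 f g = norm (f - g)"
definition uniformity_l2 :: "('a l2 \<times> 'a l2) filter" where
  "uniformity_l2 = (INF e\<in>{0<..}. principal {(x, y). dist x y < e})"
definition open_l2 :: "'a l2 set \<Rightarrow> bool" where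
  "open_l2 U \<longleftrightarrow> (\<forall>x\<in>U. \<forall>\<^sub>F (x', y) in uniformity. x' = x \<longrightarrow> y \<in> U)"

instance
proof
  fix f g h :: "'a l2" and a b :: real
  show "f + g + h = f + (g + h)" "f + g = g + f" "0 + f = f" "- f + f = 0" "f - g = f + - g"
    "a *\<^sub>R (f + g) = a *\<^sub>R f + a *\<^sub>R g" "(a + b) *\<^sub>R f = a *\<^sub>R f + b *\<^sub>R f"
    "a *\<^sub>R b *\<^sub>R f = (a * b) *\<^sub>R f" "1 *\<^sub>R f = f"
    by (transfer; simp add: sqint_eq_def sqint_add sqint_minus sqint_diff sqint_scaleR sqint_zero algebra_simps)+
  show "dist f g = norm (f - g)" "sgn f = inverse (norm f) *\<^sub>R f" "norm f = sqrt (f \<bullet> f)"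
    "uniformity = (INF e\<in>{0<..}. principal {(x, y). dist (x::'a l2) y < e})"
    by (simp_all add: dist_l2_def sgn_l2_def norm_l2_def uniformity_l2_def)
  show "open U \<longleftrightarrow> (\<forall>x\<in>U. \<forall>\<^sub>F (x', y) in uniformity. x' = x \<longrightarrow> y \<in> U)" for U :: "'a l2 set"
    by (rule open_l2_def)
  show "f \<bullet> g = g \<bullet> f"
    by transfer (simp add: inner_commute)
  show "(f + g) \<bullet> h = f \<bullet> h + g \<bullet> h"
    by transfer (auto simp: sqint_eq_def inner_add_left sqint_inner_integrable)
  show "(a *\<^sub>R f) \<bullet> g = a * (f \<bullet> g)"
    by transfer simp
  show "0 \<le> f \<bullet> f"
    by transfer (simp add: integral_nonneg_AE)
  show "(f \<bullet> f = 0) = (f = 0)"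
  proof transfer
    fix f :: "'a \<Rightarrow> complex" assume f: "sqint_eq f f"
    then have "(\<integral>x. f x \<bullet> f x \<partial>lborel) = 0 \<longleftrightarrow> (AE x in lborel. f x \<bullet> f x = 0)"
      by (intro integral_nonneg_eq_0_iff_AE sqint_inner_integrable) (auto simp: sqint_eq_def)
    then show "((\<integral>x. f x \<bullet> f x \<partial>lborel) = 0) = sqint_eq f (\<lambda>x. 0)"
      using f by (simp add: sqint_eq_def sqint_zero)
  qed
qed

end

section \<open>Classes of square integrable functions and completeness\<close>

definition l2 :: "('a::euclidean_space \<Rightarrow> complex) \<Rightarrow> 'a l2" where
  "l2 = abs_l2"

lemma l2_exhaust: "\<exists>g. sqint g \<and> h = l2 g"
  by (induct h rule: l2.abs_induct) (auto simp: l2_def sqint_eq_def)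

lemma l2_eq_iff: "sqint f \<Longrightarrow> sqint g \<Longrightarrow> l2 f = l2 g \<longleftrightarrow> (AE x in lborel. f x = g x)"
  unfolding l2_def using Quotient3_rel[OF Quotient3_l2, of f g] by (auto simp: sqint_eq_def)

lemma l2_zero: "l2 (\<lambda>x. 0) = 0"
  by (simp add: l2_def zero_l2_def)

lemma l2_add: "sqint f \<Longrightarrow> sqint g \<Longrightarrow> l2 (\<lambda>x. f x + g x) = l2 f + l2 g"
  by (simp add: l2_def plus_l2.abs_eq sqint_eq_def)

lemma l2_diff: "sqint f \<Longrightarrow> sqint g \<Longrightarrow> l2 (\<lambda>x. f x - g x) = l2 f - l2 g"
  by (simp add: l2_def minus_l2.abs_eq sqint_eq_def)

lemma l2_scaleR: "sqint f \<Longrightarrow> l2 (\<lambda>x. c *\<^sub>R f x) = c *\<^sub>R l2 f"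
  by (simp add: l2_def scaleR_l2.abs_eq sqint_eq_def)

lemma l2_inner: "sqint f \<Longrightarrow> sqint g \<Longrightarrow> l2 f \<bullet> l2 g = (\<integral>x. f x \<bullet> g x \<partial>lborel)"
  by (simp add: l2_def inner_l2.abs_eq sqint_eq_def)

lemma l2_norm_power2: "sqint f \<Longrightarrow> (norm (l2 f))\<^sup>2 = (\<integral>x. (cmod (f x))\<^sup>2 \<partial>lborel)"
  by (simp add: power2_norm_eq_inner l2_inner)

lemma l2_eqI: "sqint f \<Longrightarrow> sqint g \<Longrightarrow> AE x in lborel. f x = g x \<Longrightarrow> l2 f = l2 g"
  by (simp add: l2_eq_iff)

definition l2_rep :: "'a::euclidean_space l2 \<Rightarrow> 'a \<Rightarrow> complex" where
  "l2_rep h = (SOME g. sqint g \<and> h = l2 g)"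

lemma sqint_l2_rep: "sqint (l2_rep h)" and l2_l2_rep: "l2 (l2_rep h) = h"
  using someI_ex[OF l2_exhaust, of h] by (auto simp: l2_rep_def)

lemma l2_rep_l2: "sqint f \<Longrightarrow> AE x in lborel. l2_rep (l2 f) x = f x"
  using l2_eq_iff[OF sqint_l2_rep, of f "l2 f"] l2_l2_rep by auto

lemma l2_nn_integral:
  "sqint f \<Longrightarrow> (\<integral>\<^sup>+x. ennreal ((cmod (f x))\<^sup>2) \<partial>lborel) = ennreal ((norm (l2 f))\<^sup>2)"
  by (simp add: l2_norm_power2 nn_integral_eq_integral sqint_def)

text \<open>The bound concerns the nonnegative integral, so it can be applied right after Fatou's
  lemma or Tonelli's theorem, before square integrability is known.\<close>

lemma sqint_of_nn_integral_le:
  assumes [measurable]: "f \<in> borel_measurable borel"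
    and "(\<integral>\<^sup>+x. ennreal ((cmod (f x))\<^sup>2) \<partial>lborel) \<le> ennreal (B\<^sup>2)" "B \<ge> 0"
  shows "sqint f" "norm (l2 f) \<le> B"
proof -
  show f: "sqint f"
    unfolding sqint_def using assms(2)
    by (auto intro!: integrableI_bounded simp: less_top[symmetric] top_unique)
  have "(norm (l2 f))\<^sup>2 \<le> B\<^sup>2"
    using assms(2) by (simp add: l2_nn_integral[OF f])
  then show "norm (l2 f) \<le> B"
    using assms(3) by (rule power2_le_imp_le)
qed

text \<open>The heart of the Riesz-Fischer theorem. The weights 4^k leave the squared increments
  summable in the mean, because 4^k (1/8)^k = 2^(-k). Wherever the weighted sum is finite, the
  increments are at most a constant times 2^(-k), hence summable.\<close>

lemma l2_complete_aux:
  fixes F :: "nat \<Rightarrow> 'a::euclidean_space \<Rightarrow> complex"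
  assumes F: "\<And>k. sqint (F k)" and d: "\<And>k. (norm (l2 (F (Suc k)) - l2 (F k)))\<^sup>2 \<le> (1/8) ^ k"
  shows "AE x in lborel. convergent (\<lambda>k. F k x)"
proof -
  note [measurable] = sqint_measurable[OF F]
  define D where "D k = (\<lambda>x. F (Suc k) x - F k x)" for k
  have D: "sqint (D k)" for k
    unfolding D_def by (intro sqint_diff F)
  note [measurable] = sqint_measurable[OF D]
  have Dn: "(norm (l2 (D k)))\<^sup>2 \<le> (1/8) ^ k" for k
    using d[of k] by (simp add: D_def l2_diff F)
  have "(\<integral>\<^sup>+x. (\<Sum>k. ennreal (4 ^ k * (cmod (D k x))\<^sup>2)) \<partial>lborel)
      = (\<Sum>k. \<integral>\<^sup>+x. ennreal (4 ^ k * (cmod (D k x))\<^sup>2) \<partial>lborel)"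
    by (rule nn_integral_suminf) measurable
  also have "\<dots> = (\<Sum>k. ennreal (4 ^ k * (norm (l2 (D k)))\<^sup>2))"
    by (simp add: ennreal_mult' nn_integral_cmult l2_nn_integral[OF D])
  also have "\<dots> \<le> (\<Sum>k. ennreal ((1/2) ^ k))"
  proof (intro suminf_le ennreal_leI)
    fix k
    have "4 ^ k * (norm (l2 (D k)))\<^sup>2 \<le> 4 ^ k * (1/8) ^ k"
      by (intro mult_left_mono Dn) simp
    also have "\<dots> = (1/2::real) ^ k"
      by (simp add: power_mult_distrib[symmetric])
    finally show "4 ^ k * (norm (l2 (D k)))\<^sup>2 \<le> (1/2) ^ k" .
  qed auto
  also have "\<dots> = ennreal (\<Sum>k. (1/2) ^ k)"
    by (intro suminf_ennreal2) auto
  finally have "(\<integral>\<^sup>+x. (\<Sum>k. ennreal (4 ^ k * (cmod (D k x))\<^sup>2)) \<partial>lborel) \<noteq> \<infinity>"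
    by (auto simp: top_unique)
  then have "AE x in lborel. (\<Sum>k. ennreal (4 ^ k * (cmod (D k x))\<^sup>2)) \<noteq> \<infinity>"
    by (intro nn_integral_noteq_infinite) auto
  then show ?thesis
  proof eventually_elim
    case (elim x)
    define C where "C = enn2real (\<Sum>k. ennreal (4 ^ k * (cmod (D k x))\<^sup>2))"
    have C: "C \<ge> 0" "(\<Sum>k. ennreal (4 ^ k * (cmod (D k x))\<^sup>2)) = ennreal C"
      using elim by (simp_all add: C_def ennreal_enn2real_if)
    have "cmod (D k x) \<le> sqrt C * (1/2) ^ k" for k
    proof -
      have "ennreal (4 ^ k * (cmod (D k x))\<^sup>2) \<le> ennreal C"
        using sum_le_suminf[of "\<lambda>k. ennreal (4 ^ k * (cmod (D k x))\<^sup>2)" "{k}"] C(2) by simp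
      then have "4 ^ k * (cmod (D k x))\<^sup>2 \<le> C"
        using C(1) by simp
      moreover have "(4::real) ^ k = 2 ^ k * 2 ^ k"
        by (simp add: power_mult_distrib[symmetric])
      ultimately have "(2 ^ k * cmod (D k x))\<^sup>2 \<le> C"
        by (simp add: power2_eq_square mult.assoc mult.left_commute)
      then have "2 ^ k * cmod (D k x) \<le> sqrt C"
        by (rule real_le_rsqrt)
      then show ?thesis
        by (simp add: power_one_over field_simps)
    qed
    moreover have "summable (\<lambda>k. sqrt C * (1/2) ^ k)"
      by (intro summable_mult summable_geometric) simp
    ultimately have "summable (\<lambda>k. D k x)"
      using summable_comparison_test'[of "\<lambda>k. sqrt C * (1/2) ^ k" 0 "\<lambda>k. D k x"] by blast
    then have "convergent (\<lambda>n. \<Sum>k<n. D k x)"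
      by (simp add: summable_iff_convergent)
    then have "convergent (\<lambda>n. (F n x - F 0 x) + F 0 x)"
      unfolding D_def by (intro convergent_add convergent_const)
        (simp add: sum_lessThan_telescope[of "\<lambda>k. F k x"])
    then show ?case by simp
  qed
qed

instance l2 :: (euclidean_space) complete_space
proof
  fix X :: "nat \<Rightarrow> 'a l2" assume X: "Cauchy X"
  define f where "f n = l2_rep (X n)" for n
  have f: "sqint (f n)" "X n = l2 (f n)" for n
    by (simp_all add: f_def sqint_l2_rep l2_l2_rep)
  have "\<exists>N. \<forall>m\<ge>N. \<forall>n\<ge>N. norm (X m - X n) < (1/8) ^ k" for k
    using CauchyD[OF X, of "(1/8) ^ k"] by simp
  then obtain N where N: "\<And>k m n. m \<ge> N k \<Longrightarrow> n \<ge> N k \<Longrightarrow> norm (X m - X n) < (1/8) ^ k"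
    by metis
  \<comment> \<open>Summing the thresholds keeps \<open>r k\<close> beyond \<open>N k\<close>; the
    extra k makes \<open>r\<close> strictly increasing.\<close>
  define r where "r k = (\<Sum>i\<le>k. N i) + k" for k
  have rN: "r k \<ge> N k" for k
    unfolding r_def by (intro trans_le_add1 member_le_sum) auto
  have rS: "r (Suc k) \<ge> N k" for k
    using rN[of k] by (simp add: r_def)
  have r: "strict_mono r"
    by (auto simp: strict_mono_Suc_iff r_def)
  define F where "F k = f (r k)" for k
  have F: "sqint (F k)" for k
    by (simp add: F_def f)
  note [measurable] = sqint_measurable[OF F]
  have "(norm (l2 (F (Suc k)) - l2 (F k)))\<^sup>2 \<le> (1/8) ^ k" for k
  proof -
    have "norm (l2 (F (Suc k)) - l2 (F k)) \<le> (1/8) ^ k"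
      using N[OF rS rN, of k] by (simp add: F_def f)
    then have "(norm (l2 (F (Suc k)) - l2 (F k)))\<^sup>2 \<le> ((1/8) ^ k)\<^sup>2"
      by (intro power_mono) auto
    also have "\<dots> = (1/8) ^ k * (1/8) ^ k"
      by (simp add: power2_eq_square)
    also have "\<dots> \<le> (1/8) ^ k * 1"
      by (intro mult_left_mono power_le_one) auto
    finally show ?thesis by simp
  qed
  then have "AE x in lborel. convergent (\<lambda>k. F k x)"
    by (rule l2_complete_aux[OF F])
  then have lim: "AE x in lborel. (\<lambda>k. F k x) \<longlonglongrightarrow> lim (\<lambda>k. F k x)"
    by (simp add: convergent_LIMSEQ_iff)
  define G where "G x = lim (\<lambda>k. F k x)" for x
  have [measurable]: "G \<in> borel_measurable borel"
    unfolding G_def by measurable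
  \<comment> \<open>Fatou's lemma carries the bound on F j - F k to the pointwise limit in j; this
    yields the square integrability of G and the convergence together.\<close>
  have fatou: "sqint (\<lambda>x. G x - F k x) \<and> norm (l2 (\<lambda>x. G x - F k x)) \<le> e"
    if e: "e > 0" "\<And>m n. m \<ge> M \<Longrightarrow> n \<ge> M \<Longrightarrow> norm (X m - X n) < e" and k: "k \<ge> M" for e M k
  proof -
    have rk: "r j \<ge> M" if "j \<ge> M" for j
      using that seq_suble[OF r, of j] by simp
    have "(\<integral>\<^sup>+x. ennreal ((cmod (G x - F k x))\<^sup>2) \<partial>lborel)
        = (\<integral>\<^sup>+x. liminf (\<lambda>j. ennreal ((cmod (F j x - F k x))\<^sup>2)) \<partial>lborel)"
    proof (rule nn_integral_cong_AE)
      show "AE x in lborel. ennreal ((cmod (G x - F k x))\<^sup>2) = liminf (\<lambda>j. ennreal ((cmod (F j x - F k x))\<^sup>2))"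
        using lim
      proof eventually_elim
        case (elim x)
        then have "(\<lambda>j. ennreal ((cmod (F j x - F k x))\<^sup>2)) \<longlonglongrightarrow> ennreal ((cmod (G x - F k x))\<^sup>2)"
          unfolding G_def by (intro tendsto_ennrealI tendsto_intros)
        then show ?case
          by (rule lim_imp_Liminf[OF trivial_limit_sequentially, symmetric])
      qed
    qed
    also have "\<dots> \<le> liminf (\<lambda>j. \<integral>\<^sup>+x. ennreal ((cmod (F j x - F k x))\<^sup>2) \<partial>lborel)"
      by (rule nn_integral_liminf) measurable
    also have "\<dots> \<le> ennreal (e\<^sup>2)"
    proof (rule Liminf_le)
      show "\<forall>\<^sub>F j in sequentially. (\<integral>\<^sup>+x. ennreal ((cmod (F j x - F k x))\<^sup>2) \<partial>lborel) \<le> ennreal (e\<^sup>2)"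
        using eventually_ge_at_top[of M]
      proof eventually_elim
        case (elim j)
        have "norm (l2 (F j) - l2 (F k)) < e"
          using e(2)[OF rk[OF elim] rk[OF k]] by (simp add: F_def f)
        then have "(norm (l2 (F j) - l2 (F k)))\<^sup>2 \<le> e\<^sup>2"
          by (intro power_mono) auto
        then show ?case
          by (simp add: l2_nn_integral sqint_diff F l2_diff ennreal_leI)
      qed
    qed simp
    finally show ?thesis
      using sqint_of_nn_integral_le[of "\<lambda>x. G x - F k x" e] e(1) by auto
  qed
  have G: "sqint G"
  proof -
    obtain M where "\<And>m n. m \<ge> M \<Longrightarrow> n \<ge> M \<Longrightarrow> norm (X m - X n) < 1"
      using CauchyD[OF X, of 1] by auto
    then have "sqint (\<lambda>x. (G x - F M x) + F M x)"
      using fatou[of 1 M M] F by (intro sqint_add) auto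
    then show ?thesis by simp
  qed
  have "(X \<circ> r) \<longlonglongrightarrow> l2 G"
  proof (rule LIMSEQ_I)
    fix e :: real assume e: "e > 0"
    then obtain M where M: "\<And>m n. m \<ge> M \<Longrightarrow> n \<ge> M \<Longrightarrow> norm (X m - X n) < e / 2"
      using CauchyD[OF X, of "e / 2"] by auto
    have "norm ((X \<circ> r) k - l2 G) < e" if "k \<ge> M" for k
    proof -
      have "norm (l2 G - l2 (F k)) \<le> e / 2"
        using fatou[of "e/2" M k] M that e by (simp add: l2_diff G F)
      then show ?thesis
        using e by (simp add: F_def f norm_minus_commute)
    qed
    then show "\<exists>no. \<forall>n\<ge>no. norm ((X \<circ> r) n - l2 G) < e" by blast
  qed
  then show "convergent X"
    using Cauchy_converges_subseq[OF X r] by (auto simp: convergent_def)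
qed

section \<open>Multiplication operators\<close>

definition l2_mult :: "('a::euclidean_space \<Rightarrow> complex) \<Rightarrow> 'a l2 \<Rightarrow> 'a l2" where
  "l2_mult \<phi> h = l2 (\<lambda>x. \<phi> x * l2_rep h x)"

lemma l2_mult_l2:
  assumes "\<phi> \<in> borel_measurable borel" "\<And>x. cmod (\<phi> x) \<le> C" "sqint f"
  shows "l2_mult \<phi> (l2 f) = l2 (\<lambda>x. \<phi> x * f x)"
  unfolding l2_mult_def
proof (rule l2_eqI)
  show "AE x in lborel. \<phi> x * l2_rep (l2 f) x = \<phi> x * f x"
    using l2_rep_l2[OF assms(3)] by eventually_elim simp
qed (use assms sqint_l2_rep in \<open>auto intro: sqint_mult_bounded\<close>)

lemma l2_mult_bound:
  assumes "\<phi> \<in> borel_measurable borel" "\<And>x. cmod (\<phi> x) \<le> C" "C \<ge> 0"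
  shows "norm (l2_mult \<phi> h) \<le> C * norm h"
proof -
  note [measurable] = assms(1)
  obtain f where f: "sqint f" "h = l2 f"
    using l2_exhaust by blast
  note [measurable] = sqint_measurable[OF f(1)]
  have "(\<integral>\<^sup>+x. ennreal ((cmod (\<phi> x * f x))\<^sup>2) \<partial>lborel) \<le> (\<integral>\<^sup>+x. ennreal (C\<^sup>2) * ennreal ((cmod (f x))\<^sup>2) \<partial>lborel)"
  proof (rule nn_integral_mono)
    fix x
    have "(cmod (\<phi> x * f x))\<^sup>2 \<le> (C * cmod (f x))\<^sup>2"
      unfolding norm_mult by (intro power_mono mult_right_mono assms) auto
    then show "ennreal ((cmod (\<phi> x * f x))\<^sup>2) \<le> ennreal (C\<^sup>2) * ennreal ((cmod (f x))\<^sup>2)"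
      by (simp add: power_mult_distrib ennreal_mult'[symmetric] ennreal_leI)
  qed
  also have "\<dots> = ennreal ((C * norm h)\<^sup>2)"
    by (simp add: nn_integral_cmult l2_nn_integral[OF f(1)] f(2) power_mult_distrib ennreal_mult')
  finally have "norm (l2 (\<lambda>x. \<phi> x * f x)) \<le> C * norm h"
    using assms(3) by (intro sqint_of_nn_integral_le) auto
  then show ?thesis
    using l2_mult_l2[OF assms(1,2) f(1)] f(2) by simp
qed

lemma bounded_linear_l2_mult:
  assumes "\<phi> \<in> borel_measurable borel" "\<And>x. cmod (\<phi> x) \<le> C"
  shows "bounded_linear (l2_mult \<phi>)"
proof (rule bounded_linear_intro[where K=C])
  have C: "C \<ge> 0"
    using assms(2) norm_ge_zero order_trans by blast
  fix g h :: "'a l2" and a :: real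
  obtain f where f: "sqint f" "g = l2 f"
    using l2_exhaust by blast
  obtain f' where f': "sqint f'" "h = l2 f'"
    using l2_exhaust by blast
  show "l2_mult \<phi> (g + h) = l2_mult \<phi> g + l2_mult \<phi> h"
    using f f' assms
    by (simp add: l2_add[symmetric] l2_mult_l2[OF assms] sqint_add sqint_mult_bounded[OF _ assms] distrib_left)
  show "l2_mult \<phi> (a *\<^sub>R g) = a *\<^sub>R l2_mult \<phi> g"
    using f assms
    by (simp add: l2_scaleR[symmetric] l2_mult_l2[OF assms] sqint_scaleR sqint_mult_bounded[OF _ assms])
  show "norm (l2_mult \<phi> g) \<le> norm g * C"
    using l2_mult_bound[OF assms C, of g] by (simp add: mult.commute)
qed

section \<open>Integration by parts and translations\<close>

lemma lborel_nn_integral_shift: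
  fixes z :: "'a::euclidean_space"
  assumes "f \<in> borel_measurable borel"
  shows "(\<integral>\<^sup>+x. f (x + z) \<partial>lborel) = (\<integral>\<^sup>+x. f x \<partial>lborel)"
  using nn_integral_distr[of "(+) z" lborel borel f] lborel_distr_plus[of z] assms by (simp add: add.commute)

lemma lborel_integral_shift:
  fixes z :: "'a::euclidean_space" and f :: "'a \<Rightarrow> 'b::{banach,second_countable_topology}"
  assumes "f \<in> borel_measurable borel"
  shows "(\<integral>x. f (x + z) \<partial>lborel) = (\<integral>x. f x \<partial>lborel)"
  using integral_distr[of "(+) z" lborel borel f] lborel_distr_plus[of z] assms by (simp add: add.commute)

lemma sqint_shift:
  fixes z :: "'a::euclidean_space"
  assumes f: "sqint f"
  shows "sqint (\<lambda>x. f (x + z))" "norm (l2 (\<lambda>x. f (x + z))) = norm (l2 f)"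
proof -
  note [measurable] = sqint_measurable[OF f]
  have m: "(\<lambda>x. f (x + z)) \<in> borel_measurable borel"
    by measurable
  have eq: "(\<integral>\<^sup>+x. ennreal ((cmod (f (x + z)))\<^sup>2) \<partial>lborel) = ennreal ((norm (l2 f))\<^sup>2)"
    using lborel_nn_integral_shift[of "\<lambda>x. ennreal ((cmod (f x))\<^sup>2)" z] l2_nn_integral[OF f] by simp
  show s: "sqint (\<lambda>x. f (x + z))"
    using sqint_of_nn_integral_le(1)[OF m, of "norm (l2 f)"] eq by simp
  have "(norm (l2 (\<lambda>x. f (x + z))))\<^sup>2 = (norm (l2 f))\<^sup>2"
    using l2_nn_integral[OF s] eq by simp
  then show "norm (l2 (\<lambda>x. f (x + z))) = norm (l2 f)"
    using power2_eq_imp_eq by fastforce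
qed

section \<open>Compactly supported functions and difference quotients\<close>

definition compactly_Ck :: "nat \<Rightarrow> ('a::euclidean_space \<Rightarrow> complex) \<Rightarrow> bool" where
  "compactly_Ck k f \<longleftrightarrow> Ck_on k UNIV f \<and> (\<exists>K. compact K \<and> (\<forall>x. x \<notin> K \<longrightarrow> f x = 0))"

lemma compactly_CkI: "Ck_on k UNIV f \<Longrightarrow> compact K \<Longrightarrow> (\<And>x. x \<notin> K \<Longrightarrow> f x = 0) \<Longrightarrow> compactly_Ck k f"
  by (auto simp: compactly_Ck_def)

lemma compactly_Ck_partial_deriv:
  assumes "compactly_Ck (Suc k) f" "b \<in> Basis"
  shows "compactly_Ck k (partial_deriv b f)"
proof -
  obtain K where K: "compact K" "\<And>x. x \<notin> K \<Longrightarrow> f x = 0" "Ck_on (Suc k) UNIV f"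
    using assms(1) by (auto simp: compactly_Ck_def)
  show ?thesis
    using K assms(2) by (intro compactly_CkI[OF _ K(1)] partial_deriv_zero_outside[OF compact_imp_closed])
      (auto simp: Ck_on_Suc)
qed

lemma compactly_Ck_mono: "compactly_Ck k f \<Longrightarrow> j \<le> k \<Longrightarrow> compactly_Ck j f"
  unfolding compactly_Ck_def using Ck_on_mono by blast

lemma test_function_compactly_Ck: "\<psi> \<in> test_functions D \<Longrightarrow> compactly_Ck k \<psi>"
  using compactly_CkI[of k \<psi>] by (elim test_functionsE) (auto simp: smooth_on_def)

lemma continuous_compact_support_integrable:
  fixes f :: "'a::euclidean_space \<Rightarrow> 'b::{banach,second_countable_topology}"
  assumes "continuous_on UNIV f" "compact K" "\<And>x. x \<notin> K \<Longrightarrow> f x = 0"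
  shows "integrable lborel f"
proof -
  have "(\<lambda>x. indicator K x *\<^sub>R f x) = f"
    using assms(3) by (auto simp: indicator_def)
  then show ?thesis
    using borel_integrable_compact[OF assms(2) continuous_on_subset[OF assms(1)]] by simp
qed

lemma continuous_compact_support_bounded:
  fixes f :: "'a::euclidean_space \<Rightarrow> complex"
  assumes "continuous_on UNIV f" "compact K" "\<And>x. x \<notin> K \<Longrightarrow> f x = 0"
  obtains B where "B \<ge> 0" "\<And>x. cmod (f x) \<le> B"
proof -
  have "compact (f ` K)"
    using assms by (intro compact_continuous_image continuous_on_subset[OF assms(1)]) auto
  then have "bounded (f ` K)"
    by (rule compact_imp_bounded)
  then obtain B where "\<forall>y\<in>f ` K. norm y \<le> B"
    unfolding bounded_iff by blast
  then have "cmod (f x) \<le> max 0 B" for x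
    using assms(3)[of x] by (cases "x \<in> K") (auto simp: le_max_iff_disj)
  then show thesis
    using that[of "max 0 B"] by simp
qed

lemma compactly_Ck_continuous:
  assumes "compactly_Ck k f" shows "continuous_on UNIV f"
  using compactly_Ck_mono[OF assms, of 0] by (simp add: compactly_Ck_def Ck_on.simps)

lemma compactly_Ck_measurable: "compactly_Ck k f \<Longrightarrow> f \<in> borel_measurable borel"
  by (intro borel_measurable_continuous_onI compactly_Ck_continuous)

lemma compactly_Ck_integrable:
  assumes "compactly_Ck k f" shows "integrable lborel f"
  using assms continuous_compact_support_integrable[OF compactly_Ck_continuous[OF assms]]
  by (auto simp: compactly_Ck_def)

lemma compactly_Ck_bounded:
  assumes "compactly_Ck k f" obtains B where "B \<ge> 0" "\<And>x. cmod (f x) \<le> B"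
  using assms continuous_compact_support_bounded[OF compactly_Ck_continuous[OF assms]]
  unfolding compactly_Ck_def by metis

lemma compactly_Ck_sqint:
  assumes "compactly_Ck k f" shows "sqint f"
  unfolding sqint_def
proof
  show "integrable lborel (\<lambda>x. (cmod (f x))\<^sup>2)"
    using assms continuous_compact_support_integrable[of "\<lambda>x. (cmod (f x))\<^sup>2"] compactly_Ck_continuous[OF assms]
    by (fastforce simp: compactly_Ck_def intro!: continuous_intros)
qed (rule compactly_Ck_measurable[OF assms])

lemma compactly_C1_lipschitz:
  assumes "compactly_Ck 1 f"
  obtains L where "L \<ge> 0" "\<And>x y. cmod (f x - f y) \<le> L * norm (x - y)"
proof -
  have c1: "compactly_Ck (Suc 0) f"
    using assms by simp
  have "\<exists>B\<ge>0. \<forall>x. cmod (partial_deriv b f x) \<le> B" if "b \<in> Basis" for b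
    by (rule compactly_Ck_bounded[OF compactly_Ck_partial_deriv[OF c1 that]]) blast
  then obtain B where B: "\<And>b. b \<in> Basis \<Longrightarrow> B b \<ge> 0" "\<And>b x. b \<in> Basis \<Longrightarrow> cmod (partial_deriv b f x) \<le> B b"
    by metis
  define L where "L = (\<Sum>b\<in>Basis. B b)"
  have L: "L \<ge> 0"
    unfolding L_def by (intro sum_nonneg B)
  have D: "(f has_derivative (\<lambda>h. \<Sum>b\<in>Basis. (h \<bullet> b) *\<^sub>R partial_deriv b f x)) (at x)" for x
    using c1 by (intro has_derivative_partial_deriv) (auto simp: compactly_Ck_def Ck_on_Suc)
  have on: "onorm (\<lambda>h. \<Sum>b\<in>Basis. (h \<bullet> b) *\<^sub>R partial_deriv b f x) \<le> L" for x
  proof (rule onorm_bound[OF L])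
    fix h :: 'a
    have "norm (\<Sum>b\<in>Basis. (h \<bullet> b) *\<^sub>R partial_deriv b f x) \<le> (\<Sum>b\<in>Basis. norm h * B b)"
      using B by (intro sum_norm_le) (auto intro!: mult_mono Basis_le_norm)
    then show "norm (\<Sum>b\<in>Basis. (h \<bullet> b) *\<^sub>R partial_deriv b f x) \<le> L * norm h"
      by (simp add: L_def sum_distrib_left mult.commute)
  qed
  have "cmod (f x - f y) \<le> L * norm (x - y)" for x y
    using differentiable_bound[of UNIV f "\<lambda>x h. \<Sum>b\<in>Basis. (h \<bullet> b) *\<^sub>R partial_deriv b f x" L x y] D on by simp
  then show thesis
    using that L by blast
qed

text \<open>The bound is uniform in n and has fixed bounded support, so it can dominate both the
  quotients and their squares: the first use gives that derivatives integrate to zero, the second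
  the translation estimate.\<close>

lemma difference_quotient:
  assumes "compactly_Ck 1 f"
  obtains C R where "C \<ge> 0" "\<And>n x. cmod (real (Suc n) *\<^sub>R (f (x + z /\<^sub>R real (Suc n)) - f x)) \<le> C * indicator (cball 0 R) x"
    "\<And>x. (\<lambda>n. real (Suc n) *\<^sub>R (f (x + z /\<^sub>R real (Suc n)) - f x)) \<longlonglongrightarrow> (\<Sum>b\<in>Basis. (z \<bullet> b) *\<^sub>R partial_deriv b f x)"
proof -
  obtain L where L: "L \<ge> 0" "\<And>x y. cmod (f x - f y) \<le> L * norm (x - y)"
    using compactly_C1_lipschitz[OF assms] by blast
  obtain K where K: "compact K" "\<And>x. x \<notin> K \<Longrightarrow> f x = 0"
    using assms by (auto simp: compactly_Ck_def)
  obtain R where R: "\<And>x. x \<in> K \<Longrightarrow> norm x \<le> R"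
    using compact_imp_bounded[OF K(1)] unfolding bounded_iff by blast
  \<comment> \<open>All shifts z / (n+1) have length at most |z|, so every quotient vanishes off the
    ball of radius R + |z|.\<close>
  have bound: "cmod (real (Suc n) *\<^sub>R (f (x + z /\<^sub>R real (Suc n)) - f x)) \<le> L * norm z * indicator (cball 0 (R + norm z)) x" for n x
  proof (cases "norm x \<le> R + norm z")
    case True
    have "real (Suc n) * cmod (f (x + z /\<^sub>R real (Suc n)) - f x) \<le> real (Suc n) * (L * norm (z /\<^sub>R real (Suc n)))"
      using L(2)[of "x + z /\<^sub>R real (Suc n)" x] by (intro mult_left_mono) auto
    also have "\<dots> = L * norm z"
      by (simp add: field_simps)
    finally show ?thesis
      using True by (simp add: indicator_def)
  next
    case False
    have "norm (z /\<^sub>R real (Suc n)) \<le> norm z"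
      by (simp add: field_simps)
    then have "norm (x + z /\<^sub>R real (Suc n)) > R" "norm x > R"
      using False norm_diff_ineq[of x "z /\<^sub>R real (Suc n)"] norm_ge_zero[of z] by linarith+
    then have "f (x + z /\<^sub>R real (Suc n)) = 0" "f x = 0"
      using R K(2) by force+
    then show ?thesis
      using L(1) by simp
  qed
  have lim: "(\<lambda>n. real (Suc n) *\<^sub>R (f (x + z /\<^sub>R real (Suc n)) - f x)) \<longlonglongrightarrow> (\<Sum>b\<in>Basis. (z \<bullet> b) *\<^sub>R partial_deriv b f x)" for x
  proof -
    define V where "V = (\<Sum>b\<in>Basis. (z \<bullet> b) *\<^sub>R partial_deriv b f x)"
    have "(f has_derivative (\<lambda>h. \<Sum>b\<in>Basis. (h \<bullet> b) *\<^sub>R partial_deriv b f x)) (at (x + 0 *\<^sub>R z))"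
      using assms has_derivative_partial_deriv[of f x] by (auto simp: compactly_Ck_def Ck_on_Suc)
    moreover have "((\<lambda>t::real. x + t *\<^sub>R z) has_derivative (\<lambda>t. t *\<^sub>R z)) (at 0)"
      by (auto intro!: derivative_eq_intros)
    ultimately have "((\<lambda>t. f (x + t *\<^sub>R z)) has_derivative (\<lambda>t. \<Sum>b\<in>Basis. ((t *\<^sub>R z) \<bullet> b) *\<^sub>R partial_deriv b f x)) (at 0)"
      using has_derivative_compose by fast
    moreover have "(\<lambda>t. \<Sum>b\<in>Basis. ((t *\<^sub>R z) \<bullet> b) *\<^sub>R partial_deriv b f x) = (\<lambda>t. t *\<^sub>R V)"
      by (simp add: V_def scaleR_sum_right)
    ultimately have "((\<lambda>t. f (x + t *\<^sub>R z)) has_derivative (\<lambda>t. t *\<^sub>R V)) (at 0)"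
      by (simp only:)
    then have "((\<lambda>t. norm (f (x + t *\<^sub>R z) - f x - t *\<^sub>R V) / norm t) \<longlongrightarrow> 0) (at 0)"
      by (simp add: has_derivative_at)
    moreover have "filterlim (\<lambda>n. inverse (real (Suc n))) (at 0) sequentially"
      using LIMSEQ_inverse_real_of_nat by (auto simp: filterlim_at)
    ultimately have "(\<lambda>n. norm (f (x + inverse (real (Suc n)) *\<^sub>R z) - f x - inverse (real (Suc n)) *\<^sub>R V) / norm (inverse (real (Suc n)))) \<longlonglongrightarrow> 0"
      by (rule filterlim_compose)
    moreover have "norm (f (x + inverse (real (Suc n)) *\<^sub>R z) - f x - inverse (real (Suc n)) *\<^sub>R V) / norm (inverse (real (Suc n)))
        = norm (real (Suc n) *\<^sub>R (f (x + z /\<^sub>R real (Suc n)) - f x) - V)" for n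
    proof -
      have "real (Suc n) *\<^sub>R (f (x + z /\<^sub>R real (Suc n)) - f x) - V
          = real (Suc n) *\<^sub>R (f (x + z /\<^sub>R real (Suc n)) - f x - V /\<^sub>R real (Suc n))"
        by (simp add: scaleR_diff_right)
      then show ?thesis
        by (simp add: divide_inverse mult.commute)
    qed
    ultimately have "(\<lambda>n. norm (real (Suc n) *\<^sub>R (f (x + z /\<^sub>R real (Suc n)) - f x) - V)) \<longlonglongrightarrow> 0"
      by (simp only:)
    then show ?thesis
      unfolding V_def[symmetric] by (rule LIM_zero_cancel[OF tendsto_norm_zero_cancel])
  qed
  show thesis
    using that[of "L * norm z" "R + norm z"] L(1) bound lim by simp
qed

text \<open>By translation invariance every difference quotient has integral zero, and dominated
  convergence passes this to the derivative.\<close>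

lemma integral_partial_deriv:
  assumes "compactly_Ck 1 f" "b \<in> Basis"
  shows "(\<integral>x. partial_deriv b f x \<partial>lborel) = 0"
proof -
  let ?q = "\<lambda>n x. real (Suc n) *\<^sub>R (f (x + b /\<^sub>R real (Suc n)) - f x)"
  obtain C R where q: "C \<ge> 0" "\<And>n x. cmod (?q n x) \<le> C * indicator (cball 0 R) x"
    "\<And>x. (\<lambda>n. ?q n x) \<longlonglongrightarrow> (\<Sum>c\<in>Basis. (b \<bullet> c) *\<^sub>R partial_deriv c f x)"
    using difference_quotient[OF assms(1), of b] by blast
  have eq: "(\<Sum>c\<in>Basis. (b \<bullet> c) *\<^sub>R partial_deriv c f x) = partial_deriv b f x" for x
    using assms(2) by (simp add: inner_Basis if_distrib[of "\<lambda>t. t *\<^sub>R _"] cong: if_cong)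
  have m [measurable]: "f \<in> borel_measurable borel"
    using assms(1) by (rule compactly_Ck_measurable)
  have mb: "partial_deriv b f \<in> borel_measurable borel"
    using compactly_Ck_partial_deriv[of 0 f b] assms compactly_Ck_measurable by auto
  have i: "integrable lborel f"
    using assms(1) by (rule compactly_Ck_integrable)
  have "(\<integral>x. ?q n x \<partial>lborel) = 0" for n
  proof -
    have "integrable lborel (\<lambda>x. f (x + b /\<^sub>R real (Suc n)))"
      using integrable_distr_eq[of "(+) (b /\<^sub>R real (Suc n))" lborel borel f] lborel_distr_plus[of "b /\<^sub>R real (Suc n)"] i
      by (simp add: add.commute)
    then show ?thesis
      using i lborel_integral_shift[OF m, of "b /\<^sub>R real (Suc n)"] by simp
  qed
  moreover have "(\<lambda>n. \<integral>x. ?q n x \<partial>lborel) \<longlonglongrightarrow> (\<integral>x. partial_deriv b f x \<partial>lborel)"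
  proof (rule integral_dominated_convergence)
    show "integrable lborel (\<lambda>x. C * indicator (cball 0 R) x)"
      by (intro integrable_mult_right integrable_real_indicator) (auto simp: emeasure_compact_finite[OF compact_cball, unfolded infinity_ennreal_def])
    show "AE x in lborel. (\<lambda>n. ?q n x) \<longlonglongrightarrow> partial_deriv b f x"
      using q(3) by (simp add: eq)
    show "AE x in lborel. norm (?q n x) \<le> C * indicator (cball 0 R) x" for n
      using q(2) by simp
  qed (use mb in measurable)
  ultimately show ?thesis
    by (simp add: LIMSEQ_const_iff)
qed

section \<open>Translations are controlled by the gradient\<close>

definition grad_norm :: "('a::euclidean_space \<Rightarrow> complex) \<Rightarrow> real" where
  "grad_norm f = (\<Sum>b\<in>Basis. norm (l2 (partial_deriv b f)))"

lemma grad_norm_nonneg: "grad_norm f \<ge> 0"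
  by (simp add: grad_norm_def sum_nonneg)

lemma sqint_sum: "finite I \<Longrightarrow> (\<And>i. i \<in> I \<Longrightarrow> sqint (f i)) \<Longrightarrow> sqint (\<lambda>x. \<Sum>i\<in>I. f i x)"
  by (induction I rule: finite_induct) (auto intro: sqint_add sqint_zero)

lemma l2_sum: "finite I \<Longrightarrow> (\<And>i. i \<in> I \<Longrightarrow> sqint (f i)) \<Longrightarrow> l2 (\<lambda>x. \<Sum>i\<in>I. f i x) = (\<Sum>i\<in>I. l2 (f i))"
  by (induction I rule: finite_induct) (auto simp: l2_add sqint_sum l2_zero)

text \<open>Telescoping over n shifts by z; all increments have the same norm, since translations
  are isometries.\<close>

lemma shift_norm_multiple:
  assumes "sqint f"
  shows "norm (l2 (\<lambda>x. f (x + real n *\<^sub>R z)) - l2 f) \<le> real n * norm (l2 (\<lambda>x. f (x + z)) - l2 f)"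
proof (induction n)
  case (Suc n)
  let ?g = "\<lambda>x. f (x + z) - f x"
  have g: "sqint ?g"
    using assms by (intro sqint_diff sqint_shift)
  have "l2 (\<lambda>x. f (x + real (Suc n) *\<^sub>R z)) - l2 (\<lambda>x. f (x + real n *\<^sub>R z)) = l2 (\<lambda>x. ?g (x + real n *\<^sub>R z))"
    using assms by (simp add: l2_diff[symmetric] sqint_shift algebra_simps)
  then have "norm (l2 (\<lambda>x. f (x + real (Suc n) *\<^sub>R z)) - l2 (\<lambda>x. f (x + real n *\<^sub>R z))) = norm (l2 (\<lambda>x. f (x + z)) - l2 f)"
    using sqint_shift(2)[OF g, of "real n *\<^sub>R z"] assms by (simp add: l2_diff sqint_shift)
  then show ?case
    using Suc norm_triangle_ineq[of "l2 (\<lambda>x. f (x + real (Suc n) *\<^sub>R z)) - l2 (\<lambda>x. f (x + real n *\<^sub>R z))"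
        "l2 (\<lambda>x. f (x + real n *\<^sub>R z)) - l2 f"]
    by (simp add: algebra_simps)
qed simp

text \<open>A shift by z consists of n+1 shifts by z / (n+1), so its effect is at most the norm of
  the difference quotient, which tends to the norm of the derivative in direction z.\<close>

lemma shift_norm_le:
  assumes f: "compactly_Ck 1 f"
  shows "norm (l2 (\<lambda>x. f (x + z)) - l2 f) \<le> norm z * grad_norm f"
proof -
  let ?q = "\<lambda>n x. real (Suc n) *\<^sub>R (f (x + z /\<^sub>R real (Suc n)) - f x)"
  let ?D = "\<lambda>x. \<Sum>b\<in>Basis. (z \<bullet> b) *\<^sub>R partial_deriv b f x"
  obtain C R where q: "C \<ge> 0" "\<And>n x. cmod (?q n x) \<le> C * indicator (cball 0 R) x"
    "\<And>x. (\<lambda>n. ?q n x) \<longlonglongrightarrow> ?D x"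
    using difference_quotient[OF f, of z] by blast
  have sf: "sqint f"
    using f by (rule compactly_Ck_sqint)
  note [measurable] = sqint_measurable[OF sf]
  have sp: "sqint (partial_deriv b f)" if "b \<in> Basis" for b
    using compactly_Ck_partial_deriv[of 0 f b] f that compactly_Ck_sqint by auto
  have sD: "sqint ?D"
    using sp by (intro sqint_sum sqint_scaleR) auto
  note [measurable] = sqint_measurable[OF sD]
  have sq: "sqint (?q n)" for n
    using sf by (intro sqint_scaleR sqint_diff sqint_shift)
  have le: "norm (l2 (\<lambda>x. f (x + z)) - l2 f) \<le> norm (l2 (?q n))" for n
  proof -
    have "l2 (?q n) = real (Suc n) *\<^sub>R (l2 (\<lambda>x. f (x + z /\<^sub>R real (Suc n))) - l2 f)"
      by (subst l2_scaleR) (auto simp: l2_diff sqint_diff sqint_shift sf)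
    then show ?thesis
      using shift_norm_multiple[OF sf, of "Suc n" "z /\<^sub>R real (Suc n)"] by simp
  qed
  have "(\<lambda>n. \<integral>x. (cmod (?q n x))\<^sup>2 \<partial>lborel) \<longlonglongrightarrow> (\<integral>x. (cmod (?D x))\<^sup>2 \<partial>lborel)"
  proof (rule integral_dominated_convergence)
    show "integrable lborel (\<lambda>x::'a. C\<^sup>2 * indicator (cball 0 R) x)"
      by (intro integrable_mult_right integrable_real_indicator) (auto simp: emeasure_compact_finite[OF compact_cball, unfolded infinity_ennreal_def])
    show "AE x in lborel. (\<lambda>n. (cmod (?q n x))\<^sup>2) \<longlonglongrightarrow> (cmod (?D x))\<^sup>2"
      by (intro AE_I2 tendsto_intros q(3))
    show "AE x in lborel. norm ((cmod (?q n x))\<^sup>2) \<le> C\<^sup>2 * indicator (cball 0 R) x" for n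
    proof (rule AE_I2)
      fix x
      have "(cmod (?q n x))\<^sup>2 \<le> (C * indicator (cball 0 R) x)\<^sup>2"
        by (intro power_mono q(2)) auto
      then show "norm ((cmod (?q n x))\<^sup>2) \<le> C\<^sup>2 * indicator (cball 0 R) x"
        by (cases "norm x \<le> R") (simp_all add: indicator_def)
    qed
  qed measurable
  then have "(\<lambda>n. (norm (l2 (?q n)))\<^sup>2) \<longlonglongrightarrow> (norm (l2 ?D))\<^sup>2"
    by (simp only: l2_norm_power2[OF sq] l2_norm_power2[OF sD])
  then have "(norm (l2 (\<lambda>x. f (x + z)) - l2 f))\<^sup>2 \<le> (norm (l2 ?D))\<^sup>2"
    by (rule LIMSEQ_le_const) (use le in \<open>auto intro!: power_mono\<close>)
  then have "norm (l2 (\<lambda>x. f (x + z)) - l2 f) \<le> norm (l2 ?D)"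
    by (rule power2_le_imp_le) simp
  also have "l2 ?D = (\<Sum>b\<in>Basis. (z \<bullet> b) *\<^sub>R l2 (partial_deriv b f))"
    using sp by (simp add: l2_sum l2_scaleR sqint_scaleR)
  also have "norm \<dots> \<le> (\<Sum>b\<in>Basis. norm z * norm (l2 (partial_deriv b f)))"
    by (intro sum_norm_le) (auto intro!: mult_mono Basis_le_norm)
  finally show ?thesis
    by (simp add: grad_norm_def sum_distrib_left)
qed

section \<open>Density of test functions\<close>

lemma test_functions_add: "f \<in> test_functions D \<Longrightarrow> g \<in> test_functions D \<Longrightarrow> (\<lambda>x. f x + g x) \<in> test_functions D"
proof (elim test_functionsE)
  fix K L assume "smooth_on UNIV f" "smooth_on UNIV g" "compact K" "compact L" "K \<subseteq> D" "L \<subseteq> D"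
    "\<And>x. x \<notin> K \<Longrightarrow> f x = 0" "\<And>x. x \<notin> L \<Longrightarrow> g x = 0"
  then show ?thesis
    by (intro test_functionsI[of _ "K \<union> L"] smooth_on_add) auto
qed

lemma test_functions_mult: "f \<in> test_functions D \<Longrightarrow> smooth_on UNIV g \<Longrightarrow> (\<lambda>x. f x * g x) \<in> test_functions D"
proof (elim test_functionsE)
  fix K assume "smooth_on UNIV f" "smooth_on UNIV g" "compact K" "K \<subseteq> D" "\<And>x. x \<notin> K \<Longrightarrow> f x = 0"
  then show ?thesis
    by (intro test_functionsI[of _ K] smooth_on_mult) auto
qed

lemma test_functions_cmult: "f \<in> test_functions D \<Longrightarrow> (\<lambda>x. c * f x) \<in> test_functions D"
  using test_functions_mult[OF _ smooth_on_const[of c]] by (simp add: mult.commute)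

lemma test_functions_diff: "f \<in> test_functions D \<Longrightarrow> g \<in> test_functions D \<Longrightarrow> (\<lambda>x. f x - g x) \<in> test_functions D"
  using test_functions_add[OF _ test_functions_cmult[of g D "-1"]] by simp

lemma test_functions_cnj: "f \<in> test_functions D \<Longrightarrow> (\<lambda>x. cnj (f x)) \<in> test_functions D"
proof (elim test_functionsE)
  fix K assume "smooth_on UNIV f" "compact K" "K \<subseteq> D" "\<And>x. x \<notin> K \<Longrightarrow> f x = 0"
  then show ?thesis
    by (intro test_functionsI[of _ K] smooth_on_cnj) auto
qed

lemma test_functions_zero: "(\<lambda>x. 0) \<in> test_functions D"
  by (intro test_functionsI[of _ "{}"] smooth_on_const) auto

lemma laplacian_test_function: "f \<in> test_functions D \<Longrightarrow> laplacian f \<in> test_functions D"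
  by (elim test_functionsE) (rule test_functionsI, auto intro: smooth_on_laplacian laplacian_zero_outside compact_imp_closed)

lemma test_function_sqint: "f \<in> test_functions D \<Longrightarrow> sqint f"
  by (rule compactly_Ck_sqint[OF test_function_compactly_Ck[where k=0]])

section \<open>Sums of bumps and the fundamental lemma of the calculus of variations\<close>

definition bump_sum :: "('a::euclidean_space \<times> real) set \<Rightarrow> 'a \<Rightarrow> real" where
  "bump_sum F x = (\<Sum>(a, r)\<in>F. bump a r x)"

lemma bump_sum_nonneg: "bump_sum F x \<ge> 0"
  unfolding bump_sum_def by (intro sum_nonneg) (auto simp: bump_nonneg)

lemma bump_sum_pos_iff:
  assumes "finite F" "\<And>a r. (a, r) \<in> F \<Longrightarrow> r > 0"
  shows "bump_sum F x > 0 \<longleftrightarrow> x \<in> (\<Union>(a, r)\<in>F. ball a r)"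
proof -
  have "bump_sum F x = 0 \<longleftrightarrow> (\<forall>q\<in>F. (case q of (a, r) \<Rightarrow> bump a r x) = 0)"
    unfolding bump_sum_def using assms(1) by (intro sum_nonneg_eq_0_iff) (auto simp: bump_nonneg)
  also have "\<dots> \<longleftrightarrow> (\<forall>(a, r)\<in>F. x \<notin> ball a r)"
    using assms(2) bump_pos_iff bump_nonneg by (fastforce simp: less_le)
  also have "\<dots> \<longleftrightarrow> x \<notin> (\<Union>(a, r)\<in>F. ball a r)"
    by blast
  finally show ?thesis
    using bump_sum_nonneg[of F x] by linarith
qed

lemma smooth_on_bump_sum: "smooth_on UNIV (\<lambda>x. complex_of_real (bump_sum F x))"
  unfolding bump_sum_def of_real_sum case_prod_beta by (intro smooth_on_sum smooth_on_bump)

lemma bump_sum_zero_outside: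
  assumes "finite F" "\<And>a r. (a, r) \<in> F \<Longrightarrow> r > 0" "x \<notin> (\<Union>(a, r)\<in>F. cball a r)"
  shows "bump_sum F x = 0"
proof -
  have iff: "bump_sum F x > 0 \<longleftrightarrow> x \<in> (\<Union>(a, r)\<in>F. ball a r)"
    by (rule bump_sum_pos_iff) (use assms in auto)
  have "x \<notin> (\<Union>(a, r)\<in>F. ball a r)"
    using assms(3) ball_subset_cball by blast
  then show ?thesis
    using iff bump_sum_nonneg[of F x] by linarith
qed

lemma compact_cball_Union:
  fixes F :: "('a::euclidean_space \<times> real) set"
  shows "finite F \<Longrightarrow> compact (\<Union>(a, r)\<in>F. cball a r)"
  by (intro compact_UN) auto

lemma bump_sum_test_function:
  assumes "finite F" "\<And>a r. (a, r) \<in> F \<Longrightarrow> r > 0 \<and> cball a r \<subseteq> D"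
  shows "(\<lambda>x. complex_of_real (bump_sum F x)) \<in> test_functions D"
proof (rule test_functionsI[OF smooth_on_bump_sum compact_cball_Union[OF assms(1)]])
  show "complex_of_real (bump_sum F x) = 0" if "x \<notin> (\<Union>(a, r)\<in>F. cball a r)" for x
    using bump_sum_zero_outside[OF assms(1) _ that] assms(2) by auto
qed (use assms in auto)

text \<open>With b the sum of the bumps, 1 - exp(- k b) is a test function with values in [0, 1)
  that increases to the indicator of the union of the open balls. Dominated convergence turns
  orthogonality to these functions into a vanishing integral over the union.\<close>

lemma integral_ball_union_zero:
  fixes u :: "'a::euclidean_space \<Rightarrow> real"
  assumes u: "u \<in> borel_measurable borel"
    and loc: "\<And>W. W \<in> sets borel \<Longrightarrow> bounded W \<Longrightarrow> integrable lborel (\<lambda>x. u x * indicator W x)"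
    and orth: "\<And>s. (\<lambda>x. complex_of_real (s x)) \<in> test_functions D \<Longrightarrow> (\<integral>x. u x * s x \<partial>lborel) = 0"
    and F: "finite F" "\<And>a r. (a, r) \<in> F \<Longrightarrow> r > 0 \<and> cball a r \<subseteq> D"
  shows "(\<integral>x. u x * indicator (\<Union>(a, r)\<in>F. ball a r) x \<partial>lborel) = 0"
proof -
  note [measurable] = u
  define U where "U = (\<Union>(a, r)\<in>F. ball a r)"
  have Uo: "open U"
    unfolding U_def by auto
  then have [measurable]: "U \<in> sets borel" by simp
  have Ub: "bounded U"
    unfolding U_def using F(1) by (intro bounded_UN) auto
  define s where "s k x = 1 - exp (- (real k * bump_sum F x))" for k x
  have pos: "bump_sum F x > 0 \<longleftrightarrow> x \<in> U" for x
    unfolding U_def by (rule bump_sum_pos_iff) (use F in auto)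
  have out: "bump_sum F x = 0" if "x \<notin> U" for x
    using pos[of x] bump_sum_nonneg[of F x] that by linarith
  have "(\<lambda>x. complex_of_real (s k x)) \<in> test_functions D" for k
  proof (rule test_functionsI[OF _ compact_cball_Union[OF F(1)]])
    have "smooth_on UNIV (\<lambda>x. 1 - exp (- (complex_of_real (real k) * complex_of_real (bump_sum F x))))"
      by (intro smooth_on_diff smooth_on_const smooth_on_exp smooth_on_minus smooth_on_mult smooth_on_bump_sum)
    then show "smooth_on UNIV (\<lambda>x. complex_of_real (s k x))"
      by (simp add: s_def exp_of_real[symmetric])
    show "complex_of_real (s k x) = 0" if "x \<notin> (\<Union>(a, r)\<in>F. cball a r)" for x
      using bump_sum_zero_outside[OF F(1) _ that] F(2) by (auto simp: s_def)
  qed (use F in auto)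
  then have zero: "(\<integral>x. u x * s k x \<partial>lborel) = 0" for k
    by (rule orth)
  have bs: "bump_sum F \<in> borel_measurable borel"
    using smooth_on_continuous[OF smooth_on_bump_sum, of UNIV F]
    by (intro borel_measurable_continuous_onI) (auto dest: continuous_on_Re)
  have "(\<lambda>k. \<integral>x. u x * s k x \<partial>lborel) \<longlonglongrightarrow> (\<integral>x. u x * indicator U x \<partial>lborel)"
  proof (rule integral_dominated_convergence)
    show "integrable lborel (\<lambda>x. \<bar>u x * indicator U x\<bar>)"
      using loc[OF _ Ub] Uo by simp
    show "AE x in lborel. (\<lambda>k. u x * s k x) \<longlonglongrightarrow> u x * indicator U x"
    proof (rule AE_I2)
      fix x
      have "(\<lambda>k. s k x) \<longlonglongrightarrow> indicator U x"
      proof (cases "x \<in> U")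
        case True
        then have p: "bump_sum F x > 0" using pos by simp
        have "(\<lambda>k. exp (- (real k * bump_sum F x))) = (\<lambda>k. exp (- bump_sum F x) ^ k)"
          by (simp add: exp_of_nat_mult[symmetric])
        moreover have "(\<lambda>k. exp (- bump_sum F x) ^ k) \<longlonglongrightarrow> 0"
          by (rule LIMSEQ_power_zero) (use p in simp)
        ultimately show ?thesis
          using True tendsto_diff[OF tendsto_const[of "1::real"], of "\<lambda>k. exp (- (real k * bump_sum F x))" 0]
          by (simp add: s_def)
      qed (simp add: s_def out)
      then show "(\<lambda>k. u x * s k x) \<longlonglongrightarrow> u x * indicator U x"
        by (intro tendsto_intros)
    qed
    show "AE x in lborel. norm (u x * s k x) \<le> \<bar>u x * indicator U x\<bar>" for k
    proof (rule AE_I2)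
      fix x
      have "0 \<le> s k x" "s k x \<le> 1"
        using bump_sum_nonneg[of F x] by (auto simp: s_def)
      moreover have "x \<notin> U \<Longrightarrow> s k x = 0"
        by (simp add: s_def out)
      ultimately show "norm (u x * s k x) \<le> \<bar>u x * indicator U x\<bar>"
        by (cases "x \<in> U") (auto simp: abs_mult mult_left_le)
    qed
    show "(\<lambda>x. u x * indicator U x) \<in> borel_measurable lborel"
      by measurable
    show "(\<lambda>x. u x * s k x) \<in> borel_measurable lborel" for k
      unfolding s_def using bs by measurable
  qed
  then show ?thesis
    by (simp add: zero U_def LIMSEQ_const_iff)
qed

text \<open>By Lindelof's theorem an open set is a countable union of balls whose closures it
  contains, and the finite subunions exhaust it.\<close>

lemma integral_open_zero:
  fixes u :: "'a::euclidean_space \<Rightarrow> real"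
  assumes u: "u \<in> borel_measurable borel"
    and loc: "\<And>W. W \<in> sets borel \<Longrightarrow> bounded W \<Longrightarrow> integrable lborel (\<lambda>x. u x * indicator W x)"
    and orth: "\<And>s. (\<lambda>x. complex_of_real (s x)) \<in> test_functions D \<Longrightarrow> (\<integral>x. u x * s x \<partial>lborel) = 0"
    and V: "open V" "bounded V" "V \<subseteq> D"
  shows "(\<integral>x. u x * indicator V x \<partial>lborel) = 0"
proof -
  note [measurable] = u
  define I where "I = {(a, r). r > 0 \<and> cball a r \<subseteq> V}"
  have IV: "(\<Union>(a, r)\<in>I. ball a r) = V"
  proof
    show "(\<Union>(a, r)\<in>I. ball a r) \<subseteq> V"
      unfolding I_def using ball_subset_cball by blast
    show "V \<subseteq> (\<Union>(a, r)\<in>I. ball a r)"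
    proof
      fix x assume "x \<in> V"
      then obtain e where "e > 0" "cball x e \<subseteq> V"
        using V(1) open_contains_cball by blast
      then show "x \<in> (\<Union>(a, r)\<in>I. ball a r)"
        by (intro UN_I[of "(x, e)"]) (auto simp: I_def)
    qed
  qed
  obtain J where J: "J \<subseteq> I" "countable J" "(\<Union>(a, r)\<in>J. ball a r) = V"
  proof -
    obtain \<F>' where F': "\<F>' \<subseteq> (\<lambda>(a, r). ball a r) ` I" "countable \<F>'" "\<Union>\<F>' = \<Union>((\<lambda>(a, r). ball a r) ` I)"
    proof (rule Lindelof)
      show "open S" if "S \<in> (\<lambda>(a, r). ball a r) ` I" for S
        using that by auto
    qed
    then obtain J where "J \<subseteq> I" "countable J" "\<F>' = (\<lambda>(a, r). ball a r) ` J"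
      using countable_subset_image[of \<F>' "\<lambda>(a, r). ball a r" I] by blast
    then show thesis
      using that[of J] F'(3) IV by simp
  qed
  show ?thesis
  proof (cases "J = {}")
    case True
    then show ?thesis using J(3) by auto
  next
    case False
    define q where "q = from_nat_into J"
    define U where "U n = (\<Union>(a, r)\<in>q ` {..n}. ball a r)" for n :: nat
    have q: "range q = J"
      unfolding q_def using False J(2) by (rule range_from_nat_into)
    have zero: "(\<integral>x. u x * indicator (U n) x \<partial>lborel) = 0" for n
      unfolding U_def
    proof (rule integral_ball_union_zero[OF u, of D])
      show "0 < r \<and> cball a r \<subseteq> D" if "(a, r) \<in> q ` {..n}" for a r
        using that q J(1) V(3) unfolding I_def by blast
    qed (simp_all add: loc orth)
    have Uo: "open (U n)" for n
      unfolding U_def by (intro open_UN) (auto split: prod.splits)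
    have UV: "U n \<subseteq> V" for n
      unfolding U_def J(3)[symmetric] q[symmetric] by (rule UN_mono) auto
    have "(\<lambda>n. \<integral>x. u x * indicator (U n) x \<partial>lborel) \<longlonglongrightarrow> (\<integral>x. u x * indicator V x \<partial>lborel)"
    proof (rule integral_dominated_convergence)
      show "integrable lborel (\<lambda>x. \<bar>u x * indicator V x\<bar>)"
        using loc[OF _ V(2)] V(1) by simp
      show "AE x in lborel. (\<lambda>n. u x * indicator (U n) x) \<longlonglongrightarrow> u x * indicator V x"
      proof (rule AE_I2)
        fix x
        show "(\<lambda>n. u x * indicator (U n) x) \<longlonglongrightarrow> u x * indicator V x"
        proof (cases "x \<in> V")
          case True
          then obtain m where m: "x \<in> (case q m of (a, r) \<Rightarrow> ball a r)"
            unfolding J(3)[symmetric] q[symmetric] by (elim UN_E rangeE) simp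
          have "\<forall>\<^sub>F n in sequentially. u x * indicator (U n) x = u x * indicator V x"
            using eventually_ge_at_top[of m]
          proof eventually_elim
            case (elim n)
            then have "x \<in> U n"
              unfolding U_def using m by (intro UN_I[of "q m"]) auto
            then show ?case using True by simp
          qed
          then show ?thesis
            by (rule tendsto_eventually)
        next
          case False
          then have "x \<notin> U n" for n using UV by blast
          then show ?thesis using False by simp
        qed
      qed
      show "AE x in lborel. norm (u x * indicator (U n) x) \<le> \<bar>u x * indicator V x\<bar>" for n
        using UV[of n] by (auto simp: indicator_def)
      show "(\<lambda>x. u x * indicator V x) \<in> borel_measurable lborel"
        using borel_open[OF V(1)] by measurable
      show "(\<lambda>x. u x * indicator (U n) x) \<in> borel_measurable lborel" for n
        using borel_open[OF Uo[of n]] by measurable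
    qed
    then show ?thesis
      by (simp add: zero LIMSEQ_const_iff)
  qed
qed

text \<open>Dynkin's argument: the open sets generate the Borel sets and are stable under
  intersection. Intersecting throughout with the fixed bounded \<open>W\<close> keeps all integrals
  finite, as is needed for complements.\<close>

lemma integral_borel_zero:
  fixes u :: "'a::euclidean_space \<Rightarrow> real"
  assumes u: "u \<in> borel_measurable borel"
    and loc: "\<And>W. W \<in> sets borel \<Longrightarrow> bounded W \<Longrightarrow> integrable lborel (\<lambda>x. u x * indicator W x)"
    and orth: "\<And>s. (\<lambda>x. complex_of_real (s x)) \<in> test_functions D \<Longrightarrow> (\<integral>x. u x * s x \<partial>lborel) = 0"
    and W: "open W" "bounded W" "W \<subseteq> D" and A: "A \<in> sets borel"
  shows "(\<integral>x. u x * indicator (A \<inter> W) x \<partial>lborel) = 0"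
proof -
  note [measurable] = u
  have Wm: "W \<in> sets borel" using W(1) by simp
  have open0: "(\<integral>x. u x * indicator V x \<partial>lborel) = 0" if "open V" "bounded V" "V \<subseteq> D" for V
    using that by (intro integral_open_zero[OF u, of D] loc orth)
  have int: "integrable lborel (\<lambda>x. u x * indicator (B \<inter> W) x)" if "B \<in> sets borel" for B
    using that Wm W(2) by (intro loc) auto
  have "Int_stable {S::'a set. open S}"
    by (auto simp: Int_stable_def)
  moreover have "{S::'a set. open S} \<subseteq> Pow UNIV"
    by simp
  moreover have "A \<in> sigma_sets UNIV {S. open S}"
    using A by (simp add: borel_def)
  ultimately show ?thesis
  proof (induction rule: sigma_sets_induct_disjoint)
    case (basic S)
    then show ?case
      using W by (intro open0) auto
  next
    case (compl S)
    then have "S \<in> sets borel" by (simp add: borel_def)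
    have "(\<integral>x. u x * indicator ((UNIV - S) \<inter> W) x \<partial>lborel)
        = (\<integral>x. u x * indicator (UNIV \<inter> W) x - u x * indicator (S \<inter> W) x \<partial>lborel)"
      by (intro Bochner_Integration.integral_cong) (auto simp: indicator_def)
    also have "\<dots> = 0"
      using open0[of W] W compl int[OF \<open>S \<in> sets borel\<close>] int[of UNIV] by (subst Bochner_Integration.integral_diff) auto
    finally show ?case .
  next
    case (union B)
    have B: "B i \<in> sets borel" for i
      using union(2) by (auto simp: borel_def)
    have "(\<integral>x. u x * indicator ((\<Union>i. B i) \<inter> W) x \<partial>lborel)
        = (LINT x:(\<Union>i. B i \<inter> W)|lborel. u x)"
      unfolding set_lebesgue_integral_def by (intro Bochner_Integration.integral_cong) (auto simp: indicator_def)
    also have "\<dots> = (\<Sum>i. (LINT x:(B i \<inter> W)|lborel. u x))"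
    proof (rule lebesgue_integral_countable_add)
      show "B i \<inter> W \<in> sets lborel" for i using B Wm by auto
      show "(B i \<inter> W) \<inter> (B j \<inter> W) = {}" if "i \<noteq> j" for i j
        using union(1) that by (auto simp: disjoint_family_on_def)
      show "set_integrable lborel (\<Union>i. B i \<inter> W) u"
      proof -
        have eq: "(\<Union>i. B i \<inter> W) = (\<Union>i. B i) \<inter> W"
          by blast
        have "integrable lborel (\<lambda>x. u x * indicator ((\<Union>i. B i) \<inter> W) x)"
          using B by (intro int) auto
        then show ?thesis
          unfolding set_integrable_def eq by (simp only: real_scaleR_def mult.commute)
      qed
    qed
    also have "\<dots> = 0"
      using union(3) by (simp only: set_lebesgue_integral_def real_scaleR_def mult.commute suminf_zero)
    finally show ?case .
  qed simp
qed

text \<open>The Borel sets where u is positive or negative separate the signs, so a vanishing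
  integral forces u = 0. Local integrability is the natural hypothesis, since an L^2 function need
  not be integrable on an unbounded set; balls exhaust D.\<close>

lemma real_fundamental_lemma:
  fixes u :: "'a::euclidean_space \<Rightarrow> real"
  assumes D: "open D" and u: "u \<in> borel_measurable borel"
    and loc: "\<And>W. W \<in> sets borel \<Longrightarrow> bounded W \<Longrightarrow> integrable lborel (\<lambda>x. u x * indicator W x)"
    and orth: "\<And>s. (\<lambda>x. complex_of_real (s x)) \<in> test_functions D \<Longrightarrow> (\<integral>x. u x * s x \<partial>lborel) = 0"
  shows "AE x in lborel. x \<in> D \<longrightarrow> u x = 0"
proof -
  note [measurable] = u
  have "AE x in lborel. x \<in> D \<inter> ball 0 (real R) \<longrightarrow> u x = 0" for R :: nat
  proof -
    define W where "W = D \<inter> ball 0 (real R)"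
    have W: "open W" "bounded W" "W \<subseteq> D"
      using D by (auto simp: W_def bounded_Int)
    have zero: "(\<integral>x. u x * indicator (A \<inter> W) x \<partial>lborel) = 0" if "A \<in> sets borel" for A
      using that by (intro integral_borel_zero[OF u, of D] loc orth W)
    have Wm: "W \<in> sets borel" using W(1) by simp
    have pm: "{x. u x > 0} \<in> sets borel" "{x. u x < 0} \<in> sets borel"
      by measurable
    have "AE x in lborel. u x * indicator ({x. u x > 0} \<inter> W) x = 0"
    proof (subst integral_nonneg_eq_0_iff_AE[symmetric])
      show "integrable lborel (\<lambda>x. u x * indicator ({x. u x > 0} \<inter> W) x)"
        using pm Wm W(2) by (intro loc) auto
      show "AE x in lborel. 0 \<le> u x * indicator ({x. u x > 0} \<inter> W) x"
        by (auto simp: indicator_def)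
    qed (rule zero[OF pm(1)])
    moreover have "AE x in lborel. - (u x * indicator ({x. u x < 0} \<inter> W) x) = 0"
    proof (subst integral_nonneg_eq_0_iff_AE[symmetric])
      show "integrable lborel (\<lambda>x. - (u x * indicator ({x. u x < 0} \<inter> W) x))"
        using pm Wm W(2) by (intro integrable_minus loc) auto
      show "AE x in lborel. 0 \<le> - (u x * indicator ({x. u x < 0} \<inter> W) x)"
        by (auto simp: indicator_def)
    qed (simp add: zero[OF pm(2)])
    ultimately show ?thesis
      unfolding W_def[symmetric]
    proof eventually_elim
      case (elim x)
      then show ?case
        by (cases "u x" "0::real" rule: linorder_cases) (auto simp: indicator_def split: if_splits)
    qed
  qed
  then have "AE x in lborel. \<forall>R::nat. x \<in> D \<inter> ball 0 (real R) \<longrightarrow> u x = 0"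
    unfolding AE_all_countable by blast
  then show ?thesis
  proof eventually_elim
    case (elim x)
    obtain R :: nat where "norm x < real R"
      using reals_Archimedean2 by blast
    then show ?case using elim by auto
  qed
qed

lemma sqint_integrable_bounded_set:
  assumes f: "sqint f" and W: "W \<in> sets borel" "bounded W"
  shows "integrable lborel (\<lambda>x. indicator W x *\<^sub>R f x)"
proof (rule Bochner_Integration.integrable_bound)
  note [measurable] = sqint_measurable[OF f] W(1)
  have "emeasure lborel W < \<infinity>"
    using emeasure_bounded_finite[OF W(2)] .
  then show "integrable lborel (\<lambda>x. indicator W x + (cmod (f x))\<^sup>2)"
    using f W(1) by (auto simp: sqint_def intro!: integrable_real_indicator)
  show "(\<lambda>x. indicator W x *\<^sub>R f x) \<in> borel_measurable lborel"
    by measurable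
  have "cmod (f x) \<le> 1 + (cmod (f x))\<^sup>2" for x
    using sum_squares_bound[of "1" "cmod (f x)"] norm_ge_zero[of "f x"] unfolding power_one mult_1_right by linarith
  then show "AE x in lborel. norm (indicator W x *\<^sub>R f x) \<le> norm (indicator W x + (cmod (f x))\<^sup>2)"
    by (auto simp: indicator_def)
qed

text \<open>Real test functions multiplied by the constants 1 and i isolate the real and the
  imaginary part of g.\<close>

theorem fundamental_lemma:
  assumes D: "open D" and g: "sqint g"
    and orth: "\<And>\<psi>. \<psi> \<in> test_functions D \<Longrightarrow> l2 g \<bullet> l2 \<psi> = 0"
  shows "AE x in lborel. x \<in> D \<longrightarrow> g x = 0"
proof -
  have "AE x in lborel. x \<in> D \<longrightarrow> g x \<bullet> c = 0" for c
  proof (rule real_fundamental_lemma[OF D])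
    note [measurable] = sqint_measurable[OF g]
    show "(\<lambda>x. g x \<bullet> c) \<in> borel_measurable borel"
      by measurable
    show "integrable lborel (\<lambda>x. g x \<bullet> c * indicator W x)" if "W \<in> sets borel" "bounded W" for W
      using integrable_inner_left[OF sqint_integrable_bounded_set[OF g that], of c] by (simp add: mult.commute)
    show "(\<integral>x. g x \<bullet> c * s x \<partial>lborel) = 0" if s: "(\<lambda>x. complex_of_real (s x)) \<in> test_functions D" for s
    proof -
      have t: "(\<lambda>x. c * complex_of_real (s x)) \<in> test_functions D"
        by (rule test_functions_cmult[OF s])
      have "l2 g \<bullet> l2 (\<lambda>x. c * complex_of_real (s x)) = (\<integral>x. g x \<bullet> c * s x \<partial>lborel)"
        unfolding l2_inner[OF g test_function_sqint[OF t]]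
        by (intro Bochner_Integration.integral_cong) (auto simp: inner_complex_def algebra_simps)
      then show ?thesis
        using orth[OF t] by simp
    qed
  qed
  from this[of 1] this[of \<i>] show ?thesis
    by eventually_elim (auto simp: inner_complex_def complex_eq_iff)
qed

text \<open>The part of h orthogonal to the closure of the test functions vanishes by the
  fundamental lemma. Density is thus available before mollification and serves below to show that
  mollifiers converge.\<close>

lemma test_functions_dense:
  assumes e: "e > 0"
  shows "\<exists>\<psi>\<in>test_functions (UNIV :: 'a::euclidean_space set). norm (h - l2 \<psi>) < e"
proof -
  define V where "V = l2 ` test_functions (UNIV :: 'a set)"
  have V: "subspace V"
    unfolding subspace_def V_def
    using test_functions_add test_functions_cmult test_functions_zero
    by (auto simp: l2_zero[symmetric] l2_add[symmetric] l2_scaleR[symmetric] test_function_sqint scaleR_conv_of_real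
        intro!: imageI)
  have "subspace (closure V)"
    by (rule subspace_closure[OF V])
  then obtain y where y: "y \<in> closure V" "\<And>w. w \<in> closure V \<Longrightarrow> (h - y) \<bullet> w = 0"
    using subspace_projection_exists[OF _ closed_closure, of V h] by blast
  have "AE x in lborel. x \<in> UNIV \<longrightarrow> l2_rep (h - y) x = 0"
  proof (rule fundamental_lemma)
    show "l2 (l2_rep (h - y)) \<bullet> l2 \<psi> = 0" if "\<psi> \<in> test_functions UNIV" for \<psi>
      using y(2)[of "l2 \<psi>"] that closure_subset[of V] by (auto simp: l2_l2_rep V_def)
  qed (auto simp: sqint_l2_rep)
  then have "l2 (l2_rep (h - y)) = l2 (\<lambda>x. 0)"
    by (intro l2_eqI sqint_l2_rep sqint_zero) auto
  then have "h \<in> closure V"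
    using y(1) by (simp add: l2_l2_rep l2_zero)
  then show ?thesis
    using e unfolding closure_approachable V_def by (auto simp: dist_norm norm_minus_commute)
qed

section \<open>Mollification\<close>

lemma lborel_reflect: "distr lborel borel (\<lambda>y. x - y) = (lborel :: 'a::euclidean_space measure)"
  using lborel_affine[of "-1" x] by (simp add: density_1)

lemma lborel_integral_reflect:
  fixes f :: "'a::euclidean_space \<Rightarrow> 'b::{banach,second_countable_topology}"
  assumes "f \<in> borel_measurable borel"
  shows "(\<integral>y. f (x - y) \<partial>lborel) = (\<integral>y. f y \<partial>lborel)"
  using integral_distr[of "\<lambda>y. x - y" lborel borel f] lborel_reflect[of x] assms by simp

lemma lborel_integrable_reflect:
  fixes f :: "'a::euclidean_space \<Rightarrow> 'b::{banach,second_countable_topology}"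
  assumes "integrable lborel f"
  shows "integrable lborel (\<lambda>y. f (x - y))"
  using integrable_distr[of "\<lambda>y. x - y" lborel borel f] lborel_reflect[of x] assms by simp

text \<open>The shift sits in the argument of \<open>\<rho>\<close>, so that derivatives fall on
  \<open>\<rho>\<close> while v is merely integrable.\<close>

definition conv :: "('a::euclidean_space \<Rightarrow> complex) \<Rightarrow> ('a \<Rightarrow> complex) \<Rightarrow> 'a \<Rightarrow> complex" where
  "conv v \<rho> x = (\<integral>y. \<rho> (x - y) * v y \<partial>lborel)"

lemma conv_integrable:
  assumes "integrable lborel v" "\<rho> \<in> test_functions UNIV"
  shows "integrable lborel (\<lambda>y. \<rho> (x - y) * v y)"
proof -
  have c: "compactly_Ck 0 \<rho>"
    using assms(2) by (rule test_function_compactly_Ck)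
  note [measurable] = compactly_Ck_measurable[OF c] borel_measurable_integrable[OF assms(1)]
  obtain B where B: "B \<ge> 0" "\<And>x. cmod (\<rho> x) \<le> B"
    using compactly_Ck_bounded[OF c] by blast
  show ?thesis
  proof (rule Bochner_Integration.integrable_bound[of _ "\<lambda>y. B * cmod (v y)"])
    show "integrable lborel (\<lambda>y. B * cmod (v y))"
      using assms(1) by simp
    show "AE y in lborel. norm (\<rho> (x - y) * v y) \<le> norm (B * cmod (v y))"
      using B by (auto simp: norm_mult abs_mult intro!: mult_right_mono)
  qed measurable
qed

lemma partial_deriv_test_function:
  assumes "\<rho> \<in> test_functions D" "b \<in> Basis" shows "partial_deriv b \<rho> \<in> test_functions D"
  using assms(1)
proof (elim test_functionsE)
  fix K assume "smooth_on UNIV \<rho>" "compact K" "K \<subseteq> D" "\<And>x. x \<notin> K \<Longrightarrow> \<rho> x = 0"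
  then show ?thesis
    using assms(2) by (intro test_functionsI[of _ K] smooth_on_partial_deriv partial_deriv_zero_outside[of K])
      (auto intro: compact_imp_closed)
qed

text \<open>The mean value inequality is applied to rho minus its linearisation at z, on the ball of
  radius |k| about z, where the gradient of that difference is at most a Lipschitz constant times
  |k|.\<close>

lemma test_function_taylor:
  assumes \<rho>: "\<rho> \<in> test_functions UNIV"
  obtains C where "C \<ge> 0"
    "\<And>z k. cmod (\<rho> (z + k) - \<rho> z - (\<Sum>b\<in>Basis. (k \<bullet> b) *\<^sub>R partial_deriv b \<rho> z)) \<le> C * (norm k)\<^sup>2"
proof -
  have "\<exists>L\<ge>0. \<forall>x y. cmod (partial_deriv b \<rho> x - partial_deriv b \<rho> y) \<le> L * norm (x - y)" if "b \<in> Basis" for b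
    by (rule compactly_C1_lipschitz[OF test_function_compactly_Ck[OF partial_deriv_test_function[OF \<rho> that]]]) blast
  then obtain L where L: "\<And>b. b \<in> Basis \<Longrightarrow> L b \<ge> 0"
    "\<And>b x y. b \<in> Basis \<Longrightarrow> cmod (partial_deriv b \<rho> x - partial_deriv b \<rho> y) \<le> L b * norm (x - y)"
    by metis
  define C where "C = (\<Sum>b\<in>Basis. L b)"
  have C: "C \<ge> 0"
    unfolding C_def by (intro sum_nonneg L)
  have "cmod (\<rho> (z + k) - \<rho> z - (\<Sum>b\<in>Basis. (k \<bullet> b) *\<^sub>R partial_deriv b \<rho> z)) \<le> C * (norm k)\<^sup>2" for z k
  proof -
    define G where "G t = \<rho> t - (\<Sum>b\<in>Basis. (t \<bullet> b) *\<^sub>R partial_deriv b \<rho> z)" for t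
    have D: "(G has_derivative (\<lambda>h. \<Sum>b\<in>Basis. (h \<bullet> b) *\<^sub>R (partial_deriv b \<rho> t - partial_deriv b \<rho> z))) (at t within cball z (norm k))" for t
    proof -
      have "smooth_on UNIV \<rho>"
        using \<rho> by (elim test_functionsE)
      then have "(\<rho> has_derivative (\<lambda>h. \<Sum>b\<in>Basis. (h \<bullet> b) *\<^sub>R partial_deriv b \<rho> t)) (at t)"
        by (intro has_derivative_partial_deriv smooth_on_differentiable)
      moreover have "((\<lambda>t. \<Sum>b\<in>Basis. (t \<bullet> b) *\<^sub>R partial_deriv b \<rho> z) has_derivative (\<lambda>h. \<Sum>b\<in>Basis. (h \<bullet> b) *\<^sub>R partial_deriv b \<rho> z)) (at t)"
        by (auto intro!: derivative_eq_intros)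
      ultimately have "(G has_derivative (\<lambda>h. (\<Sum>b\<in>Basis. (h \<bullet> b) *\<^sub>R partial_deriv b \<rho> t) - (\<Sum>b\<in>Basis. (h \<bullet> b) *\<^sub>R partial_deriv b \<rho> z))) (at t)"
        unfolding G_def by (rule has_derivative_diff)
      then show ?thesis
        by (simp add: sum_subtractf scaleR_diff_right has_derivative_at_withinI)
    qed
    have on: "onorm (\<lambda>h. \<Sum>b\<in>Basis. (h \<bullet> b) *\<^sub>R (partial_deriv b \<rho> t - partial_deriv b \<rho> z)) \<le> C * norm k"
      if "t \<in> cball z (norm k)" for t
    proof (rule onorm_bound)
      show "0 \<le> C * norm k" using C by simp
      fix h :: 'a
      have "norm (\<Sum>b\<in>Basis. (h \<bullet> b) *\<^sub>R (partial_deriv b \<rho> t - partial_deriv b \<rho> z)) \<le> (\<Sum>b\<in>Basis. norm h * (L b * norm k))"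
      proof (rule sum_norm_le)
        fix b :: 'a assume b: "b \<in> Basis"
        have "cmod (partial_deriv b \<rho> t - partial_deriv b \<rho> z) \<le> L b * norm (t - z)"
          by (rule L(2)[OF b])
        also have "\<dots> \<le> L b * norm k"
          using that L(1)[OF b] by (intro mult_left_mono) (auto simp: dist_norm norm_minus_commute)
        finally show "norm ((h \<bullet> b) *\<^sub>R (partial_deriv b \<rho> t - partial_deriv b \<rho> z)) \<le> norm h * (L b * norm k)"
          unfolding norm_scaleR using Basis_le_norm[OF b, of h] by (intro mult_mono) auto
      qed
      then show "norm (\<Sum>b\<in>Basis. (h \<bullet> b) *\<^sub>R (partial_deriv b \<rho> t - partial_deriv b \<rho> z)) \<le> C * norm k * norm h"
        by (simp add: C_def sum_distrib_left[symmetric] sum_distrib_right[symmetric] mult_ac)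
    qed
    have "norm (G (z + k) - G z) \<le> C * norm k * norm ((z + k) - z)"
      by (rule differentiable_bound[OF convex_cball D on]) (auto simp: dist_norm)
    moreover have "G (z + k) - G z = \<rho> (z + k) - \<rho> z - (\<Sum>b\<in>Basis. (k \<bullet> b) *\<^sub>R partial_deriv b \<rho> z)"
      by (simp add: G_def inner_add_left scaleR_add_left sum.distrib)
    ultimately show ?thesis
      by (simp add: power2_eq_square mult.assoc)
  qed
  then show thesis
    using that C by blast
qed

text \<open>Integrating the quadratic Taylor bound against v leaves a remainder of at most C I
  |h|^2, with I the L^1 norm of v. This is differentiability directly, with no limit taken under the
  integral.\<close>

lemma conv_has_derivative:
  assumes v: "integrable lborel v" and \<rho>: "\<rho> \<in> test_functions UNIV"
  shows "(conv v \<rho> has_derivative (\<lambda>h. \<Sum>b\<in>Basis. (h \<bullet> b) *\<^sub>R conv v (partial_deriv b \<rho>) x)) (at x)"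
proof -
  obtain C where C: "C \<ge> 0"
    "\<And>z k. cmod (\<rho> (z + k) - \<rho> z - (\<Sum>b\<in>Basis. (k \<bullet> b) *\<^sub>R partial_deriv b \<rho> z)) \<le> C * (norm k)\<^sup>2"
    by (rule test_function_taylor[OF \<rho>]) blast
  define I where "I = (\<integral>y. cmod (v y) \<partial>lborel)"
  have I: "I \<ge> 0"
    by (simp add: I_def)
  let ?D = "\<lambda>h. \<Sum>b\<in>Basis. (h \<bullet> b) *\<^sub>R conv v (partial_deriv b \<rho>) x"
  have i1: "integrable lborel (\<lambda>y. \<rho> (x - y) * v y)" for x
    by (rule conv_integrable[OF v \<rho>])
  have i2: "integrable lborel (\<lambda>y. partial_deriv b \<rho> (x - y) * v y)" if "b \<in> Basis" for b x
    by (rule conv_integrable[OF v partial_deriv_test_function[OF \<rho> that]])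
  have le: "cmod (conv v \<rho> (x + h) - conv v \<rho> x - ?D h) \<le> C * I * (norm h)\<^sup>2" for h
  proof -
    let ?r = "\<lambda>y. \<rho> (x - y + h) - \<rho> (x - y) - (\<Sum>b\<in>Basis. (h \<bullet> b) *\<^sub>R partial_deriv b \<rho> (x - y))"
    have eq: "?r y * v y = \<rho> (x + h - y) * v y - \<rho> (x - y) * v y - (\<Sum>b\<in>Basis. (h \<bullet> b) *\<^sub>R (partial_deriv b \<rho> (x - y) * v y))" for y
      by (simp add: algebra_simps sum_distrib_left)
    have "conv v \<rho> (x + h) - conv v \<rho> x - ?D h = (\<integral>y. ?r y * v y \<partial>lborel)"
      unfolding eq conv_def using i1 i2
      by (simp add: Bochner_Integration.integral_sum)
    also have "cmod \<dots> \<le> (\<integral>y. C * (norm h)\<^sup>2 * cmod (v y) \<partial>lborel)"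
    proof (rule order_trans[OF integral_norm_bound integral_mono])
      show "integrable lborel (\<lambda>y. norm (?r y * v y))"
        unfolding eq using i1 i2 by (intro integrable_norm Bochner_Integration.integrable_diff Bochner_Integration.integrable_sum integrable_scaleR_right) auto
      show "integrable lborel (\<lambda>y. C * (norm h)\<^sup>2 * cmod (v y))"
        using v by simp
      show "norm (?r y * v y) \<le> C * (norm h)\<^sup>2 * cmod (v y)" for y
        unfolding norm_mult by (intro mult_right_mono C) auto
    qed
    also have "\<dots> = C * I * (norm h)\<^sup>2"
      by (simp add: I_def)
    finally show ?thesis .
  qed
  have lim: "((\<lambda>h. norm (conv v \<rho> (x + h) - conv v \<rho> x - ?D h) / norm h) \<longlongrightarrow> 0) (at 0)"
  proof (rule Lim_null_comparison)
    show "\<forall>\<^sub>F h in at 0. norm (norm (conv v \<rho> (x + h) - conv v \<rho> x - ?D h) / norm h) \<le> C * I * norm h"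
      unfolding eventually_at_filter
      using le by (auto simp: divide_le_eq power2_eq_square mult.assoc intro!: always_eventually)
    show "((\<lambda>h. C * I * norm h) \<longlongrightarrow> 0) (at 0)"
      by (intro tendsto_eq_intros) auto
  qed
  have "bounded_linear ?D"
    by (intro bounded_linear_sum bounded_linear_scaleR_const bounded_linear_inner_left)
  then show ?thesis
    using lim by (simp add: has_derivative_at)
qed

lemma partial_deriv_conv:
  assumes "integrable lborel v" "\<rho> \<in> test_functions UNIV" "b \<in> Basis"
  shows "partial_deriv b (conv v \<rho>) = conv v (partial_deriv b \<rho>)"
proof
  fix x
  have "(\<Sum>c\<in>Basis. (b \<bullet> c) *\<^sub>R conv v (partial_deriv c \<rho>) x) = conv v (partial_deriv b \<rho>) x"
    using assms(3) by (simp add: inner_Basis if_distrib[of "\<lambda>t. t *\<^sub>R _"] cong: if_cong)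
  then show "partial_deriv b (conv v \<rho>) x = conv v (partial_deriv b \<rho>) x"
    using partial_deriv_at[OF conv_has_derivative[OF assms(1,2), of x], of b] by simp
qed

lemma smooth_on_conv:
  assumes v: "integrable lborel v" and \<rho>: "\<rho> \<in> test_functions UNIV"
  shows "smooth_on UNIV (conv v \<rho>)"
proof -
  have "Ck_on k UNIV (conv v \<rho>)" for k
    using \<rho>
  proof (induction k arbitrary: \<rho>)
    case 0
    show ?case
      unfolding Ck_on_0 using conv_has_derivative[OF v 0] has_derivative_continuous by blast
  next
    case (Suc k)
    show ?case
      unfolding Ck_on_Suc
    proof (intro conjI allI ballI)
      show "conv v \<rho> differentiable (at x)" for x
        using conv_has_derivative[OF v Suc.prems] unfolding differentiable_def by blast
      show "Ck_on k UNIV (partial_deriv b (conv v \<rho>))" if "b \<in> Basis" for b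
        unfolding partial_deriv_conv[OF v Suc.prems that]
        by (rule Suc.IH[OF partial_deriv_test_function[OF Suc.prems that]])
    qed
  qed
  then show ?thesis
    by (simp add: smooth_on_def)
qed

lemma laplacian_conv:
  assumes v: "integrable lborel v" and \<rho>: "\<rho> \<in> test_functions UNIV"
  shows "laplacian (conv v \<rho>) x = (\<integral>y. laplacian \<rho> (x - y) * v y \<partial>lborel)"
proof -
  have "partial_deriv b (partial_deriv b (conv v \<rho>)) x = (\<integral>y. partial_deriv b (partial_deriv b \<rho>) (x - y) * v y \<partial>lborel)"
    if "b \<in> Basis" for b
    using partial_deriv_conv[OF v partial_deriv_test_function[OF \<rho> that] that] partial_deriv_conv[OF v \<rho> that]
    by (simp add: conv_def)
  then have "laplacian (conv v \<rho>) x = (\<Sum>b\<in>Basis. \<integral>y. partial_deriv b (partial_deriv b \<rho>) (x - y) * v y \<partial>lborel)"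
    by (simp add: laplacian_def)
  also have "\<dots> = (\<integral>y. (\<Sum>b\<in>Basis. partial_deriv b (partial_deriv b \<rho>) (x - y) * v y) \<partial>lborel)"
    using conv_integrable[OF v partial_deriv_test_function[OF partial_deriv_test_function[OF \<rho>]]]
    by (intro Bochner_Integration.integral_sum[symmetric]) auto
  finally show ?thesis
    by (simp add: laplacian_def sum_distrib_right)
qed

section \<open>Mollifiers and their convergence\<close>

definition mollifier :: "real \<Rightarrow> ('a::euclidean_space \<Rightarrow> real) \<Rightarrow> bool" where
  "mollifier e r \<longleftrightarrow> (\<lambda>x. complex_of_real (r x)) \<in> test_functions UNIV \<and> (\<forall>x. 0 \<le> r x) \<and>
     (\<forall>x. norm x > e \<longrightarrow> r x = 0) \<and> (\<integral>x. r x \<partial>lborel) = 1"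

lemma mollifier_exists:
  assumes e: "e > 0"
  shows "\<exists>r :: 'a::euclidean_space \<Rightarrow> real. mollifier e r"
proof -
  have zero: "bump 0 e x = 0" if "norm x > e" for x :: 'a
    using bump_pos_iff[OF e, of 0 x] bump_nonneg[of 0 e x] that by auto
  have t: "(\<lambda>x::'a. complex_of_real (bump 0 e x)) \<in> test_functions UNIV"
    by (rule test_functionsI[OF smooth_on_bump compact_cball[of 0 e]]) (use zero in auto)
  have "integrable lborel (\<lambda>x::'a. complex_of_real (bump 0 e x))"
    using t by (intro compactly_Ck_integrable test_function_compactly_Ck)
  then have i: "integrable lborel (\<lambda>x::'a. bump 0 e x)"
    using integrable_Re by fastforce
  define I where "I = (\<integral>x. bump (0::'a) e x \<partial>lborel)"
  have "I \<noteq> 0"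
  proof
    assume "I = 0"
    then have "AE x::'a in lborel. bump 0 e x = 0"
      unfolding I_def using integral_nonneg_eq_0_iff_AE[OF i] bump_nonneg by auto
    then have "AE x::'a in lborel. x \<notin> ball 0 e"
    proof eventually_elim
      case (elim x)
      then show ?case
        using bump_pos_iff[OF e, of "0::'a" x] by simp
    qed
    then have "ball (0::'a) e \<in> null_sets lborel"
      by (subst AE_iff_null_sets) auto
    then show False
      using e open_not_negligible[of "ball (0::'a) e"] by (auto simp: negligible_iff_null_sets null_sets_completionI)
  qed
  moreover have "I \<ge> 0"
    unfolding I_def by (intro integral_nonneg_AE) (auto simp: bump_nonneg)
  ultimately have I: "I > 0" by simp
  have "mollifier e (\<lambda>x::'a. bump 0 e x / I)"
    unfolding mollifier_def
  proof (intro conjI allI impI)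
    show "(\<lambda>x::'a. complex_of_real (bump 0 e x / I)) \<in> test_functions UNIV"
      using test_functions_cmult[OF t, of "complex_of_real (1 / I)"] by simp
    show "(\<integral>x. bump (0::'a) e x / I \<partial>lborel) = 1"
      using I by (simp add: I_def[symmetric])
      show "0 \<le> bump 0 e x / I" for x :: 'a
      using bump_nonneg I by (intro divide_nonneg_pos)
  qed (use zero in auto)
  then show ?thesis by blast
qed

lemma mollifier_integrable:
  assumes "mollifier e r" shows "integrable lborel r"
proof -
  have "integrable lborel (\<lambda>x. complex_of_real (r x))"
    using assms unfolding mollifier_def by (intro compactly_Ck_integrable test_function_compactly_Ck) auto
  then show ?thesis
    using integrable_Re by fastforce
qed

text \<open>The difference between f and its mollification is the average of f - f(. - z) with
  respect to the probability density r. Cauchy-Schwarz in z and Tonelli bound its norm by the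
  largest translation difference over the support of r.\<close>

lemma sqint_conv_diff:
  assumes f: "sqint f" "integrable lborel f" and r: "mollifier e r"
    and B: "B \<ge> 0" "\<And>z. norm z \<le> e \<Longrightarrow> norm (l2 f - l2 (\<lambda>x. f (x - z))) \<le> B"
  shows "sqint (conv f (\<lambda>x. complex_of_real (r x)))"
    "norm (l2 f - l2 (conv f (\<lambda>x. complex_of_real (r x)))) \<le> B"
proof -
  let ?\<rho> = "\<lambda>x. complex_of_real (r x)"
  have t: "?\<rho> \<in> test_functions UNIV" and r0: "\<And>x. r x \<ge> 0" and rI: "(\<integral>x. r x \<partial>lborel) = 1"
    and rs: "\<And>x. norm x > e \<Longrightarrow> r x = 0"
    using r by (auto simp: mollifier_def)
  note [measurable] = sqint_measurable[OF f(1)]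
  have ir: "integrable lborel r"
    by (rule mollifier_integrable[OF r])
  note [measurable] = borel_measurable_integrable[OF ir, simplified]
  have rI': "(\<integral>\<^sup>+x. ennreal (r x) \<partial>lborel) = 1"
    using nn_integral_eq_integral[OF ir] r0 rI by simp
  have cm [measurable]: "conv f ?\<rho> \<in> borel_measurable borel"
    using smooth_on_continuous[OF smooth_on_conv[OF f(2) t]] by (rule borel_measurable_continuous_onI)
  have pt: "ennreal ((cmod (f x - conv f ?\<rho> x))\<^sup>2) \<le> (\<integral>\<^sup>+z. ennreal (r z * (cmod (f x - f (x - z)))\<^sup>2) \<partial>lborel)" for x
  proof -
    have i1: "integrable lborel (\<lambda>z. ?\<rho> z * f (x - z))"
      using lborel_integrable_reflect[OF conv_integrable[OF f(2) t, of x], of x] by simp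
    have "conv f ?\<rho> x = (\<integral>z. ?\<rho> z * f (x - z) \<partial>lborel)"
      unfolding conv_def using lborel_integral_reflect[of "\<lambda>z. ?\<rho> z * f (x - z)" x] by simp
    moreover have "f x = (\<integral>z. ?\<rho> z * f x \<partial>lborel)"
      using rI by simp
    ultimately have eq: "f x - conv f ?\<rho> x = (\<integral>z. ?\<rho> z * f x - ?\<rho> z * f (x - z) \<partial>lborel)"
      using i1 ir by (subst Bochner_Integration.integral_diff) auto
    have id: "integrable lborel (\<lambda>z. ?\<rho> z * f x - ?\<rho> z * f (x - z))"
      using i1 ir by (intro Bochner_Integration.integrable_diff) auto
    have "ennreal (cmod (f x - conv f ?\<rho> x)) \<le> (\<integral>\<^sup>+z. ennreal (cmod (?\<rho> z * f x - ?\<rho> z * f (x - z))) \<partial>lborel)"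
      unfolding eq by (rule integral_norm_bound_ennreal[OF id])
    \<comment> \<open>Splitting r into two square roots makes the first Cauchy-Schwarz factor the
      total mass of r, which is 1.\<close>
    also have "\<dots> = (\<integral>\<^sup>+z. ennreal (sqrt (r z)) * ennreal (sqrt (r z) * cmod (f x - f (x - z))) \<partial>lborel)"
    proof (rule nn_integral_cong)
      fix z
      have "cmod (?\<rho> z * f x - ?\<rho> z * f (x - z)) = r z * cmod (f x - f (x - z))"
        using r0[of z] by (simp add: right_diff_distrib[symmetric] norm_mult)
      also have "\<dots> = sqrt (r z) * (sqrt (r z) * cmod (f x - f (x - z)))"
        using r0[of z] by (simp add: mult.assoc[symmetric])
      finally show "ennreal (cmod (?\<rho> z * f x - ?\<rho> z * f (x - z))) = ennreal (sqrt (r z)) * ennreal (sqrt (r z) * cmod (f x - f (x - z)))"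
        using r0[of z] by (simp add: ennreal_mult'[symmetric])
    qed
    finally have "(ennreal (cmod (f x - conv f ?\<rho> x)))\<^sup>2 \<le>
        (\<integral>\<^sup>+z. ennreal (sqrt (r z)) * ennreal (sqrt (r z) * cmod (f x - f (x - z))) \<partial>lborel)\<^sup>2"
      by (rule power_mono) simp
    also have "\<dots> \<le> (\<integral>\<^sup>+z. (ennreal (sqrt (r z)))\<^sup>2 \<partial>lborel) * (\<integral>\<^sup>+z. (ennreal (sqrt (r z) * cmod (f x - f (x - z))))\<^sup>2 \<partial>lborel)"
      by (rule Cauchy_Schwarz_nn_integral) measurable
    also have "(\<integral>\<^sup>+z. (ennreal (sqrt (r z)))\<^sup>2 \<partial>lborel) = 1"
      using rI' r0 by (simp add: ennreal_power)
    also have "(\<integral>\<^sup>+z. (ennreal (sqrt (r z) * cmod (f x - f (x - z))))\<^sup>2 \<partial>lborel)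
        = (\<integral>\<^sup>+z. ennreal (r z * (cmod (f x - f (x - z)))\<^sup>2) \<partial>lborel)"
      using r0 by (simp add: ennreal_power power_mult_distrib)
    finally show ?thesis
      by (simp add: ennreal_power)
  qed
  have "(\<integral>\<^sup>+x. ennreal ((cmod (f x - conv f ?\<rho> x))\<^sup>2) \<partial>lborel)
      \<le> (\<integral>\<^sup>+x. \<integral>\<^sup>+z. ennreal (r z * (cmod (f x - f (x - z)))\<^sup>2) \<partial>lborel \<partial>lborel)"
    by (intro nn_integral_mono pt)
  also have "\<dots> = (\<integral>\<^sup>+z. \<integral>\<^sup>+x. ennreal (r z * (cmod (f x - f (x - z)))\<^sup>2) \<partial>lborel \<partial>lborel)"
    by (rule lborel_pair.Fubini'[symmetric]) measurable
  also have "\<dots> \<le> (\<integral>\<^sup>+z. ennreal (r z) * ennreal (B\<^sup>2) \<partial>lborel)"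
  proof (rule nn_integral_mono)
    fix z
    have s: "sqint (\<lambda>x. f (x - z))"
      using sqint_shift(1)[OF f(1), of "- z"] by simp
    have "(\<integral>\<^sup>+x. ennreal (r z * (cmod (f x - f (x - z)))\<^sup>2) \<partial>lborel)
        = ennreal (r z) * (\<integral>\<^sup>+x. ennreal ((cmod (f x - f (x - z)))\<^sup>2) \<partial>lborel)"
      using r0[of z] by (simp add: ennreal_mult' nn_integral_cmult)
    also have "\<dots> = ennreal (r z) * ennreal ((norm (l2 f - l2 (\<lambda>x. f (x - z))))\<^sup>2)"
      using l2_nn_integral[OF sqint_diff[OF f(1) s]] by (simp add: l2_diff f(1) s)
    also have "\<dots> \<le> ennreal (r z) * ennreal (B\<^sup>2)"
    proof (cases "norm z \<le> e")
      case True
      then show ?thesis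
        using B(2)[OF True] by (intro mult_left_mono ennreal_leI power_mono) auto
    next
      case False
      then show ?thesis using rs[of z] by simp
    qed
    finally show "(\<integral>\<^sup>+x. ennreal (r z * (cmod (f x - f (x - z)))\<^sup>2) \<partial>lborel) \<le> ennreal (r z) * ennreal (B\<^sup>2)" .
  qed
  also have "\<dots> = ennreal (B\<^sup>2)"
    by (simp add: nn_integral_multc rI')
  finally have *: "sqint (\<lambda>x. f x - conv f ?\<rho> x)" "norm (l2 (\<lambda>x. f x - conv f ?\<rho> x)) \<le> B"
    using B(1) by (auto intro!: sqint_of_nn_integral_le)
  show s: "sqint (conv f ?\<rho>)"
    using sqint_diff[OF f(1) *(1)] by simp
  show "norm (l2 f - l2 (conv f ?\<rho>)) \<le> B"
    using *(2) by (simp add: l2_diff f(1) s)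
qed

text \<open>f inherits continuity under small shifts from a nearby test function: e/4 for replacing
  f, e/2 for shifting the test function by at most d, and e/4 for going back.\<close>

lemma mollifier_approximation:
  fixes f :: "'a::euclidean_space \<Rightarrow> complex"
  assumes f: "sqint f" "integrable lborel f" and e: "e > 0"
  obtains d where "d > 0" "\<And>r t. mollifier t r \<Longrightarrow> t \<le> d \<Longrightarrow> sqint (conv f (\<lambda>x. complex_of_real (r x))) \<and>
      norm (l2 f - l2 (conv f (\<lambda>x. complex_of_real (r x)))) \<le> e"
proof -
  obtain \<psi> where \<psi>: "\<psi> \<in> test_functions UNIV" "norm (l2 f - l2 \<psi>) < e / 4"
    using test_functions_dense[of "e / 4" "l2 f"] e by auto
  have s\<psi>: "sqint \<psi>"
    using \<psi>(1) by (rule test_function_sqint)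
  define d where "d = e / (2 * (grad_norm \<psi> + 1))"
  have g: "grad_norm \<psi> + 1 > 0"
    using grad_norm_nonneg[of \<psi>] by linarith
  have d: "d > 0"
    using e g by (simp add: d_def)
  have B: "norm (l2 f - l2 (\<lambda>x. f (x - z))) \<le> e" if "norm z \<le> d" for z
  proof -
    have sh: "sqint (\<lambda>x. f (x - z))" "sqint (\<lambda>x. \<psi> (x - z))"
      using sqint_shift(1)[of _ "- z"] f(1) s\<psi> by auto
    have 1: "norm (l2 (\<lambda>x. \<psi> (x - z)) - l2 (\<lambda>x. f (x - z))) = norm (l2 \<psi> - l2 f)"
      using sqint_shift(2)[OF sqint_diff[OF s\<psi> f(1)], of "- z"] by (simp add: l2_diff sh s\<psi> f(1))
    have "norm (l2 (\<lambda>x. \<psi> (x - z)) - l2 \<psi>) \<le> norm z * grad_norm \<psi>"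
      using shift_norm_le[OF test_function_compactly_Ck[OF \<psi>(1)], of "- z"] by simp
    also have "\<dots> \<le> d * grad_norm \<psi>"
      using that by (intro mult_right_mono grad_norm_nonneg)
    also have "\<dots> \<le> e / 2"
      using e g grad_norm_nonneg[of \<psi>] by (simp add: d_def field_simps)
    finally have 2: "norm (l2 \<psi> - l2 (\<lambda>x. \<psi> (x - z))) \<le> e / 2"
      by (simp add: norm_minus_commute)
    have "l2 f - l2 (\<lambda>x. f (x - z)) = (l2 f - l2 \<psi>) + (l2 \<psi> - l2 (\<lambda>x. \<psi> (x - z))) + (l2 (\<lambda>x. \<psi> (x - z)) - l2 (\<lambda>x. f (x - z)))"
      by simp
    then have "norm (l2 f - l2 (\<lambda>x. f (x - z))) \<le> norm (l2 f - l2 \<psi>) + norm (l2 \<psi> - l2 (\<lambda>x. \<psi> (x - z)))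
        + norm (l2 (\<lambda>x. \<psi> (x - z)) - l2 (\<lambda>x. f (x - z)))"
      by (metis norm_triangle_ineq norm_triangle_mono order_refl)
    then show ?thesis
      using 1 2 \<psi>(2) by (simp add: norm_minus_commute)
  qed
  show thesis
  proof (rule that[OF d])
    fix r :: "'a \<Rightarrow> real" and t assume "mollifier t r" "t \<le> d"
    then show "sqint (conv f (\<lambda>x. complex_of_real (r x))) \<and> norm (l2 f - l2 (conv f (\<lambda>x. complex_of_real (r x)))) \<le> e"
      using sqint_conv_diff[OF f, of t r e] B e by auto
  qed
qed

section \<open>Energy identities and compactness\<close>

lemma l2_norm_mono:
  assumes "sqint f" "sqint g" "\<And>x. cmod (f x) \<le> C * cmod (g x)" "C \<ge> 0"
  shows "norm (l2 f) \<le> C * norm (l2 g)"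
proof -
  note [measurable] = assms(1,2)[THEN sqint_measurable]
  have "(\<integral>\<^sup>+x. ennreal ((cmod (f x))\<^sup>2) \<partial>lborel) \<le> (\<integral>\<^sup>+x. ennreal (C\<^sup>2) * ennreal ((cmod (g x))\<^sup>2) \<partial>lborel)"
  proof (rule nn_integral_mono)
    fix x
    have "(cmod (f x))\<^sup>2 \<le> (C * cmod (g x))\<^sup>2"
      by (intro power_mono assms(3)) auto
    then show "ennreal ((cmod (f x))\<^sup>2) \<le> ennreal (C\<^sup>2) * ennreal ((cmod (g x))\<^sup>2)"
      by (simp add: power_mult_distrib ennreal_mult'[symmetric] ennreal_leI)
  qed
  also have "\<dots> = ennreal ((C * norm (l2 g))\<^sup>2)"
    by (simp add: nn_integral_cmult l2_nn_integral[OF assms(2)] power_mult_distrib ennreal_mult')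
  finally show ?thesis
    using assms(4) by (intro sqint_of_nn_integral_le(2)) auto
qed

lemma sqint_indicator:
  fixes Q :: "'a::euclidean_space set"
  assumes "bounded Q" "Q \<in> sets borel"
  shows "sqint (indicator Q :: 'a \<Rightarrow> complex)"
proof -
  have "(\<lambda>x. (cmod (indicator Q x))\<^sup>2) = (indicator Q :: 'a \<Rightarrow> real)"
    by (auto simp: indicator_def)
  then show ?thesis
    unfolding sqint_def using assms emeasure_bounded_finite[OF assms(1)]
    by (auto intro!: integrable_real_indicator)
qed

text \<open>A real function equals its conjugate, hence so does its derivative.\<close>

lemma partial_deriv_of_real:
  assumes "(\<lambda>x. complex_of_real (s x)) differentiable (at x)"
  shows "partial_deriv b (\<lambda>x. complex_of_real (s x)) x = complex_of_real (Re (partial_deriv b (\<lambda>x. complex_of_real (s x)) x))"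
  using partial_deriv_cnj[OF assms, of b] by (simp add: complex_eq_iff)

text \<open>Pointwise, |d(s w)|^2 equals |(ds) w|^2 plus the real part of d(s^2 cnj(w) dw) minus the
  real part of s^2 cnj(w) ddw. Summed over the coordinates and integrated, the exact derivatives
  vanish and the equation for w turns the last term into the mass term. Since s multiplies it, the
  equation is only required where s is nonzero.\<close>

lemma energy_identity:
  fixes w :: "'a::euclidean_space \<Rightarrow> complex"
  assumes w: "smooth_on UNIV w"
    and Z: "(\<lambda>x. complex_of_real (s x)) \<in> test_functions UNIV"
    and eq: "\<And>x. s x \<noteq> 0 \<Longrightarrow> laplacian w x = complex_of_real l * w x"
  shows "(\<Sum>b\<in>Basis. (norm (l2 (partial_deriv b (\<lambda>x. complex_of_real (s x) * w x))))\<^sup>2)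
      + l * (norm (l2 (\<lambda>x. complex_of_real (s x) * w x)))\<^sup>2
    = (\<Sum>b\<in>Basis. (norm (l2 (\<lambda>x. partial_deriv b (\<lambda>x. complex_of_real (s x)) x * w x)))\<^sup>2)"
proof -
  let ?Z = "\<lambda>x. complex_of_real (s x)"
  have Zs: "smooth_on UNIV ?Z"
    using Z by (elim test_functionsE)
  have Zw: "(\<lambda>x. ?Z x * w x) \<in> test_functions UNIV"
    by (rule test_functions_mult[OF Z w])
  \<comment> \<open>\<open>\<Phi>\<close> is the flux whose derivative integrates to zero and
    \<open>\<Psi>\<close> is the second-order part; both begin with the cutoff, which makes them
    test functions although w has no compact support.\<close>
  define \<Phi> where "\<Phi> b x = ?Z x * (?Z x * (cnj (w x) * partial_deriv b w x))" for b x
  define \<Psi> where "\<Psi> b x = ?Z x * (?Z x * (cnj (w x) * partial_deriv b (partial_deriv b w) x))" for b x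
  note sm = smooth_on_mult smooth_on_cnj smooth_on_partial_deriv Zs w
  have \<Phi>: "\<Phi> b \<in> test_functions UNIV" and \<Psi>: "\<Psi> b \<in> test_functions UNIV" if "b \<in> Basis" for b
    unfolding \<Phi>_def[abs_def] \<Psi>_def[abs_def] by (intro test_functions_mult[OF Z] sm that)+
  have sp: "sqint (partial_deriv b (\<lambda>x. ?Z x * w x))" if "b \<in> Basis" for b
    by (rule test_function_sqint[OF partial_deriv_test_function[OF Zw that]])
  have sq: "sqint (\<lambda>x. partial_deriv b ?Z x * w x)" if "b \<in> Basis" for b
    by (rule test_function_sqint[OF test_functions_mult[OF partial_deriv_test_function[OF Z that] w]])
  have pt: "(cmod (partial_deriv b (\<lambda>x. ?Z x * w x) x))\<^sup>2
      = (cmod (partial_deriv b ?Z x * w x))\<^sup>2 + Re (partial_deriv b (\<Phi> b) x) - Re (\<Psi> b x)" if b: "b \<in> Basis" for b x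
  proof -
    define z p where "z = s x" and "p = Re (partial_deriv b ?Z x)"
    have P: "partial_deriv b ?Z x = complex_of_real p"
      unfolding p_def by (rule partial_deriv_of_real[OF smooth_on_differentiable[OF Zs]])
    note d = smooth_on_differentiable[of _ x]
    have 1: "partial_deriv b (\<lambda>x. ?Z x * w x) x = complex_of_real z * partial_deriv b w x + complex_of_real p * w x"
      by (subst partial_deriv_mult) (auto intro!: d sm b simp: P z_def)
    have 2: "partial_deriv b (\<Phi> b) x = z * (z * (cnj (w x) * partial_deriv b (partial_deriv b w) x
        + cnj (partial_deriv b w x) * partial_deriv b w x)
        + p * (cnj (w x) * partial_deriv b w x)) + p * (z * (cnj (w x) * partial_deriv b w x))"
      unfolding \<Phi>_def[abs_def]
      apply (subst partial_deriv_mult, rule d[OF Zs], intro d sm b)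
      apply (subst partial_deriv_mult, rule d[OF Zs], intro d sm b)
      apply (subst partial_deriv_mult, intro d sm b, intro d sm b)
      apply (subst partial_deriv_cnj, intro d sm)
      apply (simp add: P z_def)
      done
    show ?thesis
      unfolding 1 2 P \<Psi>_def z_def[symmetric] cmod_power2
      by (simp add: power2_eq_square algebra_simps)
  qed
  have i\<Phi>: "integrable lborel (partial_deriv b (\<Phi> b))" "integrable lborel (\<Psi> b)" if "b \<in> Basis" for b
    using \<Phi>[OF that] \<Psi>[OF that] that
    by (auto intro!: compactly_Ck_integrable[where k=0] test_function_compactly_Ck partial_deriv_test_function)
  have int: "(norm (l2 (partial_deriv b (\<lambda>x. ?Z x * w x))))\<^sup>2
      = (norm (l2 (\<lambda>x. partial_deriv b ?Z x * w x)))\<^sup>2 - Re (\<integral>x. \<Psi> b x \<partial>lborel)" if b: "b \<in> Basis" for b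
  proof -
    have "(norm (l2 (partial_deriv b (\<lambda>x. ?Z x * w x))))\<^sup>2
        = (\<integral>x. (cmod (partial_deriv b ?Z x * w x))\<^sup>2 + Re (partial_deriv b (\<Phi> b) x) - Re (\<Psi> b x) \<partial>lborel)"
      unfolding l2_norm_power2[OF sp[OF b]] pt[OF b] ..
    also have "\<dots> = (\<integral>x. (cmod (partial_deriv b ?Z x * w x))\<^sup>2 \<partial>lborel)
        + (\<integral>x. Re (partial_deriv b (\<Phi> b) x) \<partial>lborel) - (\<integral>x. Re (\<Psi> b x) \<partial>lborel)"
      using sq[OF b] i\<Phi>[OF b] by (simp add: sqint_def)
    also have "(\<integral>x. Re (partial_deriv b (\<Phi> b) x) \<partial>lborel) = 0"
      using integral_partial_deriv[OF test_function_compactly_Ck[OF \<Phi>[OF b]] b] i\<Phi>(1)[OF b]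
      by (simp add: integral_Re)
    finally show ?thesis
      using i\<Phi>(2)[OF b] by (simp add: l2_norm_power2[OF sq[OF b]] integral_Re)
  qed
  have \<Psi>s: "(\<Sum>b\<in>Basis. \<Psi> b x) = complex_of_real (l * (cmod (?Z x * w x))\<^sup>2)" for x
  proof (cases "s x = 0")
    case False
    have "(\<Sum>b\<in>Basis. \<Psi> b x) = ?Z x * (?Z x * (cnj (w x) * laplacian w x))"
      by (simp add: \<Psi>_def laplacian_def sum_distrib_left)
    then show ?thesis
      unfolding eq[OF False] complex_norm_square of_real_mult by (simp add: mult_ac)
  qed (simp add: \<Psi>_def)
  have "(\<integral>x. (\<Sum>b\<in>Basis. \<Psi> b x) \<partial>lborel) = complex_of_real (\<integral>x. l * (cmod (?Z x * w x))\<^sup>2 \<partial>lborel)"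
    unfolding \<Psi>s by (rule integral_complex_of_real)
  also have "(\<integral>x. l * (cmod (?Z x * w x))\<^sup>2 \<partial>lborel) = l * (norm (l2 (\<lambda>x. ?Z x * w x)))\<^sup>2"
    unfolding l2_norm_power2[OF test_function_sqint[OF Zw]] by simp
  finally have "(\<integral>x. (\<Sum>b\<in>Basis. \<Psi> b x) \<partial>lborel) = complex_of_real (l * (norm (l2 (\<lambda>x. ?Z x * w x)))\<^sup>2)" .
  then have "(\<Sum>b\<in>Basis. \<integral>x. \<Psi> b x \<partial>lborel) = complex_of_real (l * (norm (l2 (\<lambda>x. ?Z x * w x)))\<^sup>2)"
    using i\<Phi>(2) by (simp add: Bochner_Integration.integral_sum)
  then have "(\<Sum>b\<in>Basis. Re (\<integral>x. \<Psi> b x \<partial>lborel)) = l * (norm (l2 (\<lambda>x. ?Z x * w x)))\<^sup>2"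
    by (metis Re_complex_of_real Re_sum)
  then show ?thesis
    by (simp add: int sum_subtractf)
qed

text \<open>The derivative of d(eta) cnj(psi) integrates to zero; its real part is the sum of the
  two pairings.\<close>

lemma laplacian_inner_gradient:
  assumes \<psi>: "\<psi> \<in> test_functions D" and \<eta>: "\<eta> \<in> test_functions D"
  shows "l2 \<psi> \<bullet> l2 (laplacian \<eta>) = - (\<Sum>b\<in>Basis. l2 (partial_deriv b \<psi>) \<bullet> l2 (partial_deriv b \<eta>))"
proof -
  have s: "smooth_on UNIV \<psi>" and s': "smooth_on UNIV \<eta>"
    using \<psi> \<eta> by (auto elim: test_functionsE)
  have sp: "sqint (partial_deriv b \<psi>)" and sp': "sqint (partial_deriv b \<eta>)" if "b \<in> Basis" for b
    by (rule test_function_sqint[OF partial_deriv_test_function[OF \<psi> that]],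
        rule test_function_sqint[OF partial_deriv_test_function[OF \<eta> that]])
  have spp: "sqint (partial_deriv b (partial_deriv b \<eta>))" if "b \<in> Basis" for b
    by (rule test_function_sqint[OF partial_deriv_test_function[OF partial_deriv_test_function[OF \<eta> that] that]])
  have *: "l2 \<psi> \<bullet> l2 (partial_deriv b (partial_deriv b \<eta>)) = - (l2 (partial_deriv b \<psi>) \<bullet> l2 (partial_deriv b \<eta>))"
    if b: "b \<in> Basis" for b
  proof -
    let ?\<Phi> = "\<lambda>x. partial_deriv b \<eta> x * cnj (\<psi> x)"
    have \<Phi>: "?\<Phi> \<in> test_functions D"
      by (intro test_functions_mult partial_deriv_test_function[OF \<eta>] b smooth_on_cnj s)
    have i: "integrable lborel (partial_deriv b ?\<Phi>)"
      by (rule compactly_Ck_integrable[OF test_function_compactly_Ck[OF partial_deriv_test_function[OF \<Phi> b], where k=0]])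
    have pt: "partial_deriv b ?\<Phi> x = partial_deriv b \<eta> x * cnj (partial_deriv b \<psi> x) + partial_deriv b (partial_deriv b \<eta>) x * cnj (\<psi> x)" for x
      apply (subst partial_deriv_mult, intro smooth_on_differentiable smooth_on_partial_deriv s' b, intro smooth_on_differentiable smooth_on_cnj s)
      apply (subst partial_deriv_cnj, intro smooth_on_differentiable s)
      apply simp
      done
    have "(\<integral>x. \<psi> x \<bullet> partial_deriv b (partial_deriv b \<eta>) x + partial_deriv b \<psi> x \<bullet> partial_deriv b \<eta> x \<partial>lborel)
        = (\<integral>x. Re (partial_deriv b ?\<Phi> x) \<partial>lborel)"
      unfolding pt
      by (intro Bochner_Integration.integral_cong) (auto simp: inner_complex_def)
    also have "\<dots> = 0"
      using integral_partial_deriv[OF test_function_compactly_Ck[OF \<Phi>] b] i by (simp add: integral_Re)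
    finally show ?thesis
      using sqint_inner_integrable[OF test_function_sqint[OF \<psi>] spp[OF b]] sqint_inner_integrable[OF sp[OF b] sp'[OF b]]
      by (simp add: l2_inner test_function_sqint[OF \<psi>] sp[OF b] sp'[OF b] spp[OF b])
  qed
  have "l2 (laplacian \<eta>) = (\<Sum>b\<in>Basis. l2 (partial_deriv b (partial_deriv b \<eta>)))"
    unfolding laplacian_def[abs_def] using spp by (intro l2_sum) auto
  then show ?thesis
    using * by (simp add: inner_sum_right sum_negf)
qed

lemma laplacian_inner:
  assumes \<psi>: "\<psi> \<in> test_functions D"
  shows "l2 \<psi> \<bullet> l2 (laplacian \<psi>) = - (\<Sum>b\<in>Basis. (norm (l2 (partial_deriv b \<psi>)))\<^sup>2)"
  by (simp add: laplacian_inner_gradient[OF \<psi> \<psi>] power2_norm_eq_inner)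

lemma laplacian_symmetric:
  assumes "\<psi> \<in> test_functions D" "\<eta> \<in> test_functions D"
  shows "l2 \<psi> \<bullet> l2 (laplacian \<eta>) = l2 (laplacian \<psi>) \<bullet> l2 \<eta>"
  using laplacian_inner_gradient[OF assms] laplacian_inner_gradient[OF assms(2,1)] by (simp add: inner_commute)

lemma grad_norm_power2_le:
  fixes \<psi> :: "'a::euclidean_space \<Rightarrow> complex"
  shows "(grad_norm \<psi>)\<^sup>2 \<le> DIM('a) * (\<Sum>b\<in>Basis. (norm (l2 (partial_deriv b \<psi>)))\<^sup>2)"
  unfolding grad_norm_def using sum_squared_le_sum_of_squares[of "\<lambda>b. norm (l2 (partial_deriv b \<psi>))" "Basis :: 'a set"]
  by (simp add: mult.commute)

section \<open>Rellich's theorem\<close>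

lemma subsequence_diagonal:
  fixes x :: "nat \<Rightarrow> 'a::complete_space"
  assumes "\<And>e s. e > 0 \<Longrightarrow> strict_mono (s :: nat \<Rightarrow> nat) \<Longrightarrow>
      \<exists>r::nat \<Rightarrow> nat. strict_mono r \<and> (\<forall>i j. dist (x (s (r i))) (x (s (r j))) < e)"
  shows "\<exists>r::nat \<Rightarrow> nat. strict_mono r \<and> convergent (x \<circ> r)"
proof -
  interpret subseqs "\<lambda>n s. \<forall>i j. dist (x (s i)) (x (s j)) < inverse (real (Suc n))"
  proof
    fix n and s :: "nat \<Rightarrow> nat" assume "strict_mono s"
    then show "\<exists>r'::nat \<Rightarrow> nat. strict_mono r' \<and> (\<forall>i j. dist (x ((s \<circ> r') i)) (x ((s \<circ> r') j)) < inverse (real (Suc n)))"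
      using assms[of "inverse (real (Suc n))" s] by simp
  qed
  have P: "dist (x (diagseq (Suc k + i))) (x (diagseq (Suc k + j))) < inverse (real (Suc k))" for k i j
    using diagseq_holds[of k] by (auto simp: o_def)
  have "Cauchy (x \<circ> diagseq)"
  proof (rule metric_CauchyI)
    fix e :: real assume "e > 0"
    then obtain k where k: "inverse (real (Suc k)) < e"
      using reals_Archimedean by blast
    have "dist ((x \<circ> diagseq) m) ((x \<circ> diagseq) n) < e" if "m \<ge> Suc k" "n \<ge> Suc k" for m n
      using P[of k "m - Suc k" "n - Suc k"] that k by simp
    then show "\<exists>M. \<forall>m\<ge>M. \<forall>n\<ge>M. dist ((x \<circ> diagseq) m) ((x \<circ> diagseq) n) < e"
      by blast
  qed
  then show ?thesis
    using subseq_diagseq Cauchy_convergent by blast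
qed

text \<open>Mollification at scale t moves each function by at most t C, uniformly in n, by the
  translation estimate. The mollified functions are equibounded and equi-Lipschitz and live on one
  compact set, so Arzela-Ascoli gives a uniformly convergent subsequence, which converges in L^2 as
  well. A diagonal sequence removes the error.\<close>

theorem rellich:
  fixes \<psi> :: "nat \<Rightarrow> 'a::euclidean_space \<Rightarrow> complex"
  assumes D: "bounded D" and \<psi>: "\<And>n. \<psi> n \<in> test_functions D"
    and C: "\<And>n. norm (l2 (\<psi> n)) \<le> C" "\<And>n. grad_norm (\<psi> n) \<le> C"
  shows "\<exists>r::nat \<Rightarrow> nat. strict_mono r \<and> convergent (\<lambda>n. l2 (\<psi> (r n)))"
proof -
  have "\<exists>r::nat \<Rightarrow> nat. strict_mono r \<and> convergent ((\<lambda>n. l2 (\<psi> n)) \<circ> r)"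
  proof (rule subsequence_diagonal)
    fix e :: real and s :: "nat \<Rightarrow> nat" assume e: "e > 0" and "strict_mono s"
    have C0: "C \<ge> 0"
      using C(1)[of 0] norm_ge_zero order_trans by blast
    obtain R where R: "\<And>x. x \<in> D \<Longrightarrow> norm x \<le> R"
      using D unfolding bounded_iff by blast
    \<comment> \<open>The scale at which the mollification error t C is at most e/4; the 1 covers C
      = 0.\<close>
    define t where "t = e / (4 * (C + 1))"
    have t: "t > 0" "t * C \<le> e / 4"
      using e C0 by (auto simp: t_def field_simps)
    obtain r :: "'a \<Rightarrow> real" where r: "mollifier t r"
      using mollifier_exists[OF t(1)] by blast
    let ?\<rho> = "\<lambda>x. complex_of_real (r x)"
    have \<rho>: "?\<rho> \<in> test_functions UNIV"
      using r by (simp add: mollifier_def)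
    obtain B where B: "B \<ge> 0" "\<And>x. cmod (?\<rho> x) \<le> B"
      by (rule compactly_Ck_bounded[OF test_function_compactly_Ck[OF \<rho>, of 0]]) blast
    obtain L where L: "L \<ge> 0" "\<And>x y. cmod (?\<rho> x - ?\<rho> y) \<le> L * norm (x - y)"
      by (rule compactly_C1_lipschitz[OF test_function_compactly_Ck[OF \<rho>]]) blast
    define Q where "Q = cball (0::'a) (R + t)"
    have Q: "bounded Q" "Q \<in> sets borel" "compact Q"
      by (auto simp: Q_def)
    have si: "sqint (\<psi> n)" "integrable lborel (\<psi> n)" for n
      using test_function_sqint[OF \<psi>] compactly_Ck_integrable[OF test_function_compactly_Ck[OF \<psi>, where k=0]] by auto
    have out: "\<psi> n y = 0" if "norm y > R" for n y
    proof -
      obtain K where "K \<subseteq> D" "\<And>x. x \<notin> K \<Longrightarrow> \<psi> n x = 0"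
        using \<psi>[of n] by (elim test_functionsE) blast
      then show ?thesis
        using R[of y] that by auto
    qed
    \<comment> \<open>A common L^1 bound, from |psi| <= 1 + |psi|^2 on the bounded set
      \<open>Q\<close> that carries all supports. Sup norm and Lipschitz constant of the mollified
      functions are multiples of it.\<close>
    define M where "M = measure lborel Q + C\<^sup>2"
    have L1: "(\<integral>y. cmod (\<psi> n y) \<partial>lborel) \<le> M" for n
    proof -
      have fin: "emeasure lborel Q < \<infinity>"
        using emeasure_bounded_finite[OF Q(1)] .
      have "(\<integral>y. cmod (\<psi> n y) \<partial>lborel) \<le> (\<integral>y. indicator Q y + (cmod (\<psi> n y))\<^sup>2 \<partial>lborel)"
      proof (rule integral_mono)
        show "integrable lborel (\<lambda>y. indicator Q y + (cmod (\<psi> n y))\<^sup>2)"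
          using si(1)[of n] fin Q(2) by (auto simp: sqint_def intro!: integrable_real_indicator)
        fix y
        have "cmod (\<psi> n y) \<le> 1 + (cmod (\<psi> n y))\<^sup>2"
          using sum_squares_bound[of "1" "cmod (\<psi> n y)"] norm_ge_zero[of "\<psi> n y"]
          unfolding power_one mult_1_right by linarith
        then show "cmod (\<psi> n y) \<le> indicator Q y + (cmod (\<psi> n y))\<^sup>2"
          using out[of y n] t(1) by (cases "norm y \<le> R") (auto simp: Q_def)
      qed (use si(2)[of n] in auto)
      also have "\<dots> = measure lborel Q + (norm (l2 (\<psi> n)))\<^sup>2"
        using si(1)[of n] fin Q(2) by (subst Bochner_Integration.integral_add)
          (auto simp: l2_norm_power2[OF si(1)] sqint_def intro!: integrable_real_indicator)
      also have "\<dots> \<le> M"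
        unfolding M_def by (intro add_left_mono power_mono C) auto
      finally show ?thesis .
    qed
    have M0: "M \<ge> 0"
      by (simp add: M_def)
    define g where "g n = conv (\<psi> n) ?\<rho>" for n
    have g: "sqint (g n)" "norm (l2 (\<psi> n) - l2 (g n)) \<le> e / 4" for n
    proof -
      have "norm (l2 (\<psi> n) - l2 (\<lambda>x. \<psi> n (x - z))) \<le> e / 4" if "norm z \<le> t" for z
      proof -
        have "norm (l2 (\<lambda>x. \<psi> n (x - z)) - l2 (\<psi> n)) \<le> norm z * grad_norm (\<psi> n)"
          using shift_norm_le[OF test_function_compactly_Ck[OF \<psi>], where z="- z"] by simp
        also have "\<dots> \<le> t * C"
          using that C(2) t(1) by (intro mult_mono) (auto simp: grad_norm_nonneg)
        finally show ?thesis
          using t(2) by (simp add: norm_minus_commute)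
      qed
      then show "sqint (g n)" "norm (l2 (\<psi> n) - l2 (g n)) \<le> e / 4"
        unfolding g_def using sqint_conv_diff[OF si r, of "e / 4"] e by auto
    qed
    have i: "integrable lborel (\<lambda>y. ?\<rho> (x - y) * \<psi> n y)" for x n
      by (rule conv_integrable[OF si(2) \<rho>])
    have gB: "cmod (g n x) \<le> B * M" for n x
    proof -
      have "cmod (g n x) \<le> (\<integral>y. B * cmod (\<psi> n y) \<partial>lborel)"
        unfolding g_def conv_def
      proof (rule order_trans[OF integral_norm_bound integral_mono])
        show "integrable lborel (\<lambda>y. norm (?\<rho> (x - y) * \<psi> n y))"
          by (rule integrable_norm[OF i])
        show "norm (?\<rho> (x - y) * \<psi> n y) \<le> B * cmod (\<psi> n y)" for y
          unfolding norm_mult by (intro mult_right_mono B) auto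
      qed (use si(2) in auto)
      also have "\<dots> \<le> B * M"
        using L1[of n] B(1) by (simp add: mult_left_mono)
      finally show ?thesis .
    qed
    have gL: "cmod (g n x - g n x') \<le> L * M * norm (x - x')" for n x x'
    proof -
      have "g n x - g n x' = (\<integral>y. (?\<rho> (x - y) - ?\<rho> (x' - y)) * \<psi> n y \<partial>lborel)"
        unfolding g_def conv_def left_diff_distrib using i by simp
      also have "cmod \<dots> \<le> (\<integral>y. L * norm (x - x') * cmod (\<psi> n y) \<partial>lborel)"
      proof (rule order_trans[OF integral_norm_bound integral_mono])
        show "integrable lborel (\<lambda>y. norm ((?\<rho> (x - y) - ?\<rho> (x' - y)) * \<psi> n y))"
          unfolding left_diff_distrib using i by (intro integrable_norm Bochner_Integration.integrable_diff)
        show "norm ((?\<rho> (x - y) - ?\<rho> (x' - y)) * \<psi> n y) \<le> L * norm (x - x') * cmod (\<psi> n y)" for y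
          unfolding norm_mult using L(2)[of "x - y" "x' - y"] by (intro mult_right_mono) auto
      qed (use si(2) in auto)
      also have "\<dots> \<le> L * norm (x - x') * M"
        using L1[of n] L(1) by (simp add: mult_left_mono)
      finally show ?thesis by (simp add: mult_ac)
    qed
    have gout: "g n x = 0" if "x \<notin> Q" for n x
    proof -
      have "?\<rho> (x - y) * \<psi> n y = 0" for y
      proof (cases "norm y \<le> R")
        case True
        then have "norm (x - y) > t"
          using that norm_triangle_ineq2[of x y] by (auto simp: Q_def)
        then show ?thesis
          using r by (simp add: mollifier_def)
      qed (use out in auto)
      then have "(\<lambda>y. ?\<rho> (x - y) * \<psi> n y) = (\<lambda>y. 0)"
        by blast
      then show ?thesis
        unfolding g_def conv_def by (simp only: Bochner_Integration.integral_zero)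
    qed
    have eqc: "\<exists>d. 0 < d \<and> (\<forall>n y. y \<in> Q \<and> norm (x - y) < d \<longrightarrow> cmod (g (s n) x - g (s n) y) < e')"
      if "0 < e'" for x e'
    proof (intro exI[of _ "e' / (L * M + 1)"] conjI allI impI)
      have p: "L * M + 1 > 0"
        using L(1) M0 by (simp add: add_nonneg_pos)
      show "0 < e' / (L * M + 1)"
        using that p by simp
      fix n y assume y: "y \<in> Q \<and> norm (x - y) < e' / (L * M + 1)"
      have "cmod (g (s n) x - g (s n) y) \<le> L * M * norm (x - y)"
        by (rule gL)
      also have "\<dots> \<le> (L * M + 1) * norm (x - y)"
        by (intro mult_right_mono) auto
      also have "\<dots> < e'"
        using y p by (simp add: pos_less_divide_eq mult.commute)
      finally show "cmod (g (s n) x - g (s n) y) < e'" .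
    qed
    obtain h and k :: "nat \<Rightarrow> nat" where k: "strict_mono k"
      "\<And>e. 0 < e \<Longrightarrow> \<exists>N. \<forall>n x. n \<ge> N \<and> x \<in> Q \<longrightarrow> cmod (g (s (k n)) x - h x) < e"
    proof (rule Arzela_Ascoli[OF Q(3), of "\<lambda>n. g (s n)" "B * M"])
      show "cmod (g (s n) x) \<le> B * M" for n x by (rule gB)
      show "\<exists>d. 0 < d \<and> (\<forall>n y. y \<in> Q \<and> norm (x - y) < d \<longrightarrow> cmod (g (s n) x - g (s n) y) < e')"
        if "x \<in> Q" "0 < e'" for x e'
        using eqc[OF that(2)] .
    qed blast
    define q where "q = norm (l2 (indicator Q :: 'a \<Rightarrow> complex))"
    \<comment> \<open>Uniform closeness to h within this amount on \<open>Q\<close> costs at most 2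
      \<delta> q <= e/4 in the L^2 norm, q being the norm of the indicator of
      \<open>Q\<close>.\<close>
    define \<delta> where "\<delta> = e / (8 * (q + 1))"
    have q0: "q \<ge> 0"
      by (simp add: q_def)
    have \<delta>: "\<delta> > 0" "2 * \<delta> * q \<le> e / 4"
      using e q0 by (auto simp: \<delta>_def field_simps)
    obtain N where N: "\<And>n x. n \<ge> N \<Longrightarrow> x \<in> Q \<Longrightarrow> cmod (g (s (k n)) x - h x) < \<delta>"
      using k(2)[OF \<delta>(1)] by blast
    have close: "norm (l2 (g (s (k m))) - l2 (g (s (k n)))) \<le> e / 4" if "m \<ge> N" "n \<ge> N" for m n
    proof -
      have "norm (l2 (\<lambda>x. g (s (k m)) x - g (s (k n)) x)) \<le> 2 * \<delta> * norm (l2 (indicator Q :: 'a \<Rightarrow> complex))"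
      proof (rule l2_norm_mono)
        show "cmod (g (s (k m)) x - g (s (k n)) x) \<le> 2 * \<delta> * cmod (indicator Q x)" for x
        proof (cases "x \<in> Q")
          case True
          have "cmod (g (s (k m)) x - g (s (k n)) x) \<le> cmod (g (s (k m)) x - h x) + cmod (g (s (k n)) x - h x)"
            using norm_triangle_ineq4[of "g (s (k m)) x - h x" "g (s (k n)) x - h x"] by simp
          then show ?thesis
            using N[OF that(1) True] N[OF that(2) True] True by simp
        qed (simp add: gout)
      qed (use g(1) \<delta>(1) Q in \<open>auto intro: sqint_diff sqint_indicator\<close>)
      then show ?thesis
        using \<delta>(2) by (simp add: l2_diff g(1) q_def)
    qed
    have "dist (l2 (\<psi> (s (k (i + N))))) (l2 (\<psi> (s (k (j + N))))) < e" for i j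
    proof -
      let ?a = "s (k (i + N))" and ?b = "s (k (j + N))"
      have eq: "l2 (\<psi> ?a) - l2 (\<psi> ?b) = (l2 (\<psi> ?a) - l2 (g ?a)) + ((l2 (g ?a) - l2 (g ?b)) - (l2 (\<psi> ?b) - l2 (g ?b)))"
        by simp
      have "norm (l2 (\<psi> ?a) - l2 (\<psi> ?b)) \<le> norm (l2 (\<psi> ?a) - l2 (g ?a)) + (norm (l2 (g ?a) - l2 (g ?b)) + norm (l2 (\<psi> ?b) - l2 (g ?b)))"
        unfolding eq by (rule order_trans[OF norm_triangle_ineq add_left_mono[OF norm_triangle_ineq4]])
      also have "\<dots> \<le> e / 4 + (e / 4 + e / 4)"
        by (intro add_mono g close) auto
      finally show ?thesis
        using e by (simp add: dist_norm)
    qed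
    moreover have "strict_mono (\<lambda>i. k (i + N))"
      using k(1) by (simp add: strict_mono_def)
    ultimately show "\<exists>r::nat \<Rightarrow> nat. strict_mono r \<and> (\<forall>i j. dist (l2 (\<psi> (s (r i)))) (l2 (\<psi> (s (r j)))) < e)"
      by blast
  qed
  then show ?thesis
    by (simp add: o_def)
qed

section \<open>Interior estimates\<close>

text \<open>L^2(D) as a subspace of L^2 of the whole space. As the kernel of a bounded operator it
  is visibly a closed subspace.\<close>

definition L2_supp :: "'a::euclidean_space set \<Rightarrow> 'a l2 set" where
  "L2_supp D = {h. l2_mult (indicator (- D)) h = 0}"

lemma indicator_bounded: "cmod (indicator A x) \<le> 1"
  by (simp add: indicator_def)

lemma borel_indicator: "A \<in> sets borel \<Longrightarrow> (indicator A :: 'a::euclidean_space \<Rightarrow> complex) \<in> borel_measurable borel"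
  by simp

lemma sqint_indicator_mult: "sqint f \<Longrightarrow> A \<in> sets borel \<Longrightarrow> sqint (\<lambda>x. indicator A x * f x)"
  by (rule sqint_mult_bounded[OF _ borel_indicator indicator_bounded])

lemma L2_supp_iff:
  assumes D: "open D" and f: "sqint f"
  shows "l2 f \<in> L2_supp D \<longleftrightarrow> (AE x in lborel. x \<notin> D \<longrightarrow> f x = 0)"
proof -
  have m: "- D \<in> sets borel"
    using D by (intro borel_closed) auto
  have "l2 f \<in> L2_supp D \<longleftrightarrow> l2 (\<lambda>x. indicator (- D) x * f x) = l2 (\<lambda>x. 0)"
    by (simp add: L2_supp_def l2_mult_l2[OF borel_indicator[OF m] indicator_bounded f] l2_zero)
  also have "\<dots> \<longleftrightarrow> (AE x in lborel. indicator (- D) x * f x = 0)"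
    by (intro l2_eq_iff sqint_indicator_mult f m sqint_zero)
  also have "\<dots> \<longleftrightarrow> (AE x in lborel. x \<notin> D \<longrightarrow> f x = 0)"
    by (intro AE_cong) (auto simp: indicator_def)
  finally show ?thesis .
qed

lemma bounded_linear_L2_supp: "open D \<Longrightarrow> bounded_linear (l2_mult (indicator (- D)))"
  by (rule bounded_linear_l2_mult[OF borel_indicator indicator_bounded]) (auto intro!: borel_closed)

lemma subspace_L2_supp:
  assumes "open D" shows "subspace (L2_supp D)"
proof -
  have "linear (l2_mult (indicator (- D)))"
    using bounded_linear_L2_supp[OF assms] by (rule bounded_linear.linear)
  then show ?thesis
    by (auto simp: L2_supp_def subspace_def linear_add linear_scale linear_0)
qed

lemma closed_L2_supp: "open D \<Longrightarrow> closed (L2_supp D)"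
  unfolding L2_supp_def
  by (intro closed_Collect_eq bounded_linear.continuous_on[OF bounded_linear_L2_supp] continuous_on_id continuous_on_const)

lemma L2_supp_representative:
  assumes D: "open D" and h: "h \<in> L2_supp D"
  obtains f where "sqint f" "h = l2 f" "\<And>x. x \<notin> D \<Longrightarrow> f x = 0"
proof (rule that)
  let ?f = "\<lambda>x. indicator D x * l2_rep h x"
  show s: "sqint ?f"
    using D by (intro sqint_indicator_mult sqint_l2_rep) auto
  have "AE x in lborel. x \<notin> D \<longrightarrow> l2_rep h x = 0"
    using L2_supp_iff[OF D sqint_l2_rep, of h] h by (simp add: l2_l2_rep)
  then have "AE x in lborel. l2_rep h x = ?f x"
    by eventually_elim (auto simp: indicator_def)
  then have "l2 (l2_rep h) = l2 ?f"
    by (intro l2_eqI sqint_l2_rep s)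
  then show "h = l2 ?f"
    by (simp add: l2_l2_rep)
qed (simp add: indicator_def)

lemma test_function_L2_supp:
  assumes "open D" "\<psi> \<in> test_functions D" shows "l2 \<psi> \<in> L2_supp D"
proof -
  have "\<psi> x = 0" if "x \<notin> D" for x
    using assms(2) that by (elim test_functionsE) blast
  then show ?thesis
    using L2_supp_iff[OF assms(1) test_function_sqint[OF assms(2)]] by simp
qed

section \<open>Bilinear complex pairings and the real inner product\<close>

lemma sqint_mult_integrable:
  assumes "sqint f" "sqint g" shows "integrable lborel (\<lambda>x. f x * g x)"
proof (rule Bochner_Integration.integrable_bound)
  note [measurable] = assms[THEN sqint_measurable]
  show "integrable lborel (\<lambda>x. (cmod (f x))\<^sup>2 + (cmod (g x))\<^sup>2)"
    using assms by (simp add: sqint_def)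
  have "cmod (f x) * cmod (g x) \<le> (cmod (f x))\<^sup>2 + (cmod (g x))\<^sup>2" for x
    using sum_squares_bound[of "cmod (f x)" "cmod (g x)"]
      mult_nonneg_nonneg[OF norm_ge_zero norm_ge_zero, of "f x" "g x"] by linarith
  then show "AE x in lborel. norm (f x * g x) \<le> norm ((cmod (f x))\<^sup>2 + (cmod (g x))\<^sup>2)"
    by (simp add: norm_mult)
qed (use assms in measurable)

lemma sqint_cnj: "sqint f \<Longrightarrow> sqint (\<lambda>x. cnj (f x))"
  by (rule sqint_bound[of f _ 1]) (auto intro!: borel_measurable_continuous_on[of cnj] continuous_intros dest: sqint_measurable)

lemma integral_mult_l2:
  assumes f: "sqint f" and g: "sqint g"
  shows "(\<integral>x. f x * g x \<partial>lborel) = Complex (l2 f \<bullet> l2 (\<lambda>x. cnj (g x))) (l2 f \<bullet> l2 (\<lambda>x. \<i> * cnj (g x)))"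
proof -
  have "Re (\<integral>x. f x * g x \<partial>lborel) = (\<integral>x. Re (f x * g x) \<partial>lborel)"
    by (rule integral_Re[OF sqint_mult_integrable[OF f g], symmetric])
  also have "\<dots> = l2 f \<bullet> l2 (\<lambda>x. cnj (g x))"
    unfolding l2_inner[OF f sqint_cnj[OF g]] by (simp add: inner_complex_def)
  finally have "Re (\<integral>x. f x * g x \<partial>lborel) = l2 f \<bullet> l2 (\<lambda>x. cnj (g x))" .
  moreover have "Im (\<integral>x. f x * g x \<partial>lborel) = (\<integral>x. Im (f x * g x) \<partial>lborel)"
    by (rule integral_Im[OF sqint_mult_integrable[OF f g], symmetric])
  then have "Im (\<integral>x. f x * g x \<partial>lborel) = l2 f \<bullet> l2 (\<lambda>x. \<i> * cnj (g x))"
    unfolding l2_inner[OF f sqint_cmult[OF sqint_cnj[OF g]]] by (simp add: inner_complex_def)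
  ultimately show ?thesis
    by (simp add: complex_eq_iff)
qed

text \<open>The distributional definition pairs bilinearly with complex test functions, the Hilbert
  space pairing is real. They agree because test functions are stable under conjugation and under
  multiplication by i, which together recover the real and the imaginary part.\<close>

lemma weak_laplacian_complex:
  assumes f: "sqint f" and w: "sqint w"
  shows "(\<forall>\<psi>\<in>test_functions D. l2 f \<bullet> l2 (laplacian \<psi>) = l2 w \<bullet> l2 \<psi>) \<longleftrightarrow>
    (\<forall>\<psi>\<in>test_functions D. (\<integral>x. f x * laplacian \<psi> x \<partial>lborel) = (\<integral>x. w x * \<psi> x \<partial>lborel))"
proof (intro iffI ballI)
  fix \<psi> assume *: "\<forall>\<psi>\<in>test_functions D. l2 f \<bullet> l2 (laplacian \<psi>) = l2 w \<bullet> l2 \<psi>" and \<psi>: "\<psi> \<in> test_functions D"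
  have s: "smooth_on UNIV \<psi>"
    using \<psi> by (elim test_functionsE)
  have 1: "l2 f \<bullet> l2 (\<lambda>x. cnj (laplacian \<psi> x)) = l2 w \<bullet> l2 (\<lambda>x. cnj (\<psi> x))"
    using *[rule_format, OF test_functions_cnj[OF \<psi>]] by (simp add: laplacian_cnj[OF s])
  have 2: "l2 f \<bullet> l2 (\<lambda>x. \<i> * cnj (laplacian \<psi> x)) = l2 w \<bullet> l2 (\<lambda>x. \<i> * cnj (\<psi> x))"
    using *[rule_format, OF test_functions_cmult[OF test_functions_cnj[OF \<psi>], of \<i>]]
    by (simp add: laplacian_cnj[OF s] laplacian_cmult[OF smooth_on_cnj[OF s]])
  show "(\<integral>x. f x * laplacian \<psi> x \<partial>lborel) = (\<integral>x. w x * \<psi> x \<partial>lborel)"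
    using 1 2 by (simp add: integral_mult_l2 f w test_function_sqint[OF \<psi>] test_function_sqint[OF laplacian_test_function[OF \<psi>]])
next
  fix \<psi> assume *: "\<forall>\<psi>\<in>test_functions D. (\<integral>x. f x * laplacian \<psi> x \<partial>lborel) = (\<integral>x. w x * \<psi> x \<partial>lborel)"
    and \<psi>: "\<psi> \<in> test_functions D"
  have s: "smooth_on UNIV \<psi>"
    using \<psi> by (elim test_functionsE)
  have c: "(\<lambda>x. cnj (\<psi> x)) \<in> test_functions D"
    by (rule test_functions_cnj[OF \<psi>])
  have "(\<integral>x. f x * laplacian (\<lambda>x. cnj (\<psi> x)) x \<partial>lborel) = (\<integral>x. w x * cnj (\<psi> x) \<partial>lborel)"
    using * c by blast
  then show "l2 f \<bullet> l2 (laplacian \<psi>) = l2 w \<bullet> l2 \<psi>"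
    unfolding integral_mult_l2[OF f test_function_sqint[OF laplacian_test_function[OF c]]]
      integral_mult_l2[OF w test_function_sqint[OF c]]
    by (simp add: laplacian_cnj[OF s])
qed

definition weak_kernel :: "'a::euclidean_space set \<Rightarrow> real \<Rightarrow> 'a l2 set" where
  "weak_kernel D l = {v \<in> L2_supp D. \<forall>\<psi>\<in>test_functions D. v \<bullet> l2 (laplacian \<psi>) = (l *\<^sub>R v) \<bullet> l2 \<psi>}"

text \<open>For x at distance more than the mollification radius from the complement of D, the
  reflected mollifier centred at x is an admissible test function; inserting it into the weak
  equation gives the classical equation at x.\<close>

lemma conv_solves:
  assumes f: "sqint f" "integrable lborel f" and k: "l2 f \<in> weak_kernel D l"
    and r: "mollifier t r" and x: "cball x t \<subseteq> D"
  shows "laplacian (conv f (\<lambda>x. complex_of_real (r x))) x = complex_of_real l * conv f (\<lambda>x. complex_of_real (r x)) x"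
proof -
  let ?\<rho> = "\<lambda>x. complex_of_real (r x)"
  have \<rho>: "?\<rho> \<in> test_functions UNIV"
    using r by (simp add: mollifier_def)
  then have s: "smooth_on UNIV ?\<rho>"
    by (elim test_functionsE)
  have \<psi>: "(\<lambda>y. ?\<rho> (x - y)) \<in> test_functions D"
    by (rule test_functionsI[OF smooth_on_reflect[OF s] compact_cball x])
      (use r in \<open>auto simp: mollifier_def dist_norm\<close>)
  have "\<forall>\<psi>\<in>test_functions D. l2 f \<bullet> l2 (laplacian \<psi>) = l2 (\<lambda>x. complex_of_real l * f x) \<bullet> l2 \<psi>"
    using k l2_scaleR[OF f(1), of l] by (simp add: weak_kernel_def scaleR_conv_of_real)
  then have "(\<integral>y. f y * laplacian (\<lambda>y. ?\<rho> (x - y)) y \<partial>lborel) = (\<integral>y. complex_of_real l * f y * ?\<rho> (x - y) \<partial>lborel)"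
    using weak_laplacian_complex[OF f(1) sqint_cmult[OF f(1)]] \<psi> by blast
  then show ?thesis
    unfolding laplacian_conv[OF f(2) \<rho>] conv_def laplacian_reflect[OF s]
    by (simp add: mult_ac)
qed

section \<open>Cutoffs around a compact set and interior estimates\<close>

lemma ball_cover:
  assumes "compact K" "K \<subseteq> D" "open D"
  obtains F :: "('a::euclidean_space \<times> real) set" where "finite F" "\<And>a r. (a, r) \<in> F \<Longrightarrow> r > 0 \<and> cball a r \<subseteq> D"
    "K \<subseteq> (\<Union>(a, r)\<in>F. ball a r)"
proof -
  define I where "I = {(a, r). r > 0 \<and> cball a r \<subseteq> D}"
  have "K \<subseteq> (\<Union>q\<in>I. ball (fst q) (snd q))"
  proof
    fix x assume "x \<in> K"
    then obtain e where "e > 0" "cball x e \<subseteq> D"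
      using assms open_contains_cball by blast
    then show "x \<in> (\<Union>q\<in>I. ball (fst q) (snd q))"
      by (intro UN_I[of "(x, e)"]) (auto simp: I_def)
  qed
  then obtain F where F: "F \<subseteq> I" "finite F" "K \<subseteq> (\<Union>q\<in>F. ball (fst q) (snd q))"
    using compactE_image[OF assms(1), of I "\<lambda>q. ball (fst q) (snd q)"] by auto
  show thesis
  proof (rule that[OF F(2)])
    show "r > 0 \<and> cball a r \<subseteq> D" if "(a, r) \<in> F" for a r
      using F(1) that unfolding I_def by blast
    show "K \<subseteq> (\<Union>(a, r)\<in>F. ball a r)"
      using F(3) by (simp add: case_prod_beta)
  qed
qed

text \<open>A sum of bumps is not equal to 1 on \<open>K\<close>. The positive minimum c takes over
  the role of that normalisation, at the price of a factor 1/c.\<close>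

lemma bump_sum_lower_bound:
  fixes F :: "('a::euclidean_space \<times> real) set"
  assumes F: "finite F" "\<And>a r. (a, r) \<in> F \<Longrightarrow> r > 0" and K: "compact K" "K \<subseteq> (\<Union>(a, r)\<in>F. ball a r)"
  obtains c where "c > 0" "\<And>x. x \<in> K \<Longrightarrow> c \<le> bump_sum F x"
proof (cases "K = {}")
  case True
  then show ?thesis using that[of 1] by simp
next
  case False
  have "continuous_on UNIV (bump_sum F)"
    using smooth_on_continuous[OF smooth_on_bump_sum, of UNIV F] by (auto dest: continuous_on_Re)
  then obtain x where x: "x \<in> K" "\<And>y. y \<in> K \<Longrightarrow> bump_sum F x \<le> bump_sum F y"
    using continuous_attains_inf[OF K(1) False, of "bump_sum F"] continuous_on_subset by blast
  then have "bump_sum F x > 0"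
    using bump_sum_pos_iff[of F x] F K(2) by blast
  then show ?thesis
    using that x(2) by blast
qed

lemma bump_sum_gradient_bound:
  fixes F :: "('a::euclidean_space \<times> real) set"
  assumes F: "finite F" "\<And>a r. (a, r) \<in> F \<Longrightarrow> r > 0"
  obtains A where "A \<ge> 0" "\<And>b x. b \<in> Basis \<Longrightarrow> cmod (partial_deriv b (\<lambda>x. complex_of_real (bump_sum F x)) x)
      \<le> A * indicator (\<Union>(a, r)\<in>F. cball a r) x"
proof -
  let ?Z = "\<lambda>x. complex_of_real (bump_sum F x)"
  have Z: "?Z \<in> test_functions UNIV"
    by (rule bump_sum_test_function[OF F(1)]) (use F(2) in auto)
  have "\<exists>B\<ge>0. \<forall>x. cmod (partial_deriv b ?Z x) \<le> B" if "b \<in> Basis" for b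
    by (rule compactly_Ck_bounded[OF test_function_compactly_Ck[OF partial_deriv_test_function[OF Z that], where k=0]]) blast
  then obtain B where B: "\<And>b. b \<in> Basis \<Longrightarrow> B b \<ge> 0" "\<And>b x. b \<in> Basis \<Longrightarrow> cmod (partial_deriv b ?Z x) \<le> B b"
    by metis
  define A where "A = (\<Sum>b\<in>Basis. B b)"
  have "cmod (partial_deriv b ?Z x) \<le> A * indicator (\<Union>(a, r)\<in>F. cball a r) x" if b: "b \<in> Basis" for b x
  proof (cases "x \<in> (\<Union>(a, r)\<in>F. cball a r)")
    case True
    have "B b \<le> A"
      unfolding A_def using b B(1) by (intro member_le_sum) auto
    then show ?thesis
      using B(2)[OF b, of x] True by simp
  next
    case False
    have "partial_deriv b ?Z x = 0"
    proof (rule partial_deriv_zero_outside[OF compact_imp_closed[OF compact_cball_Union[OF F(1)]] _ False])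
      show "?Z y = 0" if "y \<notin> (\<Union>(a, r)\<in>F. cball a r)" for y
        using bump_sum_zero_outside[OF F(1) _ that] F(2) by auto
    qed
    then show ?thesis using False by simp
  qed
  moreover have "A \<ge> 0"
    unfolding A_def by (intro sum_nonneg B)
  ultimately show thesis
    using that by blast
qed

text \<open>The weight q dominating the gradient of the cutoff is either a larger cutoff, which
  permits a second application of the estimate, or the constant 1.\<close>

lemma energy_bound:
  fixes w q :: "'a::euclidean_space \<Rightarrow> complex"
  assumes w: "smooth_on UNIV w"
    and Z: "(\<lambda>x. complex_of_real (s x)) \<in> test_functions UNIV"
    and eq: "\<And>x. s x \<noteq> 0 \<Longrightarrow> laplacian w x = complex_of_real l * w x"
    and A: "A \<ge> 0" "\<And>b x. b \<in> Basis \<Longrightarrow> cmod (partial_deriv b (\<lambda>x. complex_of_real (s x)) x) \<le> A * cmod (q x)"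
    and q: "sqint (\<lambda>x. q x * w x)"
  shows "(\<Sum>b\<in>Basis. (norm (l2 (partial_deriv b (\<lambda>x. complex_of_real (s x) * w x))))\<^sup>2)
      + l * (norm (l2 (\<lambda>x. complex_of_real (s x) * w x)))\<^sup>2
    \<le> DIM('a) * (A * norm (l2 (\<lambda>x. q x * w x)))\<^sup>2"
proof -
  have "(norm (l2 (\<lambda>x. partial_deriv b (\<lambda>x. complex_of_real (s x)) x * w x)))\<^sup>2 \<le> (A * norm (l2 (\<lambda>x. q x * w x)))\<^sup>2"
    if b: "b \<in> Basis" for b
  proof (intro power_mono l2_norm_mono q A(1))
    show "sqint (\<lambda>x. partial_deriv b (\<lambda>x. complex_of_real (s x)) x * w x)"
      by (rule test_function_sqint[OF test_functions_mult[OF partial_deriv_test_function[OF Z b] w]])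
    show "cmod (partial_deriv b (\<lambda>x. complex_of_real (s x)) x * w x) \<le> A * cmod (q x * w x)" for x
      unfolding norm_mult mult.assoc[symmetric] by (intro mult_right_mono A(2)[OF b]) auto
  qed auto
  then have "(\<Sum>b\<in>Basis. (norm (l2 (\<lambda>x. partial_deriv b (\<lambda>x. complex_of_real (s x)) x * w x)))\<^sup>2)
      \<le> DIM('a) * (A * norm (l2 (\<lambda>x. q x * w x)))\<^sup>2"
    by (intro sum_bounded_above) auto
  then show ?thesis
    using energy_identity[OF w Z, of l] eq by simp
qed

lemma sqint_vanishing_integrable:
  assumes "sqint f" "open D" "bounded D" "\<And>x. x \<notin> D \<Longrightarrow> f x = 0"
  shows "integrable lborel f"
proof -
  have "(\<lambda>x. indicator D x *\<^sub>R f x) = f"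
    using assms(4) by (auto simp: indicator_def)
  then show ?thesis
    using sqint_integrable_bounded_set[OF assms(1) _ assms(3)] assms(2) by simp
qed

text \<open>On a compact subset of D a mollified element of the kernel satisfies the equation
  exactly and is smooth, so energy estimates apply to it without interior regularity theory for v.
  Closeness in L^2 transfers the results back to v.\<close>

lemma kernel_mollify:
  fixes D :: "'a::euclidean_space set"
  assumes D: "open D" "bounded D" and v: "v \<in> weak_kernel D l" and K: "compact K" "K \<subseteq> D" and e: "e > 0"
  obtains w where "smooth_on UNIV w" "sqint w" "norm (v - l2 w) \<le> e"
    "\<And>x. x \<in> K \<Longrightarrow> laplacian w x = complex_of_real l * w x"
proof -
  have "v \<in> L2_supp D"
    using v by (simp add: weak_kernel_def)
  then obtain f where f: "sqint f" "v = l2 f" "\<And>x. x \<notin> D \<Longrightarrow> f x = 0"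
    using L2_supp_representative[OF D(1)] by blast
  have i: "integrable lborel f"
    using f by (intro sqint_vanishing_integrable[OF _ D])
  obtain d where d: "d > 0" "\<And>r t. mollifier t r \<Longrightarrow> t \<le> d \<Longrightarrow> sqint (conv f (\<lambda>x. complex_of_real (r x))) \<and>
      norm (l2 f - l2 (conv f (\<lambda>x. complex_of_real (r x)))) \<le> e"
    using mollifier_approximation[OF f(1) i e] by blast
  obtain t where t: "t > 0" "(\<Union>x\<in>K. cball x t) \<subseteq> D"
    using compact_subset_open_imp_cball_epsilon_subset[OF K(1) D(1) K(2)] by blast
  obtain r :: "'a \<Rightarrow> real" where r: "mollifier (min d t) r"
    using mollifier_exists[of "min d t"] d(1) t(1) by auto
  let ?\<rho> = "\<lambda>x. complex_of_real (r x)"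
  have \<rho>: "?\<rho> \<in> test_functions UNIV"
    using r by (simp add: mollifier_def)
  show thesis
  proof (rule that)
    show "smooth_on UNIV (conv f ?\<rho>)"
      by (rule smooth_on_conv[OF i \<rho>])
    show "sqint (conv f ?\<rho>)" "norm (v - l2 (conv f ?\<rho>)) \<le> e"
      using d(2)[OF r] f(2) by auto
    show "laplacian (conv f ?\<rho>) x = complex_of_real l * conv f ?\<rho> x" if "x \<in> K" for x
    proof (rule conv_solves[OF f(1) i _ r])
      have "cball x (min d t) \<subseteq> cball x t"
        by (rule subset_cball) simp
      then show "cball x (min d t) \<subseteq> D"
        using t(2) that by blast
    qed (use v f(2) in simp)
  qed
qed

text \<open>The approximation error occurs inside and outside the factor a; with error e / (a + 1)
  the total is exactly e.\<close>

lemma le_of_perturbed_le: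
  fixes x y a :: real
  assumes "\<And>e. e > 0 \<Longrightarrow> x \<le> a * (y + e) + e" "a \<ge> 0"
  shows "x \<le> a * y"
proof (rule field_le_epsilon)
  fix e :: real assume e: "e > 0"
  have "x \<le> a * (y + e / (a + 1)) + e / (a + 1)"
    using e assms(2) by (intro assms(1)) simp
  also have "\<dots> = a * y + (a + 1) * (e / (a + 1))"
    by (simp only: distrib_left distrib_right)
  also have "\<dots> = a * y + e"
    using assms(2) by simp
  finally show "x \<le> a * y + e" .
qed

text \<open>A single energy estimate bounds l times the squared norm, so it gains only l^(-1/2). The
  gradient of the inner cutoff is dominated by the outer cutoff, and the second estimate supplies
  the other half power. The constant is chosen before l and v, which the uniform bounds rely
  on.\<close>

lemma interior_decay:
  fixes D :: "'a::euclidean_space set"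
  assumes D: "open D" "bounded D" and K: "compact K" "K \<subseteq> D"
  shows "\<exists>C\<ge>0. \<forall>l>0. \<forall>v\<in>weak_kernel D l. norm (l2_mult (indicator K) v) \<le> C / l * norm v"
proof -
  obtain F where F: "finite F" "\<And>a r. (a, r) \<in> F \<Longrightarrow> r > 0 \<and> cball a r \<subseteq> D" "K \<subseteq> (\<Union>(a, r)\<in>F. ball a r)"
    using ball_cover[OF K D(1)] by blast
  \<comment> \<open>Nested sets: the inner cutoff is bounded below on \<open>K\<close> and vanishes
    off \<open>K1\<close>; the outer one is bounded below on \<open>K1\<close> and vanishes off
    \<open>K2\<close>, all inside D.\<close>
  define K1 where "K1 = (\<Union>(a, r)\<in>F. cball a r)"
  have K1: "compact K1" "K1 \<subseteq> D"
    unfolding K1_def using compact_cball_Union[OF F(1)] F(2) by auto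
  obtain F' where F': "finite F'" "\<And>a r. (a, r) \<in> F' \<Longrightarrow> r > 0 \<and> cball a r \<subseteq> D" "K1 \<subseteq> (\<Union>(a, r)\<in>F'. ball a r)"
    using ball_cover[OF K1 D(1)] by blast
  define K2 where "K2 = (\<Union>(a, r)\<in>F'. cball a r)"
  have K2: "compact K2" "K2 \<subseteq> D"
    unfolding K2_def using compact_cball_Union[OF F'(1)] F'(2) by auto
  let ?Z = "\<lambda>x. complex_of_real (bump_sum F x)" and ?X = "\<lambda>x. complex_of_real (bump_sum F' x)"
  have Z: "?Z \<in> test_functions UNIV" and X: "?X \<in> test_functions UNIV"
    by (rule bump_sum_test_function, use F F' in auto)+
  obtain c where c: "c > 0" "\<And>x. x \<in> K \<Longrightarrow> c \<le> bump_sum F x"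
    by (rule bump_sum_lower_bound[OF F(1) _ K(1) F(3)]) (use F(2) in blast)+
  obtain c' where c': "c' > 0" "\<And>x. x \<in> K1 \<Longrightarrow> c' \<le> bump_sum F' x"
    by (rule bump_sum_lower_bound[OF F'(1) _ K1(1) F'(3)]) (use F'(2) in blast)+
  obtain A where A: "A \<ge> 0" "\<And>b x. b \<in> Basis \<Longrightarrow> cmod (partial_deriv b ?Z x) \<le> A * indicator K1 x"
    unfolding K1_def by (rule bump_sum_gradient_bound[OF F(1)]) (use F(2) in blast)+
  obtain A' where A': "A' \<ge> 0" "\<And>b x. b \<in> Basis \<Longrightarrow> cmod (partial_deriv b ?X x) \<le> A' * indicator K2 x"
    unfolding K2_def by (rule bump_sum_gradient_bound[OF F'(1)]) (use F'(2) in blast)+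
  define n where "n = real DIM('a)"
  have n: "n \<ge> 0"
    by (simp add: n_def)
  \<comment> \<open>One factor sqrt n from each of the two estimates, A / c' for the inner gradient
    measured by the outer cutoff, A' for the outer gradient, and 1 / c for passing from the inner
    cutoff to the indicator of \<open>K\<close>.\<close>
  define C where "C = n * (A / c') * A' / c"
  have C0: "C \<ge> 0"
    using n A(1) A'(1) c c' by (simp add: C_def)
  have Km: "K \<in> sets borel"
    using K(1) by (simp add: borel_compact)
  have main: "norm (l2_mult (indicator K) v) \<le> C / l * norm v" if l: "l > 0" and v: "v \<in> weak_kernel D l" for l v
  proof (rule le_of_perturbed_le)
    show "0 \<le> C / l" using C0 l by simp
    fix e :: real assume e: "e > 0"
    obtain w where w: "smooth_on UNIV w" "sqint w" "norm (v - l2 w) \<le> e"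
      "\<And>x. x \<in> K1 \<union> K2 \<Longrightarrow> laplacian w x = complex_of_real l * w x"
      using kernel_mollify[OF D v _ _ e, of "K1 \<union> K2"] K1 K2 by (metis compact_Un le_sup_iff)
    have sX: "sqint (\<lambda>x. ?X x * w x)" and sZ: "sqint (\<lambda>x. ?Z x * w x)"
      by (rule test_function_sqint[OF test_functions_mult[OF X w(1)]],
          rule test_function_sqint[OF test_functions_mult[OF Z w(1)]])
    have outF: "bump_sum F x = 0" if "x \<notin> K1" for x
      by (rule bump_sum_zero_outside[OF F(1)]) (use F(2) that K1_def in auto)
    have outF': "bump_sum F' x = 0" if "x \<notin> K2" for x
      by (rule bump_sum_zero_outside[OF F'(1)]) (use F'(2) that K2_def in auto)
    have "(\<Sum>b\<in>Basis. (norm (l2 (partial_deriv b (\<lambda>x. ?Z x * w x))))\<^sup>2) + l * (norm (l2 (\<lambda>x. ?Z x * w x)))\<^sup>2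
        \<le> n * ((A / c') * norm (l2 (\<lambda>x. ?X x * w x)))\<^sup>2"
      unfolding n_def
    proof (rule energy_bound[OF w(1) Z _ _ _ sX])
      \<comment> \<open>The gradient of the inner cutoff lives on \<open>K1\<close>, where the outer
        cutoff is at least c'.\<close>
      show "cmod (partial_deriv b ?Z x) \<le> A / c' * cmod (?X x)" if "b \<in> Basis" for b x
      proof (cases "x \<in> K1")
        case True
        have "A * 1 \<le> A * (bump_sum F' x / c')"
          using A(1) c'(1) c'(2)[OF True] by (intro mult_left_mono) simp_all
        then show ?thesis
          using A(2)[OF that, of x] True bump_sum_nonneg[of F' x] by simp
      next
        case False
        then have "cmod (partial_deriv b ?Z x) \<le> 0"
          using A(2)[OF that, of x] by simp
        also have "0 \<le> A / c' * cmod (?X x)"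
          using A(1) c'(1) by simp
        finally show ?thesis .
      qed
    qed (use w(4) outF A c' in auto)
    then have 1: "l * (norm (l2 (\<lambda>x. ?Z x * w x)))\<^sup>2 \<le> n * ((A / c') * norm (l2 (\<lambda>x. ?X x * w x)))\<^sup>2"
      using sum_nonneg[of Basis "\<lambda>b. (norm (l2 (partial_deriv b (\<lambda>x. ?Z x * w x))))\<^sup>2"] by simp
    have "(\<Sum>b\<in>Basis. (norm (l2 (partial_deriv b (\<lambda>x. ?X x * w x))))\<^sup>2) + l * (norm (l2 (\<lambda>x. ?X x * w x)))\<^sup>2
        \<le> n * (A' * norm (l2 (\<lambda>x. 1 * w x)))\<^sup>2"
      unfolding n_def
    proof (rule energy_bound[OF w(1) X])
      show "cmod (partial_deriv b ?X x) \<le> A' * cmod 1" if "b \<in> Basis" for b x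
        using A'(2)[OF that, of x] A'(1) by (cases "x \<in> K2") auto
    qed (use w(2,4) outF' A'(1) in auto)
    then have 2: "l * (norm (l2 (\<lambda>x. ?X x * w x)))\<^sup>2 \<le> n * (A' * norm (l2 w))\<^sup>2"
      using sum_nonneg[of Basis "\<lambda>b. (norm (l2 (partial_deriv b (\<lambda>x. ?X x * w x))))\<^sup>2"] by simp
    \<comment> \<open>Each of the two factors l is absorbed by one of the energy estimates.\<close>
    have "(l * norm (l2 (\<lambda>x. ?Z x * w x)))\<^sup>2 = l * (l * (norm (l2 (\<lambda>x. ?Z x * w x)))\<^sup>2)"
      by (simp add: power2_eq_square)
    also have "\<dots> \<le> l * (n * ((A / c') * norm (l2 (\<lambda>x. ?X x * w x)))\<^sup>2)"
      using 1 l by (intro mult_left_mono) auto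
    also have "\<dots> = n * (A / c')\<^sup>2 * (l * (norm (l2 (\<lambda>x. ?X x * w x)))\<^sup>2)"
      by (simp add: power_mult_distrib power_divide)
    also have "\<dots> \<le> n * (A / c')\<^sup>2 * (n * (A' * norm (l2 w))\<^sup>2)"
      using 2 n by (intro mult_left_mono) auto
    also have "\<dots> = (n * (A / c') * A' * norm (l2 w))\<^sup>2"
      by (simp add: power2_eq_square)
    finally have Zl: "l * norm (l2 (\<lambda>x. ?Z x * w x)) \<le> n * (A / c') * A' * norm (l2 w)"
      by (rule power2_le_imp_le) (use n A(1) A'(1) c' in auto)
    have "norm (l2_mult (indicator K) (l2 w)) = norm (l2 (\<lambda>x. indicator K x * w x))"
      by (simp add: l2_mult_l2[OF borel_indicator[OF Km] indicator_bounded w(2)])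
    also have "\<dots> \<le> 1 / c * norm (l2 (\<lambda>x. ?Z x * w x))"
    proof (rule l2_norm_mono[OF sqint_indicator_mult[OF w(2) Km] sZ])
      show "cmod (indicator K x * w x) \<le> 1 / c * cmod (?Z x * w x)" for x
      proof (cases "x \<in> K")
        case True
        have "1 * cmod (w x) \<le> bump_sum F x / c * cmod (w x)"
          using c(1) c(2)[OF True] by (intro mult_right_mono) simp_all
        then show ?thesis
          using True bump_sum_nonneg[of F x] by (simp add: norm_mult)
      qed (use c(1) in simp)
    qed (use c(1) in simp)
    also have "\<dots> \<le> 1 / c * (n * (A / c') * A' * norm (l2 w) / l)"
    proof (rule mult_left_mono)
      show "norm (l2 (\<lambda>x. ?Z x * w x)) \<le> n * (A / c') * A' * norm (l2 w) / l"
        using Zl by (simp only: pos_le_divide_eq[OF l] mult.commute[of l])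
    qed (use c(1) in simp)
    also have "\<dots> = C / l * norm (l2 w)"
      by (simp add: C_def)
    finally have 3: "norm (l2_mult (indicator K) (l2 w)) \<le> C / l * norm (l2 w)" .
    have "norm (l2 w) \<le> norm v + e"
      using w(3) norm_triangle_ineq2[of "l2 w" v] by (simp add: norm_minus_commute)
    then have 4: "C / l * norm (l2 w) \<le> C / l * (norm v + e)"
      using C0 l by (intro mult_left_mono) auto
    have bl: "bounded_linear (l2_mult (indicator K) :: 'a l2 \<Rightarrow> 'a l2)"
      by (rule bounded_linear_l2_mult[OF borel_indicator[OF Km] indicator_bounded])
    have "norm (l2_mult (indicator K) v - l2_mult (indicator K) (l2 w)) \<le> 1 * norm (v - l2 w)"
      unfolding linear_diff[OF bounded_linear.linear[OF bl], symmetric]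
      by (rule l2_mult_bound[OF borel_indicator[OF Km] indicator_bounded]) simp
    then show "norm (l2_mult (indicator K) v) \<le> C / l * (norm v + e) + e"
      using 3 4 w(3) norm_triangle_ineq2[of "l2_mult (indicator K) v" "l2_mult (indicator K) (l2 w)"] by simp
  qed
  then show ?thesis
    using C0 by blast
qed

text \<open>Cut off by a sum of bumps, the mollified kernel elements are test functions of D with
  bounded gradients, so Rellich's theorem applies. Since phi is a bounded multiple of this cutoff,
  convergence passes to phi v.\<close>

lemma interior_compact:
  fixes D :: "'a::euclidean_space set" and v :: "nat \<Rightarrow> 'a l2"
  assumes D: "open D" "bounded D" and K: "compact K" "K \<subseteq> D" and l: "l > 0"
    and v: "\<And>n. v n \<in> weak_kernel D l" "\<And>n. norm (v n) \<le> C"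
    and \<phi>: "\<phi> \<in> borel_measurable borel" "\<And>x. cmod (\<phi> x) \<le> B" "\<And>x. x \<notin> K \<Longrightarrow> \<phi> x = 0"
  shows "\<exists>r::nat \<Rightarrow> nat. strict_mono r \<and> convergent (\<lambda>n. l2_mult \<phi> (v (r n)))"
proof -
  obtain F where F: "finite F" "\<And>a r. (a, r) \<in> F \<Longrightarrow> r > 0 \<and> cball a r \<subseteq> D" "K \<subseteq> (\<Union>(a, r)\<in>F. ball a r)"
    using ball_cover[OF K D(1)] by blast
  define K1 where "K1 = (\<Union>(a, r)\<in>F. cball a r)"
  have K1: "compact K1" "K1 \<subseteq> D"
    unfolding K1_def using compact_cball_Union[OF F(1)] F(2) by auto
  let ?Z = "\<lambda>x. complex_of_real (bump_sum F x)"
  have ZD: "?Z \<in> test_functions D" and Z: "?Z \<in> test_functions UNIV"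
    by (rule bump_sum_test_function, use F in auto)+
  obtain c where c: "c > 0" "\<And>x. x \<in> K \<Longrightarrow> c \<le> bump_sum F x"
    by (rule bump_sum_lower_bound[OF F(1) _ K(1) F(3)]) (use F(2) in blast)+
  obtain A where A: "A \<ge> 0" "\<And>b x. b \<in> Basis \<Longrightarrow> cmod (partial_deriv b ?Z x) \<le> A * indicator K1 x"
    unfolding K1_def by (rule bump_sum_gradient_bound[OF F(1)]) (use F(2) in blast)+
  obtain S where S: "S \<ge> 0" "\<And>x. cmod (?Z x) \<le> S"
    by (rule compactly_Ck_bounded[OF test_function_compactly_Ck[OF Z, where k=0]]) blast
  have Zm [measurable]: "?Z \<in> borel_measurable borel"
    by (rule compactly_Ck_measurable[OF test_function_compactly_Ck[OF Z, where k=0]])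
  have outF: "bump_sum F x = 0" if "x \<notin> K1" for x
    by (rule bump_sum_zero_outside[OF F(1)]) (use F(2) that K1_def in auto)
  have C0: "C \<ge> 0"
    using v(2)[of 0] norm_ge_zero order_trans by blast
  \<comment> \<open>The error 1/(n+1) tends to zero along every subsequence, so the original
    elements have the same limit as the mollified ones.\<close>
  have "\<exists>w. smooth_on UNIV w \<and> sqint w \<and> norm (v n - l2 w) \<le> inverse (real (Suc n)) \<and>
      (\<forall>x\<in>K1. laplacian w x = complex_of_real l * w x)" for n
    by (rule kernel_mollify[OF D v(1) K1, of "inverse (real (Suc n))" n]) auto
  then obtain w where w: "\<And>n. smooth_on UNIV (w n)" "\<And>n. sqint (w n)"
    "\<And>n. norm (v n - l2 (w n)) \<le> inverse (real (Suc n))"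
    "\<And>n x. x \<in> K1 \<Longrightarrow> laplacian (w n) x = complex_of_real l * w n x"
    by metis
  define \<psi> where "\<psi> n x = ?Z x * w n x" for n x
  have \<psi>: "\<psi> n \<in> test_functions D" for n
    unfolding \<psi>_def[abs_def] by (rule test_functions_mult[OF ZD w(1)])
  have wn: "norm (l2 (w n)) \<le> C + 1" for n
  proof -
    have "inverse (real (Suc n)) \<le> 1"
      by (simp add: field_simps)
    then show ?thesis
      using w(3)[of n] v(2)[of n] norm_triangle_ineq2[of "l2 (w n)" "v n"] by (simp add: norm_minus_commute)
  qed
  define n where "n = real DIM('a)"
  have grad: "grad_norm (\<psi> k) \<le> n * A * (C + 1)" for k
  proof -
    have "(\<Sum>b\<in>Basis. (norm (l2 (partial_deriv b (\<lambda>x. ?Z x * w k x))))\<^sup>2) + l * (norm (l2 (\<lambda>x. ?Z x * w k x)))\<^sup>2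
        \<le> n * (A * norm (l2 (\<lambda>x. 1 * w k x)))\<^sup>2"
      unfolding n_def
    proof (rule energy_bound[OF w(1) Z])
      show "cmod (partial_deriv b ?Z x) \<le> A * cmod 1" if "b \<in> Basis" for b x
        using A(2)[OF that, of x] A(1) by (cases "x \<in> K1") auto
    qed (use w(2,4) outF A(1) in auto)
    moreover have "l * (norm (l2 (\<lambda>x. ?Z x * w k x)))\<^sup>2 \<ge> 0"
      using l by simp
    ultimately have 1: "(\<Sum>b\<in>Basis. (norm (l2 (partial_deriv b (\<psi> k))))\<^sup>2) \<le> n * (A * norm (l2 (w k)))\<^sup>2"
      by (simp add: \<psi>_def[abs_def])
    have "(grad_norm (\<psi> k))\<^sup>2 \<le> n * (\<Sum>b\<in>Basis. (norm (l2 (partial_deriv b (\<psi> k))))\<^sup>2)"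
      unfolding n_def by (rule grad_norm_power2_le)
    also have "\<dots> \<le> n * (n * (A * norm (l2 (w k)))\<^sup>2)"
      using 1 by (intro mult_left_mono) (auto simp: n_def)
    also have "\<dots> = (n * A * norm (l2 (w k)))\<^sup>2"
      by (simp add: power2_eq_square)
    also have "\<dots> \<le> (n * A * (C + 1))\<^sup>2"
      using wn[of k] A(1) by (intro power_mono mult_left_mono) (auto simp: n_def)
    finally show ?thesis
      by (rule power2_le_imp_le) (use A(1) C0 in \<open>auto simp: n_def\<close>)
  qed
  have l2\<psi>: "l2 (\<psi> k) = l2_mult ?Z (l2 (w k))" for k
    by (simp add: \<psi>_def[abs_def] l2_mult_l2[OF Zm S(2) w(2)])
  have nrm: "norm (l2 (\<psi> k)) \<le> S * (C + 1)" for k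
    using l2_mult_bound[OF Zm S(2) S(1), of "l2 (w k)"] wn[of k] S(1)
    by (simp add: l2\<psi>) (meson mult_left_mono order_trans)
  have "\<exists>r::nat \<Rightarrow> nat. strict_mono r \<and> convergent (\<lambda>k. l2 (\<psi> (r k)))"
    by (rule rellich[OF D(2) \<psi>, where C="max (S * (C + 1)) (n * A * (C + 1))"])
      (auto simp: le_max_iff_disj grad nrm)
  then obtain r :: "nat \<Rightarrow> nat" and h where r: "strict_mono r" "(\<lambda>k. l2 (\<psi> (r k))) \<longlonglongrightarrow> h"
    by (auto simp: convergent_def)
  have blZ: "bounded_linear (l2_mult ?Z)"
    by (rule bounded_linear_l2_mult[OF Zm S(2)])
  have "(\<lambda>k. v (r k) - l2 (w (r k))) \<longlonglongrightarrow> 0"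
  proof (rule Lim_null_comparison)
    have "norm (v (r k) - l2 (w (r k))) \<le> inverse (real (Suc k))" for k
    proof -
      have "inverse (real (Suc (r k))) \<le> inverse (real (Suc k))"
        using seq_suble[OF r(1), of k] by (intro le_imp_inverse_le) auto
      then show ?thesis
        using w(3)[of "r k"] by linarith
    qed
    then show "\<forall>\<^sub>F k in sequentially. norm (v (r k) - l2 (w (r k))) \<le> inverse (real (Suc k))"
      by simp
  qed (rule LIMSEQ_inverse_real_of_nat)
  then have "(\<lambda>k. l2_mult ?Z (v (r k) - l2 (w (r k)))) \<longlonglongrightarrow> l2_mult ?Z 0"
    by (rule bounded_linear.tendsto[OF blZ])
  then have "(\<lambda>k. l2_mult ?Z (v (r k)) - l2 (\<psi> (r k))) \<longlonglongrightarrow> 0"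
    by (simp add: linear_diff[OF bounded_linear.linear[OF blZ]] linear_0[OF bounded_linear.linear[OF blZ]] l2\<psi>)
  from tendsto_add[OF this r(2)] have Zv: "(\<lambda>k. l2_mult ?Z (v (r k))) \<longlonglongrightarrow> h"
    by simp
  \<comment> \<open>Bounded by B / c on \<open>K\<close>, where the cutoff is at least c, and zero
    elsewhere because phi vanishes there.\<close>
  define q where "q x = \<phi> x / ?Z x" for x
  have qm: "q \<in> borel_measurable borel"
    unfolding q_def[abs_def] using \<phi>(1) by measurable
  have B0: "0 \<le> B"
    using \<phi>(2)[of undefined] norm_ge_zero[of "\<phi> undefined"] by linarith
  have qb: "cmod (q x) \<le> B / c" for x
  proof (cases "x \<in> K")
    case True
    then show ?thesis
      unfolding q_def norm_divide using \<phi>(2)[of x] c(1) c(2)[OF True] B0 by (intro frac_le) auto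
  next
    case False
    then show ?thesis
      using \<phi>(3) c(1) B0 by (simp add: q_def)
  qed
  have "l2_mult q (l2_mult ?Z h) = l2_mult \<phi> h" for h
  proof -
    have s: "sqint (\<lambda>x. ?Z x * l2_rep h x)"
      by (rule sqint_mult_bounded[OF sqint_l2_rep Zm S(2)])
    have "l2_mult q (l2_mult ?Z h) = l2 (\<lambda>x. q x * (?Z x * l2_rep h x))"
      unfolding l2_mult_def[of ?Z] by (rule l2_mult_l2[OF qm qb s])
    also have "(\<lambda>x. q x * (?Z x * l2_rep h x)) = (\<lambda>x. \<phi> x * l2_rep h x)"
    proof
      fix x
      show "q x * (?Z x * l2_rep h x) = \<phi> x * l2_rep h x"
        using c(1) c(2)[of x] \<phi>(3)[of x] by (cases "x \<in> K") (auto simp: q_def)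
    qed
    finally show ?thesis
      by (simp add: l2_mult_def[of \<phi>])
  qed
  moreover have "(\<lambda>k. l2_mult q (l2_mult ?Z (v (r k)))) \<longlonglongrightarrow> l2_mult q h"
    by (rule bounded_linear.tendsto[OF bounded_linear_l2_mult[OF qm qb] Zv])
  ultimately show ?thesis
    using r(1) by (auto simp: convergent_def)
qed

section \<open>The Laplacian on test functions as a dissipative graph\<close>

definition lap_graph :: "'a::euclidean_space set \<Rightarrow> ('a l2 \<times> 'a l2) set" where
  "lap_graph D = (\<lambda>\<psi>. (l2 \<psi>, l2 (laplacian \<psi>))) ` test_functions D"

lemma test_function_smooth: "\<psi> \<in> test_functions D \<Longrightarrow> smooth_on UNIV \<psi>"
  by (elim test_functionsE)

lemma subspace_lap_graph: "subspace (lap_graph D)"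
  unfolding subspace_def
proof (intro conjI ballI allI)
  have "laplacian (\<lambda>x. 0) = (\<lambda>x::'a. 0)"
    using laplacian_cmult[OF smooth_on_const[of 0], of 0] by simp
  then show "0 \<in> lap_graph D"
    unfolding lap_graph_def using test_functions_zero[of D]
    by (intro image_eqI[of _ _ "\<lambda>x. 0"]) (auto simp: l2_zero zero_prod_def)
  fix x y assume "x \<in> lap_graph D" "y \<in> lap_graph D"
  then obtain f g where *: "f \<in> test_functions D" "g \<in> test_functions D"
    "x = (l2 f, l2 (laplacian f))" "y = (l2 g, l2 (laplacian g))"
    by (auto simp: lap_graph_def)
  show "x + y \<in> lap_graph D"
    unfolding lap_graph_def
    by (intro image_eqI[of _ _ "\<lambda>x. f x + g x"] test_functions_add *(1,2))
      (simp add: * laplacian_add test_function_smooth[OF *(1)] test_function_smooth[OF *(2)] l2_add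
        test_function_sqint[OF *(1)] test_function_sqint[OF *(2)]
        test_function_sqint[OF laplacian_test_function[OF *(1)]] test_function_sqint[OF laplacian_test_function[OF *(2)]])
next
  fix c x assume "x \<in> lap_graph D"
  then obtain f where *: "f \<in> test_functions D" "x = (l2 f, l2 (laplacian f))"
    by (auto simp: lap_graph_def)
  show "c *\<^sub>R x \<in> lap_graph D"
    unfolding lap_graph_def
    by (intro image_eqI[of _ _ "\<lambda>x. complex_of_real c * f x"] test_functions_cmult *(1))
      (simp add: * laplacian_cmult test_function_smooth[OF *(1)] l2_scaleR[symmetric] scaleR_conv_of_real
        test_function_sqint[OF *(1)] test_function_sqint[OF laplacian_test_function[OF *(1)]])
qed

lemma l2_mult_L2_supp:
  assumes D: "open D" and \<mu>: "\<mu> \<in> borel_measurable borel" "\<And>x. cmod (\<mu> x) \<le> B" and h: "h \<in> L2_supp D"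
  shows "l2_mult \<mu> h \<in> L2_supp D"
proof -
  obtain f where f: "sqint f" "h = l2 f" "\<And>x. x \<notin> D \<Longrightarrow> f x = 0"
    using L2_supp_representative[OF D h] by blast
  then show ?thesis
    using L2_supp_iff[OF D sqint_mult_bounded[OF f(1) \<mu>]] by (simp add: l2_mult_l2[OF \<mu>])
qed

lemma l2_mult_unimodular_inner:
  assumes "cmod c = 1" shows "l2_mult (\<lambda>_. c) x \<bullet> l2_mult (\<lambda>_. c) y = x \<bullet> y"
proof -
  have m: "(\<lambda>_. c) \<in> borel_measurable borel" by simp
  obtain f where f: "sqint f" "x = l2 f" using l2_exhaust by blast
  obtain g where g: "sqint g" "y = l2 g" using l2_exhaust by blast
  have "(c * z) \<bullet> (c * w) = z \<bullet> w" for z w :: complex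
  proof -
    have "(c * z) \<bullet> (c * w) = Re (c * cnj c * (z * cnj w))"
      by (simp add: inner_complex_def algebra_simps)
    also have "c * cnj c = 1"
      using assms complex_norm_square[of c] by simp
    finally show ?thesis
      by (simp add: inner_complex_def)
  qed
  then show ?thesis
    using f g by (simp add: l2_mult_l2[OF m, of 1] assms l2_inner sqint_cmult)
qed

lemma dissipative_system_lap_graph:
  assumes D: "open D" and \<mu>: "\<mu> \<in> borel_measurable borel" "\<And>x. cmod (\<mu> x) \<le> B" and c: "cmod c = 1"
  shows "dissipative_system (L2_supp D) (lap_graph D) (l2_mult \<mu>) (l2_mult (\<lambda>_. c))"
proof (rule dissipative_system.intro)
  show "subspace (L2_supp D)" "closed (L2_supp D)"
    by (rule subspace_L2_supp[OF D], rule closed_L2_supp[OF D])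
  show "subspace (lap_graph D)"
    by (rule subspace_lap_graph)
  show "lap_graph D \<subseteq> L2_supp D \<times> L2_supp D"
    using test_function_L2_supp[OF D] laplacian_test_function by (auto simp: lap_graph_def)
  show "p \<bullet> d \<le> 0" if "(p, d) \<in> lap_graph D" for p d
    using that by (auto simp: lap_graph_def laplacian_inner intro!: sum_nonneg)
  show "bounded_linear (l2_mult \<mu>)"
    by (rule bounded_linear_l2_mult[OF \<mu>])
  show "l2_mult \<mu> x \<in> L2_supp D" if "x \<in> L2_supp D" for x :: "'a l2"
    by (rule l2_mult_L2_supp[OF D \<mu> that])
  show "bounded_linear (l2_mult (\<lambda>_. c))"
    by (rule bounded_linear_l2_mult[of _ 1]) (use c in auto)
  show "l2_mult (\<lambda>_. c) x \<bullet> l2_mult (\<lambda>_. c) y = x \<bullet> y" for x y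
    by (rule l2_mult_unimodular_inner[OF c])
qed

text \<open>For test functions the squared gradient equals - <psi, Delta psi>, so bounds on psi and
  Delta psi bound it by Cauchy-Schwarz, and Rellich's theorem applies to approximants of u.\<close>

lemma lap_graph_closure_rellich:
  fixes u w :: "nat \<Rightarrow> 'a::euclidean_space l2"
  assumes D: "bounded D" and *: "\<forall>n. (u n, w n) \<in> closure (lap_graph D) \<and> norm (u n) \<le> C \<and> norm (w n) \<le> C"
  shows "\<exists>r::nat \<Rightarrow> nat. strict_mono r \<and> convergent (u \<circ> r)"
proof -
  have C0: "C \<ge> 0"
    using * norm_ge_zero order_trans by blast
  \<comment> \<open>The approximation of u has to improve with n because its limit is sought; for w
    a bounded error suffices.\<close>
  have "\<exists>\<psi>\<in>test_functions D. norm (u n - l2 \<psi>) \<le> inverse (real (Suc n)) \<and> norm (w n - l2 (laplacian \<psi>)) \<le> 1" for n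
  proof -
    have "(u n, w n) \<in> closure (lap_graph D)"
      using * by blast
    then obtain q where q: "q \<in> lap_graph D" "dist q (u n, w n) < inverse (real (Suc n))"
      unfolding closure_approachable by (metis inverse_positive_iff_positive of_nat_0_less_iff zero_less_Suc)
    then obtain \<psi> where \<psi>: "\<psi> \<in> test_functions D" "q = (l2 \<psi>, l2 (laplacian \<psi>))"
      by (auto simp: lap_graph_def)
    have "norm (u n - l2 \<psi>) \<le> dist q (u n, w n)" "norm (w n - l2 (laplacian \<psi>)) \<le> dist q (u n, w n)"
      using dist_fst_le[of q "(u n, w n)"] dist_snd_le[of q "(u n, w n)"]
      by (simp_all add: \<psi>(2) dist_norm norm_minus_commute)
    moreover have "inverse (real (Suc n)) \<le> 1"
      by (simp add: field_simps)
    ultimately show ?thesis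
      using q(2) \<psi>(1) by (intro bexI[of _ \<psi>]) auto
  qed
  then obtain \<psi> where \<psi>: "\<And>n. \<psi> n \<in> test_functions D" "\<And>n. norm (u n - l2 (\<psi> n)) \<le> inverse (real (Suc n))"
    "\<And>n. norm (w n - l2 (laplacian (\<psi> n))) \<le> 1"
    by metis
  have n1: "norm (l2 (\<psi> n)) \<le> C + 1" for n
  proof -
    have "inverse (real (Suc n)) \<le> 1"
      by (simp add: field_simps)
    then show ?thesis
      using \<psi>(2)[of n] * norm_triangle_ineq2[of "l2 (\<psi> n)" "u n"] by (smt (verit) norm_minus_commute)
  qed
  have n2: "norm (l2 (laplacian (\<psi> n))) \<le> C + 1" for n
    using \<psi>(3)[of n] * norm_triangle_ineq2[of "l2 (laplacian (\<psi> n))" "w n"] by (smt (verit) norm_minus_commute)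
  define d where "d = real DIM('a)"
  have d: "d \<ge> 1"
    by (simp add: d_def DIM_positive Suc_leI)
  have g: "grad_norm (\<psi> n) \<le> d * (C + 1)" for n
  proof -
    have "(\<Sum>b\<in>Basis. (norm (l2 (partial_deriv b (\<psi> n))))\<^sup>2) = - (l2 (\<psi> n) \<bullet> l2 (laplacian (\<psi> n)))"
      using laplacian_inner[OF \<psi>(1)] by simp
    also have "\<dots> \<le> norm (l2 (\<psi> n)) * norm (l2 (laplacian (\<psi> n)))"
      using Cauchy_Schwarz_ineq2[of "l2 (\<psi> n)" "l2 (laplacian (\<psi> n))"] by linarith
    also have "\<dots> \<le> (C + 1) * (C + 1)"
      by (intro mult_mono n1 n2) (use C0 in auto)
    finally have "(grad_norm (\<psi> n))\<^sup>2 \<le> d * ((C + 1) * (C + 1))"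
      using grad_norm_power2_le[of "\<psi> n"] d by (smt (verit) d_def mult_left_mono)
    also have "\<dots> \<le> (d * d) * ((C + 1) * (C + 1))"
      using d C0 by (intro mult_right_mono) auto
    also have "\<dots> = (d * (C + 1))\<^sup>2"
      by (simp add: power2_eq_square)
    finally show ?thesis
      by (rule power2_le_imp_le) (use d C0 in auto)
  qed
  have "C + 1 \<le> d * (C + 1)"
    using mult_right_mono[OF d, of "C + 1"] C0 by simp
  then have "\<exists>r::nat \<Rightarrow> nat. strict_mono r \<and> convergent (\<lambda>k. l2 (\<psi> (r k)))"
    using n1 by (intro rellich[OF D \<psi>(1) _ g]) (rule order_trans)
  then obtain r :: "nat \<Rightarrow> nat" and h where r: "strict_mono r" "(\<lambda>k. l2 (\<psi> (r k))) \<longlonglongrightarrow> h"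
    by (auto simp: convergent_def)
  have "(\<lambda>k. u (r k) - l2 (\<psi> (r k))) \<longlonglongrightarrow> 0"
  proof (rule Lim_null_comparison)
    have "norm (u (r k) - l2 (\<psi> (r k))) \<le> inverse (real (Suc k))" for k
    proof -
      have "inverse (real (Suc (r k))) \<le> inverse (real (Suc k))"
        using seq_suble[OF r(1), of k] by (intro le_imp_inverse_le) auto
      then show ?thesis
        using \<psi>(2)[of "r k"] by linarith
    qed
    then show "\<forall>\<^sub>F k in sequentially. norm (u (r k) - l2 (\<psi> (r k))) \<le> inverse (real (Suc k))"
      by simp
  qed (rule LIMSEQ_inverse_real_of_nat)
  from tendsto_add[OF this r(2)] have "(u \<circ> r) \<longlonglongrightarrow> h"
    by (simp add: o_def)
  then show ?thesis
    using r(1) by (auto simp: convergent_def)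
qed

section \<open>$L^2(D)$ inside $L^2$\<close>

lemma AE_lebesgue_on_open:
  assumes "open D" shows "(AE x in lebesgue_on D. P x) \<longleftrightarrow> (AE x in lborel. x \<in> D \<longrightarrow> P x)"
  using assms by (simp add: AE_restrict_space_iff AE_completion_iff)

text \<open>Lebesgue measure is the completion of Borel measure, so the real and imaginary parts of
  the extension by zero have Borel versions; the indicator restores exact vanishing off D.\<close>

lemma borel_representative:
  fixes f :: "'a::euclidean_space \<Rightarrow> complex"
  assumes D: "open D" and f: "f \<in> borel_measurable (lebesgue_on D)"
  obtains g where "g \<in> borel_measurable borel" "\<And>x. x \<notin> D \<Longrightarrow> g x = 0" "AE x in lebesgue_on D. f x = g x"
proof -
  let ?f = "\<lambda>x. if x \<in> D then f x else 0"
  have m: "?f \<in> borel_measurable lebesgue"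
    using f D by (intro borel_measurable_if_I) auto
  obtain a where a: "a \<in> borel_measurable lborel" "AE x in lborel. Re (?f x) = a x"
    using completion_ex_borel_measurable_real[of "\<lambda>x. Re (?f x)" lborel] m by (auto simp del: Re_def)
  obtain b where b: "b \<in> borel_measurable lborel" "AE x in lborel. Im (?f x) = b x"
    using completion_ex_borel_measurable_real[of "\<lambda>x. Im (?f x)" lborel] m by auto
  define g where "g x = indicator D x * (complex_of_real (a x) + \<i> * complex_of_real (b x))" for x
  have [measurable]: "a \<in> borel_measurable borel" "b \<in> borel_measurable borel" "D \<in> sets borel"
    using a b D by auto
  show thesis
  proof (rule that)
    show "g \<in> borel_measurable borel"
      unfolding g_def by measurable
    show "g x = 0" if "x \<notin> D" for x
      using that by (simp add: g_def)
    show "AE x in lebesgue_on D. f x = g x"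
      unfolding AE_lebesgue_on_open[OF D] using a(2) b(2)
      by eventually_elim (auto simp: g_def complex_eq_iff)
  qed
qed

lemma lebesgue_on_borel:
  fixes F G :: "'a::euclidean_space \<Rightarrow> 'b::{banach,second_countable_topology}"
  assumes D: "open D" and F: "F \<in> borel_measurable (lebesgue_on D)" and G: "G \<in> borel_measurable borel"
    and G0: "\<And>x. x \<notin> D \<Longrightarrow> G x = 0" and eq: "AE x in lebesgue_on D. F x = G x"
  shows "integral\<^sup>L (lebesgue_on D) F = integral\<^sup>L lborel G" "integrable (lebesgue_on D) F \<longleftrightarrow> integrable lborel G"
proof -
  have GL: "G \<in> borel_measurable lebesgue"
    using G by (simp add: measurable_completion)
  then have GD: "G \<in> borel_measurable (lebesgue_on D)"
    by (rule measurable_restrict_space1)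
  have D': "D \<inter> space lebesgue \<in> sets lebesgue"
    using D by auto
  have ind: "(\<lambda>x. indicator D x *\<^sub>R G x) = G"
    using G0 by (auto simp: indicator_def)
  have "integral\<^sup>L (lebesgue_on D) F = integral\<^sup>L (lebesgue_on D) G"
    by (rule integral_cong_AE[OF F GD eq])
  also have "\<dots> = integral\<^sup>L lebesgue G"
    by (simp only: integral_restrict_space[OF D'] ind)
  also have "\<dots> = integral\<^sup>L lborel G"
    by (rule integral_completion) (use G in simp)
  finally show "integral\<^sup>L (lebesgue_on D) F = integral\<^sup>L lborel G" .
  have "integrable (lebesgue_on D) F \<longleftrightarrow> integrable (lebesgue_on D) G"
    by (rule integrable_cong_AE[OF F GD eq])
  also have "\<dots> \<longleftrightarrow> integrable lebesgue G"
    by (simp only: integrable_restrict_space[OF D'] ind)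
  also have "\<dots> \<longleftrightarrow> integrable lborel G"
    by (rule integrable_completion) (use G in simp)
  finally show "integrable (lebesgue_on D) F \<longleftrightarrow> integrable lborel G" .
qed

text \<open>\<open>represents D f g\<close>: \<open>g\<close> is a Borel version of the extension of \<open>f\<close> from \<open>D\<close> by zero.\<close>

definition represents :: "'a::euclidean_space set \<Rightarrow> ('a \<Rightarrow> complex) \<Rightarrow> ('a \<Rightarrow> complex) \<Rightarrow> bool" where
  "represents D f g \<longleftrightarrow> sqint g \<and> (\<forall>x. x \<notin> D \<longrightarrow> g x = 0) \<and> (AE x in lebesgue_on D. f x = g x)"

text \<open>The isometric embedding of L^2(D) onto \<open>L2_supp D\<close>. The choice is harmless,
  since any two representatives agree almost everywhere.\<close>

definition l2_class :: "'a::euclidean_space set \<Rightarrow> ('a \<Rightarrow> complex) \<Rightarrow> 'a l2" where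
  "l2_class D f = l2 (SOME g. represents D f g)"

context
  fixes D :: "'a::euclidean_space set"
  assumes D: "open D"
begin

section \<open>Classes of functions on D\<close>

lemma L2_represents:
  assumes f: "f \<in> L2 D" shows "\<exists>g. represents D f g"
proof -
  have m: "f \<in> borel_measurable (lebesgue_on D)" and i: "integrable (lebesgue_on D) (\<lambda>x. (cmod (f x))\<^sup>2)"
    using f by (auto simp: L2_def)
  obtain g where g: "g \<in> borel_measurable borel" "\<And>x. x \<notin> D \<Longrightarrow> g x = 0" "AE x in lebesgue_on D. f x = g x"
    using borel_representative[OF D m] by blast
  have [measurable]: "g \<in> borel_measurable borel" by fact
  have "integrable lborel (\<lambda>x. (cmod (g x))\<^sup>2)"
  proof (subst lebesgue_on_borel(2)[OF D, symmetric, of "\<lambda>x. (cmod (f x))\<^sup>2"])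
    show "(\<lambda>x. (cmod (f x))\<^sup>2) \<in> borel_measurable (lebesgue_on D)"
      using m by measurable
    show "AE x in lebesgue_on D. (cmod (f x))\<^sup>2 = (cmod (g x))\<^sup>2"
      using g(3) by eventually_elim simp
  qed (use g(2) i in auto)
  then show ?thesis
    using g unfolding represents_def sqint_def by blast
qed

lemma represents_L2:
  assumes f: "f \<in> borel_measurable (lebesgue_on D)" and r: "represents D f g"
  shows "f \<in> L2 D"
proof -
  have [measurable]: "g \<in> borel_measurable borel"
    using r by (auto simp: represents_def dest: sqint_measurable)
  have "integrable (lebesgue_on D) (\<lambda>x. (cmod (f x))\<^sup>2) \<longleftrightarrow> integrable lborel (\<lambda>x. (cmod (g x))\<^sup>2)"
  proof (rule lebesgue_on_borel(2)[OF D])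
    show "(\<lambda>x. (cmod (f x))\<^sup>2) \<in> borel_measurable (lebesgue_on D)"
      using f by measurable
    show "AE x in lebesgue_on D. (cmod (f x))\<^sup>2 = (cmod (g x))\<^sup>2"
      using r unfolding represents_def by (auto elim: AE_mp)
  qed (use r in \<open>auto simp: represents_def\<close>)
  then show ?thesis
    using f r by (auto simp: L2_def represents_def sqint_def)
qed

lemma represents_unique:
  assumes "represents D f g" "represents D f' g'"
  shows "l2 g = l2 g' \<longleftrightarrow> ae_eq D f f'"
proof -
  have 1: "AE x in lborel. x \<in> D \<longrightarrow> f x = g x" "AE x in lborel. x \<in> D \<longrightarrow> f' x = g' x"
    using assms by (auto simp: represents_def AE_lebesgue_on_open[OF D])
  have "l2 g = l2 g' \<longleftrightarrow> (AE x in lborel. g x = g' x)"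
    using assms by (intro l2_eq_iff) (auto simp: represents_def)
  also have "\<dots> \<longleftrightarrow> (AE x in lborel. x \<in> D \<longrightarrow> g x = g' x)"
    using assms by (intro AE_cong) (auto simp: represents_def)
  also have "\<dots> \<longleftrightarrow> (AE x in lborel. x \<in> D \<longrightarrow> f x = f' x)"
  proof
    assume "AE x in lborel. x \<in> D \<longrightarrow> g x = g' x"
    with 1 show "AE x in lborel. x \<in> D \<longrightarrow> f x = f' x"
      by eventually_elim auto
  next
    assume "AE x in lborel. x \<in> D \<longrightarrow> f x = f' x"
    with 1 show "AE x in lborel. x \<in> D \<longrightarrow> g x = g' x"
      by eventually_elim auto
  qed
  finally show ?thesis
    by (simp add: ae_eq_def AE_lebesgue_on_open[OF D])
qed

lemma ae_eq_refl: "ae_eq D f f"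
  by (simp add: ae_eq_def)

lemma l2_class_eq:
  assumes "represents D f g" shows "l2_class D f = l2 g"
  unfolding l2_class_def
  using represents_unique[OF someI[of "represents D f", OF assms] assms] ae_eq_refl by blast

lemma l2_class_eq_iff:
  assumes "f \<in> L2 D" "g \<in> L2 D"
  shows "l2_class D f = l2_class D g \<longleftrightarrow> ae_eq D f g"
proof -
  obtain f' g' where "represents D f f'" "represents D g g'"
    using L2_represents assms by metis
  then show ?thesis
    using represents_unique l2_class_eq by metis
qed

lemma l2_class_L2_supp:
  assumes "f \<in> L2 D" shows "l2_class D f \<in> L2_supp D"
proof -
  obtain g where g: "represents D f g"
    using L2_represents[OF assms] by blast
  then show ?thesis
    using L2_supp_iff[OF D, of g] l2_class_eq[OF g] by (simp add: represents_def)
qed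

lemma l2_class_norm:
  assumes "f \<in> L2 D" shows "norm (l2_class D f) = l2norm D f"
proof -
  obtain g where g: "represents D f g"
    using L2_represents[OF assms] by blast
  have [measurable]: "f \<in> borel_measurable (lebesgue_on D)"
    using assms by (simp add: L2_def)
  have s: "sqint g"
    using g by (simp add: represents_def)
  note [measurable] = sqint_measurable[OF s]
  have "integral\<^sup>L (lebesgue_on D) (\<lambda>x. (cmod (f x))\<^sup>2) = integral\<^sup>L lborel (\<lambda>x. (cmod (g x))\<^sup>2)"
  proof (rule lebesgue_on_borel(1)[OF D])
    show "AE x in lebesgue_on D. (cmod (f x))\<^sup>2 = (cmod (g x))\<^sup>2"
      using g unfolding represents_def by (auto elim: AE_mp)
  qed (use g in \<open>auto simp: represents_def\<close>)
  then show ?thesis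
    by (simp add: l2norm_def l2_class_eq[OF g] l2_norm_power2[OF s, symmetric])
qed

lemma represents_self:
  assumes "sqint g" "\<And>x. x \<notin> D \<Longrightarrow> g x = 0" shows "represents D g g"
  using assms by (simp add: represents_def)

lemma borel_lebesgue_on:
  fixes g :: "'a \<Rightarrow> complex"
  shows "g \<in> borel_measurable borel \<Longrightarrow> g \<in> borel_measurable (lebesgue_on D)"
  by (intro measurable_restrict_space1) (simp add: measurable_completion)

lemma sqint_L2:
  assumes "sqint g" "\<And>x. x \<notin> D \<Longrightarrow> g x = 0" shows "g \<in> L2 D" "l2_class D g = l2 g"
  using represents_L2[OF borel_lebesgue_on[OF sqint_measurable[OF assms(1)]] represents_self[OF assms]]
    l2_class_eq[OF represents_self[OF assms]] by auto

lemma test_function_vanishes: "\<psi> \<in> test_functions D \<Longrightarrow> x \<notin> D \<Longrightarrow> \<psi> x = 0"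
  by (elim test_functionsE) blast

lemma test_function_L2:
  assumes "\<psi> \<in> test_functions D" shows "\<psi> \<in> L2 D" "l2_class D \<psi> = l2 \<psi>"
  using sqint_L2[OF test_function_sqint[OF assms] test_function_vanishes[OF assms]] by auto

lemma l2_class_surj:
  assumes "h \<in> L2_supp D" shows "\<exists>f\<in>L2 D. l2_class D f = h"
proof -
  obtain f where "sqint f" "h = l2 f" "\<And>x. x \<notin> D \<Longrightarrow> f x = 0"
    using L2_supp_representative[OF D assms] by blast
  then show ?thesis
    using sqint_L2[of f] by auto
qed

lemma represents_mult:
  assumes r: "represents D f g" and \<mu>: "\<mu> \<in> borel_measurable borel" "\<And>x. cmod (\<mu> x) \<le> B"
    and eq: "AE x in lebesgue_on D. m x = \<mu> x"
  shows "represents D (\<lambda>x. m x * f x) (\<lambda>x. \<mu> x * g x)"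
  unfolding represents_def
proof (intro conjI)
  show "sqint (\<lambda>x. \<mu> x * g x)"
    using r by (intro sqint_mult_bounded[OF _ \<mu>]) (simp add: represents_def)
  have "AE x in lebesgue_on D. f x = g x"
    using r by (simp add: represents_def)
  with eq show "AE x in lebesgue_on D. m x * f x = \<mu> x * g x"
    by eventually_elim simp
qed (use r in \<open>auto simp: represents_def\<close>)

lemma L2_mult:
  assumes f: "f \<in> L2 D" and m: "m \<in> borel_measurable (lebesgue_on D)"
    and \<mu>: "\<mu> \<in> borel_measurable borel" "\<And>x. cmod (\<mu> x) \<le> B"
    and eq: "AE x in lebesgue_on D. m x = \<mu> x"
  shows "(\<lambda>x. m x * f x) \<in> L2 D" "l2_class D (\<lambda>x. m x * f x) = l2_mult \<mu> (l2_class D f)"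
proof -
  obtain g where g: "represents D f g"
    using L2_represents[OF f] by blast
  have [measurable]: "f \<in> borel_measurable (lebesgue_on D)"
    using f by (simp add: L2_def)
  note r = represents_mult[OF g \<mu> eq]
  show "(\<lambda>x. m x * f x) \<in> L2 D"
    by (rule represents_L2[OF _ r]) (use m in measurable)
  show "l2_class D (\<lambda>x. m x * f x) = l2_mult \<mu> (l2_class D f)"
    using g by (simp add: l2_class_eq[OF r] l2_class_eq[OF g] l2_mult_l2[OF \<mu>] represents_def)
qed

lemma L2_cmult:
  assumes "f \<in> L2 D"
  shows "(\<lambda>x. c * f x) \<in> L2 D" "l2_class D (\<lambda>x. c * f x) = l2_mult (\<lambda>_. c) (l2_class D f)"
  using L2_mult[OF assms, of "\<lambda>_. c" "\<lambda>_. c" "cmod c"] by auto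

lemma L2_add:
  assumes "f \<in> L2 D" "g \<in> L2 D"
  shows "(\<lambda>x. f x + g x) \<in> L2 D" "l2_class D (\<lambda>x. f x + g x) = l2_class D f + l2_class D g"
proof -
  obtain f' g' where r: "represents D f f'" "represents D g g'"
    using L2_represents assms by metis
  have "AE x in lebesgue_on D. f x = f' x" "AE x in lebesgue_on D. g x = g' x"
    using r by (auto simp: represents_def)
  then have "AE x in lebesgue_on D. f x + g x = f' x + g' x"
    by eventually_elim simp
  then have r': "represents D (\<lambda>x. f x + g x) (\<lambda>x. f' x + g' x)"
    using r by (auto simp: represents_def sqint_add)
  have [measurable]: "f \<in> borel_measurable (lebesgue_on D)" "g \<in> borel_measurable (lebesgue_on D)"
    using assms by (auto simp: L2_def)
  show "(\<lambda>x. f x + g x) \<in> L2 D"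
    by (rule represents_L2[OF _ r']) measurable
  show "l2_class D (\<lambda>x. f x + g x) = l2_class D f + l2_class D g"
    using r by (simp add: l2_class_eq[OF r'] l2_class_eq[OF r(1)] l2_class_eq[OF r(2)] l2_add represents_def)
qed

lemma l2_mult_real: "l2_mult (\<lambda>_. complex_of_real a) h = a *\<^sub>R (h :: 'a l2)"
proof -
  obtain f where f: "sqint f" "h = l2 f" using l2_exhaust by blast
  show ?thesis
    using l2_mult_l2[of "\<lambda>_. complex_of_real a" "\<bar>a\<bar>", OF _ _ f(1)] l2_scaleR[OF f(1), of a] f(2)
    by (simp add: scaleR_conv_of_real)
qed

lemma L2_diff:
  assumes "f \<in> L2 D" "g \<in> L2 D"
  shows "(\<lambda>x. f x - g x) \<in> L2 D" "l2_class D (\<lambda>x. f x - g x) = l2_class D f - l2_class D g"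
  using L2_add[OF assms(1) L2_cmult(1)[OF assms(2), of "- 1"]] L2_cmult(2)[OF assms(2), of "- 1"]
    l2_mult_real[of "-1" "l2_class D g"] by auto

lemma L2_zero: "(\<lambda>x. 0) \<in> L2 D" "l2_class D (\<lambda>x. 0) = 0"
  using sqint_L2[OF sqint_zero] by (auto simp: l2_zero)

text \<open>The adjoint graph \<open>Gmax\<close> for \<open>lap_graph D\<close>, available here
  apart from any choice of the multipliers.\<close>

definition Lap_max :: "('a l2 \<times> 'a l2) set" where
  "Lap_max = {(v, z). v \<in> L2_supp D \<and> z \<in> L2_supp D \<and> (\<forall>(p, d)\<in>lap_graph D. v \<bullet> d = z \<bullet> p)}"

lemma is_distr_laplacian_iff:
  assumes v: "v \<in> L2 D" and w: "w \<in> L2 D"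
  shows "is_distr_laplacian D v w \<longleftrightarrow> (l2_class D v, l2_class D w) \<in> Lap_max"
proof -
  obtain f g where r: "represents D v f" "represents D w g"
    using L2_represents assms by metis
  have s: "sqint f" "sqint g"
    using r by (auto simp: represents_def)
  have [measurable]: "v \<in> borel_measurable (lebesgue_on D)" "w \<in> borel_measurable (lebesgue_on D)"
    using v w by (auto simp: L2_def)
  have int: "integral\<^sup>L (lebesgue_on D) (\<lambda>x. v' x * \<psi> x) = (\<integral>x. f' x * \<psi> x \<partial>lborel)"
    if \<psi>: "\<psi> \<in> test_functions D" and r: "represents D v' f'" and m: "v' \<in> borel_measurable (lebesgue_on D)" for \<psi> v' f'
  proof (rule lebesgue_on_borel(1)[OF D])
    have [measurable]: "\<psi> \<in> borel_measurable borel" "f' \<in> borel_measurable borel"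
      using test_function_sqint[OF \<psi>] r by (auto simp: represents_def dest: sqint_measurable)
    have "\<psi> \<in> borel_measurable (lebesgue_on D)"
      by (rule borel_lebesgue_on) measurable
    then show "(\<lambda>x. v' x * \<psi> x) \<in> borel_measurable (lebesgue_on D)"
      using m by measurable
    show "(\<lambda>x. f' x * \<psi> x) \<in> borel_measurable borel"
      by measurable
    have "AE x in lebesgue_on D. v' x = f' x"
      using r by (simp add: represents_def)
    then show "AE x in lebesgue_on D. v' x * \<psi> x = f' x * \<psi> x"
      by eventually_elim simp
  qed (use r in \<open>auto simp: represents_def\<close>)
  have "is_distr_laplacian D v w \<longleftrightarrow>
      (\<forall>\<psi>\<in>test_functions D. (\<integral>x. f x * laplacian \<psi> x \<partial>lborel) = (\<integral>x. g x * \<psi> x \<partial>lborel))"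
    unfolding is_distr_laplacian_def using int[OF laplacian_test_function r(1)] int[OF _ r(2)] by simp
  also have "\<dots> \<longleftrightarrow> (\<forall>\<psi>\<in>test_functions D. l2 f \<bullet> l2 (laplacian \<psi>) = l2 g \<bullet> l2 \<psi>)"
    by (rule weak_laplacian_complex[OF s, symmetric])
  also have "\<dots> \<longleftrightarrow> (l2_class D v, l2_class D w) \<in> Lap_max"
    using l2_class_L2_supp[OF v] l2_class_L2_supp[OF w]
    by (auto simp: Lap_max_def lap_graph_def l2_class_eq[OF r(1)] l2_class_eq[OF r(2)])
  finally show ?thesis .
qed

text \<open>Two values differ by an element of L^2(D) orthogonal to all test functions of D, which
  vanishes by the fundamental lemma.\<close>

lemma Lap_max_unique:
  assumes "(v, z) \<in> Lap_max" "(v, z') \<in> Lap_max" shows "z = z'"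
proof -
  have "z \<in> L2_supp D" "z' \<in> L2_supp D"
    using assms by (auto simp: Lap_max_def)
  then have "z - z' \<in> L2_supp D"
    by (rule subspace_diff[OF subspace_L2_supp[OF D]])
  then obtain g where g: "sqint g" "z - z' = l2 g" "\<And>x. x \<notin> D \<Longrightarrow> g x = 0"
    using L2_supp_representative[OF D] by blast
  have "l2 g \<bullet> l2 \<psi> = 0" if "\<psi> \<in> test_functions D" for \<psi>
    using assms that unfolding g(2)[symmetric] by (auto simp: Lap_max_def lap_graph_def inner_diff_left)
  then have "AE x in lborel. x \<in> D \<longrightarrow> g x = 0"
    by (rule fundamental_lemma[OF D g(1)])
  then have "AE x in lborel. g x = 0"
    by eventually_elim (use g(3) in blast)
  then have "l2 g = 0"
    unfolding l2_zero[symmetric] by (intro l2_eqI g sqint_zero)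
  then show ?thesis
    using g(2) by simp
qed

lemma distr_laplacian_works:
  assumes "v \<in> L2_laplacian_dom D"
  shows "distr_laplacian D v \<in> L2 D" "(l2_class D v, l2_class D (distr_laplacian D v)) \<in> Lap_max"
proof -
  have v: "v \<in> L2 D" and ex: "\<exists>w. w \<in> L2 D \<and> is_distr_laplacian D v w"
    using assms by (auto simp: L2_laplacian_dom_def)
  show "distr_laplacian D v \<in> L2 D" "(l2_class D v, l2_class D (distr_laplacian D v)) \<in> Lap_max"
    using someI_ex[OF ex] is_distr_laplacian_iff[OF v] unfolding distr_laplacian_def by auto
qed

lemma L2_laplacian_dom_iff:
  assumes v: "v \<in> L2 D"
  shows "v \<in> L2_laplacian_dom D \<longleftrightarrow> (\<exists>z. (l2_class D v, z) \<in> Lap_max)"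
proof
  assume "v \<in> L2_laplacian_dom D"
  then show "\<exists>z. (l2_class D v, z) \<in> Lap_max"
    using distr_laplacian_works by blast
next
  assume "\<exists>z. (l2_class D v, z) \<in> Lap_max"
  then obtain z where z: "(l2_class D v, z) \<in> Lap_max" by blast
  then have "z \<in> L2_supp D"
    by (simp add: Lap_max_def)
  then obtain w where "w \<in> L2 D" "l2_class D w = z"
    using l2_class_surj by blast
  then show "v \<in> L2_laplacian_dom D"
    using is_distr_laplacian_iff[OF v] z v by (auto simp: L2_laplacian_dom_def)
qed

lemma H2norm_eq:
  assumes "\<psi> \<in> test_functions D" shows "H2norm D \<psi> = norm (l2 \<psi>, l2 (laplacian \<psi>))"
  using l2_class_norm[OF test_function_L2(1)[OF assms]] test_function_L2(2)[OF assms]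
    l2_class_norm[OF test_function_L2(1)[OF laplacian_test_function[OF assms]]]
    test_function_L2(2)[OF laplacian_test_function[OF assms]]
  by (simp add: H2norm_def norm_Pair)

text \<open>\<open>H2norm\<close> on test functions is the graph norm, so Cauchy sequences in it are
  Cauchy sequences in the graph; completeness of the product space supplies the limit w of the
  Laplacians.\<close>

lemma H20_iff:
  assumes u: "u \<in> L2 D"
  shows "u \<in> H20 D \<longleftrightarrow> (\<exists>w. (l2_class D u, w) \<in> closure (lap_graph D))"
proof -
  have diff: "H2norm D (\<lambda>x. \<psi> x - \<eta> x) = norm ((l2 \<psi>, l2 (laplacian \<psi>)) - (l2 \<eta>, l2 (laplacian \<eta>)))"
    if "\<psi> \<in> test_functions D" "\<eta> \<in> test_functions D" for \<psi> \<eta>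
    using that
    by (simp add: H2norm_eq test_functions_diff laplacian_diff test_function_smooth l2_diff
        test_function_sqint[of \<psi>] test_function_sqint[of \<eta>] test_function_sqint[OF laplacian_test_function[of \<psi>]]
        test_function_sqint[OF laplacian_test_function[of \<eta>]])
  have dist: "l2norm D (\<lambda>x. \<psi> x - u x) = norm (l2 \<psi> - l2_class D u)" if "\<psi> \<in> test_functions D" for \<psi>
    using l2_class_norm[OF L2_diff(1)[OF test_function_L2(1)[OF that] u]]
      L2_diff(2)[OF test_function_L2(1)[OF that] u] test_function_L2(2)[OF that] by simp
  show ?thesis
  proof
    assume "u \<in> H20 D"
    then obtain \<psi> where \<psi>: "\<And>k::nat. \<psi> k \<in> test_functions D"
      "\<And>e. e > 0 \<Longrightarrow> \<exists>M. \<forall>j\<ge>M. \<forall>k\<ge>M. H2norm D (\<lambda>x. \<psi> j x - \<psi> k x) < e"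
      "(\<lambda>k. l2norm D (\<lambda>x. \<psi> k x - u x)) \<longlonglongrightarrow> 0"
      unfolding H20_def by blast
    let ?q = "\<lambda>k. (l2 (\<psi> k), l2 (laplacian (\<psi> k)))"
    have "Cauchy ?q"
      by (rule CauchyI) (use \<psi>(2) in \<open>simp add: diff[OF \<psi>(1) \<psi>(1)]\<close>)
    then obtain q where q: "?q \<longlonglongrightarrow> q"
      using Cauchy_convergent convergent_def by blast
    then have mem: "q \<in> closure (lap_graph D)"
      unfolding closure_sequential using \<psi>(1) by (intro exI[of _ ?q]) (auto simp: lap_graph_def)
    have "(\<lambda>k. l2 (\<psi> k)) \<longlonglongrightarrow> fst q"
      using tendsto_fst[OF q] by simp
    moreover have "(\<lambda>k. l2 (\<psi> k)) \<longlonglongrightarrow> l2_class D u"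
      using \<psi>(3) by (simp add: dist[OF \<psi>(1)] LIM_zero_iff tendsto_norm_zero_iff)
    ultimately have "fst q = l2_class D u"
      using LIMSEQ_unique by blast
    then show "\<exists>w. (l2_class D u, w) \<in> closure (lap_graph D)"
      using mem by (metis prod.collapse)
  next
    assume "\<exists>w. (l2_class D u, w) \<in> closure (lap_graph D)"
    then obtain w s where s: "\<And>n::nat. s n \<in> lap_graph D" "s \<longlonglongrightarrow> (l2_class D u, w)"
      unfolding closure_sequential by blast
    then have "\<forall>n. \<exists>\<psi>\<in>test_functions D. s n = (l2 \<psi>, l2 (laplacian \<psi>))"
      unfolding lap_graph_def by blast
    then obtain \<psi> where \<psi>: "\<And>n. \<psi> n \<in> test_functions D" "\<And>n. s n = (l2 (\<psi> n), l2 (laplacian (\<psi> n)))"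
      by metis
    have "Cauchy s"
      using s(2) by (rule LIMSEQ_imp_Cauchy)
    then have "\<exists>M. \<forall>j\<ge>M. \<forall>k\<ge>M. H2norm D (\<lambda>x. \<psi> j x - \<psi> k x) < e" if "e > 0" for e
      using CauchyD[of s e] that unfolding diff[OF \<psi>(1) \<psi>(1)] \<psi>(2)[symmetric] by blast
    moreover have "(\<lambda>n. l2 (\<psi> n)) \<longlonglongrightarrow> l2_class D u"
      using tendsto_fst[OF s(2)] by (simp add: \<psi>(2))
    then have "(\<lambda>k. l2norm D (\<lambda>x. \<psi> k x - u x)) \<longlonglongrightarrow> 0"
      by (simp add: dist[OF \<psi>(1)] LIM_zero_iff tendsto_norm_zero_iff)
    ultimately show "u \<in> H20 D"
      unfolding H20_def using u \<psi>(1) by blast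
  qed
qed

text \<open>Green's formula puts the graph into its adjoint, which is closed. Hence the limit of the
  Laplacians along an approximating sequence is the distributional Laplacian of the limit, and the
  Laplacian is closable.\<close>

lemma lap_graph_closure_subset_Lap_max: "closure (lap_graph D) \<subseteq> Lap_max"
proof -
  have "lap_graph D \<subseteq> Lap_max"
    using test_function_L2_supp[OF D] laplacian_test_function laplacian_symmetric
    by (fastforce simp: lap_graph_def Lap_max_def)
  moreover have "closed Lap_max"
  proof -
    have "Lap_max = (L2_supp D \<times> L2_supp D) \<inter> (\<Inter>q\<in>lap_graph D. {y. fst y \<bullet> snd q = snd y \<bullet> fst q})"
      by (fastforce simp: Lap_max_def)
    moreover have "closed {y. fst y \<bullet> snd q = snd y \<bullet> fst q}" for q :: "'a l2 \<times> 'a l2"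
      by (intro closed_Collect_eq continuous_intros)
    ultimately show ?thesis
      using closed_L2_supp[OF D] by (auto intro!: closed_Int closed_INT closed_Times)
  qed
  ultimately show ?thesis
    by (rule closure_minimal)
qed

lemma l2_mult_adjoint: "l2_mult (\<lambda>_. c) x \<bullet> y = x \<bullet> l2_mult (\<lambda>_. cnj c) (y :: 'a l2)"
proof -
  obtain f where f: "sqint f" "x = l2 f" using l2_exhaust by blast
  obtain g where g: "sqint g" "y = l2 g" using l2_exhaust by blast
  have "(c * z) \<bullet> w = z \<bullet> (cnj c * w)" for z w
    by (simp add: inner_complex_def algebra_simps)
  then show ?thesis
    using f g by (simp add: l2_mult_l2[of "\<lambda>_. c" "cmod c"] l2_mult_l2[of "\<lambda>_. cnj c" "cmod c"] l2_inner sqint_cmult)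
qed

lemma l2_mult_assoc:
  fixes h :: "'a l2"
  assumes "\<mu> \<in> borel_measurable borel" "\<And>x. cmod (\<mu> x) \<le> B" "\<nu> \<in> borel_measurable borel" "\<And>x. cmod (\<nu> x) \<le> B'"
  shows "l2_mult \<mu> (l2_mult \<nu> h) = l2_mult (\<lambda>x. \<mu> x * \<nu> x) h"
proof -
  have "l2_mult \<mu> (l2_mult \<nu> h) = l2 (\<lambda>x. \<mu> x * (\<nu> x * l2_rep h x))"
    unfolding l2_mult_def[of \<nu>]
    by (rule l2_mult_l2[OF assms(1,2) sqint_mult_bounded[OF sqint_l2_rep assms(3,4)]])
  then show ?thesis
    by (simp add: l2_mult_def mult.assoc)
qed

text \<open>The abstract system knows only real scalars. Stability of the graphs under complex
  constants gives the complex linearity of the blocks and the invariance of the kernel under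
  rotation.\<close>

lemma lap_graph_cmult: "(p, d) \<in> lap_graph D \<Longrightarrow> (l2_mult (\<lambda>_. c) p, l2_mult (\<lambda>_. c) d) \<in> lap_graph D"
proof -
  assume "(p, d) \<in> lap_graph D"
  then obtain \<psi> where \<psi>: "\<psi> \<in> test_functions D" "p = l2 \<psi>" "d = l2 (laplacian \<psi>)"
    by (auto simp: lap_graph_def)
  show ?thesis
    unfolding lap_graph_def
    by (rule image_eqI[of _ _ "\<lambda>x. c * \<psi> x"])
      (simp_all add: \<psi> test_functions_cmult laplacian_cmult test_function_smooth[OF \<psi>(1)] l2_mult_l2[of "\<lambda>_. c" "cmod c"]
        test_function_sqint[OF \<psi>(1)] test_function_sqint[OF laplacian_test_function[OF \<psi>(1)]])
qed

lemma bounded_linear_l2_cmult: "bounded_linear (l2_mult (\<lambda>_. c) :: 'a l2 \<Rightarrow> 'a l2)"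
  by (rule bounded_linear_l2_mult[of _ "cmod c"]) auto

lemma lap_graph_closure_cmult:
  assumes "(u, w) \<in> closure (lap_graph D)"
  shows "(l2_mult (\<lambda>_. c) u, l2_mult (\<lambda>_. c) w) \<in> closure (lap_graph D)"
proof -
  obtain s where s: "\<And>n::nat. s n \<in> lap_graph D" "s \<longlonglongrightarrow> (u, w)"
    using assms unfolding closure_sequential by blast
  have "(l2_mult (\<lambda>_. c) (fst (s n)), l2_mult (\<lambda>_. c) (snd (s n))) \<in> lap_graph D" for n
    using lap_graph_cmult[of "fst (s n)" "snd (s n)" c] s(1)[of n] by simp
  moreover have "(\<lambda>n. (l2_mult (\<lambda>_. c) (fst (s n)), l2_mult (\<lambda>_. c) (snd (s n)))) \<longlonglongrightarrow> (l2_mult (\<lambda>_. c) u, l2_mult (\<lambda>_. c) w)"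
    using tendsto_fst[OF s(2)] tendsto_snd[OF s(2)]
    by (intro tendsto_Pair bounded_linear.tendsto[OF bounded_linear_l2_cmult]) auto
  ultimately show ?thesis
    unfolding closure_sequential
    by (intro exI[of _ "\<lambda>n. (l2_mult (\<lambda>_. c) (fst (s n)), l2_mult (\<lambda>_. c) (snd (s n)))"] conjI allI)
qed

text \<open>The constant crosses the inner product as its conjugate and is absorbed by the graph of
  test functions.\<close>

lemma Lap_max_cmult:
  assumes "(v, z) \<in> Lap_max" shows "(l2_mult (\<lambda>_. c) v, l2_mult (\<lambda>_. c) z) \<in> Lap_max"
  using assms lap_graph_cmult[of _ _ "cnj c"] l2_mult_L2_supp[OF D, of "\<lambda>_. c" "cmod c"]
  by (fastforce simp: Lap_max_def l2_mult_adjoint)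

end

section \<open>The resolvent\<close>

text \<open>The resolvent is obtained by choice, so its blocks are not linear by construction.
  Linearity and compatibility with equality almost everywhere follow because the values satisfy a
  relation \<open>P\<close> that is single valued, additive and homogeneous.\<close>

lemma L2_operatorI:
  assumes D: "open D"
    and T: "\<And>f. f \<in> L2 D \<Longrightarrow> T f \<in> L2 D" "\<And>f. f \<in> L2 D \<Longrightarrow> P (l2_class D f) (l2_class D (T f))"
    and P: "\<And>a b b'. P a b \<Longrightarrow> P a b' \<Longrightarrow> b = b'" "\<And>a b a' b'. P a b \<Longrightarrow> P a' b' \<Longrightarrow> P (a + a') (b + b')"
      "\<And>a b c. P a b \<Longrightarrow> P (l2_mult (\<lambda>_. c) a) (l2_mult (\<lambda>_. c) b)"
  shows "L2_operator D T"
  unfolding L2_operator_def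
proof (intro conjI ballI allI impI)
  fix f g assume f: "f \<in> L2 D" and g: "g \<in> L2 D"
  note add = L2_add[OF D f g] and add' = L2_add[OF D T(1)[OF f] T(1)[OF g]]
  have "l2_class D (T (\<lambda>x. f x + g x)) = l2_class D (\<lambda>x. T f x + T g x)"
    using P(1)[OF T(2)[OF add(1)]] P(2)[OF T(2)[OF f] T(2)[OF g]] by (simp add: add(2) add'(2))
  then show "ae_eq D (T (\<lambda>x. f x + g x)) (\<lambda>x. T f x + T g x)"
    using l2_class_eq_iff[OF D T(1)[OF add(1)] add'(1)] by simp
  show "ae_eq D (T f) (T g)" if "ae_eq D f g"
  proof -
    have "l2_class D f = l2_class D g"
      using l2_class_eq_iff[OF D f g] that by simp
    then have "l2_class D (T f) = l2_class D (T g)"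
      using P(1)[OF T(2)[OF f]] T(2)[OF g] by simp
    then show ?thesis
      using l2_class_eq_iff[OF D T(1)[OF f] T(1)[OF g]] by simp
  qed
next
  fix c f assume f: "f \<in> L2 D"
  note cm = L2_cmult[OF D f, of c] and cm' = L2_cmult[OF D T(1)[OF f], of c]
  have "l2_class D (T (\<lambda>x. c * f x)) = l2_class D (\<lambda>x. c * T f x)"
    using P(1)[OF T(2)[OF cm(1)]] P(3)[OF T(2)[OF f], of c] by (simp add: cm(2) cm'(2))
  then show "ae_eq D (T (\<lambda>x. c * f x)) (\<lambda>x. c * T f x)"
    using l2_class_eq_iff[OF D T(1)[OF cm(1)] cm'(1)] by simp
qed (rule T(1))

lemma L2_compact_operatorI:
  assumes D: "open D" and T: "L2_operator D T"
    and compact: "\<And>(f :: nat \<Rightarrow> _) C. (\<And>k. f k \<in> L2 D) \<Longrightarrow> (\<And>k. norm (l2_class D (f k)) \<le> C) \<Longrightarrow>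
      \<exists>r::nat \<Rightarrow> nat. strict_mono r \<and> convergent (\<lambda>k. l2_class D (T (f (r k))))"
  shows "L2_compact_operator D T"
  unfolding L2_compact_operator_def
proof (intro conjI allI impI T)
  fix f :: "nat \<Rightarrow> 'a \<Rightarrow> complex"
  assume *: "(\<forall>k. f k \<in> L2 D) \<and> (\<exists>C. \<forall>k. l2norm D (f k) \<le> C)"
  then obtain C where C: "\<And>k. l2norm D (f k) \<le> C" by blast
  have f: "f k \<in> L2 D" for k
    using * by blast
  obtain r :: "nat \<Rightarrow> nat" and h where r: "strict_mono r" "(\<lambda>k. l2_class D (T (f (r k)))) \<longlonglongrightarrow> h"
    using compact[of f C] f C by (auto simp: l2_class_norm[OF D] convergent_def)
  have Tf: "T (f k) \<in> L2 D" for k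
    using T f by (simp add: L2_operator_def)
  have "h \<in> L2_supp D"
    using closed_sequentially[OF closed_L2_supp[OF D] _ r(2)] l2_class_L2_supp[OF D Tf] by blast
  then obtain g where g: "g \<in> L2 D" "l2_class D g = h"
    using l2_class_surj[OF D] by blast
  have "l2norm D (\<lambda>x. T (f (r k)) x - g x) = norm (l2_class D (T (f (r k))) - h)" for k
    using l2_class_norm[OF D L2_diff(1)[OF D Tf g(1)]] L2_diff(2)[OF D Tf g(1)] g(2) by simp
  then have "(\<lambda>k. l2norm D (\<lambda>x. T (f (r k)) x - g x)) \<longlonglongrightarrow> 0"
    using r(2) by (simp add: LIM_zero_iff tendsto_norm_zero_iff)
  then show "\<exists>g\<in>L2 D. \<exists>r. strict_mono r \<and> (\<lambda>k. l2norm D (\<lambda>x. T (f (r k)) x - g x)) \<longlonglongrightarrow> 0"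
    using g(1) r(1) by blast
qed

lemma L2_opnorm_le:
  assumes "\<And>f. f \<in> L2 D \<Longrightarrow> l2norm D (T f) \<le> c * l2norm D f" "c \<ge> 0"
  shows "L2_opnorm D T \<le> ennreal c"
  unfolding L2_opnorm_def
proof (rule SUP_least)
  fix f assume "f \<in> {f \<in> L2 D. l2norm D f \<le> 1}"
  then have "l2norm D (T f) \<le> c * l2norm D f" "l2norm D f \<le> 1"
    using assms(1) by auto
  moreover have "c * l2norm D f \<le> c * 1"
    using \<open>l2norm D f \<le> 1\<close> assms(2) by (rule mult_left_mono)
  ultimately have "l2norm D (T f) \<le> c"
    by simp
  then show "ennreal (l2norm D (T f)) \<le> ennreal c"
    by (rule ennreal_leI)
qed

text \<open>Values exceeding B are set to zero, so that the bound holds at every point, as the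
  estimates for multiplication operators require.\<close>

lemma borel_bounded_representative:
  assumes D: "open D" and m: "m \<in> borel_measurable (lebesgue_on D)" and B: "B \<ge> 0"
    and le: "AE x in lebesgue_on D. cmod (m x) \<le> B"
  obtains \<mu> where "\<mu> \<in> borel_measurable borel" "\<And>x. cmod (\<mu> x) \<le> B" "AE x in lebesgue_on D. m x = \<mu> x"
proof -
  obtain g where g: "g \<in> borel_measurable borel" "AE x in lebesgue_on D. m x = g x"
    using borel_representative[OF D m] by metis
  have [measurable]: "g \<in> borel_measurable borel" by fact
  show thesis
  proof (rule that[of "\<lambda>x. if cmod (g x) \<le> B then g x else 0"])
    show "(\<lambda>x. if cmod (g x) \<le> B then g x else 0) \<in> borel_measurable borel"
      by measurable
    show "cmod (if cmod (g x) \<le> B then g x else 0) \<le> B" for x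
      using B by simp
    show "AE x in lebesgue_on D. m x = (if cmod (g x) \<le> B then g x else 0)"
      using g(2) le by eventually_elim auto
  qed
qed

text \<open>The density Re(c \<mu>) |f|^2 is at least a |f|^2 on N and at least - B |f|^2 off N; the
  loss against a |f|^2 is at most a + B times the mass of f on D - N.\<close>

lemma multiplier_lower_bound:
  fixes D N :: "'a::euclidean_space set"
  assumes D: "open D" and K: "D - N \<in> sets borel"
    and \<mu>: "\<mu> \<in> borel_measurable borel" "\<And>x. cmod (\<mu> x) \<le> B" and c: "cmod c = 1"
    and low: "AE x in lborel. x \<in> D \<longrightarrow> x \<in> N \<longrightarrow> Re (c * \<mu> x) \<ge> a" and v: "v \<in> L2_supp D"
  shows "a * (norm v)\<^sup>2 - (a + B) * (norm (l2_mult (indicator (D - N)) v))\<^sup>2 \<le> l2_mult (\<lambda>_. c) (l2_mult \<mu> v) \<bullet> v"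
proof -
  obtain f where f: "sqint f" "v = l2 f" "\<And>x. x \<notin> D \<Longrightarrow> f x = 0"
    using L2_supp_representative[OF D v] by blast
  have s\<mu>: "sqint (\<lambda>x. \<mu> x * f x)"
    by (rule sqint_mult_bounded[OF f(1) \<mu>])
  have sK: "sqint (\<lambda>x. indicator (D - N) x * f x)"
    by (rule sqint_indicator_mult[OF f(1) K])
  have M: "l2_mult (\<lambda>_. c) (l2_mult \<mu> v) = l2 (\<lambda>x. c * (\<mu> x * f x))"
    using l2_mult_l2[of "\<lambda>_. c" 1, OF _ _ s\<mu>] c by (simp add: f(2) l2_mult_l2[OF \<mu> f(1)])
  have "a * (norm v)\<^sup>2 - (a + B) * (norm (l2_mult (indicator (D - N)) v))\<^sup>2
      = (\<integral>x. a * (cmod (f x))\<^sup>2 - (a + B) * (cmod (indicator (D - N) x * f x))\<^sup>2 \<partial>lborel)"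
    using f(1) sK
    by (simp add: f(2) l2_mult_l2[OF borel_indicator[OF K] indicator_bounded f(1)] l2_norm_power2[OF f(1)] l2_norm_power2[OF sK] sqint_def)
  also have "\<dots> \<le> (\<integral>x. (c * (\<mu> x * f x)) \<bullet> f x \<partial>lborel)"
  proof (rule integral_mono_AE)
    show "integrable lborel (\<lambda>x. a * (cmod (f x))\<^sup>2 - (a + B) * (cmod (indicator (D - N) x * f x))\<^sup>2)"
      using f(1) sK by (simp add: sqint_def)
    show "integrable lborel (\<lambda>x. (c * (\<mu> x * f x)) \<bullet> f x)"
      by (rule sqint_inner_integrable[OF sqint_cmult[OF s\<mu>] f(1)])
    show "AE x in lborel. a * (cmod (f x))\<^sup>2 - (a + B) * (cmod (indicator (D - N) x * f x))\<^sup>2 \<le> (c * (\<mu> x * f x)) \<bullet> f x"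
      using low
    proof eventually_elim
      case (elim x)
      have eq: "(c * (\<mu> x * f x)) \<bullet> f x = Re (c * \<mu> x) * (cmod (f x))\<^sup>2"
        unfolding cmod_power2 by (simp add: inner_complex_def power2_eq_square algebra_simps)
      show ?case
      proof (cases "x \<in> D")
        case True
        show ?thesis
        proof (cases "x \<in> N")
          case True
          then have "a * (cmod (f x))\<^sup>2 \<le> Re (c * \<mu> x) * (cmod (f x))\<^sup>2"
            using elim \<open>x \<in> D\<close> by (intro mult_right_mono) auto
          then show ?thesis
            using True by (simp add: eq)
        next
          case False
          have "\<bar>Re (c * \<mu> x)\<bar> \<le> B"
            using abs_Re_le_cmod[of "c * \<mu> x"] \<mu>(2)[of x] c by (simp add: norm_mult)
          then have "- B * (cmod (f x))\<^sup>2 \<le> Re (c * \<mu> x) * (cmod (f x))\<^sup>2"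
            by (intro mult_right_mono) auto
          then show ?thesis
            using False True by (simp add: eq algebra_simps)
        qed
      qed (simp add: f(3))
    qed
  qed
  also have "\<dots> = l2_mult (\<lambda>_. c) (l2_mult \<mu> v) \<bullet> v"
    unfolding M by (simp add: f(2) l2_inner[OF sqint_cmult[OF s\<mu>] f(1)])
  finally show ?thesis .
qed

text \<open>\<open>\<mu>\<close> is an everywhere bounded Borel version of m, and the unimodular
  constant \<open>e\<close> is the rotation that makes m coercive on the kernel.\<close>

locale resolvent_setting =
  fixes D :: "'a::euclidean_space set" and m \<mu> :: "'a \<Rightarrow> complex" and e :: complex and l c B :: real
  assumes D: "open D" and m: "m \<in> borel_measurable (lebesgue_on D)"
    and \<mu>: "\<mu> \<in> borel_measurable borel" "\<And>x. cmod (\<mu> x) \<le> B" "AE x in lebesgue_on D. m x = \<mu> x"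
    and coercive_system: "coercive_system (L2_supp D) (lap_graph D) (l2_mult \<mu>) (l2_mult (\<lambda>_. e)) l c B"
begin

sublocale coercive_system "L2_supp D" "lap_graph D" "l2_mult \<mu>" "l2_mult (\<lambda>_. e)" l c B
  by (rule coercive_system)

abbreviation cl :: "('a \<Rightarrow> complex) \<Rightarrow> 'a l2" where
  "cl \<equiv> l2_class D"

section \<open>From the abstract system to the operator B\<close>

lemma Gmax_eq: "Gmax = Lap_max D"
  by (simp add: Gmax_def Lap_max_def[OF D])

lemma Gcl_Gmax: "Gcl \<subseteq> Gmax"
  unfolding Gmax_eq Gcl_def by (rule lap_graph_closure_subset_Lap_max[OF D])

lemma M_cmult: "l2_mult \<mu> (l2_mult (\<lambda>_. a) h) = l2_mult (\<lambda>_. a) (l2_mult \<mu> h)"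
  using l2_mult_assoc[OF D \<mu>(1,2), of "\<lambda>_. a" "cmod a" h] l2_mult_assoc[OF D _ _ \<mu>(1,2), of "\<lambda>_. a" "cmod a" h]
  by (simp add: mult.commute)

lemma solves_add:
  assumes "solves l f g u w v z" "solves l f' g' u' w' v' z'"
  shows "solves l (f + f') (g + g') (u + u') (w + w') (v + v') (z + z')"
proof -
  have "f + f' = (w - l *\<^sub>R u + l2_mult \<mu> v) + (w' - l *\<^sub>R u' + l2_mult \<mu> v')"
       "g + g' = (z - l *\<^sub>R v) + (z' - l *\<^sub>R v')"
    using assms by (auto simp: solves_def)
  then have "w + w' - l *\<^sub>R (u + u') + l2_mult \<mu> (v + v') = f + f'" "z + z' - l *\<^sub>R (v + v') = g + g'"
    by (simp_all add: M_add algebra_simps)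
  then show ?thesis
    using assms Gmax_add subspace_add[OF subspace_Gcl, of "(u, w)" "(u', w')"]
    by (simp add: solves_def)
qed

lemma solves_cmult:
  assumes "solves l f g u w v z"
  shows "solves l (l2_mult (\<lambda>_. a) f) (l2_mult (\<lambda>_. a) g) (l2_mult (\<lambda>_. a) u) (l2_mult (\<lambda>_. a) w)
    (l2_mult (\<lambda>_. a) v) (l2_mult (\<lambda>_. a) z)"
proof -
  have lin: "linear (l2_mult (\<lambda>_. a) :: 'a l2 \<Rightarrow> 'a l2)"
    using bounded_linear_l2_cmult[OF D] by (rule bounded_linear.linear)
  have "f = w - l *\<^sub>R u + l2_mult \<mu> v" "g = z - l *\<^sub>R v"
    using assms by (auto simp: solves_def)
  then show ?thesis
    using assms lap_graph_closure_cmult[OF D, of u w a] Lap_max_cmult[OF D, of v z a]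
    by (auto simp: solves_def Gcl_def Gmax_eq M_cmult linear_add[OF lin] linear_diff[OF lin] linear_scale[OF lin])
qed

text \<open>Together with \<open>solves_opB_minus\<close> this is the dictionary between B - l
  acting on functions and the abstract system acting on classes.\<close>

lemma opB_minus_solves:
  assumes "W \<in> domB D"
  shows "opB_minus D m l W \<in> L2_pair D"
    "\<exists>w z. solves l (cl (fst (opB_minus D m l W))) (cl (snd (opB_minus D m l W))) (cl (fst W)) w (cl (snd W)) z"
proof -
  obtain u v where W: "W = (u, v)" "u \<in> H20 D" "v \<in> L2_laplacian_dom D"
    using assms by (auto simp: domB_def)
  have uv: "u \<in> L2 D" "v \<in> L2 D"
    using W by (auto simp: H20_def L2_laplacian_dom_def)
  obtain w where w: "(cl u, w) \<in> Gcl"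
    using W(2) H20_iff[OF D uv(1)] unfolding Gcl_def by blast
  then have "(cl u, w) \<in> Lap_max D"
    using Gcl_Gmax Gmax_eq by blast
  then have "u \<in> L2_laplacian_dom D"
    using L2_laplacian_dom_iff[OF D uv(1)] by blast
  note du = distr_laplacian_works[OF D this] and dv = distr_laplacian_works[OF D W(3)]
  \<comment> \<open>The Laplacian obtained as a limit along test functions and the one chosen in
    \<open>distr_laplacian\<close> coincide because the maximal graph is single valued.\<close>
  have w_eq: "cl (distr_laplacian D u) = w"
    by (rule Lap_max_unique[OF D du(2)]) fact
  note mv = L2_mult[OF D uv(2) m \<mu>]
  note lu = L2_cmult[OF D uv(1), of "complex_of_real l"] and lv = L2_cmult[OF D uv(2), of "complex_of_real l"]
  note a = L2_add[OF D du(1) mv(1)]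
  note F = L2_diff[OF D a(1) lu(1)] and G = L2_diff[OF D dv(1) lv(1)]
  have eq: "opB_minus D m l W = (\<lambda>x. distr_laplacian D u x + m x * v x - of_real l * u x,
      \<lambda>x. distr_laplacian D v x - of_real l * v x)"
    by (simp add: opB_minus_def opB_def W(1))
  show "opB_minus D m l W \<in> L2_pair D"
    using F(1) G(1) by (simp add: eq L2_pair_def)
  have "solves l (cl (\<lambda>x. distr_laplacian D u x + m x * v x - of_real l * u x)) (cl (\<lambda>x. distr_laplacian D v x - of_real l * v x))
      (cl u) w (cl v) (cl (distr_laplacian D v))"
    using w dv(2) by (simp add: solves_def Gmax_eq F(2) G(2) a(2) mv(2) lu(2) lv(2) l2_mult_real[OF D] w_eq)
  then show "\<exists>w z. solves l (cl (fst (opB_minus D m l W))) (cl (snd (opB_minus D m l W))) (cl (fst W)) w (cl (snd W)) z"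
    unfolding eq fst_conv snd_conv by (auto simp: W(1))
qed

lemma solves_opB_minus:
  assumes f: "f \<in> L2 D" "g \<in> L2 D" and u: "u \<in> L2 D" "v \<in> L2 D"
    and s: "solves l (cl f) (cl g) (cl u) w (cl v) z"
  shows "(u, v) \<in> domB D" "pair_ae_eq D (opB_minus D m l (u, v)) (f, g)"
proof -
  have G: "(cl u, w) \<in> Gcl" "(cl v, z) \<in> Lap_max D"
    using s by (auto simp: solves_def Gmax_eq)
  show dom: "(u, v) \<in> domB D"
    using G H20_iff[OF D u(1)] L2_laplacian_dom_iff[OF D u(2)] unfolding domB_def Gcl_def by blast
  obtain w' z' where s': "solves l (cl (fst (opB_minus D m l (u, v)))) (cl (snd (opB_minus D m l (u, v)))) (cl u) w' (cl v) z'"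
    using opB_minus_solves(2)[OF dom] by auto
  have "(cl u, w') \<in> Lap_max D" "(cl u, w) \<in> Lap_max D"
    using s' G(1) Gcl_Gmax by (auto simp: solves_def Gmax_eq)
  then have "w' = w"
    by (rule Lap_max_unique[OF D])
  moreover have "z' = z"
    using s' G(2) Lap_max_unique[OF D] by (auto simp: solves_def Gmax_eq)
  ultimately have "cl (fst (opB_minus D m l (u, v))) = cl f" "cl (snd (opB_minus D m l (u, v))) = cl g"
    using s s' by (auto simp: solves_def)
  then show "pair_ae_eq D (opB_minus D m l (u, v)) (f, g)"
    using opB_minus_solves(1)[OF dom] f l2_class_eq_iff[OF D]
    by (simp add: pair_ae_eq_def L2_pair_def mem_Times_iff)
qed

lemma pair_ae_eq_iff:
  assumes "F \<in> L2_pair D" "G \<in> L2_pair D"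
  shows "pair_ae_eq D F G \<longleftrightarrow> cl (fst F) = cl (fst G) \<and> cl (snd F) = cl (snd G)"
  using assms l2_class_eq_iff[OF D] by (auto simp: pair_ae_eq_def L2_pair_def)

lemma domB_L2_pair: "domB D \<subseteq> L2_pair D"
  by (auto simp: domB_def L2_pair_def H20_def L2_laplacian_dom_def)

lemma resolventB_exists: "resolventB_exists D m l"
proof -
  define Q where "Q F W \<longleftrightarrow> fst W \<in> L2 D \<and> snd W \<in> L2 D \<and>
      (\<exists>w z. solves l (fst F) (snd F) (cl (fst W)) w (cl (snd W)) z)" for F :: "'a l2 \<times> 'a l2" and W
  have Qex: "\<exists>W. Q F W" if F: "fst F \<in> L2_supp D" "snd F \<in> L2_supp D" for F
  proof -
    obtain u w v z where s: "solves l (fst F) (snd F) u w v z"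
      using solves_exists[OF F] by blast
    then have "u \<in> L2_supp D" "v \<in> L2_supp D"
      using Gcl_H by (auto simp: solves_def Gmax_def)
    then obtain u' v' where "u' \<in> L2 D" "cl u' = u" "v' \<in> L2 D" "cl v' = v"
      using l2_class_surj[OF D] by metis
    then show ?thesis
      using s by (intro exI[of _ "(u', v')"]) (auto simp: Q_def)
  qed
  \<comment> \<open>The choice depends on F only through the classes of its components, so pairs
    equal almost everywhere get the very same value.\<close>
  define R where "R F = (SOME W. Q (cl (fst F), cl (snd F)) W)" for F
  have R: "Q (cl (fst F), cl (snd F)) (R F)" if "F \<in> L2_pair D" for F
    unfolding R_def
    by (rule someI_ex, rule Qex) (use that l2_class_L2_supp[OF D] in \<open>auto simp: L2_pair_def\<close>)
  have 1: "R F \<in> domB D" "pair_ae_eq D (opB_minus D m l (R F)) F" if F: "F \<in> L2_pair D" for F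
    using R[OF F] F solves_opB_minus[of "fst F" "snd F" "fst (R F)" "snd (R F)"]
    by (auto simp: Q_def L2_pair_def)
  have 2: "pair_ae_eq D (R F) (R G)" if "F \<in> L2_pair D" "G \<in> L2_pair D" "pair_ae_eq D F G" for F G
  proof -
    have "R F = R G"
      using that by (simp add: R_def pair_ae_eq_iff)
    then show ?thesis
      by (simp add: pair_ae_eq_def ae_eq_refl[OF D])
  qed
  have 3: "opB_minus D m l W \<in> L2_pair D \<and> pair_ae_eq D (R (opB_minus D m l W)) W" if W: "W \<in> domB D" for W
  proof
    show F: "opB_minus D m l W \<in> L2_pair D"
      by (rule opB_minus_solves(1)[OF W])
    obtain w z where s: "solves l (cl (fst (opB_minus D m l W))) (cl (snd (opB_minus D m l W))) (cl (fst W)) w (cl (snd W)) z"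
      using opB_minus_solves(2)[OF W] by blast
    obtain w' z' where s': "solves l (cl (fst (opB_minus D m l W))) (cl (snd (opB_minus D m l W)))
        (cl (fst (R (opB_minus D m l W)))) w' (cl (snd (R (opB_minus D m l W)))) z'"
      using R[OF F] by (auto simp: Q_def)
    show "pair_ae_eq D (R (opB_minus D m l W)) W"
      using solves_unique[OF s' s] 1(1)[OF F] W domB_L2_pair by (subst pair_ae_eq_iff) auto
  qed
  \<comment> \<open>The first summand bounds u and the other two bound v, after both components of F
    are replaced by the norm of the pair in \<open>solves_bounds\<close>.\<close>
  define C where "C = (1 + B / l) * (1 + B / c) / l + 1 / l + (1 + B / l) / c"
  have 4: "pair_norm D (R F) \<le> C * pair_norm D F" if F: "F \<in> L2_pair D" for F
  proof -
    let ?f = "l2norm D (fst F)" and ?g = "l2norm D (snd F)"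
    define p where "p = pair_norm D F"
    have FL: "fst F \<in> L2 D" "snd F \<in> L2 D"
      using F by (auto simp: L2_pair_def)
    have fg: "?f \<ge> 0" "?g \<ge> 0"
      by (simp_all add: l2norm_def)
    have p: "?f \<le> p" "?g \<le> p"
      unfolding p_def pair_norm_def by (simp_all add: real_le_rsqrt)
    obtain w z where uv: "fst (R F) \<in> L2 D" "snd (R F) \<in> L2 D"
      and s: "solves l (cl (fst F)) (cl (snd F)) (cl (fst (R F))) w (cl (snd (R F))) z"
      using R[OF F] by (auto simp: Q_def)
    define E where "E = ?f + B * ?g / l"
    have E: "E \<le> (1 + B / l) * p"
    proof -
      have "B / l * ?g \<le> B / l * p"
        using p(2) B(1) l by (intro mult_left_mono) auto
      then show ?thesis
        using p(1) by (simp add: E_def algebra_simps)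
    qed
    have v: "l2norm D (snd (R F)) \<le> ?g / l + E / c" and u: "l * l2norm D (fst (R F)) \<le> E + B * (E / c)"
      using solves_bounds[OF s] by (simp_all add: E_def l2_class_norm[OF D FL(1)] l2_class_norm[OF D FL(2)]
          l2_class_norm[OF D uv(1)] l2_class_norm[OF D uv(2)])
    have "l2norm D (fst (R F)) \<le> (1 + B / c) * E / l"
      using u l by (simp add: pos_le_divide_eq algebra_simps)
    also have "\<dots> \<le> (1 + B / c) * ((1 + B / l) * p) / l"
      using E B(1) c l by (intro divide_right_mono mult_left_mono) auto
    finally have u': "l2norm D (fst (R F)) \<le> (1 + B / l) * (1 + B / c) / l * p"
      by (simp add: mult_ac)
    have "?g / l + E / c \<le> p / l + (1 + B / l) * p / c"
      using p(2) E c l by (intro add_mono divide_right_mono) auto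
    then have v': "l2norm D (snd (R F)) \<le> (1 / l + (1 + B / l) / c) * p"
      using v by (simp add: algebra_simps)
    have "pair_norm D (R F) \<le> l2norm D (fst (R F)) + l2norm D (snd (R F))"
      unfolding pair_norm_def by (rule sqrt_sum_squares_le_sum) (simp_all add: l2norm_def)
    also have "\<dots> \<le> C * p"
      using u' v' by (simp add: C_def algebra_simps)
    finally show ?thesis
      by (simp add: p_def)
  qed
  have "is_bounded_inverse D (domB D) (opB_minus D m l) R"
    unfolding is_bounded_inverse_def using 1 2 3 4 by blast
  then show ?thesis
    unfolding resolventB_exists_def by blast
qed

text \<open>Whichever bounded inverse the choice operator picks, inverting B - l from the right
  already places its values among the solutions of the abstract system.\<close>

lemma resolventB_solves:
  assumes f: "f \<in> L2 D" "g \<in> L2 D"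
  shows "fst (resolventB D m l (f, g)) \<in> L2 D" "snd (resolventB D m l (f, g)) \<in> L2 D"
    "\<exists>w z. solves l (cl f) (cl g) (cl (fst (resolventB D m l (f, g)))) w (cl (snd (resolventB D m l (f, g)))) z"
proof -
  let ?W = "resolventB D m l (f, g)"
  have R: "is_bounded_inverse D (domB D) (opB_minus D m l) (resolventB D m l)"
    unfolding resolventB_def using resolventB_exists unfolding resolventB_exists_def by (rule someI_ex)
  have F: "(f, g) \<in> L2_pair D"
    using f by (simp add: L2_pair_def)
  have W: "?W \<in> domB D" "pair_ae_eq D (opB_minus D m l ?W) (f, g)"
    using R F unfolding is_bounded_inverse_def by blast+
  show "fst ?W \<in> L2 D" "snd ?W \<in> L2 D"
    using W(1) domB_L2_pair by (auto simp: L2_pair_def)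
  have "cl (fst (opB_minus D m l ?W)) = cl f" "cl (snd (opB_minus D m l ?W)) = cl g"
    using W(2) pair_ae_eq_iff[OF opB_minus_solves(1)[OF W(1)] F] by auto
  then show "\<exists>w z. solves l (cl f) (cl g) (cl (fst ?W)) w (cl (snd ?W)) z"
    using opB_minus_solves(2)[OF W(1)] by simp
qed

section \<open>The blocks of the resolvent as linear operators\<close>

lemma first_column:
  assumes "f \<in> L2 D"
  shows "R11 D m l f \<in> L2 D" "R21 D m l f \<in> L2 D"
    "\<exists>w z. solves l (cl f) 0 (cl (R11 D m l f)) w (cl (R21 D m l f)) z"
  using resolventB_solves[OF assms L2_zero(1)[OF D]] by (auto simp: R11_def R21_def L2_zero(2)[OF D])

lemma second_column:
  assumes "g \<in> L2 D"
  shows "R12 D m l g \<in> L2 D" "R22 D m l g \<in> L2 D"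
    "\<exists>w z. solves l 0 (cl g) (cl (R12 D m l g)) w (cl (R22 D m l g)) z"
  using resolventB_solves[OF L2_zero(1)[OF D] assms] by (auto simp: R12_def R22_def L2_zero(2)[OF D])

lemma first_column_kernel:
  assumes "solves l f 0 u w v z" shows "v \<in> Ker l"
  using assms unfolding Ker_iff_Gmax solves_def by auto

lemma cmult_zero: "l2_mult (\<lambda>_. a) (0 :: 'a l2) = 0"
  by (rule linear_0[OF bounded_linear.linear[OF bounded_linear_l2_cmult[OF D]]])

lemma R11_operator: "L2_operator D (R11 D m l)"
proof (rule L2_operatorI[OF D, where P="\<lambda>a b. \<exists>w v z. solves l a 0 b w v z"])
  show "\<exists>w v z. solves l (a + a') 0 (b + b') w v z"
    if "\<exists>w v z. solves l a 0 b w v z" "\<exists>w v z. solves l a' 0 b' w v z" for a b a' b'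
    using that solves_add[of a 0 b _ _ _ a' 0 b'] by simp blast
  show "\<exists>w v z. solves l (l2_mult (\<lambda>_. k) a) 0 (l2_mult (\<lambda>_. k) b) w v z" if "\<exists>w v z. solves l a 0 b w v z" for a b k
    using that solves_cmult[of a 0 b _ _ _ k] by (simp add: cmult_zero) blast
  show "R11 D m l f \<in> L2 D" "\<exists>w v z. solves l (cl f) 0 (cl (R11 D m l f)) w v z" if "f \<in> L2 D" for f
    using first_column(1)[OF that] first_column(3)[OF that] by blast+
  show "b = b'" if "\<exists>w v z. solves l a 0 b w v z" "\<exists>w v z. solves l a 0 b' w v z" for a b b'
    using that solves_unique(1) by blast
qed

lemma R12_operator: "L2_operator D (R12 D m l)"
proof (rule L2_operatorI[OF D, where P="\<lambda>a b. \<exists>w v z. solves l 0 a b w v z"])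
  show "\<exists>w v z. solves l 0 (a + a') (b + b') w v z"
    if "\<exists>w v z. solves l 0 a b w v z" "\<exists>w v z. solves l 0 a' b' w v z" for a b a' b'
    using that solves_add[of 0 a b _ _ _ 0 a' b'] by simp blast
  show "\<exists>w v z. solves l 0 (l2_mult (\<lambda>_. k) a) (l2_mult (\<lambda>_. k) b) w v z" if "\<exists>w v z. solves l 0 a b w v z" for a b k
    using that solves_cmult[of 0 a b _ _ _ k] by (simp add: cmult_zero) blast
  show "R12 D m l f \<in> L2 D" "\<exists>w v z. solves l 0 (cl f) (cl (R12 D m l f)) w v z" if "f \<in> L2 D" for f
    using second_column(1)[OF that] second_column(3)[OF that] by blast+
  show "b = b'" if "\<exists>w v z. solves l 0 a b w v z" "\<exists>w v z. solves l 0 a b' w v z" for a b b'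
    using that solves_unique(1) by blast
qed

lemma R22_operator: "L2_operator D (R22 D m l)"
proof (rule L2_operatorI[OF D, where P="\<lambda>a b. \<exists>u w z. solves l 0 a u w b z"])
  show "\<exists>u w z. solves l 0 (a + a') u w (b + b') z"
    if "\<exists>u w z. solves l 0 a u w b z" "\<exists>u w z. solves l 0 a' u w b' z" for a b a' b'
    using that solves_add[of 0 a _ _ b _ 0 a' _ _ b'] by simp blast
  show "\<exists>u w z. solves l 0 (l2_mult (\<lambda>_. k) a) u w (l2_mult (\<lambda>_. k) b) z" if "\<exists>u w z. solves l 0 a u w b z" for a b k
    using that solves_cmult[of 0 a _ _ b _ k] by (simp add: cmult_zero) blast
  show "R22 D m l f \<in> L2 D" "\<exists>u w z. solves l 0 (cl f) u w (cl (R22 D m l f)) z" if "f \<in> L2 D" for f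
    using second_column(2)[OF that] second_column(3)[OF that] by blast+
  show "b = b'" if "\<exists>u w z. solves l 0 a u w b z" "\<exists>u w z. solves l 0 a u w b' z" for a b b'
    using that solves_unique(2) by blast
qed

lemma R21_cutoff:
  assumes \<phi>: "\<phi> \<in> borel_measurable (lebesgue_on D)"
    and q: "q \<in> borel_measurable borel" "\<And>x. cmod (q x) \<le> S" "AE x in lebesgue_on D. \<phi> x = q x"
    and f: "f \<in> L2 D"
  shows "mult_op \<phi> (R21 D m l) f \<in> L2 D"
    "\<exists>u w v z. solves l (cl f) 0 u w v z \<and> cl (mult_op \<phi> (R21 D m l) f) = l2_mult q v \<and> v = cl (R21 D m l f)"
  using L2_mult[OF D first_column(2)[OF f] \<phi> q] first_column(3)[OF f] by (auto simp: mult_op_def)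

text \<open>The relation names the uncut v, which is unique, so that q v is unique as well.\<close>

lemma R21_cutoff_operator:
  assumes \<phi>: "\<phi> \<in> borel_measurable (lebesgue_on D)"
    and q: "q \<in> borel_measurable borel" "\<And>x. cmod (q x) \<le> S" "AE x in lebesgue_on D. \<phi> x = q x"
  shows "L2_operator D (mult_op \<phi> (R21 D m l))"
proof (rule L2_operatorI[OF D, where P="\<lambda>a b. \<exists>u w v z. solves l a 0 u w v z \<and> b = l2_mult q v"])
  note R = R21_cutoff[OF \<phi> q]
  have lin: "linear (l2_mult q)"
    by (rule bounded_linear.linear[OF bounded_linear_l2_mult[OF q(1,2)]])
  show "mult_op \<phi> (R21 D m l) f \<in> L2 D" if "f \<in> L2 D" for f
    by (rule R(1)[OF that])
  show "\<exists>u w v z. solves l (cl f) 0 u w v z \<and> cl (mult_op \<phi> (R21 D m l) f) = l2_mult q v" if "f \<in> L2 D" for f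
    using R(2)[OF that] by blast
  show "b = b'" if "\<exists>u w v z. solves l a 0 u w v z \<and> b = l2_mult q v" "\<exists>u w v z. solves l a 0 u w v z \<and> b' = l2_mult q v" for a b b'
    using that solves_unique(2) by blast
  show "\<exists>u w v z. solves l (a + a') 0 u w v z \<and> b + b' = l2_mult q v"
    if ab: "\<exists>u w v z. solves l a 0 u w v z \<and> b = l2_mult q v" "\<exists>u w v z. solves l a' 0 u w v z \<and> b' = l2_mult q v" for a b a' b'
  proof -
    obtain u w v z u' w' v' z' where s: "solves l a 0 u w v z" "b = l2_mult q v" "solves l a' 0 u' w' v' z'" "b' = l2_mult q v'"
      using ab by blast
    have "solves l (a + a') 0 (u + u') (w + w') (v + v') (z + z')"
      using solves_add[OF s(1,3)] by simp
    moreover have "b + b' = l2_mult q (v + v')"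
      by (simp add: s linear_add[OF lin])
    ultimately show ?thesis by blast
  qed
  show "\<exists>u w v z. solves l (l2_mult (\<lambda>_. k) a) 0 u w v z \<and> l2_mult (\<lambda>_. k) b = l2_mult q v"
    if ab: "\<exists>u w v z. solves l a 0 u w v z \<and> b = l2_mult q v" for a b k
  proof -
    obtain u w v z where s: "solves l a 0 u w v z" "b = l2_mult q v"
      using ab by blast
    have "l2_mult (\<lambda>_. k) b = l2_mult q (l2_mult (\<lambda>_. k) v)"
      using l2_mult_assoc[OF D q(1,2), of "\<lambda>_. k" "cmod k" v] l2_mult_assoc[OF D _ _ q(1,2), of "\<lambda>_. k" "cmod k" v]
      by (simp add: s(2) mult.commute)
    then show ?thesis
      using solves_cmult[OF s(1), of k] unfolding cmult_zero by blast
  qed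
qed

end

context resolvent_setting
begin

section \<open>Bounds for the blocks with explicit dependence on l\<close>

lemma R11_bound:
  assumes "f \<in> L2 D" shows "l * l2norm D (R11 D m l f) \<le> (1 + B / c) * l2norm D f"
proof -
  obtain w z where "solves l (cl f) 0 (cl (R11 D m l f)) w (cl (R21 D m l f)) z"
    using first_column(3)[OF assms] by blast
  from solves_bounds(2)[OF this] show ?thesis
    by (simp add: l2_class_norm[OF D] assms first_column(1) algebra_simps)
qed

text \<open>Here the data enter only through the particular solution, itself of size 1/l, so this
  block decays like 1/l^2.\<close>

lemma R12_bound:
  assumes "g \<in> L2 D" shows "l * l2norm D (R12 D m l g) \<le> (1 + B / c) * (B * l2norm D g / l)"
proof -
  obtain w z where "solves l 0 (cl g) (cl (R12 D m l g)) w (cl (R22 D m l g)) z"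
    using second_column(3)[OF assms] by blast
  from solves_bounds(2)[OF this] show ?thesis
    by (simp add: l2_class_norm[OF D] assms second_column(1) algebra_simps add_divide_distrib)
qed

lemma R22_bound:
  assumes "g \<in> L2 D" shows "l * l2norm D (R22 D m l g) \<le> (1 + B / c) * l2norm D g"
proof -
  obtain w z where "solves l 0 (cl g) (cl (R12 D m l g)) w (cl (R22 D m l g)) z"
    using second_column(3)[OF assms] by blast
  from solves_bounds(1)[OF this] have "l2norm D (R22 D m l g) \<le> l2norm D g / l + B * l2norm D g / l / c"
    by (simp add: l2_class_norm[OF D] assms second_column(2))
  then have "l * l2norm D (R22 D m l g) \<le> l * (l2norm D g / l + B * l2norm D g / l / c)"
    using l by (intro mult_left_mono) auto
  also have "\<dots> = (1 + B / c) * l2norm D g"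
    using l by (simp add: distrib_left distrib_right)
  finally show ?thesis .
qed

text \<open>The bound does not decay in l. Membership in the kernel is what yields the missing 1/l,
  through \<open>interior_decay\<close>, once a cutoff is applied.\<close>

lemma R21_bound:
  assumes "f \<in> L2 D" shows "norm (cl (R21 D m l f)) \<le> l2norm D f / c" "cl (R21 D m l f) \<in> Ker l"
proof -
  obtain w z where s: "solves l (cl f) 0 (cl (R11 D m l f)) w (cl (R21 D m l f)) z"
    using first_column(3)[OF assms] by blast
  from solves_bounds(1)[OF s] show "norm (cl (R21 D m l f)) \<le> l2norm D f / c"
    by (simp add: l2_class_norm[OF D assms])
  show "cl (R21 D m l f) \<in> Ker l"
    by (rule first_column_kernel[OF s])
qed

lemma Ker_eq: "Ker l' = weak_kernel D l'"
  unfolding Ker_def weak_kernel_def by (auto simp: lap_graph_def inner_diff_right)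

end

locale bounded_resolvent_setting = resolvent_setting +
  assumes bounded: "bounded D"
begin

section \<open>Compactness of the blocks\<close>

lemma rellich_Gcl:
  "\<forall>n. (u n, w n) \<in> Gcl \<and> norm (u n) \<le> C \<and> norm (w n) \<le> C \<Longrightarrow>
    \<exists>r::nat \<Rightarrow> nat. strict_mono r \<and> convergent (u \<circ> r)"
  unfolding Gcl_def by (rule lap_graph_closure_rellich[OF bounded])

lemma R11_compact: "L2_compact_operator D (R11 D m l)"
proof (rule L2_compact_operatorI[OF D R11_operator])
  fix f :: "nat \<Rightarrow> 'a \<Rightarrow> complex" and C
  assume f: "\<And>k. f k \<in> L2 D" "\<And>k. norm (cl (f k)) \<le> C"
  then have C: "C \<ge> 0"
    using norm_ge_zero order_trans by blast
  obtain w z where s: "\<And>k. solves l (cl (f k)) 0 (cl (R11 D m l (f k))) (w k) (cl (R21 D m l (f k))) (z k)"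
    using first_column(3)[OF f(1)] by metis
  show "\<exists>r::nat \<Rightarrow> nat. strict_mono r \<and> convergent (\<lambda>k. cl (R11 D m l (f (r k))))"
    using first_component_compact[OF rellich_Gcl s f(2)] C by (simp add: o_def)
qed

lemma R12_compact: "L2_compact_operator D (R12 D m l)"
proof (rule L2_compact_operatorI[OF D R12_operator])
  fix f :: "nat \<Rightarrow> 'a \<Rightarrow> complex" and C
  assume f: "\<And>k. f k \<in> L2 D" "\<And>k. norm (cl (f k)) \<le> C"
  then have C: "C \<ge> 0"
    using norm_ge_zero order_trans by blast
  obtain w z where s: "\<And>k. solves l 0 (cl (f k)) (cl (R12 D m l (f k))) (w k) (cl (R22 D m l (f k))) (z k)"
    using second_column(3)[OF f(1)] by metis
  show "\<exists>r::nat \<Rightarrow> nat. strict_mono r \<and> convergent (\<lambda>k. cl (R12 D m l (f (r k))))"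
    using first_component_compact[OF rellich_Gcl s _ f(2)] C by (simp add: o_def)
qed

lemma R22_compact: "L2_compact_operator D (R22 D m l)"
proof (rule L2_compact_operatorI[OF D R22_operator])
  fix f :: "nat \<Rightarrow> 'a \<Rightarrow> complex" and C
  assume f: "\<And>k. f k \<in> L2 D" "\<And>k. norm (cl (f k)) \<le> C"
  obtain w z where s: "\<And>k. solves l 0 (cl (f k)) (cl (R12 D m l (f k))) (w k) (cl (R22 D m l (f k))) (z k)"
    using second_column(3)[OF f(1)] by metis
  show "\<exists>r::nat \<Rightarrow> nat. strict_mono r \<and> convergent (\<lambda>k. cl (R22 D m l (f (r k))))"
    using second_component_compact[OF rellich_Gcl s f(2)] by (simp add: o_def)
qed

text \<open>On the first column g = 0, so R_21 maps bounded sets to bounded subsets of the kernel,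
  where multiplication by a function supported in a compact part of D is compact.\<close>

lemma R21_cutoff_compact:
  assumes \<phi>: "\<phi> \<in> borel_measurable (lebesgue_on D)"
    and q: "q \<in> borel_measurable borel" "\<And>x. cmod (q x) \<le> S" "AE x in lebesgue_on D. \<phi> x = q x"
    and K: "compact K" "K \<subseteq> D" "\<And>x. x \<notin> K \<Longrightarrow> q x = 0"
  shows "L2_compact_operator D (mult_op \<phi> (R21 D m l))"
proof (rule L2_compact_operatorI[OF D R21_cutoff_operator[OF \<phi> q]])
  fix f :: "nat \<Rightarrow> 'a \<Rightarrow> complex" and C
  assume f: "\<And>k. f k \<in> L2 D" "\<And>k. norm (cl (f k)) \<le> C"
  have eq: "cl (mult_op \<phi> (R21 D m l) (f k)) = l2_mult q (cl (R21 D m l (f k)))" for k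
    using R21_cutoff(2)[OF \<phi> q f(1)] by auto
  have "norm (cl (R21 D m l (f k))) \<le> C / c" for k
    using R21_bound(1)[OF f(1), of k] divide_right_mono[OF f(2)[of k], of c] c
    by (simp add: l2_class_norm[OF D f(1)])
  then show "\<exists>r::nat \<Rightarrow> nat. strict_mono r \<and> convergent (\<lambda>k. cl (mult_op \<phi> (R21 D m l) (f (r k))))"
    unfolding eq
    using R21_bound(2)[OF f(1)] unfolding Ker_eq
    by (intro interior_compact[OF D bounded K(1,2) l _ _ q(1,2) K(3), of "\<lambda>k. cl (R21 D m l (f k))" "C / c"]) auto
qed

end

text \<open>Kernel elements have only a fraction C / l of their norm on D - N, the part of D where
  the sign of m is uncontrolled. For large l the resulting loss is at most half of the lower bound
  a, which leaves the coercivity constant a/2 for all such l.\<close>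

lemma bounded_resolvent_settingI:
  fixes D N :: "'a::euclidean_space set"
  assumes D: "open D" "bounded D" and m: "m \<in> borel_measurable (lebesgue_on D)"
    and N: "open N" "frontier D \<subseteq> N"
    and \<mu>: "\<mu> \<in> borel_measurable borel" "\<And>x. cmod (\<mu> x) \<le> B" "AE x in lebesgue_on D. m x = \<mu> x"
    and a: "a > 0" and e: "cmod e = 1" and low: "AE x in lebesgue_on D. x \<in> N \<longrightarrow> Re (e * m x) > a"
  shows "\<exists>L\<ge>1. \<forall>l\<ge>L. bounded_resolvent_setting D m \<mu> e l (a / 2) B"
proof -
  define K where "K = D - N"
  \<comment> \<open>The boundary lies in N, so removing N from D or from its closure gives the same
    set, and it is compact.\<close>
  have "K = closure D - N"
    using N(2) D(1) by (auto simp: K_def frontier_def interior_open closure_def)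
  then have K: "compact K" "K \<subseteq> D"
    using D(2) N(1) by (auto simp: K_def compact_diff compact_closure)
  have Km: "D - N \<in> sets borel"
    using D(1) N(1) by auto
  have B0: "B \<ge> 0"
    using \<mu>(2)[of undefined] norm_ge_zero[of "\<mu> undefined"] by linarith
  obtain C where C: "C \<ge> 0" "\<And>l v. l > 0 \<Longrightarrow> v \<in> weak_kernel D l \<Longrightarrow> norm (l2_mult (indicator K) v) \<le> C / l * norm v"
    using interior_decay[OF D K] by blast
  have low': "AE x in lborel. x \<in> D \<longrightarrow> x \<in> N \<longrightarrow> Re (e * \<mu> x) \<ge> a"
    using low \<mu>(3) unfolding AE_lebesgue_on_open[OF D(1)] by eventually_elim auto
  \<comment> \<open>From l >= L follows (a + B) C^2 <= (a/2) l, and l >= 1 improves the right-hand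
    side to (a/2) l^2.\<close>
  define L where "L = 1 + 2 * (a + B) * C\<^sup>2 / a"
  have L1: "L \<ge> 1"
    using a B0 by (simp add: L_def)
  interpret ds: dissipative_system "L2_supp D" "lap_graph D" "l2_mult \<mu>" "l2_mult (\<lambda>_. e)"
    by (rule dissipative_system_lap_graph[OF D(1) \<mu>(1,2) e])
  have Ker: "ds.Ker l = weak_kernel D l" for l
    unfolding ds.Ker_def weak_kernel_def by (auto simp: lap_graph_def inner_diff_right)
  have Gmax: "ds.Gmax = Lap_max D"
    by (simp add: ds.Gmax_def Lap_max_def[OF D(1)])
  have cm: "l2_mult (\<lambda>_. k) v \<in> ds.Ker l" if "v \<in> ds.Ker l" for k v l
  proof -
    have "l2_mult (\<lambda>_. k) (l *\<^sub>R v) = l *\<^sub>R l2_mult (\<lambda>_. k) v"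
      by (rule linear_scale[OF bounded_linear.linear[OF bounded_linear_l2_cmult[OF D(1)]]])
    then show ?thesis
      using Lap_max_cmult[OF D(1), of v "l *\<^sub>R v" k] that by (simp add: ds.Ker_iff_Gmax Gmax)
  qed
  have "bounded_resolvent_setting D m \<mu> e l (a / 2) B" if l: "l \<ge> L" for l
  proof (intro bounded_resolvent_setting.intro resolvent_setting.intro coercive_system.intro
      coercive_system_axioms.intro bounded_resolvent_setting_axioms.intro)
    show "dissipative_system (L2_supp D) (lap_graph D) (l2_mult \<mu>) (l2_mult (\<lambda>_. e))"
      by (rule ds.dissipative_system_axioms)
    show "norm (l2_mult \<mu> x) \<le> B * norm x" for x
      by (rule l2_mult_bound[OF \<mu>(1,2) B0])
    show "l2_mult (\<lambda>_. e) v \<in> ds.Ker l" if "v \<in> ds.Ker l" for v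
      by (rule cm[OF that])
    \<comment> \<open>The preimage is the rotation by the conjugate constant, the inverse because
      |e| = 1.\<close>
    show "\<exists>v'\<in>ds.Ker l. l2_mult (\<lambda>_. e) v' = v" if "v \<in> ds.Ker l" for v
    proof (rule bexI[OF _ cm[OF that, of "cnj e"]])
      have "e * cnj e = 1"
        using e complex_norm_square[of e] by simp
      moreover have "l2_mult (\<lambda>_. e) (l2_mult (\<lambda>_. cnj e) v) = l2_mult (\<lambda>_. e * cnj e) v"
        by (rule l2_mult_assoc[OF D(1), of _ 1 _ 1]) (use e in auto)
      ultimately show "l2_mult (\<lambda>_. e) (l2_mult (\<lambda>_. cnj e) v) = v"
        using l2_mult_real[OF D(1), of 1 v] by simp
    qed
    have lpos: "l > 0" "l \<ge> 1"
      using l L1 by auto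
    show "a / 2 * (norm v)\<^sup>2 \<le> l2_mult (\<lambda>_. e) (l2_mult \<mu> v) \<bullet> v" if "v \<in> ds.Ker l" for v
    proof -
      have v: "v \<in> weak_kernel D l" "v \<in> L2_supp D"
        using that by (auto simp: Ker weak_kernel_def)
      have "(norm (l2_mult (indicator K) v))\<^sup>2 \<le> (C / l * norm v)\<^sup>2"
        by (intro power_mono C(2)[OF lpos(1) v(1)]) auto
      then have "(a + B) * (norm (l2_mult (indicator K) v))\<^sup>2 \<le> (a + B) * (C / l * norm v)\<^sup>2"
        using a B0 by (intro mult_left_mono) auto
      also have "\<dots> = (a + B) * C\<^sup>2 / l\<^sup>2 * (norm v)\<^sup>2"
        by (simp add: power_mult_distrib power_divide)
      also have "\<dots> \<le> a / 2 * (norm v)\<^sup>2"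
      proof (rule mult_right_mono)
        have "2 * (a + B) * C\<^sup>2 / a \<le> l"
          using l by (simp add: L_def)
        then have "(a + B) * C\<^sup>2 \<le> a / 2 * l"
          using a by (simp add: field_simps)
        also have "\<dots> \<le> a / 2 * l\<^sup>2"
          using a lpos(2) by (intro mult_left_mono) (auto simp: power2_eq_square)
        finally show "(a + B) * C\<^sup>2 / l\<^sup>2 \<le> a / 2"
          using lpos(1) by (simp add: pos_divide_le_eq)
      qed simp
      finally have "(a + B) * (norm (l2_mult (indicator K) v))\<^sup>2 \<le> a / 2 * (norm v)\<^sup>2" .
      moreover have "a * (norm v)\<^sup>2 - (a + B) * (norm (l2_mult (indicator K) v))\<^sup>2 \<le> l2_mult (\<lambda>_. e) (l2_mult \<mu> v) \<bullet> v"
        unfolding K_def by (rule multiplier_lower_bound[OF D(1) Km \<mu>(1,2) e low' v(2)])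
      ultimately show ?thesis by simp
    qed
  qed (use D m \<mu> a B0 l L1 in auto)
  then show ?thesis
    using L1 by blast
qed

text \<open>The cutoff is smooth in D only, with no control up to the boundary. Since it vanishes
  near the boundary, it is carried by the compact set D - U, where continuity bounds it, and its
  restriction to that set is a bounded Borel version.\<close>

lemma cutoff_representative:
  fixes D N :: "'a::euclidean_space set"
  assumes D: "open D" "bounded D" and \<phi>: "is_cutoff D N \<phi>"
  obtains K q S where "compact K" "K \<subseteq> D" "q \<in> borel_measurable borel" "\<And>x. cmod (q x) \<le> S"
    "\<And>x. x \<notin> K \<Longrightarrow> q x = 0" "AE x in lebesgue_on D. \<phi> x = q x" "\<phi> \<in> borel_measurable (lebesgue_on D)"
proof -
  obtain U where U: "open U" "frontier D \<subseteq> U" "\<And>x. x \<in> U \<inter> D \<Longrightarrow> \<phi> x = 0"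
    using \<phi> by (auto simp: is_cutoff_def)
  have "Ck_on 0 D \<phi>"
    using \<phi> by (simp add: is_cutoff_def smooth_on_def)
  then have cont: "continuous_on D \<phi>"
    by (simp add: Ck_on.simps)
  define K where "K = D - U"
  have "K = closure D - U"
    using U(2) D(1) by (auto simp: K_def frontier_def interior_open closure_def)
  then have K: "compact K" "K \<subseteq> D"
    using D(2) U(1) by (auto simp: K_def compact_diff compact_closure)
  have contK: "continuous_on K \<phi>"
    using cont K(2) continuous_on_subset by blast
  have "bounded (\<phi> ` K)"
    by (rule compact_imp_bounded[OF compact_continuous_image[OF contK K(1)]])
  then obtain S where S: "\<And>x. x \<in> K \<Longrightarrow> cmod (\<phi> x) \<le> S"
    unfolding bounded_iff by blast
  show thesis
  proof (rule that[OF K])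
    show "(\<lambda>x. indicator K x *\<^sub>R \<phi> x) \<in> borel_measurable borel"
      by (rule borel_measurable_continuous_on_indicator[OF borel_compact[OF K(1)] contK])
    show "cmod (indicator K x *\<^sub>R \<phi> x) \<le> max 0 S" for x
      using S[of x] by (cases "x \<in> K") (auto simp: le_max_iff_disj)
    show "indicator K x *\<^sub>R \<phi> x = 0" if "x \<notin> K" for x
      using that by simp
    show "AE x in lebesgue_on D. \<phi> x = indicator K x *\<^sub>R \<phi> x"
      unfolding AE_lebesgue_on_open[OF D(1)] using U(3) by (auto simp: K_def indicator_def)
    show "\<phi> \<in> borel_measurable (lebesgue_on D)"
      using D(1) by (intro continuous_imp_measurable_on_sets_lebesgue cont) auto
  qed
qed

theorem proposition10:
  fixes D N :: "(real ^ 'n) set"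
    and m :: "real ^ 'n \<Rightarrow> complex"
    and m_low m_up \<theta> :: real
  assumes "open D" and "connected D" and "bounded D" and "D \<noteq> {}"
    and "m \<in> Linfty D"
    and "m_low > 0" and "m_up \<ge> m_low"
    and "open N" and "frontier D \<subseteq> N"
    and "AE x in lebesgue_on D. x \<in> N \<longrightarrow> Re (cis \<theta> * m x) > m_low"
    and "AE x in lebesgue_on D. cmod (m x) < m_up"
  shows "\<exists>L>0.
    (\<forall>l\<ge>L. resolventB_exists D m l) \<and>
    (\<forall>l\<ge>L.
       L2_compact_operator D (R11 D m l) \<and>
       L2_compact_operator D (R12 D m l) \<and>
       L2_compact_operator D (R22 D m l) \<and>
       (\<forall>\<phi>. is_cutoff D N \<phi> \<longrightarrow> L2_compact_operator D (mult_op \<phi> (R21 D m l)))) \<and>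
    (\<forall>\<phi>. is_cutoff D N \<phi> \<longrightarrow>
       (\<exists>K::real. \<forall>l\<ge>L.
          L2_opnorm D (R11 D m l) + L2_opnorm D (R12 D m l) + L2_opnorm D (R22 D m l)
            + L2_opnorm D (mult_op \<phi> (R21 D m l)) \<le> ennreal (K / l)))"
proof -
  note D = \<open>open D\<close> \<open>bounded D\<close>
  have m: "m \<in> borel_measurable (lebesgue_on D)"
    using \<open>m \<in> Linfty D\<close> by (simp add: Linfty_def)
  have up: "m_up \<ge> 0"
    using assms by linarith
  have "AE x in lebesgue_on D. cmod (m x) \<le> m_up"
    using assms(11) by eventually_elim simp
  then obtain \<mu> where \<mu>: "\<mu> \<in> borel_measurable borel" "\<And>x. cmod (\<mu> x) \<le> m_up" "AE x in lebesgue_on D. m x = \<mu> x"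
    using borel_bounded_representative[OF D(1) m up] by blast
  obtain L where L: "L \<ge> 1" "\<And>l. l \<ge> L \<Longrightarrow> bounded_resolvent_setting D m \<mu> (cis \<theta>) l (m_low / 2) m_up"
    using bounded_resolvent_settingI[OF D m assms(8,9) \<mu> assms(6) _ assms(10)] by auto
  \<comment> \<open>The factor 1 + B / c of the block bounds, with B = m_up and coercivity constant
    c = m_low / 2.\<close>
  define b where "b = 1 + m_up / (m_low / 2)"
  have b: "b \<ge> 0"
    using assms(6) up by (simp add: b_def)
  \<comment> \<open>The threshold L is fixed before the cutoff; the constant in the estimate depends
    on the cutoff through its supremum and its support.\<close>
  have bound: "\<exists>K::real. \<forall>l\<ge>L. L2_opnorm D (R11 D m l) + L2_opnorm D (R12 D m l) + L2_opnorm D (R22 D m l)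
            + L2_opnorm D (mult_op \<phi> (R21 D m l)) \<le> ennreal (K / l)" if \<phi>: "is_cutoff D N \<phi>" for \<phi>
  proof -
    obtain K q S where K: "compact K" "K \<subseteq> D" and q: "q \<in> borel_measurable borel" "\<And>x. cmod (q x) \<le> S"
      and qK: "\<And>x. x \<notin> K \<Longrightarrow> q x = 0" and ae: "AE x in lebesgue_on D. \<phi> x = q x"
      and \<phi>m: "\<phi> \<in> borel_measurable (lebesgue_on D)"
      by (rule cutoff_representative[OF D \<phi>]) blast
    have S: "S \<ge> 0"
      using q(2)[of 0] norm_ge_zero[of "q 0"] by linarith
    have Km: "K \<in> sets borel"
      using K(1) by (rule borel_compact)
    obtain C where C: "C \<ge> 0" "\<And>l v. l > 0 \<Longrightarrow> v \<in> weak_kernel D l \<Longrightarrow> norm (l2_mult (indicator K) v) \<le> C / l * norm v"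
      using interior_decay[OF D K] by blast
    \<comment> \<open>S bounds the cutoff, C is the interior decay constant on its support, and 2 /
      m_low bounds R_21.\<close>
    define C' where "C' = S * C / (m_low / 2)"
    have C': "C' \<ge> 0"
      using S C assms(6) by (simp add: C'_def mult_ac)
    have "L2_opnorm D (R11 D m l) + L2_opnorm D (R12 D m l) + L2_opnorm D (R22 D m l)
            + L2_opnorm D (mult_op \<phi> (R21 D m l)) \<le> ennreal ((b + b * m_up + b + C') / l)" if lL: "l \<ge> L" for l
    proof -
      interpret bounded_resolvent_setting D m \<mu> "cis \<theta>" l "m_low / 2" m_up
        by (rule L(2)[OF lL])
      have l1: "l \<ge> 1" "l > 0"
        using lL L(1) by auto
      have n0: "l2norm D f \<ge> 0" for f :: "real ^ 'n \<Rightarrow> complex"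
        by (simp add: l2norm_def)
      have 1: "L2_opnorm D (R11 D m l) \<le> ennreal (b / l)"
        using R11_bound l1 b by (intro L2_opnorm_le) (auto simp: b_def pos_le_divide_eq mult.commute)
      have 2: "L2_opnorm D (R12 D m l) \<le> ennreal (b * m_up / l)"
      proof (rule L2_opnorm_le)
        fix f :: "real ^ 'n \<Rightarrow> complex" assume f: "f \<in> L2 D"
        have "l * l2norm D (R12 D m l f) \<le> b * (m_up * l2norm D f / l)"
          using R12_bound[OF f] by (simp add: b_def)
        \<comment> \<open>One of the two factors 1/l of this block is given away, using l >=
          1.\<close>
        also have "\<dots> \<le> b * (m_up * l2norm D f / 1)"
          using l1 b up n0[of f] by (intro mult_left_mono divide_left_mono) auto
        finally show "l2norm D (R12 D m l f) \<le> b * m_up / l * l2norm D f"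
          using l1 by (simp add: pos_le_divide_eq mult_ac)
      qed (use b up l1 in auto)
      have 3: "L2_opnorm D (R22 D m l) \<le> ennreal (b / l)"
        using R22_bound l1 b by (intro L2_opnorm_le) (auto simp: b_def pos_le_divide_eq mult.commute)
      have 4: "L2_opnorm D (mult_op \<phi> (R21 D m l)) \<le> ennreal (C' / l)"
      proof (rule L2_opnorm_le)
        fix f :: "real ^ 'n \<Rightarrow> complex" assume f: "f \<in> L2 D"
        define v where "v = cl (R21 D m l f)"
        have v: "v \<in> weak_kernel D l" "norm v \<le> l2norm D f / (m_low / 2)"
          using R21_bound[OF f] by (simp_all add: v_def Ker_eq)
        \<comment> \<open>Inserting the indicator of \<open>K\<close>, which leaves q unchanged,
          exposes the part of v that the interior decay controls.\<close>
        have "l2_mult q (l2_mult (indicator K) v) = l2_mult (\<lambda>x. q x * indicator K x) v"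
          by (rule l2_mult_assoc[OF D(1) q borel_indicator[OF Km] indicator_bounded])
        also have "(\<lambda>x. q x * indicator K x) = q"
        proof
          show "q x * indicator K x = q x" for x
            using qK by (cases "x \<in> K") simp_all
        qed
        finally have qv: "l2_mult q v = l2_mult q (l2_mult (indicator K) v)" ..
        have "l2norm D (mult_op \<phi> (R21 D m l) f) = norm (l2_mult q v)"
          using l2_class_norm[OF D(1) R21_cutoff(1)[OF \<phi>m q ae f]] R21_cutoff(2)[OF \<phi>m q ae f]
          by (auto simp: v_def)
        also have "\<dots> \<le> S * norm (l2_mult (indicator K) v)"
          unfolding qv by (rule l2_mult_bound[OF q S])
        also have "\<dots> \<le> S * (C / l * norm v)"
          by (intro mult_left_mono C(2) l1 v S)
        also have "\<dots> \<le> S * (C / l * (l2norm D f / (m_low / 2)))"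
          using S C(1) l1 v(2) by (intro mult_left_mono) auto
        also have "\<dots> = C' / l * l2norm D f"
          by (simp add: C'_def mult_ac)
        finally show "l2norm D (mult_op \<phi> (R21 D m l) f) \<le> C' / l * l2norm D f" .
      qed (use C' l1 in auto)
      have "L2_opnorm D (R11 D m l) + L2_opnorm D (R12 D m l) + L2_opnorm D (R22 D m l)
            + L2_opnorm D (mult_op \<phi> (R21 D m l)) \<le> ennreal (b / l) + ennreal (b * m_up / l) + ennreal (b / l) + ennreal (C' / l)"
        by (intro add_mono 1 2 3 4)
      also have "\<dots> = ennreal ((b + b * m_up + b + C') / l)"
        using b up C' l1 by (simp add: ennreal_plus[symmetric] add_divide_distrib del: ennreal_plus)
      finally show ?thesis .
    qed
    then show ?thesis by blast
  qed
  show ?thesis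
  proof (rule exI[of _ L], intro conjI allI impI)
    show "L > 0" using L(1) by simp
    fix l assume l: "l \<ge> L"
    interpret bounded_resolvent_setting D m \<mu> "cis \<theta>" l "m_low / 2" m_up
      by (rule L(2)[OF l])
    show "resolventB_exists D m l"
      by (rule resolventB_exists)
    show "L2_compact_operator D (R11 D m l)" "L2_compact_operator D (R12 D m l)" "L2_compact_operator D (R22 D m l)"
      by (rule R11_compact, rule R12_compact, rule R22_compact)
    fix \<phi> assume \<phi>: "is_cutoff D N \<phi>"
    obtain K q S where K: "compact K" "K \<subseteq> D" and q: "q \<in> borel_measurable borel" "\<And>x. cmod (q x) \<le> S"
      and qK: "\<And>x. x \<notin> K \<Longrightarrow> q x = 0" and ae: "AE x in lebesgue_on D. \<phi> x = q x"
      and \<phi>m: "\<phi> \<in> borel_measurable (lebesgue_on D)"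
      by (rule cutoff_representative[OF assms(1,3) \<phi>]) blast
    show "L2_compact_operator D (mult_op \<phi> (R21 D m l))"
      by (rule R21_cutoff_compact[OF \<phi>m q ae K qK])
  qed (rule bound)
qed

end
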